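(* Let $\mathcal B$ be a Heyting category, $(A,\cdot)$ a partial combinatory algebra in $\mathcal B$ and $\phi$ a combinatory complete filter on $(A,\cdot)$. Let $p$ be a proposition (closed formula) in the internal language of $\mathsf{Asm}(\mathcal B,(A,\cdot),\phi)$ and let $\tau_p\in\mathsf{Sub}(1)$ be its truth value. Then $\tau_p=\top$ if and only if the realizability interpretation satisfies $p$, i.e. if and only if $\{a\in A\mid a\mathrel{\mathbf r}p\}\in\phi$.
   Context: All categories considered as base categories are small. A *Heyting category* is a category with finite limits such that: for each object $X$ the poset $\mathsf{Sub}(X)$ of subobjects (isomorphism classes of monomorphisms into $X$) is a Heyting algebra; for each $f:X\to Y$ the inverse image map $f^{-1}:\mathsf{Sub}(Y)\to\mathsf{Sub}(X)$ (pullback) is a homomorphism of Heyting algebras with a left adjoint $\exists_f$ and a right adjoint $\forall_f$; and for each pullback square $f\circ g'=g\circ f'$ the Beck–Chevalley conditions $\exists_{g'}\circ (f')^{-1}=f^{-1}\circ\exists_g$ and $\forall_{g'}\circ (f')^{-1}=f^{-1}\circ\forall_g$ hold. First-order intuitionistic formulas are interpreted in the internal language in the usual way. An object (or subobject with domain) $X$ is *inhabited* if $X\to 1$ is a regular epimorphism. A *partial morphism* $X\rightharpoonup Y$ is an isomorphism class of spans $(m:Z\to X,\ f:Z\to Y)$ with $m$ monic; its domain is the subobject represented by $m$. A *partial applicative structure* is an object $A$ with a partial morphism $\cdot:A\times A\rightharpoonup A$; $x\cdot y\downarrow$ means $(x,y)\in\mathrm{dom}(\cdot)$. It is a *partial combinatory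 algebra* if there are inhabited $\mathbf k,\mathbf s\in\mathsf{Sub}(A)$ such that (internally) for all $k\in\mathbf k$, $s\in\mathbf s$, $x,y,z\in A$: $(k\cdot x)\cdot y=x$; $(s\cdot x)\cdot y$ is defined; if $(x\cdot z)\cdot(y\cdot z)$ is defined then $((s\cdot x)\cdot y)\cdot z=(x\cdot z)\cdot(y\cdot z)$. A *filter* on $(A,\cdot)$ is a set $\phi\subseteq\mathsf{Sub}(A)$ of inhabited subobjects which is upward closed and such that if $U,V\in\phi$ and $U\times V\subseteq\mathrm{dom}(\cdot)$ then the image of $U\times V$ under $\cdot$ is in $\phi$. A partial morphism $f:A^n\rightharpoonup A$ (with $n\ge1$) is *$\phi$-computable* if there is $R\in\phi$ such that internally: for all $r\in R$, $\vec x\in A^{n-1}$, $((r\cdot x_1)\cdots x_{n-1})$ is defined; for all $r\in R$, $\vec y\in\mathrm{dom} f$, $((r\cdot y_1)\cdots y_n)$ is defined and equals $f(\vec y)$. The filter $\phi$ is *combinatory complete* if all projections $A^n\to A$ are $\phi$-computable and $\phi$-computable partial morphisms $f,g:A^n\rightharpoonup A$ have $\phi$-computable pointwise application $(\cdot)\circ(f,g)$, with domain $(f,g)^{-1}(\mathrm{dom}(\cdot))$. An *$A$-assembly* $X$ is a pair $(|X|,\rho_X)$ with $|X|$ an object of $\mathcal B$ and $\rho_X\in\mathsf{Sub}(A\times|X|)$ such that $\mathcal B\models\forall x\in|X|.\exists a\in A.\ \rho_X(a,x)$. $R\in\mathsf{Sub}(A)$ *tracks* $f:|X|\to|Y|$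 if $\mathcal B\models\forall a,b\in A,\,x\in|X|.\ a\in R\wedge(b,x)\in\rho_X\to a\cdot b\downarrow\wedge\,(a\cdot b,f(x))\in\rho_Y$; $f$ is *$\phi$-total* if some $R\in\phi$ tracks it. $\mathsf{Asm}(\mathcal B,(A,\cdot),\phi)$ is the category of $A$-assemblies and $\phi$-total morphisms; it is a Heyting category, so its internal first-order language makes sense and each proposition $p$ has a truth value $\tau_p$, a subobject of the terminal object $1$ of $\mathsf{Asm}(\mathcal B,(A,\cdot),\phi)$. *Representing subobjects.* For an object $X$ of $\mathcal B$ and $U,V\in\mathsf{Sub}(A\times X)$ let $h_X(U,V)=\{a\in A\mid\forall(b,x)\in U.\ a\cdot b\downarrow\wedge(a\cdot b,x)\in V\}$, and write $U\le_{\mathbf r}V$ if $h_X(U,V)\in\phi$ (a preorder). For an assembly $X$ and a subobject $U\in\mathsf{Sub}(X)$ in $\mathsf{Asm}(\mathcal B,(A,\cdot),\phi)$ with a chosen representing monomorphism $\mu_U:X_U\to X$, let $E_X(U)=\exists_{\mathrm{id}_A\times\mu_U}(\rho_{X_U})\in\mathsf{Sub}(A\times|X|)$. *Realizability relation.* Let $\mathbf 0=\{k\in A\mid\forall x,y\in A.\ k\cdot x\downarrow\wedge(k\cdot x)\cdot y\downarrow\wedge(k\cdot x)\cdot y=x\}$, $\mathbf 1=\{k\in A\mid\forall x,y\in A.\ k\cdot x\downarrow\wedge(k\cdot x)\cdot y\downarrow\wedge(k\cdot x)\cdot y=y\}$, and $A_2=\{a\in A\mid\forall k\in\mathbf 0\cup\mathbf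 1.\ a\cdot k\downarrow\}$. For a formula $p$ of the internal language of $\mathsf{Asm}(\mathcal B,(A,\cdot),\phi)$ and a variable $a$ of type $A$, the formula $a\mathrel{\mathbf r}p$ of the internal language of $\mathcal B$ (where variables of sort $X$ are replaced by variables of sort $|X|$ and morphisms by their underlying morphisms) is defined recursively: - $a\mathrel{\mathbf r}(t=s)$ iff $t=s$; $a\mathrel{\mathbf r}\top$ iff $\top$; $a\mathrel{\mathbf r}\bot$ iff $\bot$; - $a\mathrel{\mathbf r}(x\in U)$, for an atomic relation given by a subobject $U\in\mathsf{Sub}(X)$, iff $(a,x)\in V$, where $V\in\mathsf{Sub}(A\times|X|)$ is a fixed chosen representation of $U$, i.e. $V\le_{\mathbf r}E_X(U)$ and $E_X(U)\le_{\mathbf r}V$; - $a\mathrel{\mathbf r}(p\wedge q)$ iff $a\in A_2\wedge\forall k\in\mathbf 0.(a\cdot k\mathrel{\mathbf r}p)\wedge\forall l\in\mathbf 1.(a\cdot l\mathrel{\mathbf r}q)$; - $a\mathrel{\mathbf r}(p\vee q)$ iff $\bigl(a\in A_2\wedge(\forall k\in\mathbf 0.\,a\cdot k\in\mathbf 0)\wedge\forall l\in\mathbf 1.(a\cdot l\mathrel{\mathbf r}p)\bigr)\vee\bigl(a\in A_2\wedge(\forall k\in\mathbf 0.\,a\cdot k\in\mathbf 1)\wedge\forall l\in\mathbf 1.(a\cdot l\mathrel{\mathbf r}q)\bigr)$; - $a\mathrel{\mathbf r}(p\to q)$ iff $\forall b\in A.\ (b\mathrel{\mathbf r}p)\to a\cdot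 b\downarrow\wedge(a\cdot b\mathrel{\mathbf r}q)$; - $a\mathrel{\mathbf r}(\exists x\in X.\,p)$ iff $a\in A_2\wedge\exists x\in|X|.\ \forall k\in\mathbf 0.\,(a\cdot k,x)\in\rho_X\wedge\forall l\in\mathbf 1.\,(a\cdot l\mathrel{\mathbf r}p)$; - $a\mathrel{\mathbf r}(\forall x\in X.\,p)$ iff $\forall b\in A,x\in|X|.\ (b,x)\in\rho_X\to a\cdot b\downarrow\wedge(a\cdot b\mathrel{\mathbf r}p)$. *)

theory Defs
  imports "HOL-Algebra.Galois_Connection"
begin

section \<open>Categories and finite limits\<close>

record ('o, 'm) cat =
  objs :: "'o set"
  arrs :: "'m set"
  src :: "'m \<Rightarrow> 'o"
  tgt :: "'m \<Rightarrow> 'o"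
  idn :: "'o \<Rightarrow> 'm"
  cmp :: "'m \<Rightarrow> 'm \<Rightarrow> 'm" (infixr \<open>\<odot>\<index>\<close> 75)

definition Hom :: "('o, 'm) cat \<Rightarrow> 'o \<Rightarrow> 'o \<Rightarrow> 'm set" where
  "Hom C X Y = {f \<in> arrs C. src C f = X \<and> tgt C f = Y}"

locale category =
  fixes C :: "('o, 'm) cat" (structure)
  assumes src_obj: "f \<in> arrs C \<Longrightarrow> src C f \<in> objs C"
    and tgt_obj: "f \<in> arrs C \<Longrightarrow> tgt C f \<in> objs C"
    and idn_hom: "X \<in> objs C \<Longrightarrow> idn C X \<in> Hom C X X"
    and cmp_hom: "\<lbrakk>f \<in> Hom C X Y; g \<in> Hom C Y Z\<rbrakk> \<Longrightarrow> g \<odot> f \<in> Hom C X Z"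
    and idn_right: "f \<in> Hom C X Y \<Longrightarrow> f \<odot> idn C X = f"
    and idn_left: "f \<in> Hom C X Y \<Longrightarrow> idn C Y \<odot> f = f"
    and cmp_assoc: "\<lbrakk>f \<in> Hom C W X; g \<in> Hom C X Y; h \<in> Hom C Y Z\<rbrakk>
      \<Longrightarrow> (h \<odot> g) \<odot> f = h \<odot> (g \<odot> f)"

definition monic :: "('o, 'm) cat \<Rightarrow> 'm \<Rightarrow> bool" where
  "monic C m \<longleftrightarrow> m \<in> arrs C \<and>
     (\<forall>W. \<forall>g \<in> Hom C W (src C m). \<forall>h \<in> Hom C W (src C m).
        m \<odot>\<^bsub>C\<^esub> g = m \<odot>\<^bsub>C\<^esub> h \<longrightarrow> g = h)"

definition iso_arr :: "('o, 'm) cat \<Rightarrow> 'm \<Rightarrow> bool" where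
  "iso_arr C f \<longleftrightarrow> f \<in> arrs C \<and>
     (\<exists>g \<in> Hom C (tgt C f) (src C f).
        g \<odot>\<^bsub>C\<^esub> f = idn C (src C f) \<and> f \<odot>\<^bsub>C\<^esub> g = idn C (tgt C f))"

definition regular_epi :: "('o, 'm) cat \<Rightarrow> 'm \<Rightarrow> bool" where
  "regular_epi C e \<longleftrightarrow> e \<in> arrs C \<and>
     (\<exists>W. \<exists>f \<in> Hom C W (src C e). \<exists>g \<in> Hom C W (src C e).
        e \<odot>\<^bsub>C\<^esub> f = e \<odot>\<^bsub>C\<^esub> g \<and>
        (\<forall>Z. \<forall>h \<in> Hom C (src C e) Z. h \<odot>\<^bsub>C\<^esub> f = h \<odot>\<^bsub>C\<^esub> g \<longrightarrow>
           (\<exists>!k. k \<in> Hom C (tgt C e) Z \<and> k \<odot>\<^bsub>C\<^esub> e = h)))"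

definition is_terminal :: "('o, 'm) cat \<Rightarrow> 'o \<Rightarrow> bool" where
  "is_terminal C T \<longleftrightarrow> T \<in> objs C \<and> (\<forall>X \<in> objs C. \<exists>!h. h \<in> Hom C X T)"

definition is_product :: "('o, 'm) cat \<Rightarrow> 'm \<Rightarrow> 'm \<Rightarrow> bool" where
  "is_product C p q \<longleftrightarrow> p \<in> arrs C \<and> q \<in> arrs C \<and> src C p = src C q \<and>
     (\<forall>Z. \<forall>f \<in> Hom C Z (tgt C p). \<forall>g \<in> Hom C Z (tgt C q).
        \<exists>!h. h \<in> Hom C Z (src C p) \<and> p \<odot>\<^bsub>C\<^esub> h = f \<and> q \<odot>\<^bsub>C\<^esub> h = g)"

definition is_equalizer :: "('o, 'm) cat \<Rightarrow> 'm \<Rightarrow> 'm \<Rightarrow> 'm \<Rightarrow> bool" where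
  "is_equalizer C e f g \<longleftrightarrow>
     f \<in> arrs C \<and> g \<in> Hom C (src C f) (tgt C f) \<and> e \<in> arrs C \<and> tgt C e = src C f \<and>
     f \<odot>\<^bsub>C\<^esub> e = g \<odot>\<^bsub>C\<^esub> e \<and>
     (\<forall>Z. \<forall>h \<in> Hom C Z (src C f). f \<odot>\<^bsub>C\<^esub> h = g \<odot>\<^bsub>C\<^esub> h \<longrightarrow>
        (\<exists>!k. k \<in> Hom C Z (src C e) \<and> e \<odot>\<^bsub>C\<^esub> k = h))"

text \<open>In \<open>is_pullback C p q f g\<close> the arrow \<open>p\<close> is the pullback of \<open>g\<close> along \<open>f\<close>;
  the commuting square is \<open>f \<circ> p = g \<circ> q\<close>.\<close>

definition is_pullback :: "('o, 'm) cat \<Rightarrow> 'm \<Rightarrow> 'm \<Rightarrow> 'm \<Rightarrow> 'm \<Rightarrow> bool" where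
  "is_pullback C p q f g \<longleftrightarrow>
     f \<in> arrs C \<and> g \<in> arrs C \<and> tgt C f = tgt C g \<and>
     p \<in> arrs C \<and> tgt C p = src C f \<and> q \<in> Hom C (src C p) (src C g) \<and>
     f \<odot>\<^bsub>C\<^esub> p = g \<odot>\<^bsub>C\<^esub> q \<and>
     (\<forall>Z. \<forall>u \<in> Hom C Z (src C f). \<forall>v \<in> Hom C Z (src C g).
        f \<odot>\<^bsub>C\<^esub> u = g \<odot>\<^bsub>C\<^esub> v \<longrightarrow>
        (\<exists>!h. h \<in> Hom C Z (src C p) \<and> p \<odot>\<^bsub>C\<^esub> h = u \<and> q \<odot>\<^bsub>C\<^esub> h = v))"

definition is_power :: "('o, 'm) cat \<Rightarrow> 'o \<Rightarrow> 'o \<Rightarrow> 'm list \<Rightarrow> bool" where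
  "is_power C A P ps \<longleftrightarrow> P \<in> objs C \<and> set ps \<subseteq> Hom C P A \<and>
     (\<forall>Z \<in> objs C. \<forall>fs. length fs = length ps \<and> set fs \<subseteq> Hom C Z A \<longrightarrow>
        (\<exists>!h. h \<in> Hom C Z P \<and> map (\<lambda>p. p \<odot>\<^bsub>C\<^esub> h) ps = fs))"

locale finite_limit_category = category +
  assumes terminal_exists: "\<exists>T. is_terminal C T"
    and product_exists: "\<lbrakk>X \<in> objs C; Y \<in> objs C\<rbrakk>
      \<Longrightarrow> \<exists>p q. is_product C p q \<and> tgt C p = X \<and> tgt C q = Y"
    and equalizer_exists: "\<lbrakk>f \<in> Hom C X Y; g \<in> Hom C X Y\<rbrakk> \<Longrightarrow> \<exists>e. is_equalizer C e f g"

definition one :: "('o, 'm) cat \<Rightarrow> 'o" where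
  "one C = (SOME T. is_terminal C T)"

definition bang :: "('o, 'm) cat \<Rightarrow> 'o \<Rightarrow> 'o \<Rightarrow> 'm" where
  "bang C X T = (THE h. h \<in> Hom C X T)"

definition prod_cone :: "('o, 'm) cat \<Rightarrow> 'o \<Rightarrow> 'o \<Rightarrow> 'm \<times> 'm" where
  "prod_cone C X Y = (SOME (p, q). is_product C p q \<and> tgt C p = X \<and> tgt C q = Y)"

definition pr1 :: "('o, 'm) cat \<Rightarrow> 'o \<Rightarrow> 'o \<Rightarrow> 'm" where
  "pr1 C X Y = fst (prod_cone C X Y)"

definition pr2 :: "('o, 'm) cat \<Rightarrow> 'o \<Rightarrow> 'o \<Rightarrow> 'm" where
  "pr2 C X Y = snd (prod_cone C X Y)"

definition prd :: "('o, 'm) cat \<Rightarrow> 'o \<Rightarrow> 'o \<Rightarrow> 'o" where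
  "prd C X Y = src C (pr1 C X Y)"

definition tuple :: "('o, 'm) cat \<Rightarrow> 'm \<Rightarrow> 'm \<Rightarrow> 'm \<Rightarrow> 'm \<Rightarrow> 'm" where
  "tuple C p q f g =
     (THE h. h \<in> Hom C (src C f) (src C p) \<and> p \<odot>\<^bsub>C\<^esub> h = f \<and> q \<odot>\<^bsub>C\<^esub> h = g)"

definition prod_map :: "('o, 'm) cat \<Rightarrow> 'm \<Rightarrow> 'm \<Rightarrow> 'm" where
  "prod_map C f g =
     tuple C (pr1 C (tgt C f) (tgt C g)) (pr2 C (tgt C f) (tgt C g))
       (f \<odot>\<^bsub>C\<^esub> pr1 C (src C f) (src C g)) (g \<odot>\<^bsub>C\<^esub> pr2 C (src C f) (src C g))"


section \<open>Subobjects\<close>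

definition sub_of :: "('o, 'm) cat \<Rightarrow> 'm \<Rightarrow> 'm set" where
  "sub_of C m = {n. monic C n \<and> tgt C n = tgt C m \<and>
     (\<exists>h \<in> Hom C (src C n) (src C m). iso_arr C h \<and> m \<odot>\<^bsub>C\<^esub> h = n)}"

definition Sub :: "('o, 'm) cat \<Rightarrow> 'o \<Rightarrow> 'm set gorder" where
  "Sub C X = \<lparr>carrier = sub_of C ` {m. monic C m \<and> tgt C m = X},
              eq = (=),
              le = (\<lambda>U V. \<exists>m \<in> U. \<exists>n \<in> V.
                      \<exists>h \<in> Hom C (src C m) (src C n). n \<odot>\<^bsub>C\<^esub> h = m)\<rparr>"

text \<open>The pullbacks along \<open>f\<close> of the members of an isomorphism class of monomorphisms
  form an isomorphism class again.\<close>

definition inv_im :: "('o, 'm) cat \<Rightarrow> 'm \<Rightarrow> 'm set \<Rightarrow> 'm set" where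
  "inv_im C f U = {n. \<exists>m \<in> U. \<exists>g. is_pullback C n g f m}"

definition is_ex_im :: "('o, 'm) cat \<Rightarrow> 'm \<Rightarrow> ('m set \<Rightarrow> 'm set) \<Rightarrow> bool" where
  "is_ex_im C f E \<longleftrightarrow> galois_connection
     \<lparr>orderA = Sub C (src C f), orderB = Sub C (tgt C f), lower = E, upper = inv_im C f\<rparr>"

definition is_all_im :: "('o, 'm) cat \<Rightarrow> 'm \<Rightarrow> ('m set \<Rightarrow> 'm set) \<Rightarrow> bool" where
  "is_all_im C f F \<longleftrightarrow> galois_connection
     \<lparr>orderA = Sub C (tgt C f), orderB = Sub C (src C f), lower = inv_im C f, upper = F\<rparr>"

definition ex_im :: "('o, 'm) cat \<Rightarrow> 'm \<Rightarrow> 'm set \<Rightarrow> 'm set" where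
  "ex_im C f = (SOME E. is_ex_im C f E)"

definition all_im :: "('o, 'm) cat \<Rightarrow> 'm \<Rightarrow> 'm set \<Rightarrow> 'm set" where
  "all_im C f = (SOME F. is_all_im C f F)"

definition inhabited :: "('o, 'm) cat \<Rightarrow> 'o \<Rightarrow> bool" where
  "inhabited C X \<longleftrightarrow> regular_epi C (bang C X (one C))"

definition inhabited_sub :: "('o, 'm) cat \<Rightarrow> 'm set \<Rightarrow> bool" where
  "inhabited_sub C U \<longleftrightarrow> (\<exists>m \<in> U. inhabited C (src C m))"


section \<open>Heyting categories\<close>

locale heyting_algebra = bounded_lattice +
  assumes imp_exists: "\<lbrakk>x \<in> carrier L; y \<in> carrier L\<rbrakk>
    \<Longrightarrow> \<exists>r. greatest L r {z \<in> carrier L. z \<sqinter> x \<sqsubseteq> y}"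

definition himp :: "'a gorder \<Rightarrow> 'a \<Rightarrow> 'a \<Rightarrow> 'a" where
  "himp L x y = (SOME r. greatest L r {z \<in> carrier L. z \<sqinter>\<^bsub>L\<^esub> x \<sqsubseteq>\<^bsub>L\<^esub> y})"

definition heyting_hom :: "'a gorder \<Rightarrow> 'b gorder \<Rightarrow> ('a \<Rightarrow> 'b) \<Rightarrow> bool" where
  "heyting_hom L M f \<longleftrightarrow> f \<in> carrier L \<rightarrow> carrier M \<and>
     f \<top>\<^bsub>L\<^esub> = \<top>\<^bsub>M\<^esub> \<and> f \<bottom>\<^bsub>L\<^esub> = \<bottom>\<^bsub>M\<^esub> \<and>
     (\<forall>x \<in> carrier L. \<forall>y \<in> carrier L.
        f (x \<sqinter>\<^bsub>L\<^esub> y) = f x \<sqinter>\<^bsub>M\<^esub> f y \<and>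
        f (x \<squnion>\<^bsub>L\<^esub> y) = f x \<squnion>\<^bsub>M\<^esub> f y \<and>
        f (himp L x y) = himp M (f x) (f y))"

locale heyting_category = finite_limit_category +
  assumes sub_heyting: "X \<in> objs C \<Longrightarrow> heyting_algebra (Sub C X)"
    and inv_im_hom: "f \<in> Hom C X Y \<Longrightarrow> heyting_hom (Sub C Y) (Sub C X) (inv_im C f)"
    and ex_im_exists: "f \<in> arrs C \<Longrightarrow> \<exists>E. is_ex_im C f E"
    and all_im_exists: "f \<in> arrs C \<Longrightarrow> \<exists>F. is_all_im C f F"
    and beck_chevalley_ex: "\<lbrakk>is_pullback C g' f' f g; U \<in> carrier (Sub C (src C g))\<rbrakk>
      \<Longrightarrow> ex_im C g' (inv_im C f' U) = inv_im C f (ex_im C g U)"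
    and beck_chevalley_all: "\<lbrakk>is_pullback C g' f' f g; U \<in> carrier (Sub C (src C g))\<rbrakk>
      \<Longrightarrow> all_im C g' (inv_im C f' U) = inv_im C f (all_im C g U)"


section \<open>The internal language\<close>

text \<open>The sorts are the objects, the function symbols the arrows and the relation symbols the
  subobjects of the category.  Symbols with several arguments are obtained with \<open>TPair p q\<close>,
  which forms pairs with respect to an arbitrary binary product cone \<open>(p, q)\<close>, and constants
  with \<open>TUnit T\<close>, the element of an arbitrary terminal object \<open>T\<close>.\<close>

datatype ('v, 'o, 'm) trm =
    TVar 'v
  | TApp 'm "('v, 'o, 'm) trm"
  | TUnit 'o
  | TPair 'm 'm "('v, 'o, 'm) trm" "('v, 'o, 'm) trm"

datatype ('v, 'o, 'm) fml =
    FEq "('v, 'o, 'm) trm" "('v, 'o, 'm) trm"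
  | FMem 'o "'m set" "('v, 'o, 'm) trm"
  | FTop
  | FBot
  | FAnd "('v, 'o, 'm) fml" "('v, 'o, 'm) fml"
  | FOr "('v, 'o, 'm) fml" "('v, 'o, 'm) fml"
  | FImp "('v, 'o, 'm) fml" "('v, 'o, 'm) fml"
  | FEx 'v 'o "('v, 'o, 'm) fml"
  | FAll 'v 'o "('v, 'o, 'm) fml"

primrec has_sort ::
  "('o, 'm) cat \<Rightarrow> ('v \<rightharpoonup> 'o) \<Rightarrow> ('v, 'o, 'm) trm \<Rightarrow> 'o \<Rightarrow> bool" where
  "has_sort C \<Gamma> (TVar v) X \<longleftrightarrow> \<Gamma> v = Some X"
| "has_sort C \<Gamma> (TApp f t) X \<longleftrightarrow> f \<in> arrs C \<and> tgt C f = X \<and> has_sort C \<Gamma> t (src C f)"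
| "has_sort C \<Gamma> (TUnit T) X \<longleftrightarrow> is_terminal C T \<and> T = X"
| "has_sort C \<Gamma> (TPair p q t s) X \<longleftrightarrow> is_product C p q \<and> src C p = X \<and>
     has_sort C \<Gamma> t (tgt C p) \<and> has_sort C \<Gamma> s (tgt C q)"

primrec wf_fml :: "('o, 'm) cat \<Rightarrow> ('v \<rightharpoonup> 'o) \<Rightarrow> ('v, 'o, 'm) fml \<Rightarrow> bool" where
  "wf_fml C \<Gamma> (FEq t s) \<longleftrightarrow> (\<exists>X. has_sort C \<Gamma> t X \<and> has_sort C \<Gamma> s X)"
| "wf_fml C \<Gamma> (FMem X U t) \<longleftrightarrow> X \<in> objs C \<and> U \<in> carrier (Sub C X) \<and> has_sort C \<Gamma> t X"
| "wf_fml C \<Gamma> FTop \<longleftrightarrow> True"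
| "wf_fml C \<Gamma> FBot \<longleftrightarrow> True"
| "wf_fml C \<Gamma> (FAnd p q) \<longleftrightarrow> wf_fml C \<Gamma> p \<and> wf_fml C \<Gamma> q"
| "wf_fml C \<Gamma> (FOr p q) \<longleftrightarrow> wf_fml C \<Gamma> p \<and> wf_fml C \<Gamma> q"
| "wf_fml C \<Gamma> (FImp p q) \<longleftrightarrow> wf_fml C \<Gamma> p \<and> wf_fml C \<Gamma> q"
| "wf_fml C \<Gamma> (FEx v X p) \<longleftrightarrow> X \<in> objs C \<and> wf_fml C (\<Gamma>(v \<mapsto> X)) p"
| "wf_fml C \<Gamma> (FAll v X p) \<longleftrightarrow> X \<in> objs C \<and> wf_fml C (\<Gamma>(v \<mapsto> X)) p"

definition closed_fml :: "('o, 'm) cat \<Rightarrow> ('v, 'o, 'm) fml \<Rightarrow> bool" where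
  "closed_fml C p \<longleftrightarrow> wf_fml C Map.empty p"

text \<open>Terms and formulas are interpreted over an object \<open>Z\<close> that interprets the context; the
  environment \<open>e\<close> assigns to each variable in the context its projection, an arrow out of \<open>Z\<close>.
  A quantifier over \<open>X\<close> enlarges the context to \<open>X \<times> Z\<close>.\<close>

primrec trm_val ::
  "('o, 'm) cat \<Rightarrow> 'o \<Rightarrow> ('v \<rightharpoonup> 'm) \<Rightarrow> ('v, 'o, 'm) trm \<Rightarrow> 'm" where
  "trm_val C Z e (TVar v) = the (e v)"
| "trm_val C Z e (TApp f t) = f \<odot>\<^bsub>C\<^esub> trm_val C Z e t"
| "trm_val C Z e (TUnit T) = bang C Z T"
| "trm_val C Z e (TPair p q t s) = tuple C p q (trm_val C Z e t) (trm_val C Z e s)"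

definition env_ext ::
  "('o, 'm) cat \<Rightarrow> 'v \<Rightarrow> 'o \<Rightarrow> 'o \<Rightarrow> ('v \<rightharpoonup> 'm) \<Rightarrow> ('v \<rightharpoonup> 'm)" where
  "env_ext C v X Z e =
     (\<lambda>w. map_option (\<lambda>g. g \<odot>\<^bsub>C\<^esub> pr2 C X Z) (e w))(v \<mapsto> pr1 C X Z)"

primrec fml_val ::
  "('o, 'm) cat \<Rightarrow> ('v, 'o, 'm) fml \<Rightarrow> 'o \<Rightarrow> ('v \<rightharpoonup> 'm) \<Rightarrow> 'm set" where
  "fml_val C (FEq t s) Z e = {m. is_equalizer C m (trm_val C Z e t) (trm_val C Z e s)}"
| "fml_val C (FMem X U t) Z e = inv_im C (trm_val C Z e t) U"
| "fml_val C FTop Z e = \<top>\<^bsub>Sub C Z\<^esub>"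
| "fml_val C FBot Z e = \<bottom>\<^bsub>Sub C Z\<^esub>"
| "fml_val C (FAnd p q) Z e = fml_val C p Z e \<sqinter>\<^bsub>Sub C Z\<^esub> fml_val C q Z e"
| "fml_val C (FOr p q) Z e = fml_val C p Z e \<squnion>\<^bsub>Sub C Z\<^esub> fml_val C q Z e"
| "fml_val C (FImp p q) Z e = himp (Sub C Z) (fml_val C p Z e) (fml_val C q Z e)"
| "fml_val C (FEx v X p) Z e =
     ex_im C (pr2 C X Z) (fml_val C p (prd C X Z) (env_ext C v X Z e))"
| "fml_val C (FAll v X p) Z e =
     all_im C (pr2 C X Z) (fml_val C p (prd C X Z) (env_ext C v X Z e))"

definition truth_value :: "('o, 'm) cat \<Rightarrow> ('v, 'o, 'm) fml \<Rightarrow> 'm set" where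
  "truth_value C p = fml_val C p (one C) Map.empty"

definition holds :: "('o, 'm) cat \<Rightarrow> ('v, 'o, 'm) fml \<Rightarrow> bool" where
  "holds C p \<longleftrightarrow> truth_value C p = \<top>\<^bsub>Sub C (one C)\<^esub>"

definition compr :: "('o, 'm) cat \<Rightarrow> 'v \<Rightarrow> 'o \<Rightarrow> ('v, 'o, 'm) fml \<Rightarrow> 'm set" where
  "compr C v X p = fml_val C p X [v \<mapsto> idn C X]"

definition pair_trm ::
  "('o, 'm) cat \<Rightarrow> 'o \<Rightarrow> 'o \<Rightarrow> ('v, 'o, 'm) trm \<Rightarrow> ('v, 'o, 'm) trm \<Rightarrow> ('v, 'o, 'm) trm" where
  "pair_trm C X Y t s = TPair (pr1 C X Y) (pr2 C X Y) t s"

definition FBall ::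
  "'v \<Rightarrow> 'o \<Rightarrow> 'm set \<Rightarrow> ('v, 'o, 'm) fml \<Rightarrow> ('v, 'o, 'm) fml" where
  "FBall v X U p = FAll v X (FImp (FMem X U (TVar v)) p)"


section \<open>Partial applicative structures\<close>

text \<open>A partial morphism is given by a representing span.\<close>

definition partial_mor :: "('o, 'm) cat \<Rightarrow> 'o \<Rightarrow> 'o \<Rightarrow> 'm \<Rightarrow> 'm \<Rightarrow> bool" where
  "partial_mor C X Y m f \<longleftrightarrow> monic C m \<and> tgt C m = X \<and> f \<in> Hom C (src C m) Y"

record ('o, 'm) pas =
  elts :: 'o
  app_dom :: 'm
  app_map :: 'm

definition is_pas :: "('o, 'm) cat \<Rightarrow> ('o, 'm) pas \<Rightarrow> bool" where
  "is_pas C S \<longleftrightarrow> elts S \<in> objs C \<and>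
     partial_mor C (prd C (elts S) (elts S)) (elts S) (app_dom S) (app_map S)"

text \<open>Formulas of the base category use variables \<open>Inl n\<close> as auxiliary variables, mostly of
  sort \<open>A\<close>, and \<open>Inr x\<close> for the variables \<open>x\<close> of a formula that is being realized.\<close>

type_synonym ('o, 'm) btrm = "(nat + nat, 'o, 'm) trm"
type_synonym ('o, 'm) bfml = "(nat + nat, 'o, 'm) fml"

abbreviation rv :: "nat \<Rightarrow> ('o, 'm) btrm" where
  "rv n \<equiv> TVar (Inl n)"

text \<open>\<open>dot C S n t s K\<close> is the formula \<open>t \<cdot> s \<down> \<and> K (t \<cdot> s)\<close>.  For a
  span \<open>m : D \<rightarrow> A \<times> A\<close>, \<open>f : D \<rightarrow> A\<close> representing the application it is written as
  \<open>\<exists>d \<in> D. m(d) = (t, s) \<and> K (f(d))\<close>.  The variable \<open>Inl n\<close> is used for \<open>d\<close>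
  and must be fresh: no variable \<open>Inl i\<close> with \<open>i \<ge> n\<close> may occur in \<open>t\<close> or \<open>s\<close>.
  Likewise \<open>apps C S n t [s\<^sub>1, \<dots>, s\<^sub>k] K\<close> says that \<open>(t \<cdot> s\<^sub>1) \<cdots> s\<^sub>k\<close> is defined and satisfies \<open>K\<close>;
  it uses up the variables \<open>Inl n, \<dots>, Inl (n + k - 1)\<close>.\<close>

definition dot ::
  "('o, 'm) cat \<Rightarrow> ('o, 'm) pas \<Rightarrow> nat \<Rightarrow> ('o, 'm) btrm \<Rightarrow> ('o, 'm) btrm \<Rightarrow>
   (('o, 'm) btrm \<Rightarrow> ('o, 'm) bfml) \<Rightarrow> ('o, 'm) bfml" where
  "dot C S n t s K =
     FEx (Inl n) (src C (app_dom S))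
       (FAnd (FEq (TApp (app_dom S) (rv n)) (pair_trm C (elts S) (elts S) t s))
             (K (TApp (app_map S) (rv n))))"

fun apps ::
  "('o, 'm) cat \<Rightarrow> ('o, 'm) pas \<Rightarrow> nat \<Rightarrow> ('o, 'm) btrm \<Rightarrow> ('o, 'm) btrm list \<Rightarrow>
   (('o, 'm) btrm \<Rightarrow> ('o, 'm) bfml) \<Rightarrow> ('o, 'm) bfml" where
  "apps C S n t [] K = K t"
| "apps C S n t (s # ss) K = dot C S n t s (\<lambda>u. apps C S (Suc n) u ss K)"

text \<open>The variables \<open>0, \<dots>, 4\<close> below are \<open>k, s, x, y, z\<close>.\<close>

definition pca_axioms ::
  "('o, 'm) cat \<Rightarrow> ('o, 'm) pas \<Rightarrow> 'm set \<Rightarrow> 'm set \<Rightarrow> ('o, 'm) bfml" where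
  "pca_axioms C S kk ss =
     (let A = elts S; k = rv 0; s = rv 1; x = rv 2; y = rv 3; z = rv 4 in
      FBall (Inl 0) A kk (FBall (Inl 1) A ss
        (FAll (Inl 2) A (FAll (Inl 3) A (FAll (Inl 4) A
          (FAnd (apps C S 5 k [x, y] (\<lambda>u. FEq u x))
          (FAnd (apps C S 5 s [x, y] (\<lambda>u. FTop))
            (FImp
              (dot C S 5 x z (\<lambda>u. dot C S 6 y z (\<lambda>v. dot C S 7 u v (\<lambda>w. FTop))))
              (dot C S 5 x z (\<lambda>u. dot C S 6 y z (\<lambda>v. dot C S 7 u v
                (\<lambda>w. apps C S 8 s [x, y, z] (\<lambda>w'. FEq w' w)))))))))))))"

definition is_pca :: "('o, 'm) cat \<Rightarrow> ('o, 'm) pas \<Rightarrow> bool" where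
  "is_pca C S \<longleftrightarrow> is_pas C S \<and>
     (\<exists>kk \<in> carrier (Sub C (elts S)). \<exists>ss \<in> carrier (Sub C (elts S)).
        inhabited_sub C kk \<and> inhabited_sub C ss \<and> holds C (pca_axioms C S kk ss))"


section \<open>Filters\<close>

definition sub_prod :: "('o, 'm) cat \<Rightarrow> 'o \<Rightarrow> 'o \<Rightarrow> 'm set \<Rightarrow> 'm set \<Rightarrow> 'm set" where
  "sub_prod C X Y U V =
     inv_im C (pr1 C X Y) U \<sqinter>\<^bsub>Sub C (prd C X Y)\<^esub> inv_im C (pr2 C X Y) V"

definition app_image :: "('o, 'm) cat \<Rightarrow> ('o, 'm) pas \<Rightarrow> 'm set \<Rightarrow> 'm set \<Rightarrow> 'm set" where
  "app_image C S U V =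
     ex_im C (app_map S) (inv_im C (app_dom S) (sub_prod C (elts S) (elts S) U V))"

definition is_pas_filter :: "('o, 'm) cat \<Rightarrow> ('o, 'm) pas \<Rightarrow> 'm set set \<Rightarrow> bool" where
  "is_pas_filter C S \<phi> \<longleftrightarrow>
     \<phi> \<subseteq> {U \<in> carrier (Sub C (elts S)). inhabited_sub C U} \<and>
     (\<forall>U \<in> \<phi>. \<forall>V \<in> carrier (Sub C (elts S)). U \<sqsubseteq>\<^bsub>Sub C (elts S)\<^esub> V \<longrightarrow> V \<in> \<phi>) \<and>
     (\<forall>U \<in> \<phi>. \<forall>V \<in> \<phi>.
        sub_prod C (elts S) (elts S) U V
          \<sqsubseteq>\<^bsub>Sub C (prd C (elts S) (elts S))\<^esub> sub_of C (app_dom S)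
        \<longrightarrow> app_image C S U V \<in> \<phi>)"

text \<open>Computability of the partial morphism \<open>A\<^sup>n \<rightharpoonup> A\<close> represented by \<open>m : D \<rightarrow> A\<^sup>n\<close> and
  \<open>f : D \<rightarrow> A\<close>, where \<open>ps\<close> are the \<open>n\<close> projections of \<open>A\<^sup>n\<close>.  In the second formula the tuples
  in the domain are given as \<open>m(d)\<close> with \<open>d \<in> D\<close>.\<close>

definition computable ::
  "('o, 'm) cat \<Rightarrow> ('o, 'm) pas \<Rightarrow> 'm set set \<Rightarrow> 'm list \<Rightarrow> 'm \<Rightarrow> 'm \<Rightarrow> bool" where
  "computable C S \<phi> ps m f \<longleftrightarrow>
     (let A = elts S; n = length ps in
      \<exists>R \<in> \<phi>.
        holds C (FBall (Inl 0) A R (foldr (\<lambda>i. FAll (Inl i) A) [1..<n]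
          (apps C S n (rv 0) (map rv [1..<n]) (\<lambda>u. FTop)))) \<and>
        holds C (FBall (Inl 0) A R (FAll (Inl 1) (src C m)
          (apps C S 2 (rv 0) (map (\<lambda>p. TApp p (TApp m (rv 1))) ps)
            (\<lambda>u. FEq u (TApp f (rv 1)))))))"

text \<open>The span \<open>(m, f)\<close> represents the pointwise application of the partial morphisms
  represented by \<open>(m1, f1)\<close> and \<open>(m2, f2)\<close>: first restrict both to the intersection of their
  domains, then to the preimage of the domain of the application.\<close>

definition pointwise_app ::
  "('o, 'm) cat \<Rightarrow> ('o, 'm) pas \<Rightarrow> 'm \<Rightarrow> 'm \<Rightarrow> 'm \<Rightarrow> 'm \<Rightarrow> 'm \<Rightarrow> 'm \<Rightarrow> bool" where
  "pointwise_app C S m1 f1 m2 f2 m f \<longleftrightarrow>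
     (\<exists>d1 d2 b1 b2. is_pullback C d1 d2 m1 m2 \<and>
        is_pullback C b1 b2
          (tuple C (pr1 C (elts S) (elts S)) (pr2 C (elts S) (elts S))
             (f1 \<odot>\<^bsub>C\<^esub> d1) (f2 \<odot>\<^bsub>C\<^esub> d2))
          (app_dom S) \<and>
        m = m1 \<odot>\<^bsub>C\<^esub> (d1 \<odot>\<^bsub>C\<^esub> b1) \<and> f = app_map S \<odot>\<^bsub>C\<^esub> b2)"

definition combinatory_complete ::
  "('o, 'm) cat \<Rightarrow> ('o, 'm) pas \<Rightarrow> 'm set set \<Rightarrow> bool" where
  "combinatory_complete C S \<phi> \<longleftrightarrow>
     (\<forall>P ps. ps \<noteq> [] \<and> is_power C (elts S) P ps \<longrightarrow>
        (\<forall>p \<in> set ps. computable C S \<phi> ps (idn C P) p) \<and>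
        (\<forall>m1 f1 m2 f2 m f.
           partial_mor C P (elts S) m1 f1 \<and> computable C S \<phi> ps m1 f1 \<and>
           partial_mor C P (elts S) m2 f2 \<and> computable C S \<phi> ps m2 f2 \<and>
           pointwise_app C S m1 f1 m2 f2 m f \<longrightarrow> computable C S \<phi> ps m f))"


section \<open>Assemblies\<close>

type_synonym ('o, 'm) asm = "'o \<times> 'm set"
type_synonym ('o, 'm) asm_arr = "('o, 'm) asm \<times> 'm \<times> ('o, 'm) asm"

abbreviation und :: "('o, 'm) asm \<Rightarrow> 'o" where "und X \<equiv> fst X"
abbreviation rlz :: "('o, 'm) asm \<Rightarrow> 'm set" where "rlz X \<equiv> snd X"
abbreviation und_arr :: "('o, 'm) asm_arr \<Rightarrow> 'm" where "und_arr f \<equiv> fst (snd f)"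

definition is_asm :: "('o, 'm) cat \<Rightarrow> ('o, 'm) pas \<Rightarrow> ('o, 'm) asm \<Rightarrow> bool" where
  "is_asm C S X \<longleftrightarrow> und X \<in> objs C \<and> rlz X \<in> carrier (Sub C (prd C (elts S) (und X))) \<and>
     holds C (FAll (Inl 1) (und X) (FEx (Inl 0) (elts S)
       (FMem (prd C (elts S) (und X)) (rlz X)
         (pair_trm C (elts S) (und X) (rv 0) (rv 1))) :: ('o, 'm) bfml))"

definition tracks ::
  "('o, 'm) cat \<Rightarrow> ('o, 'm) pas \<Rightarrow> 'm set \<Rightarrow> ('o, 'm) asm \<Rightarrow> 'm \<Rightarrow> ('o, 'm) asm \<Rightarrow> bool" where
  "tracks C S R X f Y \<longleftrightarrow>
     (let A = elts S; a = rv 0; b = rv 1; x = rv 2 in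
      holds C (FAll (Inl 0) A (FAll (Inl 1) A (FAll (Inl 2) (und X)
        (FImp
          (FAnd (FMem A R a) (FMem (prd C A (und X)) (rlz X) (pair_trm C A (und X) b x)))
          (dot C S 3 a b
            (\<lambda>c. FMem (prd C A (und Y)) (rlz Y) (pair_trm C A (und Y) c (TApp f x)))))))))"

definition Asm ::
  "('o, 'm) cat \<Rightarrow> ('o, 'm) pas \<Rightarrow> 'm set set \<Rightarrow> (('o, 'm) asm, ('o, 'm) asm_arr) cat" where
  "Asm C S \<phi> =
     \<lparr>objs = {X. is_asm C S X},
      arrs = {(X, f, Y). is_asm C S X \<and> is_asm C S Y \<and> f \<in> Hom C (und X) (und Y) \<and>
                (\<exists>R \<in> \<phi>. tracks C S R X f Y)},
      src = (\<lambda>(X, f, Y). X),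
      tgt = (\<lambda>(X, f, Y). Y),
      idn = (\<lambda>X. (X, idn C (und X), X)),
      cmp = (\<lambda>(Y', g, Z) (X, f, Y). (X, g \<odot>\<^bsub>C\<^esub> f, Z))\<rparr>"


section \<open>Representing subobjects\<close>

definition hset ::
  "('o, 'm) cat \<Rightarrow> ('o, 'm) pas \<Rightarrow> 'o \<Rightarrow> 'm set \<Rightarrow> 'm set \<Rightarrow> 'm set" where
  "hset C S X U V =
     (let A = elts S; a = rv 0; b = rv 1; x = rv 2 in
      compr C (Inl 0) A (FAll (Inl 1) A (FAll (Inl 2) X
        (FImp (FMem (prd C A X) U (pair_trm C A X b x))
          (dot C S 3 a b (\<lambda>c. FMem (prd C A X) V (pair_trm C A X c x)))))))"

definition le_r ::
  "('o, 'm) cat \<Rightarrow> ('o, 'm) pas \<Rightarrow> 'm set set \<Rightarrow> 'o \<Rightarrow> 'm set \<Rightarrow> 'm set \<Rightarrow> bool" where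
  "le_r C S \<phi> X U V \<longleftrightarrow> hset C S X U V \<in> \<phi>"

text \<open>For a representing monomorphism \<open>\<mu> : X\<^sub>U \<rightarrow> X\<close> of \<open>U\<close>, this is \<open>E\<^sub>X(U)\<close>.\<close>

definition sub_rlz ::
  "('o, 'm) cat \<Rightarrow> ('o, 'm) pas \<Rightarrow> ('o, 'm) asm_arr \<Rightarrow> 'm set" where
  "sub_rlz C S \<mu> = ex_im C (prod_map C (idn C (elts S)) (und_arr \<mu>)) (rlz (fst \<mu>))"

definition is_mono_choice ::
  "('o, 'm) cat \<Rightarrow> ('o, 'm) pas \<Rightarrow> 'm set set \<Rightarrow>
   (('o, 'm) asm \<Rightarrow> ('o, 'm) asm_arr set \<Rightarrow> ('o, 'm) asm_arr) \<Rightarrow> bool" where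
  "is_mono_choice C S \<phi> \<mu> \<longleftrightarrow>
     (\<forall>X \<in> objs (Asm C S \<phi>). \<forall>U \<in> carrier (Sub (Asm C S \<phi>) X). \<mu> X U \<in> U)"

definition is_representation ::
  "('o, 'm) cat \<Rightarrow> ('o, 'm) pas \<Rightarrow> 'm set set \<Rightarrow>
   (('o, 'm) asm \<Rightarrow> ('o, 'm) asm_arr set \<Rightarrow> ('o, 'm) asm_arr) \<Rightarrow>
   (('o, 'm) asm \<Rightarrow> ('o, 'm) asm_arr set \<Rightarrow> 'm set) \<Rightarrow> bool" where
  "is_representation C S \<phi> \<mu> V \<longleftrightarrow>
     (\<forall>X \<in> objs (Asm C S \<phi>). \<forall>U \<in> carrier (Sub (Asm C S \<phi>) X).
        V X U \<in> carrier (Sub C (prd C (elts S) (und X))) \<and>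
        le_r C S \<phi> (und X) (V X U) (sub_rlz C S (\<mu> X U)) \<and>
        le_r C S \<phi> (und X) (sub_rlz C S (\<mu> X U)) (V X U))"


section \<open>Realizability\<close>

definition zero_sub :: "('o, 'm) cat \<Rightarrow> ('o, 'm) pas \<Rightarrow> 'm set" where
  "zero_sub C S =
     compr C (Inl 0) (elts S) (FAll (Inl 1) (elts S) (FAll (Inl 2) (elts S)
       (apps C S 3 (rv 0) [rv 1, rv 2] (\<lambda>u. FEq u (rv 1)))))"

definition one_sub :: "('o, 'm) cat \<Rightarrow> ('o, 'm) pas \<Rightarrow> 'm set" where
  "one_sub C S =
     compr C (Inl 0) (elts S) (FAll (Inl 1) (elts S) (FAll (Inl 2) (elts S)
       (apps C S 3 (rv 0) [rv 1, rv 2] (\<lambda>u. FEq u (rv 2)))))"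

definition A2_sub :: "('o, 'm) cat \<Rightarrow> ('o, 'm) pas \<Rightarrow> 'm set" where
  "A2_sub C S =
     compr C (Inl 0) (elts S)
       (FBall (Inl 1) (elts S) (zero_sub C S \<squnion>\<^bsub>Sub C (elts S)\<^esub> one_sub C S)
         (dot C S 2 (rv 0) (rv 1) (\<lambda>u. FTop)))"

primrec und_trm ::
  "(nat, ('o, 'm) asm, ('o, 'm) asm_arr) trm \<Rightarrow> ('o, 'm) btrm" where
  "und_trm (TVar x) = TVar (Inr x)"
| "und_trm (TApp f t) = TApp (und_arr f) (und_trm t)"
| "und_trm (TUnit T) = TUnit (und T)"
| "und_trm (TPair p q t s) = TPair (und_arr p) (und_arr q) (und_trm t) (und_trm s)"

text \<open>\<open>rlzs C S V p n a\<close> is the formula \<open>a \<^bold>r p\<close> for a term \<open>a\<close> of sort \<open>A\<close> in which no variable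
  \<open>Inl i\<close> with \<open>i \<ge> n\<close> occurs.  An instance \<open>a \<cdot> k \<^bold>r p\<close> asserts in particular that
  \<open>a \<cdot> k\<close> is defined.\<close>

primrec rlzs ::
  "('o, 'm) cat \<Rightarrow> ('o, 'm) pas \<Rightarrow>
   (('o, 'm) asm \<Rightarrow> ('o, 'm) asm_arr set \<Rightarrow> 'm set) \<Rightarrow>
   (nat, ('o, 'm) asm, ('o, 'm) asm_arr) fml \<Rightarrow> nat \<Rightarrow> ('o, 'm) btrm \<Rightarrow> ('o, 'm) bfml" where
  "rlzs C S V (FEq t s) n a = FEq (und_trm t) (und_trm s)"
| "rlzs C S V (FMem X U t) n a =
     FMem (prd C (elts S) (und X)) (V X U) (pair_trm C (elts S) (und X) a (und_trm t))"
| "rlzs C S V FTop n a = FTop"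
| "rlzs C S V FBot n a = FBot"
| "rlzs C S V (FAnd p q) n a =
     FAnd (FMem (elts S) (A2_sub C S) a)
    (FAnd (FBall (Inl n) (elts S) (zero_sub C S)
            (dot C S (n + 1) a (rv n) (\<lambda>c. rlzs C S V p (n + 2) c)))
          (FBall (Inl n) (elts S) (one_sub C S)
            (dot C S (n + 1) a (rv n) (\<lambda>c. rlzs C S V q (n + 2) c))))"
| "rlzs C S V (FOr p q) n a =
     FOr
      (FAnd (FMem (elts S) (A2_sub C S) a)
      (FAnd (FBall (Inl n) (elts S) (zero_sub C S)
              (dot C S (n + 1) a (rv n) (\<lambda>c. FMem (elts S) (zero_sub C S) c)))
            (FBall (Inl n) (elts S) (one_sub C S)
              (dot C S (n + 1) a (rv n) (\<lambda>c. rlzs C S V p (n + 2) c)))))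
      (FAnd (FMem (elts S) (A2_sub C S) a)
      (FAnd (FBall (Inl n) (elts S) (zero_sub C S)
              (dot C S (n + 1) a (rv n) (\<lambda>c. FMem (elts S) (one_sub C S) c)))
            (FBall (Inl n) (elts S) (one_sub C S)
              (dot C S (n + 1) a (rv n) (\<lambda>c. rlzs C S V q (n + 2) c)))))"
| "rlzs C S V (FImp p q) n a =
     FAll (Inl n) (elts S)
       (FImp (rlzs C S V p (n + 1) (rv n))
             (dot C S (n + 1) a (rv n) (\<lambda>c. rlzs C S V q (n + 2) c)))"
| "rlzs C S V (FEx x X p) n a =
     FAnd (FMem (elts S) (A2_sub C S) a)
      (FEx (Inr x) (und X)
        (FAnd (FBall (Inl n) (elts S) (zero_sub C S)
                (dot C S (n + 1) a (rv n)
                  (\<lambda>c. FMem (prd C (elts S) (und X)) (rlz X)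
                          (pair_trm C (elts S) (und X) c (TVar (Inr x))))))
              (FBall (Inl n) (elts S) (one_sub C S)
                (dot C S (n + 1) a (rv n) (\<lambda>c. rlzs C S V p (n + 2) c)))))"
| "rlzs C S V (FAll x X p) n a =
     FAll (Inl n) (elts S) (FAll (Inr x) (und X)
       (FImp (FMem (prd C (elts S) (und X)) (rlz X)
               (pair_trm C (elts S) (und X) (rv n) (TVar (Inr x))))
             (dot C S (n + 1) a (rv n) (\<lambda>c. rlzs C S V p (n + 2) c))))"

definition realizer_set ::
  "('o, 'm) cat \<Rightarrow> ('o, 'm) pas \<Rightarrow>
   (('o, 'm) asm \<Rightarrow> ('o, 'm) asm_arr set \<Rightarrow> 'm set) \<Rightarrow>
   (nat, ('o, 'm) asm, ('o, 'm) asm_arr) fml \<Rightarrow> 'm set" where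
  "realizer_set C S V p = compr C (Inl 0) (elts S) (rlzs C S V p 1 (rv 0))"

end

theory Submission
  imports Defs
begin

text \<open>Forcing over generalized elements (Kripke-Joyal semantics, with covers defined through
  subobjects instead of regular epimorphisms) turns statements of the internal language of \<open>B\<close> into
  statements about arrows.  Combinatory completeness yields functional completeness: every
  applicative polynomial with parameters from members of \<open>\<phi>\<close> is tracked by a member of \<open>\<phi>\<close>.
  Hence \<open>Sub(A \<times> |\<Gamma>|)\<close>, preordered by uniform realizability, carries the logical operations given by
  the clauses of \<open>a \<^bold>r p\<close>, and by comprehension the subobjects of an assembly \<open>\<Gamma>\<close> correspond to
  its elements taken relative to \<open>\<rho>\<^sub>\<Gamma>\<close>; this correspondence \<open>rep\<close> preserves the logical operations.
  By induction on \<open>p\<close> the truth value of \<open>p\<close> is represented by its set of realizers.  Over the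
  terminal assembly, \<open>\<tau>\<^sub>p = \<top>\<close> then says that some \<open>R \<in> \<phi>\<close> maps every element of \<open>A\<close> to a
  realizer of \<open>p\<close>, which is to say that the set of realizers belongs to \<open>\<phi>\<close>.\<close>

section \<open>Categories and subobjects\<close>

text \<open>The difficulty is that the members of \<open>\<phi>\<close> are subobjects that need not
  have global elements. A realizer can therefore not be chosen: it is replaced by all generalized
  elements of some \<open>R \<in> \<phi>\<close> at all stages at once, and an element of the image
  of \<open>R \<times> F\<close> under application is an application \<open>r \<cdot> f\<close> only
  after passing to a cover. Every statement about realizers must hence be local. It is local because
  application has a monic domain: witnesses of definedness are unique, so the values found on a
  cover are restrictions of one value at the stage itself. The operations on subobjects of
  assemblies are not read off from a Heyting structure known beforehand. Several are picked by
  \<open>SOME\<close> from a universal property, and each is identified by exhibiting a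
  comprehension that has this property. Terms may refer to arbitrary terminal objects and arbitrary
  product cones of assemblies, so these are compared with standard ones to see that their underlying
  arrows have the same universal property in the base.\<close>

lemma Hom_iff [simp]: "f \<in> Hom C X Y \<longleftrightarrow> f \<in> arrs C \<and> src C f = X \<and> tgt C f = Y"
 by (simp add: Hom_def)

abbreviation subs :: "('o, 'm) cat \<Rightarrow> 'o \<Rightarrow> 'm set set" where
 "subs C X \<equiv> carrier (Sub C X)"

text \<open>Elements in the generalized sense: arrows from an arbitrary stage. The members of a
  subobject factor through one another by isomorphisms, so it does not matter which representative
  \<open>m\<close> is met.\<close>

definition mem :: "('o, 'm) cat \<Rightarrow> 'm \<Rightarrow> 'm set \<Rightarrow> bool" where
 "mem C x U \<longleftrightarrow> x \<in> arrs C \<and>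
  (\<exists>m \<in> U. \<exists>h \<in> arrs C. src C x = src C h \<and> tgt C h = src C m \<and> m \<odot>\<^bsub>C\<^esub> h = x)"

lemma mem_arr [dest]: "mem C x U \<Longrightarrow> x \<in> arrs C"
 by (simp add: mem_def)

section \<open>Operations of an order determined by their universal property\<close>

text \<open>The adjoints of inverse image are specified through records of HOL-Algebra. In this
  unfolded form the adjunctions are used for the base and established for assemblies.\<close>

lemma galois_connection_iff:
 assumes "partial_order K" "partial_order L"
 shows "galois_connection \<lparr>orderA = K, orderB = L, lower = F, upper = G\<rparr> \<longleftrightarrow>
  F \<in> carrier K \<rightarrow> carrier L \<and> G \<in> carrier L \<rightarrow> carrier K \<and>
  (\<forall>x \<in> carrier K. \<forall>y \<in> carrier L. F x \<sqsubseteq>\<^bsub>L\<^esub> y \<longleftrightarrow> x \<sqsubseteq>\<^bsub>K\<^esub> G y)"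
 using assms by (auto simp: galois_connection_def connection_def galois_connection_axioms_def)

text \<open>The operations of HOL-Algebra are picked by \<open>SOME\<close>; antisymmetry identifies
  the pick with any candidate having the universal property. Only a partial order is assumed,
  because the criterion is also meant for subobjects of assemblies, where no lattice structure is at
  hand.\<close>

lemma (in partial_order) top_eqI:
 assumes "w \<in> carrier L" "\<And>x. x \<in> carrier L \<Longrightarrow> x \<sqsubseteq> w"
 shows "\<top> = w"
proof -
 have "greatest L w (carrier L)"
  using assms by (simp add: greatest_def)
 moreover from this have "greatest L (\<top>) (carrier L)"
  unfolding top_def by (rule someI)
 ultimately show ?thesis
  by (meson greatest_closed greatest_le le_antisym)
qed

lemma (in partial_order) bottom_eqI:
 assumes "w \<in> carrier L" "\<And>x. x \<in> carrier L \<Longrightarrow> w \<sqsubseteq> x"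
 shows "\<bottom> = w"
proof -
 have "least L w (carrier L)"
  using assms by (simp add: least_def)
 moreover from this have "least L (\<bottom>) (carrier L)"
  unfolding bottom_def by (rule someI)
 ultimately show ?thesis
  by (meson least_closed least_le le_antisym)
qed

lemma (in partial_order) meet_eqI:
 assumes "w \<in> carrier L" "a \<in> carrier L" "b \<in> carrier L"
  and "\<And>x. x \<in> carrier L \<Longrightarrow> x \<sqsubseteq> w \<longleftrightarrow> x \<sqsubseteq> a \<and> x \<sqsubseteq> b"
 shows "a \<sqinter> b = w"
proof -
 have *: "greatest L w (Lower L {a, b})"
  using assms by (auto simp: greatest_def Lower_def)
 then have "greatest L (a \<sqinter> b) (Lower L {a, b})"
  unfolding meet_def inf_def by (rule someI)
 with * show ?thesis
  by (meson greatest_closed greatest_le greatest_mem le_antisym)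
qed

lemma (in partial_order) join_eqI:
 assumes "w \<in> carrier L" "a \<in> carrier L" "b \<in> carrier L"
  and "\<And>x. x \<in> carrier L \<Longrightarrow> w \<sqsubseteq> x \<longleftrightarrow> a \<sqsubseteq> x \<and> b \<sqsubseteq> x"
 shows "a \<squnion> b = w"
proof -
 have *: "least L w (Upper L {a, b})"
  using assms by (auto simp: least_def Upper_def)
 then have "least L (a \<squnion> b) (Upper L {a, b})"
  unfolding join_def sup_def by (rule someI)
 with * show ?thesis
  by (meson least_closed least_le least_mem le_antisym)
qed

lemma himp_eqI:
 fixes L :: "'a gorder" (structure)
 assumes "partial_order L"
  and "w \<in> carrier L" "\<And>z. z \<in> carrier L \<Longrightarrow> z \<sqsubseteq> w \<longleftrightarrow> z \<sqinter> a \<sqsubseteq> b"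
 shows "himp L a b = w"
proof -
 interpret partial_order L by fact
 have *: "greatest L w {z \<in> carrier L. z \<sqinter> a \<sqsubseteq> b}"
  using assms by (auto simp: greatest_def)
 then have "greatest L (himp L a b) {z \<in> carrier L. z \<sqinter> a \<sqsubseteq> b}"
  unfolding himp_def by (rule someI)
 with * show ?thesis
  by (meson greatest_closed greatest_le greatest_mem le_antisym)
qed

section \<open>Composition, monomorphisms and isomorphisms\<close>

context category
begin

declare src_obj [simp] tgt_obj [simp]

lemma cmp_simps [simp]:
 assumes "f \<in> arrs C" "g \<in> arrs C" "tgt C f = src C g"
 shows "g \<odot> f \<in> arrs C" "src C (g \<odot> f) = src C f" "tgt C (g \<odot> f) = tgt C g"
 using cmp_hom[of f "src C f" "src C g" g "tgt C g"] assms by auto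

lemma idn_simps [simp]:
 assumes "X \<in> objs C"
 shows "idn C X \<in> arrs C" "src C (idn C X) = X" "tgt C (idn C X) = X"
 using idn_hom[OF assms] by auto

lemma cmp_idn [simp]:
 "f \<in> arrs C \<Longrightarrow> src C f = X \<Longrightarrow> f \<odot> idn C X = f"
 "f \<in> arrs C \<Longrightarrow> tgt C f = X \<Longrightarrow> idn C X \<odot> f = f"
 using idn_right idn_left by auto

lemma assoc [simp]:
 assumes "f \<in> arrs C" "g \<in> arrs C" "h \<in> arrs C" "tgt C f = src C g" "tgt C g = src C h"
 shows "(h \<odot> g) \<odot> f = h \<odot> (g \<odot> f)"
 using cmp_assoc[of f "src C f" "tgt C f" g "tgt C g" h "tgt C h"] assms by simp

text \<open>The rule \<open>assoc\<close> normalizes composites to the right, so an equation for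
  \<open>g \<odot> f\<close> no longer matches inside \<open>g \<odot> (f \<odot> h)\<close>; this
  form makes it applicable there.\<close>

lemma cmp_reassoc:
 assumes "g \<odot> f = k" "f \<in> arrs C" "g \<in> arrs C" "h \<in> arrs C" "tgt C f = src C g" "tgt C h = src C f"
 shows "g \<odot> (f \<odot> h) = k \<odot> h"
 using assms by auto

lemma monicD:
 assumes "monic C m" "m \<odot> g = m \<odot> h" "g \<in> arrs C" "h \<in> arrs C" "src C g = src C h"
  "tgt C g = src C m" "tgt C h = src C m"
 shows "g = h"
 using assms unfolding monic_def by auto

lemma monic_arr [simp]: "monic C m \<Longrightarrow> m \<in> arrs C"
 by (simp add: monic_def)

lemma monic_idn: "X \<in> objs C \<Longrightarrow> monic C (idn C X)"
 unfolding monic_def by auto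

lemma iso_idn: "X \<in> objs C \<Longrightarrow> iso_arr C (idn C X)"
 by (auto simp: iso_arr_def intro!: bexI[of _ "idn C X"])

lemma monic_cmp:
 assumes "monic C m" "monic C n" "tgt C m = src C n"
 shows "monic C (n \<odot> m)"
 unfolding monic_def
proof (intro conjI allI ballI impI)
 show "n \<odot> m \<in> arrs C" using assms by simp
 fix W g h
 assume *: "g \<in> Hom C W (src C (n \<odot> m))" "h \<in> Hom C W (src C (n \<odot> m))"
  "(n \<odot> m) \<odot> g = (n \<odot> m) \<odot> h"
 then have "m \<odot> g = m \<odot> h"
  using assms by - (rule monicD[OF assms(2)], auto)
 with * show "g = h"
  using assms by - (rule monicD[OF assms(1)], auto)
qed

lemma sub_of_self: "monic C m \<Longrightarrow> m \<in> sub_of C m"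
 using iso_idn[of "src C m"] by (auto simp: sub_of_def intro!: bexI[of _ "idn C (src C m)"])

lemma sub_ofE:
 assumes "n \<in> sub_of C m"
 obtains i where "monic C n" "tgt C n = tgt C m" "i \<in> arrs C" "src C n = src C i" "tgt C i = src C m"
  "iso_arr C i" "m \<odot> i = n"
 using assms unfolding sub_of_def Hom_iff by fastforce

lemma sub_ofI:
 assumes "monic C n" "tgt C n = tgt C m" "i \<in> arrs C" "src C n = src C i" "tgt C i = src C m"
  "iso_arr C i" "m \<odot> i = n"
 shows "n \<in> sub_of C m"
 using assms unfolding sub_of_def Hom_iff by fastforce

lemma iso_arrE:
 assumes "iso_arr C i"
 obtains j where "i \<in> arrs C" "j \<in> arrs C" "src C j = tgt C i" "tgt C j = src C i"
  "j \<odot> i = idn C (src C i)" "i \<odot> j = idn C (tgt C i)"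
 using assms unfolding iso_arr_def by auto

lemma iso_arrI:
 assumes "i \<in> arrs C" "j \<in> arrs C" "src C j = tgt C i" "tgt C j = src C i"
  "j \<odot> i = idn C (src C i)" "i \<odot> j = idn C (tgt C i)"
 shows "iso_arr C i"
 using assms unfolding iso_arr_def by auto

lemma iso_cmp:
 assumes "iso_arr C f" "iso_arr C g" "tgt C f = src C g"
 shows "iso_arr C (g \<odot> f)"
proof -
 obtain f' where f: "f \<in> arrs C" "f' \<in> arrs C" "src C f' = tgt C f" "tgt C f' = src C f"
  "f' \<odot> f = idn C (src C f)" "f \<odot> f' = idn C (tgt C f)"
  using assms(1) by (rule iso_arrE)
 obtain g' where g: "g \<in> arrs C" "g' \<in> arrs C" "src C g' = tgt C g" "tgt C g' = src C g"
  "g' \<odot> g = idn C (src C g)" "g \<odot> g' = idn C (tgt C g)"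
  using assms(2) by (rule iso_arrE)
 show ?thesis
  by (rule iso_arrI[of _ "f' \<odot> g'"])
   (use f g assms(3) in \<open>simp_all add: cmp_reassoc[OF f(6)] cmp_reassoc[OF g(5)]\<close>)
qed

section \<open>Subobjects through their generalized elements\<close>

lemma carrier_SubE:
 assumes "U \<in> subs C X"
 obtains m where "monic C m" "tgt C m = X" "U = sub_of C m"
 using assms by (auto simp: Sub_def)

lemma sub_of_carrier: "monic C m \<Longrightarrow> tgt C m = X \<Longrightarrow> sub_of C m \<in> subs C X"
 by (auto simp: Sub_def)

lemma mem_sub_of:
 assumes "monic C m"
 shows "mem C x (sub_of C m) \<longleftrightarrow>
  x \<in> arrs C \<and> (\<exists>h \<in> arrs C. src C x = src C h \<and> tgt C h = src C m \<and> m \<odot> h = x)"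
proof
 assume "mem C x (sub_of C m)"
 then obtain n h where n: "n \<in> sub_of C m"
  and h: "x \<in> arrs C" "h \<in> arrs C" "src C x = src C h" "tgt C h = src C n" "n \<odot> h = x"
  by (auto simp: mem_def)
 from n obtain i where "monic C n" "i \<in> arrs C" "src C n = src C i" "tgt C i = src C m" "m \<odot> i = n"
  by (rule sub_ofE)
 with h show "x \<in> arrs C \<and> (\<exists>h \<in> arrs C. src C x = src C h \<and> tgt C h = src C m \<and> m \<odot> h = x)"
  using assms by (auto intro!: bexI[of _ "i \<odot> h"])
next
 assume "x \<in> arrs C \<and> (\<exists>h \<in> arrs C. src C x = src C h \<and> tgt C h = src C m \<and> m \<odot> h = x)"
 then show "mem C x (sub_of C m)"
  using sub_of_self[OF assms] by (auto simp: mem_def)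
qed

lemma mem_tgt: "mem C x U \<Longrightarrow> U \<in> subs C X \<Longrightarrow> tgt C x = X"
 by (auto elim!: carrier_SubE simp: mem_sub_of)

lemma mem_cmp:
 assumes "mem C x U" "U \<in> subs C X" "k \<in> arrs C" "tgt C k = src C x"
 shows "mem C (x \<odot> k) U"
proof -
 obtain m where m: "monic C m" "tgt C m = X" "U = sub_of C m"
  using assms(2) by (rule carrier_SubE)
 with assms(1) obtain h where "x \<in> arrs C" "h \<in> arrs C" "src C x = src C h" "tgt C h = src C m" "m \<odot> h = x"
  by (auto simp: mem_sub_of)
 with m assms(3,4) show ?thesis
  by (auto simp: mem_sub_of intro!: bexI[of _ "h \<odot> k"])
qed

lemma mem_self:
 assumes "monic C m"
 shows "mem C m (sub_of C m)"
 using assms by (auto simp: mem_sub_of intro!: bexI[of _ "idn C (src C m)"])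

text \<open>Isomorphisms compose and invert, so a subobject is the class of each of its members.
  Later proofs can work with whichever representative a definition happens to deliver.\<close>

lemma in_carrierD:
 assumes "U \<in> subs C X" "m \<in> U"
 shows "monic C m" "tgt C m = X" "U = sub_of C m"
proof -
 obtain n where n: "monic C n" "tgt C n = X" "U = sub_of C n"
  using assms(1) by (rule carrier_SubE)
 have "m \<in> sub_of C n"
  using assms(2) n(3) by simp
 then obtain i where i: "monic C m" "tgt C m = tgt C n" "i \<in> arrs C" "src C m = src C i" "tgt C i = src C n"
  "iso_arr C i" "n \<odot> i = m"
  by (rule sub_ofE)
 then show m: "monic C m" "tgt C m = X"
  using n by simp_all
 obtain j where j: "j \<in> arrs C" "src C j = tgt C i" "tgt C j = src C i"
  "j \<odot> i = idn C (src C i)" "i \<odot> j = idn C (tgt C i)"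
  using i(6) by (rule iso_arrE)
 have "iso_arr C j"
  by (rule iso_arrI[of _ i]) (use i j in simp_all)
 have nm: "m \<odot> j = n"
  using i(7)[symmetric] i(3,5) j n by simp
 \<comment> \<open>Both inclusions are transport along an isomorphism: once along \<open>j\<close>,
   once along its inverse \<open>i\<close>.\<close>
 have sub: "p \<in> sub_of C b" if "p \<in> sub_of C a" "b \<odot> k = a" "iso_arr C k" "tgt C k = src C b" "src C a = src C k"
   "monic C a" "monic C b" "tgt C a = tgt C b" for a b k p
 proof -
  from that(1) obtain h where h: "monic C p" "tgt C p = tgt C a" "h \<in> arrs C" "src C p = src C h"
   "tgt C h = src C a" "iso_arr C h" "a \<odot> h = p"
   by (rule sub_ofE)
  have k: "k \<in> arrs C" using that(3) by (simp add: iso_arr_def)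
  show ?thesis
   by (rule sub_ofI[of _ _ "k \<odot> h"]) (use h k that iso_cmp[OF h(6) that(3)] in \<open>simp_all add: cmp_reassoc[OF that(2)]\<close>)
 qed
 show "U = sub_of C m"
  unfolding n(3)
 proof (intro equalityI subsetI)
  fix p assume "p \<in> sub_of C n"
  then show "p \<in> sub_of C m"
   by (rule sub[where k = j]) (use i j n nm \<open>iso_arr C j\<close> in simp_all)
 next
  fix p assume "p \<in> sub_of C m"
  then show "p \<in> sub_of C n"
   by (rule sub[where k = i]) (use i j n in simp_all)
 qed
qed

text \<open>A Yoneda argument: membership is stable under precomposition, and a representing
  monomorphism is itself the generic element of its subobject. All later comparisons of subobjects
  go through elements.\<close>

lemma Sub_le_iff:
 assumes "U \<in> subs C X" "V \<in> subs C X"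
 shows "U \<sqsubseteq>\<^bsub>Sub C X\<^esub> V \<longleftrightarrow> (\<forall>x. mem C x U \<longrightarrow> mem C x V)"
proof
 assume "U \<sqsubseteq>\<^bsub>Sub C X\<^esub> V"
 then obtain m n h where *: "m \<in> U" "n \<in> V" "h \<in> arrs C" "src C m = src C h" "tgt C h = src C n" "n \<odot> h = m"
  by (auto simp: Sub_def)
 note U = in_carrierD[OF assms(1) *(1)] and V = in_carrierD[OF assms(2) *(2)]
 show "\<forall>x. mem C x U \<longrightarrow> mem C x V"
 proof (intro allI impI)
  fix x assume "mem C x U"
  then obtain k where "x \<in> arrs C" "k \<in> arrs C" "src C x = src C k" "tgt C k = src C m" "m \<odot> k = x"
   unfolding U(3) by (auto simp: mem_sub_of U)
  with * U V show "mem C x V"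
   unfolding V(3) by (auto simp: mem_sub_of intro!: bexI[of _ "h \<odot> k"])
 qed
next
 assume *: "\<forall>x. mem C x U \<longrightarrow> mem C x V"
 obtain m where m: "monic C m" "tgt C m = X" "U = sub_of C m"
  using assms(1) by (rule carrier_SubE)
 then have "mem C m V"
  using * mem_self by blast
 then obtain n h where n: "n \<in> V" "h \<in> arrs C" "src C m = src C h" "tgt C h = src C n" "n \<odot> h = m"
  by (auto simp: mem_def)
 have "h \<in> Hom C (src C m) (src C n)"
  using n by simp
 with n(1,5) sub_of_self[OF m(1)] show "U \<sqsubseteq>\<^bsub>Sub C X\<^esub> V"
  unfolding m(3) Sub_def gorder.select_convs by blast
qed

text \<open>The two generic elements factor through each other, and the factorizations are mutually
  inverse because both monomorphisms can be cancelled.\<close>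

lemma sub_eqI:
 assumes U: "U \<in> subs C X" and V: "V \<in> subs C X"
  and *: "\<And>x. mem C x U \<longleftrightarrow> mem C x V"
 shows "U = V"
proof -
 obtain m where m: "monic C m" "tgt C m = X" "U = sub_of C m"
  using U by (rule carrier_SubE)
 obtain n where n: "monic C n" "tgt C n = X" "V = sub_of C n"
  using V by (rule carrier_SubE)
 have "mem C m V" "mem C n U"
  using * m n mem_self by auto
 then obtain h k where h: "h \<in> arrs C" "src C m = src C h" "tgt C h = src C n" "n \<odot> h = m"
  and k: "k \<in> arrs C" "src C n = src C k" "tgt C k = src C m" "m \<odot> k = n"
  by (auto simp: m n mem_sub_of)
 have "h \<odot> k = idn C (src C n)"
  by (rule monicD[OF n(1)]) (use h k n m in \<open>auto simp: cmp_reassoc[OF h(4)]\<close>)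
 moreover have "k \<odot> h = idn C (src C m)"
  by (rule monicD[OF m(1)]) (use h k n m in \<open>auto simp: cmp_reassoc[OF k(4)]\<close>)
 ultimately have "iso_arr C h"
  by (intro iso_arrI[of h k]) (use h k in simp_all)
 then have "m \<in> V"
  unfolding n(3) by (intro sub_ofI[of _ _ h]) (use h k m n in simp_all)
 with in_carrierD(3)[OF V] m show ?thesis by metis
qed

lemma Sub_partial_order: "partial_order (Sub C X)"
proof -
 have eq: "x .=\<^bsub>Sub C X\<^esub> y \<longleftrightarrow> x = y" for x y
  by (simp add: Sub_def)
 show ?thesis
 proof unfold_locales
  show "(.=\<^bsub>Sub C X\<^esub>) = (=)" by (auto simp: Sub_def)
 next
  fix x y
  assume "x \<sqsubseteq>\<^bsub>Sub C X\<^esub> y" "y \<sqsubseteq>\<^bsub>Sub C X\<^esub> x" "x \<in> subs C X" "y \<in> subs C X"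
  then show "x .=\<^bsub>Sub C X\<^esub> y"
   unfolding eq by (intro sub_eqI[of x X y]) (auto simp: Sub_le_iff)
 qed (auto simp: eq Sub_le_iff)
qed

lemma
 assumes "X \<in> objs C"
 shows top_carrier: "\<top>\<^bsub>Sub C X\<^esub> \<in> subs C X"
  and mem_top: "mem C x (\<top>\<^bsub>Sub C X\<^esub>) \<longleftrightarrow> x \<in> arrs C \<and> tgt C x = X"
proof -
 have i: "monic C (idn C X)" by (rule monic_idn[OF assms])
 have c: "sub_of C (idn C X) \<in> subs C X"
  by (rule sub_of_carrier) (use assms i in auto)
 have m: "mem C x (sub_of C (idn C X)) \<longleftrightarrow> x \<in> arrs C \<and> tgt C x = X" for x
  using assms i by (auto simp: mem_sub_of)
 have "\<top>\<^bsub>Sub C X\<^esub> = sub_of C (idn C X)"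
  by (rule partial_order.top_eqI[OF Sub_partial_order c])
   (use c in \<open>auto simp: Sub_le_iff m mem_tgt\<close>)
 with c m show "\<top>\<^bsub>Sub C X\<^esub> \<in> subs C X"
  "mem C x (\<top>\<^bsub>Sub C X\<^esub>) \<longleftrightarrow> x \<in> arrs C \<and> tgt C x = X"
  by auto
qed

lemma eq_top_iff:
 assumes "X \<in> objs C" "U \<in> subs C X"
 shows "U = \<top>\<^bsub>Sub C X\<^esub> \<longleftrightarrow> mem C (idn C X) U"
proof
 assume *: "mem C (idn C X) U"
 show "U = \<top>\<^bsub>Sub C X\<^esub>"
  by (rule sub_eqI[OF assms(2) top_carrier[OF assms(1)]])
   (use mem_cmp[OF * assms(2)] assms mem_tgt in \<open>auto simp: mem_top\<close>)
qed (use assms in \<open>auto simp: mem_top\<close>)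

lemma meet_charI:
 assumes "W \<in> subs C X" "U \<in> subs C X" "V \<in> subs C X"
  and "\<And>x. mem C x W \<longleftrightarrow> mem C x U \<and> mem C x V"
 shows "U \<sqinter>\<^bsub>Sub C X\<^esub> V = W"
 by (rule partial_order.meet_eqI[OF Sub_partial_order]) (use assms in \<open>auto simp: Sub_le_iff\<close>)

lemma equalizer_sub:
 assumes m: "is_equalizer C m f g" and fg: "f \<in> Hom C X Y" "g \<in> Hom C X Y"
 shows "monic C m" "tgt C m = X"
  and "mem C x (sub_of C m) \<longleftrightarrow> x \<in> arrs C \<and> tgt C x = X \<and> f \<odot> x = g \<odot> x"
proof -
 have ex: "\<exists>!k. k \<in> Hom C (src C h) (src C m) \<and> m \<odot> k = h"
  if "h \<in> arrs C" "tgt C h = X" "f \<odot> h = g \<odot> h" for h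
  using m that fg by (auto simp: is_equalizer_def)
 have m': "m \<in> arrs C" "tgt C m = X" "f \<odot> m = g \<odot> m"
  using m fg by (auto simp: is_equalizer_def)
 show mono: "monic C m"
  unfolding monic_def
 proof (intro conjI allI ballI impI)
  fix V a b assume ab: "a \<in> Hom C V (src C m)" "b \<in> Hom C V (src C m)" "m \<odot> a = m \<odot> b"
  have "\<exists>!k. k \<in> Hom C (src C (m \<odot> a)) (src C m) \<and> m \<odot> k = m \<odot> a"
   by (rule ex) (use ab m' fg in \<open>auto simp: cmp_reassoc[OF m'(3)]\<close>)
  then show "a = b" using ab m' by auto
 qed (rule m')
 show "tgt C m = X" by (rule m'(2))
 show "mem C x (sub_of C m) \<longleftrightarrow> x \<in> arrs C \<and> tgt C x = X \<and> f \<odot> x = g \<odot> x"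
  unfolding mem_sub_of[OF mono]
 proof (intro iffI conjI; elim conjE bexE)
  fix h assume h: "h \<in> arrs C" "src C x = src C h" "tgt C h = src C m" "m \<odot> h = x"
  then show "tgt C x = X" using m' by auto
  have "f \<odot> m \<odot> h = g \<odot> m \<odot> h"
   using h m' fg cmp_reassoc[OF m'(3), of h] by auto
  with h show "f \<odot> x = g \<odot> x" by simp
 next
  assume "x \<in> arrs C" "tgt C x = X" "f \<odot> x = g \<odot> x"
  from ex1_implies_ex[OF ex[OF this]]
  show "\<exists>h\<in>arrs C. src C x = src C h \<and> tgt C h = src C m \<and> m \<odot> h = x"
   by (metis Hom_iff)
 qed auto
qed

text \<open>An equation is interpreted as the set of all its equalizers. Every equalizer has the
  elements of \<open>W\<close>, and conversely each member of \<open>W\<close> inherits the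
  universal property from the description of its elements. The existence of an equalizer is thus a
  consequence, which is how assemblies obtain theirs.\<close>

lemma equalizer_charI:
 assumes "W \<in> subs C X" "f \<in> Hom C X Y" "g \<in> Hom C X Y"
  and *: "\<And>x. mem C x W \<longleftrightarrow> x \<in> arrs C \<and> tgt C x = X \<and> f \<odot> x = g \<odot> x"
 shows "{m. is_equalizer C m f g} = W"
proof -
 have 1: "monic C m \<and> tgt C m = X \<and> (\<forall>x. mem C x (sub_of C m) \<longleftrightarrow> mem C x W)" if m: "is_equalizer C m f g" for m
  using equalizer_sub[OF m assms(2,3)] * by blast
 have "m \<in> W" if m: "is_equalizer C m f g" for m
  using 1[OF m] sub_of_self sub_eqI[OF sub_of_carrier assms(1)] by metis
 moreover have "is_equalizer C m f g" if "m \<in> W" for m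
 proof -
  note m = in_carrierD[OF assms(1) that]
  have mm: "mem C m W" using m mem_self by metis
  then have fm: "f \<odot> m = g \<odot> m" by (simp add: *)
  show ?thesis
   unfolding is_equalizer_def
  proof (intro conjI allI ballI impI)
   fix Z h assume "h \<in> Hom C Z (src C f)" "f \<odot> h = g \<odot> h"
   then have "mem C h W" using assms by (auto simp: *)
   then obtain k where "k \<in> arrs C" "src C h = src C k" "tgt C k = src C m" "m \<odot> k = h"
    by (subst (asm) m(3)) (auto simp: mem_sub_of m)
   then show "\<exists>!k. k \<in> Hom C Z (src C m) \<and> m \<odot> k = h"
    using monicD[OF m(1)] \<open>h \<in> _\<close> by (intro ex1I[of _ k]) auto
  qed (use assms m fm in auto)
 qed
 ultimately show ?thesis by blast
qed

lemma mem_inv_im_aux: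
 assumes "is_pullback C n g f m" "monic C m"
 shows "monic C n" "mem C x (sub_of C n) \<longleftrightarrow> x \<in> arrs C \<and> tgt C x = src C f \<and> mem C (f \<odot> x) (sub_of C m)"
proof -
 have pb: "f \<in> arrs C" "m \<in> arrs C" "tgt C f = tgt C m" "n \<in> arrs C" "tgt C n = src C f"
  "g \<in> arrs C" "src C n = src C g" "tgt C g = src C m" "f \<odot> n = m \<odot> g"
  using assms by (auto simp: is_pullback_def)
 have ex: "\<exists>!h. h \<in> Hom C (src C u) (src C n) \<and> n \<odot> h = u \<and> g \<odot> h = v"
  if "u \<in> arrs C" "tgt C u = src C f" "v \<in> arrs C" "src C v = src C u" "tgt C v = src C m" "f \<odot> u = m \<odot> v" for u v
  using assms(1) that by (auto simp: is_pullback_def)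
 show mono: "monic C n"
  unfolding monic_def
 proof (intro conjI allI ballI impI)
  fix W a b assume ab: "a \<in> Hom C W (src C n)" "b \<in> Hom C W (src C n)" "n \<odot> a = n \<odot> b"
  have eq: "m \<odot> (g \<odot> h) = f \<odot> (n \<odot> h)" if "h \<in> arrs C" "tgt C h = src C n" for h
   using that pb cmp_reassoc[OF pb(9)] by auto
  have "m \<odot> (g \<odot> a) = m \<odot> (g \<odot> b)"
   using ab by (simp add: eq)
  then have "g \<odot> a = g \<odot> b"
   by (rule monicD[OF assms(2)]) (use ab pb in auto)
  moreover have "\<exists>!h. h \<in> Hom C (src C (n \<odot> a)) (src C n) \<and> n \<odot> h = n \<odot> a \<and> g \<odot> h = g \<odot> a"
   by (rule ex) (use ab pb in \<open>auto simp: eq\<close>)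
  ultimately show "a = b" using ab pb by auto
 qed (use pb in auto)
 show "mem C x (sub_of C n) \<longleftrightarrow> x \<in> arrs C \<and> tgt C x = src C f \<and> mem C (f \<odot> x) (sub_of C m)"
  unfolding mem_sub_of[OF mono] mem_sub_of[OF assms(2)]
 proof (intro iffI conjI; elim conjE bexE)
  fix h assume h: "x \<in> arrs C" "h \<in> arrs C" "src C x = src C h" "tgt C h = src C n" "n \<odot> h = x"
  then show x: "x \<in> arrs C" "tgt C x = src C f" "f \<odot> x \<in> arrs C"
   using pb by auto
  show "\<exists>k\<in>arrs C. src C (f \<odot> x) = src C k \<and> tgt C k = src C m \<and> m \<odot> k = f \<odot> x"
   by (rule bexI[of _ "g \<odot> h"]) (use pb h x cmp_reassoc[OF pb(9)] in auto)
 next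
  fix h assume h: "x \<in> arrs C" "tgt C x = src C f"
   "h \<in> arrs C" "src C (f \<odot> x) = src C h" "tgt C h = src C m" "m \<odot> h = f \<odot> x"
  have "src C h = src C x"
   using h pb cmp_simps(2)[of x f] by metis
  then have "\<exists>!k. k \<in> Hom C (src C x) (src C n) \<and> n \<odot> k = x \<and> g \<odot> k = h"
   using h by (intro ex) simp_all
  from ex1_implies_ex[OF this]
  show "\<exists>h\<in>arrs C. src C x = src C h \<and> tgt C h = src C n \<and> n \<odot> h = x"
   by (metis Hom_iff)
 qed auto
qed

text \<open>The assumption that \<open>inv_im C f U\<close> is a subobject carries the existence of
  a pullback: a subobject is nonempty as a class, so some pullback square can be inspected.\<close>

lemma mem_inv_im:
 assumes "f \<in> Hom C X Y" "U \<in> subs C Y" "inv_im C f U \<in> subs C X"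
 shows "mem C x (inv_im C f U) \<longleftrightarrow> x \<in> arrs C \<and> tgt C x = X \<and> mem C (f \<odot> x) U"
proof -
 obtain n where n: "n \<in> inv_im C f U"
  using assms(3) by (auto elim!: carrier_SubE dest: sub_of_self)
 then obtain m g where m: "m \<in> U" "is_pullback C n g f m"
  by (auto simp: inv_im_def)
 note U = in_carrierD[OF assms(2) m(1)] and V = in_carrierD[OF assms(3) n]
 show ?thesis
  using mem_inv_im_aux(2)[OF m(2) U(1)] assms(1) U(3) V(3) by auto
qed

text \<open>No pullback is presupposed. The description of the elements of \<open>W\<close> is
  exactly the universal property that makes each member of \<open>W\<close> a pullback, so this
  criterion also computes inverse images of assemblies.\<close>

lemma inv_im_charI:
 assumes f: "f \<in> Hom C X Y" and U: "U \<in> subs C Y" and W: "W \<in> subs C X"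
  and *: "\<And>x. mem C x W \<longleftrightarrow> x \<in> arrs C \<and> tgt C x = X \<and> mem C (f \<odot> x) U"
 shows "inv_im C f U = W"
proof -
 have "n \<in> W" if "n \<in> inv_im C f U" for n
 proof -
  from that obtain m g where m: "m \<in> U" "is_pullback C n g f m"
   by (auto simp: inv_im_def)
  note U' = in_carrierD[OF U m(1)]
  have n: "monic C n" "tgt C n = X"
   using mem_inv_im_aux[OF m(2) U'(1)] m f by (auto simp: is_pullback_def)
  have "sub_of C n = W"
   by (rule sub_eqI[OF sub_of_carrier[OF n] W])
    (use mem_inv_im_aux(2)[OF m(2) U'(1)] f U'(3) * in auto)
  with sub_of_self n show ?thesis by blast
 qed
 moreover have "n \<in> inv_im C f U" if n: "n \<in> W" for n
 proof -
  note W' = in_carrierD[OF W n]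
  obtain m where m: "monic C m" "tgt C m = Y" "U = sub_of C m"
   using U by (rule carrier_SubE)
  have "mem C n W" using W' mem_self by metis
  then have "mem C (f \<odot> n) U" by (simp add: *)
  then obtain g where g: "g \<in> arrs C" "src C n = src C g" "tgt C g = src C m" "m \<odot> g = f \<odot> n"
   using f W' by (auto simp: m mem_sub_of)
  have "is_pullback C n g f m"
   unfolding is_pullback_def
  proof (intro conjI allI ballI impI)
   fix Z u v assume uv: "u \<in> Hom C Z (src C f)" "v \<in> Hom C Z (src C m)" "f \<odot> u = m \<odot> v"
   then have "mem C (f \<odot> u) U"
    unfolding m(3) mem_sub_of[OF m(1)] using f m by (intro conjI bexI[of _ v]) auto
   then have "mem C u W" using * uv f by auto
   then obtain h where h: "h \<in> arrs C" "src C u = src C h" "tgt C h = src C n" "n \<odot> h = u"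
    by (subst (asm) W'(3)) (auto simp: mem_sub_of W')
   have "m \<odot> (g \<odot> h) = m \<odot> v"
    using uv g h f m W' by (simp add: cmp_reassoc[OF g(4)])
   then have "g \<odot> h = v"
    by (rule monicD[OF m(1)]) (use uv g h in auto)
   then show "\<exists>!h. h \<in> Hom C Z (src C n) \<and> n \<odot> h = u \<and> g \<odot> h = v"
    using h uv monicD[OF W'(1)] by (intro ex1I[of _ h]) auto
  qed (use g f m W' in auto)
  then show ?thesis
   using m sub_of_self by (auto simp: inv_im_def)
 qed
 ultimately show ?thesis by blast
qed

section \<open>Terminal objects, binary products and pullbacks\<close>

lemma terminal_arr:
 assumes "is_terminal C T" "X \<in> objs C"
 shows "bang C X T \<in> arrs C" "src C (bang C X T) = X" "tgt C (bang C X T) = T"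
 using assms theI'[of "\<lambda>h. h \<in> Hom C X T"] by (auto simp: is_terminal_def bang_def)

lemma terminal_eq:
 assumes "is_terminal C T" "f \<in> arrs C" "g \<in> arrs C" "src C f = src C g" "tgt C f = T" "tgt C g = T"
 shows "f = g"
proof -
 have "\<exists>!h. h \<in> Hom C (src C f) T"
  using assms(1,2) by (auto simp: is_terminal_def)
 then show ?thesis using assms by auto
qed

lemma productD:
 assumes "is_product C p q"
 shows "p \<in> arrs C" "q \<in> arrs C" "src C q = src C p"
 using assms by (auto simp: is_product_def)

lemma product_ex1:
 assumes "is_product C p q" "f \<in> Hom C Z (tgt C p)" "g \<in> Hom C Z (tgt C q)"
 shows "\<exists>!h. h \<in> Hom C Z (src C p) \<and> p \<odot> h = f \<and> q \<odot> h = g"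
 using assms unfolding is_product_def by blast

lemma tuple:
 assumes "is_product C p q" "f \<in> arrs C" "g \<in> arrs C" "src C f = src C g"
  "tgt C f = tgt C p" "tgt C g = tgt C q"
 shows tuple_arr: "tuple C p q f g \<in> arrs C" "src C (tuple C p q f g) = src C g"
  "tgt C (tuple C p q f g) = src C p"
  and tuple_pr: "p \<odot> tuple C p q f g = f" "q \<odot> tuple C p q f g = g"
proof -
 have *: "\<exists>!h. h \<in> Hom C (src C f) (src C p) \<and> p \<odot> h = f \<and> q \<odot> h = g"
  by (rule product_ex1[OF assms(1)]) (use assms in simp_all)
 from theI'[OF *, folded tuple_def] show "tuple C p q f g \<in> arrs C" "src C (tuple C p q f g) = src C g"
  "tgt C (tuple C p q f g) = src C p" "p \<odot> tuple C p q f g = f" "q \<odot> tuple C p q f g = g"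
  using assms(4) by simp_all
qed

lemma product_eqI:
 assumes "is_product C p q" "h \<in> arrs C" "k \<in> arrs C" "src C h = src C k"
  "tgt C h = src C p" "tgt C k = src C p" "p \<odot> h = p \<odot> k" "q \<odot> h = q \<odot> k"
 shows "h = k"
proof -
 have "\<exists>!l. l \<in> Hom C (src C h) (src C p) \<and> p \<odot> l = p \<odot> h \<and> q \<odot> l = q \<odot> h"
  by (rule product_ex1[OF assms(1)]) (use assms productD[OF assms(1)] in simp_all)
 then show ?thesis using assms(2-8) by (metis Hom_iff)
qed

lemma tuple_eqI:
 assumes "is_product C p q" "h \<in> arrs C" "tgt C h = src C p" "p \<odot> h = f" "q \<odot> h = g"
 shows "tuple C p q f g = h"
proof (rule product_eqI[OF assms(1)])
 have fg: "f \<in> arrs C" "g \<in> arrs C" "src C f = src C h" "src C g = src C h" "tgt C f = tgt C p" "tgt C g = tgt C q"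
  using assms productD[OF assms(1)] by auto
 show "tuple C p q f g \<in> arrs C" "src C (tuple C p q f g) = src C h"
  "tgt C (tuple C p q f g) = src C p" "p \<odot> tuple C p q f g = p \<odot> h" "q \<odot> tuple C p q f g = q \<odot> h"
  using tuple[OF assms(1), of f g] fg assms by auto
qed (use assms in auto)

lemma tuple_cmp:
 assumes "is_product C p q" "f \<in> arrs C" "g \<in> arrs C" "src C f = src C g"
  "tgt C f = tgt C p" "tgt C g = tgt C q" "k \<in> arrs C" "tgt C k = src C g"
 shows "tuple C p q f g \<odot> k = tuple C p q (f \<odot> k) (g \<odot> k)"
proof (rule tuple_eqI[OF assms(1), symmetric])
 note t = tuple[OF assms(1-6)] and p = productD[OF assms(1)]
 show "p \<odot> tuple C p q f g \<odot> k = f \<odot> k" "q \<odot> tuple C p q f g \<odot> k = g \<odot> k"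
  using t p assms by (auto simp: cmp_reassoc[OF t(4)] cmp_reassoc[OF t(5)])
qed (use tuple[OF assms(1-6)] assms in auto)

end

context finite_limit_category
begin

lemma one_terminal: "is_terminal C (one C)"
 unfolding one_def using terminal_exists by (rule someI_ex)

lemma one_obj [simp]: "one C \<in> objs C"
 using one_terminal by (simp add: is_terminal_def)

lemma prod_cone:
 assumes "X \<in> objs C" "Y \<in> objs C"
 shows "is_product C (pr1 C X Y) (pr2 C X Y)" "tgt C (pr1 C X Y) = X" "tgt C (pr2 C X Y) = Y"
proof -
 have "\<exists>pq. case pq of (p, q) \<Rightarrow> is_product C p q \<and> tgt C p = X \<and> tgt C q = Y"
  using product_exists[OF assms] by auto
 from someI_ex[OF this]
 show "is_product C (pr1 C X Y) (pr2 C X Y)" "tgt C (pr1 C X Y) = X" "tgt C (pr2 C X Y) = Y"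
  by (auto simp: pr1_def pr2_def prod_cone_def split: prod.splits)
qed

lemma pr_simps [simp]:
 assumes "X \<in> objs C" "Y \<in> objs C"
 shows "pr1 C X Y \<in> arrs C" "pr2 C X Y \<in> arrs C"
  "src C (pr1 C X Y) = prd C X Y" "src C (pr2 C X Y) = prd C X Y"
  "tgt C (pr1 C X Y) = X" "tgt C (pr2 C X Y) = Y" "prd C X Y \<in> objs C"
 using prod_cone[OF assms] productD[OF prod_cone(1)[OF assms]] by (auto simp: prd_def)

abbreviation "pair X Y \<equiv> tuple C (pr1 C X Y) (pr2 C X Y)"

lemma pair_simps [simp]:
 assumes "f \<in> arrs C" "g \<in> arrs C" "src C f = src C g" "tgt C f = X" "tgt C g = Y"
 shows "pair X Y f g \<in> arrs C"
  "src C (pair X Y f g) = src C g"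
  "tgt C (pair X Y f g) = prd C X Y"
  "pr1 C X Y \<odot> pair X Y f g = f"
  "pr2 C X Y \<odot> pair X Y f g = g"
 using tuple[OF prod_cone(1)[of X Y], of f g] assms prod_cone(2,3)[of X Y] by auto

lemma pair_cmp:
 assumes "f \<in> arrs C" "g \<in> arrs C" "src C f = src C g" "tgt C f = X" "tgt C g = Y"
  "k \<in> arrs C" "tgt C k = src C g"
 shows "pair X Y f g \<odot> k = pair X Y (f \<odot> k) (g \<odot> k)"
 using tuple_cmp[OF prod_cone(1)[of X Y], of f g k] assms prod_cone(2,3)[of X Y] by auto

lemma pair_eta:
 assumes "X \<in> objs C" "Y \<in> objs C" "z \<in> arrs C" "tgt C z = prd C X Y"
 shows "pair X Y (pr1 C X Y \<odot> z) (pr2 C X Y \<odot> z) = z"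
 by (rule tuple_eqI[OF prod_cone(1)]) (use assms in auto)

text \<open>Equalize the two composites on the product of the sources. The Beck-Chevalley conditions
  are stated for given pullback squares, so such squares are needed to apply them.\<close>

lemma pullback_exists:
 assumes "f \<in> arrs C" "g \<in> arrs C" "tgt C f = tgt C g"
 shows "\<exists>p q. is_pullback C p q f g"
proof -
 let ?p = "pr1 C (src C f) (src C g)" and ?q = "pr2 C (src C f) (src C g)"
 have o: "src C f \<in> objs C" "src C g \<in> objs C" using assms by auto
 obtain e where e: "is_equalizer C e (f \<odot> ?p) (g \<odot> ?q)"
  using equalizer_exists[of "f \<odot> ?p" "prd C (src C f) (src C g)" "tgt C f" "g \<odot> ?q"] assms o by auto
 have e': "e \<in> arrs C" "tgt C e = prd C (src C f) (src C g)" "f \<odot> ?p \<odot> e = g \<odot> ?q \<odot> e"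
  using e o assms by (auto simp: is_equalizer_def)
 have "is_pullback C (?p \<odot> e) (?q \<odot> e) f g"
  unfolding is_pullback_def
 proof (intro conjI allI ballI impI)
  fix Z u v assume uv: "u \<in> Hom C Z (src C f)" "v \<in> Hom C Z (src C g)" "f \<odot> u = g \<odot> v"
  let ?t = "tuple C ?p ?q u v"
  have t: "?t \<in> arrs C" "src C ?t = Z" "tgt C ?t = prd C (src C f) (src C g)" "?p \<odot> ?t = u" "?q \<odot> ?t = v"
   using uv o by auto
  have "f \<odot> ?p \<odot> ?t = g \<odot> ?q \<odot> ?t"
   using t uv by simp
  then have ex: "\<exists>!k. k \<in> Hom C Z (src C e) \<and> e \<odot> k = ?t"
   using e t(1-3) o assms by (simp add: is_equalizer_def)
  \<comment> \<open>Factorizations of the pair through the equalizer are the same as mediating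
    arrows to the pullback, so existence and uniqueness carry over together.\<close>
  have iff: "e \<odot> k = ?t \<longleftrightarrow> (?p \<odot> e) \<odot> k = u \<and> (?q \<odot> e) \<odot> k = v"
   if "k \<in> Hom C Z (src C e)" for k
  proof
   assume "e \<odot> k = ?t"
   then show "(?p \<odot> e) \<odot> k = u \<and> (?q \<odot> e) \<odot> k = v"
    using t o e' that by auto
  next
   assume "(?p \<odot> e) \<odot> k = u \<and> (?q \<odot> e) \<odot> k = v"
   then show "e \<odot> k = ?t"
    using e' that o by (intro tuple_eqI[OF prod_cone(1)[OF o], symmetric]) auto
  qed
  from ex obtain k where k: "k \<in> Hom C Z (src C e)" "e \<odot> k = ?t"
   and uniq: "\<And>h. h \<in> Hom C Z (src C e) \<Longrightarrow> e \<odot> h = ?t \<Longrightarrow> h = k"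
   by blast
  have s: "src C (?p \<odot> e) = src C e" using e' o by simp
  show "\<exists>!h. h \<in> Hom C Z (src C (?p \<odot> e)) \<and> (?p \<odot> e) \<odot> h = u \<and> (?q \<odot> e) \<odot> h = v"
   unfolding s using k uniq iff by blast
 qed (use assms o e' in auto)
 then show ?thesis by blast
qed

end

section \<open>Kripke-Joyal semantics\<close>

text \<open>The arrows satisfying \<open>P\<close> cover \<open>T\<close> if, after pullback along
  any \<open>h\<close>, no proper subobject contains all of them. Quantifying over \<open>h\<close>
  builds stability into the notion. Testing against subobjects alone treats the empty family, unions
  of two subobjects and images in the same way.\<close>

definition cvr :: "('o, 'm) cat \<Rightarrow> 'o \<Rightarrow> ('m \<Rightarrow> bool) \<Rightarrow> bool" where
 "cvr C T P \<longleftrightarrow> (\<forall>h \<in> arrs C. tgt C h = T \<longrightarrow> (\<forall>Q \<in> subs C (src C h).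
  (\<forall>k \<in> arrs C. tgt C k = src C h \<longrightarrow> P (h \<odot>\<^bsub>C\<^esub> k) \<longrightarrow> mem C k Q) \<longrightarrow>
  mem C (idn C (src C h)) Q))"

definition sb :: "('o, 'm) cat \<Rightarrow> 'm \<Rightarrow> ('v \<rightharpoonup> 'm) \<Rightarrow> ('v \<rightharpoonup> 'm)" where
 "sb C k e = (\<lambda>w. map_option (\<lambda>g. g \<odot>\<^bsub>C\<^esub> k) (e w))"

lemma sb_upd [simp]: "sb C k (e(v \<mapsto> x)) = (sb C k e)(v \<mapsto> x \<odot>\<^bsub>C\<^esub> k)"
 by (auto simp: sb_def)

lemma sb_empty [simp]: "sb C k Map.empty = Map.empty"
 by (simp add: sb_def)

primrec force :: "('o, 'm) cat \<Rightarrow> ('v, 'o, 'm) fml \<Rightarrow> 'o \<Rightarrow> ('v \<rightharpoonup> 'm) \<Rightarrow> bool" where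
 "force C (FEq t s) T e \<longleftrightarrow> trm_val C T e t = trm_val C T e s"
| "force C (FMem X U t) T e \<longleftrightarrow> mem C (trm_val C T e t) U"
| "force C FTop T e \<longleftrightarrow> True"
| "force C FBot T e \<longleftrightarrow> cvr C T (\<lambda>k. False)"
| "force C (FAnd p q) T e \<longleftrightarrow> force C p T e \<and> force C q T e"
| "force C (FOr p q) T e \<longleftrightarrow>
  cvr C T (\<lambda>k. force C p (src C k) (sb C k e) \<or> force C q (src C k) (sb C k e))"
| "force C (FImp p q) T e \<longleftrightarrow> (\<forall>k \<in> arrs C. tgt C k = T \<longrightarrow>
  force C p (src C k) (sb C k e) \<longrightarrow> force C q (src C k) (sb C k e))"
| "force C (FEx v X p) T e \<longleftrightarrow>
  cvr C T (\<lambda>k. \<exists>x \<in> arrs C. src C x = src C k \<and> tgt C x = X \<and>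
   force C p (src C k) ((sb C k e)(v \<mapsto> x)))"
| "force C (FAll v X p) T e \<longleftrightarrow> (\<forall>k \<in> arrs C. tgt C k = T \<longrightarrow>
  (\<forall>x \<in> arrs C. src C x = src C k \<longrightarrow> tgt C x = X \<longrightarrow>
   force C p (src C k) ((sb C k e)(v \<mapsto> x))))"

text \<open>Sorts are prescribed only for the variables of \<open>\<Gamma>\<close>; further entries
  of \<open>e\<close> merely have to be arrows out of \<open>Z\<close>. An environment may therefore
  carry auxiliary variables unknown to the context.\<close>

definition env_ok :: "('o, 'm) cat \<Rightarrow> ('v \<rightharpoonup> 'o) \<Rightarrow> 'o \<Rightarrow> ('v \<rightharpoonup> 'm) \<Rightarrow> bool" where
 "env_ok C \<Gamma> Z e \<longleftrightarrow> (\<forall>v g. e v = Some g \<longrightarrow> g \<in> arrs C \<and> src C g = Z) \<and>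
  (\<forall>v X. \<Gamma> v = Some X \<longrightarrow> (\<exists>g. e v = Some g \<and> tgt C g = X))"

lemma env_ok_empty [simp]: "env_ok C Map.empty Z Map.empty"
 by (simp add: env_ok_def)

lemma env_ok_upd [simp]:
 "env_ok C \<Gamma> Z e \<Longrightarrow> g \<in> arrs C \<Longrightarrow> src C g = Z \<Longrightarrow> tgt C g = X \<Longrightarrow>
  env_ok C (\<Gamma>(v \<mapsto> X)) Z (e(v \<mapsto> g))"
 by (auto simp: env_ok_def)

context category
begin

lemma sb_idn: "env_ok C \<Gamma> Z e \<Longrightarrow> sb C (idn C Z) e = e"
 by (auto simp: sb_def env_ok_def fun_eq_iff option.map_id intro!: option.map_ident_strong)

lemma sb_sb:
 assumes "env_ok C \<Gamma> (tgt C z) e" "z \<in> arrs C" "k \<in> arrs C" "tgt C k = src C z"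
 shows "sb C k (sb C z e) = sb C (z \<odot> k) e"
proof
 fix w
 show "sb C k (sb C z e) w = sb C (z \<odot> k) e w"
  using assms by (cases "e w") (auto simp: sb_def env_ok_def)
qed

lemma env_ok_sb:
 assumes "env_ok C \<Gamma> (tgt C k) e" "k \<in> arrs C"
 shows "env_ok C \<Gamma> (src C k) (sb C k e)"
 using assms unfolding env_ok_def sb_def by fastforce

lemma trm_val_typed:
 assumes "has_sort C \<Gamma> t X" "env_ok C \<Gamma> Z e" "Z \<in> objs C"
 shows "trm_val C Z e t \<in> arrs C" "src C (trm_val C Z e t) = Z" "tgt C (trm_val C Z e t) = X"
proof -
 have "trm_val C Z e t \<in> arrs C \<and> src C (trm_val C Z e t) = Z \<and> tgt C (trm_val C Z e t) = X"
  using assms(1)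
 proof (induction t arbitrary: X)
  case (TVar v)
  then show ?case using assms(2) by (fastforce simp: env_ok_def)
 next
  case (TApp f t)
  then show ?case by auto
 next
  case (TUnit T)
  then show ?case using terminal_arr assms(3) by auto
 next
  case (TPair p q t s)
  have t: "has_sort C \<Gamma> t (tgt C p)" "has_sort C \<Gamma> s (tgt C q)" "is_product C p q" "src C p = X"
   using TPair.prems by auto
  show ?case
   using TPair.IH(1)[OF t(1)] TPair.IH(2)[OF t(2)] tuple[OF t(3), of "trm_val C Z e t" "trm_val C Z e s"] t(4)
   by simp
 qed
 then show "trm_val C Z e t \<in> arrs C" "src C (trm_val C Z e t) = Z" "tgt C (trm_val C Z e t) = X"
  by auto
qed

lemma trm_val_sb:
 assumes "has_sort C \<Gamma> t X" "env_ok C \<Gamma> (tgt C k) e" "k \<in> arrs C"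
 shows "trm_val C (src C k) (sb C k e) t = trm_val C (tgt C k) e t \<odot> k"
 using assms(1)
proof (induction t arbitrary: X)
 case (TVar v)
 then obtain g where "e v = Some g" using assms(2) unfolding env_ok_def has_sort.simps by blast
 then show ?case by (simp add: sb_def)
next
 case (TApp f t)
 then show ?case using assms trm_val_typed[of \<Gamma> t "src C f" "tgt C k" e] by auto
next
 case (TUnit T)
 then have T: "is_terminal C T" unfolding has_sort.simps by blast
 then have "T \<in> objs C" by (simp add: is_terminal_def)
 then show ?case
  using terminal_arr[OF T, of "src C k"] terminal_arr[OF T, of "tgt C k"] assms(3)
  by (auto intro!: terminal_eq[OF T])
next
 case (TPair p q t s)
 have t: "has_sort C \<Gamma> t (tgt C p)" "has_sort C \<Gamma> s (tgt C q)" "is_product C p q"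
  using TPair.prems by auto
 have k: "tgt C k \<in> objs C" using assms by simp
 show ?case
  using tuple_cmp[OF t(3), of "trm_val C (tgt C k) e t" "trm_val C (tgt C k) e s" k]
   trm_val_typed[OF t(1) assms(2) k] trm_val_typed[OF t(2) assms(2) k] assms(3)
   TPair.IH(1)[OF t(1)] TPair.IH(2)[OF t(2)]
  by simp
qed

end

context heyting_category
begin

section \<open>Elements of meets and implications\<close>

lemma lattice_Sub: "X \<in> objs C \<Longrightarrow> bounded_lattice (Sub C X)"
 using sub_heyting heyting_algebra.axioms(1) by blast

lemma inv_im_closed:
 assumes "f \<in> arrs C" "U \<in> subs C (tgt C f)"
 shows "inv_im C f U \<in> subs C (src C f)"
 using inv_im_hom[of f "src C f" "tgt C f"] assms by (auto simp: heyting_hom_def)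

lemma mem_inv:
 assumes "f \<in> arrs C" "U \<in> subs C (tgt C f)"
 shows "mem C x (inv_im C f U) \<longleftrightarrow> x \<in> arrs C \<and> tgt C x = src C f \<and> mem C (f \<odot> x) U"
 by (rule mem_inv_im) (use assms inv_im_closed in auto)

lemma mem_idn_inv:
 assumes "x \<in> arrs C" "U \<in> subs C (tgt C x)"
 shows "mem C (idn C (src C x)) (inv_im C x U) \<longleftrightarrow> mem C x U"
 using assms by (simp add: mem_inv)

text \<open>Pullback along \<open>x\<close> makes \<open>x\<close> generic, so membership becomes an
  equation with the top element, and such equations can be computed through homomorphisms of Heyting
  algebras.\<close>

lemma mem_iff_top:
 assumes "x \<in> arrs C" "U \<in> subs C (tgt C x)"
 shows "mem C x U \<longleftrightarrow> inv_im C x U = \<top>\<^bsub>Sub C (src C x)\<^esub>"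
 using assms eq_top_iff[of "src C x" "inv_im C x U"] inv_im_closed[of x U] mem_idn_inv[of x U] by simp

lemma inv_im_ops:
 assumes "f \<in> arrs C" "U \<in> subs C (tgt C f)" "V \<in> subs C (tgt C f)"
 shows "inv_im C f (U \<sqinter>\<^bsub>Sub C (tgt C f)\<^esub> V) = inv_im C f U \<sqinter>\<^bsub>Sub C (src C f)\<^esub> inv_im C f V"
  "inv_im C f (U \<squnion>\<^bsub>Sub C (tgt C f)\<^esub> V) = inv_im C f U \<squnion>\<^bsub>Sub C (src C f)\<^esub> inv_im C f V"
  "inv_im C f (himp (Sub C (tgt C f)) U V) = himp (Sub C (src C f)) (inv_im C f U) (inv_im C f V)"
  "inv_im C f (\<bottom>\<^bsub>Sub C (tgt C f)\<^esub>) = \<bottom>\<^bsub>Sub C (src C f)\<^esub>"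
 using inv_im_hom[of f "src C f" "tgt C f"] assms by (auto simp: heyting_hom_def)

lemma ops_closed:
 assumes "X \<in> objs C" "U \<in> subs C X" "V \<in> subs C X"
 shows "U \<sqinter>\<^bsub>Sub C X\<^esub> V \<in> subs C X" "U \<squnion>\<^bsub>Sub C X\<^esub> V \<in> subs C X"
proof -
 interpret bounded_lattice "Sub C X" by (rule lattice_Sub[OF assms(1)])
 show "U \<sqinter>\<^bsub>Sub C X\<^esub> V \<in> subs C X" "U \<squnion>\<^bsub>Sub C X\<^esub> V \<in> subs C X"
  using assms by auto
qed

lemma bottom_closed: "X \<in> objs C \<Longrightarrow> \<bottom>\<^bsub>Sub C X\<^esub> \<in> subs C X"
 using lattice_Sub bounded_lattice.axioms(2) weak_partial_order_bottom.bottom_closed by blast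

lemma
 assumes "X \<in> objs C" "U \<in> subs C X" "V \<in> subs C X"
 shows himp_closed: "himp (Sub C X) U V \<in> subs C X"
  and himp_adj: "Z \<in> subs C X \<Longrightarrow>
   Z \<sqsubseteq>\<^bsub>Sub C X\<^esub> himp (Sub C X) U V \<longleftrightarrow> Z \<sqinter>\<^bsub>Sub C X\<^esub> U \<sqsubseteq>\<^bsub>Sub C X\<^esub> V"
proof -
 interpret L: heyting_algebra "Sub C X" by (rule sub_heyting[OF assms(1)])
 have *: "greatest (Sub C X) (himp (Sub C X) U V)
   {z \<in> subs C X. z \<sqinter>\<^bsub>Sub C X\<^esub> U \<sqsubseteq>\<^bsub>Sub C X\<^esub> V}"
  unfolding himp_def by (rule someI_ex[OF L.imp_exists[OF assms(2,3)]])
 then show c: "himp (Sub C X) U V \<in> subs C X"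
  by (rule greatest_closed)
 assume Z: "Z \<in> subs C X"
 show "Z \<sqsubseteq>\<^bsub>Sub C X\<^esub> himp (Sub C X) U V \<longleftrightarrow> Z \<sqinter>\<^bsub>Sub C X\<^esub> U \<sqsubseteq>\<^bsub>Sub C X\<^esub> V"
 proof
  assume le: "Z \<sqsubseteq>\<^bsub>Sub C X\<^esub> himp (Sub C X) U V"
  have "himp (Sub C X) U V \<sqinter>\<^bsub>Sub C X\<^esub> U \<sqsubseteq>\<^bsub>Sub C X\<^esub> V"
   using greatest_mem[OF *] by simp
  moreover have "Z \<sqinter>\<^bsub>Sub C X\<^esub> U \<sqsubseteq>\<^bsub>Sub C X\<^esub> himp (Sub C X) U V \<sqinter>\<^bsub>Sub C X\<^esub> U"
   using le Z c assms by (meson L.le_trans L.meet_closed L.meet_le L.meet_left L.meet_right)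
  ultimately show "Z \<sqinter>\<^bsub>Sub C X\<^esub> U \<sqsubseteq>\<^bsub>Sub C X\<^esub> V"
   using Z c assms by (meson L.le_trans L.meet_closed)
 next
  assume "Z \<sqinter>\<^bsub>Sub C X\<^esub> U \<sqsubseteq>\<^bsub>Sub C X\<^esub> V"
  then show "Z \<sqsubseteq>\<^bsub>Sub C X\<^esub> himp (Sub C X) U V"
   using greatest_le[OF *] Z by simp
 qed
qed

lemma top_le_iff:
 assumes "X \<in> objs C" "U \<in> subs C X"
 shows "\<top>\<^bsub>Sub C X\<^esub> \<sqsubseteq>\<^bsub>Sub C X\<^esub> U \<longleftrightarrow> mem C (idn C X) U"
 using assms eq_top_iff[OF assms] Sub_le_iff[OF top_carrier[OF assms(1)] assms(2)]
 by (auto simp: mem_top)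

lemma mem_meet:
 assumes "x \<in> arrs C" "U \<in> subs C (tgt C x)" "V \<in> subs C (tgt C x)"
 shows "mem C x (U \<sqinter>\<^bsub>Sub C (tgt C x)\<^esub> V) \<longleftrightarrow> mem C x U \<and> mem C x V"
proof -
 let ?L = "Sub C (src C x)"
 interpret L: bounded_lattice ?L by (rule lattice_Sub) (use assms in simp)
 note [simp] = inv_im_closed[OF assms(1,2)] inv_im_closed[OF assms(1,3)]
 have *: "mem C x (U \<sqinter>\<^bsub>Sub C (tgt C x)\<^esub> V) \<longleftrightarrow> inv_im C x U \<sqinter>\<^bsub>?L\<^esub> inv_im C x V = \<top>\<^bsub>?L\<^esub>"
  using assms mem_iff_top[of x "U \<sqinter>\<^bsub>Sub C (tgt C x)\<^esub> V"] ops_closed[of "tgt C x" U V]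
   inv_im_ops(1)[OF assms]
  by auto
 have "inv_im C x U \<sqinter>\<^bsub>?L\<^esub> inv_im C x V = \<top>\<^bsub>?L\<^esub> \<longleftrightarrow> inv_im C x U = \<top>\<^bsub>?L\<^esub> \<and> inv_im C x V = \<top>\<^bsub>?L\<^esub>"
  by (metis L.meet_left L.meet_right L.le_antisym L.top_closed L.top_higher L.top_meet
    inv_im_closed[OF assms(1,2)] inv_im_closed[OF assms(1,3)] L.eq_is_equal)
 with * assms show ?thesis
  by (simp add: mem_iff_top)
qed

text \<open>Inverse image along \<open>x\<close> preserves implication, which moves the question to
  the identity of \<open>src C x\<close>. There the adjunction turns it into an inclusion of inverse
  images, that is, into a statement about all \<open>k\<close>.\<close>

lemma mem_himp:
 assumes "x \<in> arrs C" "U \<in> subs C (tgt C x)" "V \<in> subs C (tgt C x)"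
 shows "mem C x (himp (Sub C (tgt C x)) U V) \<longleftrightarrow>
  (\<forall>k \<in> arrs C. tgt C k = src C x \<longrightarrow> mem C (x \<odot> k) U \<longrightarrow> mem C (x \<odot> k) V)"
proof -
 let ?L = "Sub C (src C x)"
 have o: "src C x \<in> objs C" "tgt C x \<in> objs C" using assms by auto
 interpret L: bounded_lattice ?L by (rule lattice_Sub[OF o(1)])
 note UV = inv_im_closed[OF assms(1,2)] inv_im_closed[OF assms(1,3)]
 have "mem C x (himp (Sub C (tgt C x)) U V) \<longleftrightarrow>
   mem C (idn C (src C x)) (himp ?L (inv_im C x U) (inv_im C x V))"
  using mem_idn_inv[OF assms(1) himp_closed[OF o(2) assms(2,3)]] inv_im_ops(3)[OF assms] by simp
 also have "\<dots> \<longleftrightarrow> \<top>\<^bsub>?L\<^esub> \<sqsubseteq>\<^bsub>?L\<^esub> himp ?L (inv_im C x U) (inv_im C x V)"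
  using top_le_iff[OF o(1) himp_closed[OF o(1) UV]] by simp
 also have "\<dots> \<longleftrightarrow> \<top>\<^bsub>?L\<^esub> \<sqinter>\<^bsub>?L\<^esub> inv_im C x U \<sqsubseteq>\<^bsub>?L\<^esub> inv_im C x V"
  by (rule himp_adj[OF o(1) UV L.top_closed])
 also have "\<top>\<^bsub>?L\<^esub> \<sqinter>\<^bsub>?L\<^esub> inv_im C x U = inv_im C x U"
  using L.top_meet[OF UV(1)] L.eq_is_equal by simp
 also have "inv_im C x U \<sqsubseteq>\<^bsub>?L\<^esub> inv_im C x V \<longleftrightarrow>
   (\<forall>k \<in> arrs C. tgt C k = src C x \<longrightarrow> mem C (x \<odot> k) U \<longrightarrow> mem C (x \<odot> k) V)"
  unfolding Sub_le_iff[OF UV] using assms by (auto simp: mem_inv)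
 finally show ?thesis .
qed

section \<open>Covers\<close>

lemma cvrI:
 assumes "\<And>h Q. h \<in> arrs C \<Longrightarrow> tgt C h = T \<Longrightarrow> Q \<in> subs C (src C h) \<Longrightarrow>
   (\<And>k. k \<in> arrs C \<Longrightarrow> tgt C k = src C h \<Longrightarrow> P (h \<odot> k) \<Longrightarrow> mem C k Q) \<Longrightarrow> mem C (idn C (src C h)) Q"
 shows "cvr C T P"
 using assms unfolding cvr_def by blast

lemma cvrD:
 assumes "cvr C T P" "h \<in> arrs C" "tgt C h = T" "Q \<in> subs C (src C h)"
  "\<And>k. k \<in> arrs C \<Longrightarrow> tgt C k = src C h \<Longrightarrow> P (h \<odot> k) \<Longrightarrow> mem C k Q"
 shows "mem C (idn C (src C h)) Q"
 using assms unfolding cvr_def by blast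

lemma cvr_now:
 assumes "\<And>h. h \<in> arrs C \<Longrightarrow> tgt C h = T \<Longrightarrow> P h"
 shows "cvr C T P"
proof (rule cvrI)
 fix h Q assume h: "h \<in> arrs C" "tgt C h = T"
  and *: "\<And>k. k \<in> arrs C \<Longrightarrow> tgt C k = src C h \<Longrightarrow> P (h \<odot> k) \<Longrightarrow> mem C k Q"
 show "mem C (idn C (src C h)) Q"
  by (rule *) (use h assms in auto)
qed

text \<open>Membership is local: apply the defining test of the cover to the inverse image of
  \<open>U\<close> along \<open>g\<close>. This is the way in which covers are eliminated.\<close>

lemma cvr_mem:
 assumes "cvr C (src C g) P" "g \<in> arrs C" "U \<in> subs C (tgt C g)"
  and *: "\<And>k. k \<in> arrs C \<Longrightarrow> tgt C k = src C g \<Longrightarrow> P k \<Longrightarrow> mem C (g \<odot> k) U"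
 shows "mem C g U"
proof -
 let ?i = "idn C (src C g)"
 have i: "?i \<in> arrs C" "src C ?i = src C g" "tgt C ?i = src C g"
  using assms(2) by auto
 have "mem C (idn C (src C ?i)) (inv_im C g U)"
 proof (rule cvrD[OF assms(1)])
  fix k assume k: "k \<in> arrs C" "tgt C k = src C ?i" "P (?i \<odot> k)"
  then have "mem C (g \<odot> k) U"
   using i by (intro *) auto
  then show "mem C k (inv_im C g U)"
   using k i assms by (simp add: mem_inv)
 qed (use i inv_im_closed assms in auto)
 then show ?thesis
  using i assms mem_idn_inv by simp
qed

lemma cvr_stable:
 assumes "cvr C T P" "h \<in> arrs C" "tgt C h = T"
 shows "cvr C (src C h) (\<lambda>k. P (h \<odot> k))"
proof (rule cvrI)
 fix l Q assume l: "l \<in> arrs C" "tgt C l = src C h" and Q: "Q \<in> subs C (src C l)"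
  and *: "\<And>k. k \<in> arrs C \<Longrightarrow> tgt C k = src C l \<Longrightarrow> P (h \<odot> (l \<odot> k)) \<Longrightarrow> mem C k Q"
 have "mem C (idn C (src C (h \<odot> l))) Q"
  by (rule cvrD[OF assms(1)]) (use assms l Q * in auto)
 with assms l show "mem C (idn C (src C l)) Q" by simp
qed

text \<open>Covers are transitive. A subobject containing the refined family contains each
  \<open>k\<close> of the coarse one by locality of membership, and then the coarse cover finishes
  the test.\<close>

lemma cvr_bind:
 assumes "cvr C T P"
  and "\<And>k. k \<in> arrs C \<Longrightarrow> tgt C k = T \<Longrightarrow> P k \<Longrightarrow> cvr C (src C k) (\<lambda>l. P' (k \<odot> l))"
 shows "cvr C T P'"
proof (rule cvrI)
 fix h Q assume h: "h \<in> arrs C" "tgt C h = T" and Q: "Q \<in> subs C (src C h)"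
  and *: "\<And>k. k \<in> arrs C \<Longrightarrow> tgt C k = src C h \<Longrightarrow> P' (h \<odot> k) \<Longrightarrow> mem C k Q"
 show "mem C (idn C (src C h)) Q"
 proof (rule cvrD[OF assms(1) h Q])
  fix k assume k: "k \<in> arrs C" "tgt C k = src C h" "P (h \<odot> k)"
  then have "cvr C (src C (h \<odot> k)) (\<lambda>l. P' ((h \<odot> k) \<odot> l))"
   using h by (intro assms(2)) auto
  then have c: "cvr C (src C k) (\<lambda>l. P' ((h \<odot> k) \<odot> l))"
   using h k by simp
  show "mem C k Q"
  proof (rule cvr_mem[OF c])
   fix l assume "l \<in> arrs C" "tgt C l = src C k" "P' ((h \<odot> k) \<odot> l)"
   then show "mem C (k \<odot> l) Q"
    using h k by (intro *) auto
  qed (use k Q in auto)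
 qed
qed

lemma cvr_mono:
 assumes "cvr C T P" "\<And>k. k \<in> arrs C \<Longrightarrow> tgt C k = T \<Longrightarrow> P k \<Longrightarrow> P' k"
 shows "cvr C T P'"
proof (rule cvrI)
 fix h Q assume h: "h \<in> arrs C" "tgt C h = T" "Q \<in> subs C (src C h)"
  and *: "\<And>k. k \<in> arrs C \<Longrightarrow> tgt C k = src C h \<Longrightarrow> P' (h \<odot> k) \<Longrightarrow> mem C k Q"
 show "mem C (idn C (src C h)) Q"
  by (rule cvrD[OF assms(1) h]) (use h assms(2) * in auto)
qed

lemma cvr_cong:
 assumes "\<And>k. k \<in> arrs C \<Longrightarrow> tgt C k = T \<Longrightarrow> P k \<longleftrightarrow> P' k"
 shows "cvr C T P \<longleftrightarrow> cvr C T P'"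
 using cvr_mono[of T P P'] cvr_mono[of T P' P] assms by blast

text \<open>Equality of two arrows is membership in their equalizer, hence it may be checked on a
  cover.\<close>

lemma cvr_eq:
 assumes "cvr C (src C f) P" "f \<in> arrs C" "g \<in> arrs C" "src C g = src C f" "tgt C g = tgt C f"
  and *: "\<And>k. k \<in> arrs C \<Longrightarrow> tgt C k = src C f \<Longrightarrow> P k \<Longrightarrow> f \<odot> k = g \<odot> k"
 shows "f = g"
proof -
 obtain e where e: "is_equalizer C e f g"
  using equalizer_exists[of f "src C f" "tgt C f" g] assms by auto
 have fg: "f \<in> Hom C (src C f) (tgt C f)" "g \<in> Hom C (src C f) (tgt C f)" using assms by auto
 note e' = equalizer_sub[OF e fg]
 have "mem C (idn C (src C f)) (sub_of C e)"
 proof (rule cvr_mem)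
  show "cvr C (src C (idn C (src C f))) P" using assms by simp
  show "sub_of C e \<in> subs C (tgt C (idn C (src C f)))"
   using assms(2) sub_of_carrier[OF e'(1,2)] by simp
  fix k assume k: "k \<in> arrs C" "tgt C k = src C (idn C (src C f))" "P k"
  then show "mem C (idn C (src C f) \<odot> k) (sub_of C e)"
   unfolding e'(3) using * assms(2) by simp
 qed (use assms(2) in simp)
 then show ?thesis
  unfolding e'(3) using assms(2-4) by simp
qed

text \<open>Common pattern for joins, bottom and images. The first condition bounds \<open>W\<close>
  from above by every subobject that contains the \<open>P\<close>-elements, at every stage; the
  second says that the \<open>P\<close>-elements belong to \<open>W\<close>. The predicate
  \<open>P\<close> itself need not be stable under change of stage.\<close>

lemma cvr_iff_nonstable:
 assumes x: "x \<in> arrs C" and W: "W \<in> subs C (tgt C x)"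
  and 1: "\<And>y Q. y \<in> arrs C \<Longrightarrow> tgt C y = tgt C x \<Longrightarrow> mem C y W \<Longrightarrow> Q \<in> subs C (src C y) \<Longrightarrow>
   (\<And>k. k \<in> arrs C \<Longrightarrow> tgt C k = src C y \<Longrightarrow> P (y \<odot> k) \<Longrightarrow> mem C k Q) \<Longrightarrow>
   mem C (idn C (src C y)) Q"
  and 2: "\<And>k. k \<in> arrs C \<Longrightarrow> tgt C k = tgt C x \<Longrightarrow> P k \<Longrightarrow> mem C k W"
 shows "mem C x W \<longleftrightarrow> cvr C (src C x) (\<lambda>k. P (x \<odot> k))"
proof
 assume m: "mem C x W"
 show "cvr C (src C x) (\<lambda>k. P (x \<odot> k))"
 proof (rule cvrI)
  fix h Q assume h: "h \<in> arrs C" "tgt C h = src C x" "Q \<in> subs C (src C h)"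
   and *: "\<And>k. k \<in> arrs C \<Longrightarrow> tgt C k = src C h \<Longrightarrow> P (x \<odot> h \<odot> k) \<Longrightarrow> mem C k Q"
  have "mem C (idn C (src C (x \<odot> h))) Q"
   by (rule 1) (use h x * mem_cmp[OF m W] in auto)
  with h x show "mem C (idn C (src C h)) Q" by simp
 qed
next
 assume "cvr C (src C x) (\<lambda>k. P (x \<odot> k))"
 then show "mem C x W"
  by (rule cvr_mem) (use x W 2 in auto)
qed

section \<open>Joins, bottom and the two adjoints in terms of covers\<close>

text \<open>Joins are stable under inverse image. At an element \<open>y\<close> of the join the
  identity therefore lies in the join of the two inverse images, and this join lies below every
  \<open>Q\<close> containing both.\<close>

lemma mem_join:
 assumes "x \<in> arrs C" "U \<in> subs C (tgt C x)" "V \<in> subs C (tgt C x)"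
 shows "mem C x (U \<squnion>\<^bsub>Sub C (tgt C x)\<^esub> V) \<longleftrightarrow>
  cvr C (src C x) (\<lambda>k. mem C (x \<odot> k) U \<or> mem C (x \<odot> k) V)"
proof (rule cvr_iff_nonstable[where P = "\<lambda>y. mem C y U \<or> mem C y V"])
 have o: "tgt C x \<in> objs C" using assms by simp
 interpret X: bounded_lattice "Sub C (tgt C x)" by (rule lattice_Sub[OF o])
 show W: "U \<squnion>\<^bsub>Sub C (tgt C x)\<^esub> V \<in> subs C (tgt C x)"
  using assms by simp
 {
  fix k assume "mem C k U \<or> mem C k V"
  then show "mem C k (U \<squnion>\<^bsub>Sub C (tgt C x)\<^esub> V)"
   using X.join_left[OF assms(2,3)] X.join_right[OF assms(2,3)] Sub_le_iff[OF assms(2) W]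
    Sub_le_iff[OF assms(3) W] by blast
 }
 fix y Q assume y: "y \<in> arrs C" "tgt C y = tgt C x" "mem C y (U \<squnion>\<^bsub>Sub C (tgt C x)\<^esub> V)"
  and Q: "Q \<in> subs C (src C y)"
  and *: "\<And>k. k \<in> arrs C \<Longrightarrow> tgt C k = src C y \<Longrightarrow> mem C (y \<odot> k) U \<or> mem C (y \<odot> k) V \<Longrightarrow> mem C k Q"
 let ?L = "Sub C (src C y)"
 interpret L: bounded_lattice ?L by (rule lattice_Sub) (use y in simp)
 have UV: "U \<in> subs C (tgt C y)" "V \<in> subs C (tgt C y)"
  using assms y by auto
 note i = inv_im_closed[OF y(1) UV(1)] inv_im_closed[OF y(1) UV(2)]
 have "inv_im C y U \<sqsubseteq>\<^bsub>?L\<^esub> Q" "inv_im C y V \<sqsubseteq>\<^bsub>?L\<^esub> Q"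
  unfolding Sub_le_iff[OF i(1) Q] Sub_le_iff[OF i(2) Q]
  using * by (auto simp: mem_inv[OF y(1) UV(1)] mem_inv[OF y(1) UV(2)])
 then have "inv_im C y U \<squnion>\<^bsub>?L\<^esub> inv_im C y V \<sqsubseteq>\<^bsub>?L\<^esub> Q"
  using i Q by (intro L.join_le)
 moreover have "mem C (idn C (src C y)) (inv_im C y U \<squnion>\<^bsub>?L\<^esub> inv_im C y V)"
  using y(3) inv_im_ops(2)[OF y(1) UV] mem_idn_inv[OF y(1), of "U \<squnion>\<^bsub>Sub C (tgt C y)\<^esub> V"] W y(2)
  by simp
 moreover have "inv_im C y U \<squnion>\<^bsub>?L\<^esub> inv_im C y V \<in> carrier ?L"
  using i by simp
 ultimately show "mem C (idn C (src C y)) Q"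
  using Q Sub_le_iff by blast
qed (use assms in auto)

lemma mem_bottom:
 assumes "x \<in> arrs C"
 shows "mem C x (\<bottom>\<^bsub>Sub C (tgt C x)\<^esub>) \<longleftrightarrow> cvr C (src C x) (\<lambda>k. False)"
proof (rule cvr_iff_nonstable[where P = "\<lambda>_. False"])
 show W: "\<bottom>\<^bsub>Sub C (tgt C x)\<^esub> \<in> subs C (tgt C x)"
  using assms bottom_closed by simp
 fix y Q assume y: "y \<in> arrs C" "tgt C y = tgt C x" "mem C y (\<bottom>\<^bsub>Sub C (tgt C x)\<^esub>)"
  and Q: "Q \<in> subs C (src C y)"
 interpret L: bounded_lattice "Sub C (src C y)" by (rule lattice_Sub) (use y in simp)
 have "mem C (idn C (src C y)) (\<bottom>\<^bsub>Sub C (src C y)\<^esub>)"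
  using y mem_idn_inv[of y "\<bottom>\<^bsub>Sub C (tgt C y)\<^esub>"] W inv_im_ops(4)[OF y(1), of "\<bottom>\<^bsub>Sub C (tgt C y)\<^esub>" "\<bottom>\<^bsub>Sub C (tgt C y)\<^esub>"]
  by simp
 moreover have "\<bottom>\<^bsub>Sub C (src C y)\<^esub> \<sqsubseteq>\<^bsub>Sub C (src C y)\<^esub> Q"
  by (rule L.bottom_lower[OF Q])
 ultimately show "mem C (idn C (src C y)) Q"
  using Sub_le_iff[OF L.bottom_closed Q] by blast
qed (use assms in auto)

lemma
 assumes "f \<in> arrs C"
 shows ex_im_closed: "U \<in> subs C (src C f) \<Longrightarrow> ex_im C f U \<in> subs C (tgt C f)"
  and ex_im_adj: "U \<in> subs C (src C f) \<Longrightarrow> V \<in> subs C (tgt C f) \<Longrightarrow>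
   ex_im C f U \<sqsubseteq>\<^bsub>Sub C (tgt C f)\<^esub> V \<longleftrightarrow> U \<sqsubseteq>\<^bsub>Sub C (src C f)\<^esub> inv_im C f V"
proof -
 have "is_ex_im C f (ex_im C f)"
  unfolding ex_im_def by (rule someI_ex[OF ex_im_exists[OF assms]])
 then have "ex_im C f \<in> subs C (src C f) \<rightarrow> subs C (tgt C f)"
  "\<forall>x\<in>subs C (src C f). \<forall>y\<in>subs C (tgt C f).
   (ex_im C f x \<sqsubseteq>\<^bsub>Sub C (tgt C f)\<^esub> y) = (x \<sqsubseteq>\<^bsub>Sub C (src C f)\<^esub> inv_im C f y)"
  unfolding is_ex_im_def galois_connection_iff[OF Sub_partial_order Sub_partial_order] by blast+
 then show "U \<in> subs C (src C f) \<Longrightarrow> ex_im C f U \<in> subs C (tgt C f)"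
  "U \<in> subs C (src C f) \<Longrightarrow> V \<in> subs C (tgt C f) \<Longrightarrow>
   ex_im C f U \<sqsubseteq>\<^bsub>Sub C (tgt C f)\<^esub> V \<longleftrightarrow> U \<sqsubseteq>\<^bsub>Sub C (src C f)\<^esub> inv_im C f V"
  by auto
qed

lemma
 assumes "f \<in> arrs C"
 shows all_im_closed: "U \<in> subs C (src C f) \<Longrightarrow> all_im C f U \<in> subs C (tgt C f)"
  and all_im_adj: "U \<in> subs C (src C f) \<Longrightarrow> V \<in> subs C (tgt C f) \<Longrightarrow>
   inv_im C f V \<sqsubseteq>\<^bsub>Sub C (src C f)\<^esub> U \<longleftrightarrow> V \<sqsubseteq>\<^bsub>Sub C (tgt C f)\<^esub> all_im C f U"
proof -
 have "is_all_im C f (all_im C f)"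
  unfolding all_im_def by (rule someI_ex[OF all_im_exists[OF assms]])
 then have "all_im C f \<in> subs C (src C f) \<rightarrow> subs C (tgt C f)"
  "\<forall>x\<in>subs C (tgt C f). \<forall>y\<in>subs C (src C f).
   (inv_im C f x \<sqsubseteq>\<^bsub>Sub C (src C f)\<^esub> y) = (x \<sqsubseteq>\<^bsub>Sub C (tgt C f)\<^esub> all_im C f y)"
  unfolding is_all_im_def galois_connection_iff[OF Sub_partial_order Sub_partial_order] by blast+
 then show "U \<in> subs C (src C f) \<Longrightarrow> all_im C f U \<in> subs C (tgt C f)"
  "U \<in> subs C (src C f) \<Longrightarrow> V \<in> subs C (tgt C f) \<Longrightarrow>
   inv_im C f V \<sqsubseteq>\<^bsub>Sub C (src C f)\<^esub> U \<longleftrightarrow> V \<sqsubseteq>\<^bsub>Sub C (tgt C f)\<^esub> all_im C f U"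
  by auto
qed

lemma mem_ex_imI:
 assumes "f \<in> arrs C" "U \<in> subs C (src C f)" "mem C y U"
 shows "mem C (f \<odot> y) (ex_im C f U)"
proof -
 note c = ex_im_closed[OF assms(1,2)]
 interpret L: partial_order "Sub C (tgt C f)" by (rule Sub_partial_order)
 have "U \<sqsubseteq>\<^bsub>Sub C (src C f)\<^esub> inv_im C f (ex_im C f U)"
  using ex_im_adj[OF assms(1,2) c] L.le_refl[OF c] by simp
 then have "mem C y (inv_im C f (ex_im C f U))"
  using Sub_le_iff[OF assms(2) inv_im_closed[OF assms(1) c]] assms(3) by blast
 then show ?thesis
  by (simp add: mem_inv[OF assms(1) c])
qed

text \<open>By Beck-Chevalley, the inverse image of the image along \<open>y\<close> is the image
  along the pullback \<open>p\<close> of \<open>f\<close>. The adjunction for \<open>p\<close>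
  reduces its inclusion in \<open>Q\<close> to elements that have a preimage under
  \<open>f\<close>.\<close>

lemma mem_ex_im:
 assumes "x \<in> arrs C" "f \<in> arrs C" "tgt C x = tgt C f" "U \<in> subs C (src C f)"
 shows "mem C x (ex_im C f U) \<longleftrightarrow>
  cvr C (src C x) (\<lambda>k. \<exists>y. f \<odot> y = x \<odot> k \<and> mem C y U)"
proof (rule cvr_iff_nonstable[where P = "\<lambda>z. \<exists>y. f \<odot> y = z \<and> mem C y U"])
 show W: "ex_im C f U \<in> subs C (tgt C x)"
  using ex_im_closed assms by simp
 {
  fix k assume "\<exists>y. f \<odot> y = k \<and> mem C y U"
  then show "mem C k (ex_im C f U)"
   using mem_ex_imI[OF assms(2,4)] by blast
 }
 fix y Q assume y: "y \<in> arrs C" "tgt C y = tgt C x" "mem C y (ex_im C f U)"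
  and Q: "Q \<in> subs C (src C y)"
  and *: "\<And>k. k \<in> arrs C \<Longrightarrow> tgt C k = src C y \<Longrightarrow> \<exists>z. f \<odot> z = y \<odot> k \<and> mem C z U \<Longrightarrow> mem C k Q"
 obtain p q where pb: "is_pullback C p q y f"
  using pullback_exists[of y f] y assms by auto
 then have pq: "p \<in> arrs C" "tgt C p = src C y" "q \<in> arrs C" "src C q = src C p" "tgt C q = src C f"
  "y \<odot> p = f \<odot> q"
  by (auto simp: is_pullback_def)
 have eq: "ex_im C p (inv_im C q U) = inv_im C y (ex_im C f U)"
  by (rule beck_chevalley_ex[OF pb assms(4)])
 have c: "inv_im C q U \<in> subs C (src C p)"
  using inv_im_closed[of q U] pq assms by simp
 have Q': "Q \<in> subs C (tgt C p)" using Q pq by simp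
 have "inv_im C q U \<sqsubseteq>\<^bsub>Sub C (src C p)\<^esub> inv_im C p Q"
  unfolding Sub_le_iff[OF c inv_im_closed[OF pq(1) Q']]
 proof (intro allI impI)
  fix z assume "mem C z (inv_im C q U)"
  then have z: "z \<in> arrs C" "tgt C z = src C q" "mem C (q \<odot> z) U"
   using mem_inv[of q U] pq assms by auto
  then have "mem C (p \<odot> z) Q"
   using pq y assms cmp_reassoc[OF pq(6), of z]
   by (intro * exI[of _ "q \<odot> z"]) auto
  with z show "mem C z (inv_im C p Q)"
   using mem_inv[OF pq(1) Q'] pq by auto
 qed
 then have "ex_im C p (inv_im C q U) \<sqsubseteq>\<^bsub>Sub C (tgt C p)\<^esub> Q"
  using ex_im_adj[OF pq(1) c Q'] by simp
 moreover have "mem C (idn C (src C y)) (ex_im C p (inv_im C q U))"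
  unfolding eq using mem_idn_inv[of y] y W by simp
 ultimately show "mem C (idn C (src C y)) Q"
  using Sub_le_iff[OF ex_im_closed[OF pq(1) c] Q'] by blast
qed (use assms in auto)

text \<open>From left to right this is the counit of the adjunction. Conversely, Beck-Chevalley
  moves the question to the pullback \<open>p\<close> of \<open>f\<close> along \<open>x\<close>,
  where by adjunction it suffices that every element of \<open>src C p\<close> is sent by
  \<open>q\<close> into \<open>U\<close>.\<close>

lemma mem_all_im:
 assumes "x \<in> arrs C" "f \<in> arrs C" "tgt C x = tgt C f" "U \<in> subs C (src C f)"
 shows "mem C x (all_im C f U) \<longleftrightarrow>
  (\<forall>k \<in> arrs C. tgt C k = src C x \<longrightarrow>
   (\<forall>y \<in> arrs C. tgt C y = src C f \<longrightarrow> f \<odot> y = x \<odot> k \<longrightarrow> mem C y U))"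
proof (intro iffI ballI impI)
 note c = all_im_closed[OF assms(2,4)]
 interpret L: partial_order "Sub C (tgt C f)" by (rule Sub_partial_order)
 have "inv_im C f (all_im C f U) \<sqsubseteq>\<^bsub>Sub C (src C f)\<^esub> U"
  using all_im_adj[OF assms(2,4) c] L.le_refl[OF c] by simp
 then have counit: "mem C y (inv_im C f (all_im C f U)) \<Longrightarrow> mem C y U" for y
  using Sub_le_iff[OF inv_im_closed[OF assms(2) c] assms(4)] by blast
 fix k y assume "mem C x (all_im C f U)" and k: "k \<in> arrs C" "tgt C k = src C x"
  and y: "y \<in> arrs C" "tgt C y = src C f" "f \<odot> y = x \<odot> k"
 then have "mem C (x \<odot> k) (all_im C f U)"
  using mem_cmp[OF _ c] by blast
 then show "mem C y U"
  using y mem_inv[OF assms(2) c] counit by auto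
next
 assume *: "\<forall>k \<in> arrs C. tgt C k = src C x \<longrightarrow>
   (\<forall>y \<in> arrs C. tgt C y = src C f \<longrightarrow> f \<odot> y = x \<odot> k \<longrightarrow> mem C y U)"
 obtain p q where pb: "is_pullback C p q x f"
  using pullback_exists[of x f] assms by auto
 then have pq: "p \<in> arrs C" "tgt C p = src C x" "q \<in> arrs C" "src C q = src C p" "tgt C q = src C f"
  "x \<odot> p = f \<odot> q"
  by (auto simp: is_pullback_def)
 have eq: "all_im C p (inv_im C q U) = inv_im C x (all_im C f U)"
  by (rule beck_chevalley_all[OF pb assms(4)])
 have c: "inv_im C q U \<in> subs C (src C p)"
  using inv_im_closed[of q U] pq assms by simp
 have o: "src C x \<in> objs C" using assms by simp
 note t = top_carrier[OF o]
 have t': "\<top>\<^bsub>Sub C (src C x)\<^esub> \<in> subs C (tgt C p)" using t pq by simp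
 have "inv_im C p (\<top>\<^bsub>Sub C (src C x)\<^esub>) \<sqsubseteq>\<^bsub>Sub C (src C p)\<^esub> inv_im C q U"
  unfolding Sub_le_iff[OF inv_im_closed[OF pq(1) t'] c]
 proof (intro allI impI)
  fix z assume "mem C z (inv_im C p (\<top>\<^bsub>Sub C (src C x)\<^esub>))"
  then have z: "z \<in> arrs C" "tgt C z = src C p"
   using mem_inv[OF pq(1) t'] by auto
  then have "mem C (q \<odot> z) U"
   using pq assms cmp_reassoc[OF pq(6), of z] by (intro *[rule_format, of "p \<odot> z"]) auto
  with z show "mem C z (inv_im C q U)"
   using mem_inv[of q U] pq assms by auto
 qed
 then have "\<top>\<^bsub>Sub C (src C x)\<^esub> \<sqsubseteq>\<^bsub>Sub C (src C x)\<^esub> all_im C p (inv_im C q U)"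
  using all_im_adj[OF pq(1) c t'] pq by simp
 then have "mem C (idn C (src C x)) (all_im C p (inv_im C q U))"
  using top_le_iff[OF o] all_im_closed[OF pq(1) c] pq by simp
 then show "mem C x (all_im C f U)"
  unfolding eq using mem_idn_inv[of x] assms all_im_closed[OF assms(2,4)] by simp
qed

section \<open>Forcing computes the interpretation of formulas\<close>

lemma env_ext_eq: "env_ext C v X Z e = (sb C (pr2 C X Z) e)(v \<mapsto> pr1 C X Z)"
 by (simp add: env_ext_def sb_def)

lemma env_ok_ext:
 assumes "env_ok C \<Gamma> Z e" "X \<in> objs C" "Z \<in> objs C"
 shows "env_ok C (\<Gamma>(v \<mapsto> X)) (prd C X Z) (env_ext C v X Z e)"
 unfolding env_ext_eq
proof (rule env_ok_upd)
 show "env_ok C \<Gamma> (prd C X Z) (sb C (pr2 C X Z) e)"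
  using env_ok_sb[of \<Gamma> "pr2 C X Z" e] assms by simp
qed (use assms in auto)

lemma sb_env_ext:
 assumes "env_ok C \<Gamma> Z e" "X \<in> objs C" "Z \<in> objs C" "y \<in> arrs C" "tgt C y = prd C X Z"
 shows "sb C y (env_ext C v X Z e) = (sb C (pr2 C X Z \<odot> y) e)(v \<mapsto> pr1 C X Z \<odot> y)"
 using sb_sb[of \<Gamma> "pr2 C X Z" e y] assms
 unfolding env_ext_eq by simp

text \<open>Being a subobject and the description by forcing are proved together, since the
  membership lemmas require their operands to be subobjects. All elements \<open>z\<close> are
  treated rather than the identity alone, because implications, quantifiers and covers call for the
  induction hypothesis at a further stage.\<close>

theorem kripke_joyal:
 assumes "wf_fml C \<Gamma> \<phi>" "env_ok C \<Gamma> Z e" "Z \<in> objs C"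
 shows "fml_val C \<phi> Z e \<in> subs C Z \<and>
  (\<forall>z \<in> arrs C. tgt C z = Z \<longrightarrow> (mem C z (fml_val C \<phi> Z e) \<longleftrightarrow> force C \<phi> (src C z) (sb C z e)))"
 using assms
proof (induction \<phi> arbitrary: \<Gamma> Z e)
 case (FEq t s)
 then obtain X where ts: "has_sort C \<Gamma> t X" "has_sort C \<Gamma> s X" by auto
 note t = trm_val_typed[OF ts(1) FEq(2,3)] and s = trm_val_typed[OF ts(2) FEq(2,3)]
 obtain m where m: "is_equalizer C m (trm_val C Z e t) (trm_val C Z e s)"
  using equalizer_exists[of "trm_val C Z e t" Z X] t s by auto
 note m' = equalizer_sub[OF m, of Z X]
 have mono: "monic C m" "tgt C m = Z"
  and memb: "mem C x (sub_of C m) \<longleftrightarrow> x \<in> arrs C \<and> tgt C x = Z \<and> trm_val C Z e t \<odot> x = trm_val C Z e s \<odot> x" for x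
  using m' t s by simp_all
 have eq: "fml_val C (FEq t s) Z e = sub_of C m"
  using equalizer_charI[OF sub_of_carrier[OF mono], of "trm_val C Z e t" X "trm_val C Z e s"]
   t s memb by simp
 show ?case
  unfolding eq memb using sub_of_carrier[OF mono] FEq(2) ts
  by (auto simp: trm_val_sb)
next
 case (FMem X U t)
 then have ts: "has_sort C \<Gamma> t X" "U \<in> subs C X" by auto
 note t = trm_val_typed[OF ts(1) FMem(2,3)]
 show ?case
  using inv_im_closed[of "trm_val C Z e t" U] mem_inv[of "trm_val C Z e t" U] ts t FMem(2)
  by (auto simp: trm_val_sb)
next
 case FTop
 then show ?case by (simp add: top_carrier mem_top)
next
 case FBot
 then show ?case by (auto simp: bottom_closed mem_bottom)
next
 case (FAnd p q)
 then have "wf_fml C \<Gamma> p" "wf_fml C \<Gamma> q" by auto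
 note p = FAnd.IH(1)[OF this(1) FAnd.prems(2,3)] and q = FAnd.IH(2)[OF this(2) FAnd.prems(2,3)]
 show ?case
  using p q ops_closed(1)[OF FAnd.prems(3)] mem_meet by auto
next
 case (FOr p q)
 then have "wf_fml C \<Gamma> p" "wf_fml C \<Gamma> q" by auto
 note p = FOr.IH(1)[OF this(1) FOr.prems(2,3)] and q = FOr.IH(2)[OF this(2) FOr.prems(2,3)]
 have "(mem C (z \<odot> k) (fml_val C p Z e) \<or> mem C (z \<odot> k) (fml_val C q Z e)) \<longleftrightarrow>
   force C p (src C k) (sb C k (sb C z e)) \<or> force C q (src C k) (sb C k (sb C z e))"
  if "z \<in> arrs C" "tgt C z = Z" "k \<in> arrs C" "tgt C k = src C z" for z k
  using p q that FOr.prems(2) sb_sb[of \<Gamma> z e k] by auto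
 then have "mem C z (fml_val C p Z e \<squnion>\<^bsub>Sub C Z\<^esub> fml_val C q Z e) \<longleftrightarrow>
   cvr C (src C z) (\<lambda>k. force C p (src C k) (sb C k (sb C z e)) \<or> force C q (src C k) (sb C k (sb C z e)))"
  if z: "z \<in> arrs C" "tgt C z = Z" for z
  using mem_join[of z "fml_val C p Z e" "fml_val C q Z e"] p q z cvr_cong[of "src C z"
   "\<lambda>k. mem C (z \<odot> k) (fml_val C p Z e) \<or> mem C (z \<odot> k) (fml_val C q Z e)"] by simp
 then show ?case
  using p q ops_closed(2)[OF FOr.prems(3)] by auto
next
 case (FImp p q)
 then have "wf_fml C \<Gamma> p" "wf_fml C \<Gamma> q" by auto
 note p = FImp.IH(1)[OF this(1) FImp.prems(2,3)] and q = FImp.IH(2)[OF this(2) FImp.prems(2,3)]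
 have "mem C z (himp (Sub C Z) (fml_val C p Z e) (fml_val C q Z e)) \<longleftrightarrow>
   force C (FImp p q) (src C z) (sb C z e)" if z: "z \<in> arrs C" "tgt C z = Z" for z
  using mem_himp[of z "fml_val C p Z e" "fml_val C q Z e"] p q z FImp.prems(2) sb_sb[of \<Gamma> z e]
  by simp
 then show ?case
  using p q himp_closed[OF FImp.prems(3)] by simp
next
 case (FEx v X p)
 then have X: "X \<in> objs C" and wf: "wf_fml C (\<Gamma>(v \<mapsto> X)) p" by auto
 note Z = FEx.prems(3) and e = FEx.prems(2)
 have P: "prd C X Z \<in> objs C" using X Z by simp
 let ?V = "fml_val C p (prd C X Z) (env_ext C v X Z e)"
 note p = FEx.IH[OF wf env_ok_ext[OF e X Z] P]
 have "mem C z (ex_im C (pr2 C X Z) ?V) \<longleftrightarrow> force C (FEx v X p) (src C z) (sb C z e)"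
  if z: "z \<in> arrs C" "tgt C z = Z" for z
 proof -
  have "mem C z (ex_im C (pr2 C X Z) ?V) \<longleftrightarrow>
    cvr C (src C z) (\<lambda>k. \<exists>y. pr2 C X Z \<odot> y = z \<odot> k \<and> mem C y ?V)"
   by (rule mem_ex_im) (use X Z z p in auto)
  moreover have "(\<exists>y. pr2 C X Z \<odot> y = z \<odot> k \<and> mem C y ?V) \<longleftrightarrow>
    (\<exists>x\<in>arrs C. src C x = src C k \<and> tgt C x = X \<and> force C p (src C k) ((sb C k (sb C z e))(v \<mapsto> x)))"
   if k: "k \<in> arrs C" "tgt C k = src C z" for k
  proof
   assume "\<exists>y. pr2 C X Z \<odot> y = z \<odot> k \<and> mem C y ?V"
   then obtain y where y: "pr2 C X Z \<odot> y = z \<odot> k" "mem C y ?V" by blast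
   then have y': "y \<in> arrs C" "tgt C y = prd C X Z"
    using p mem_tgt by auto
   have "src C y = src C (pr2 C X Z \<odot> y)" using X Z y' by simp
   then have s: "src C y = src C k" unfolding y(1) using z k by simp
   have "force C p (src C y) (sb C y (env_ext C v X Z e))"
    using p y y' by blast
   then have "force C p (src C k) ((sb C k (sb C z e))(v \<mapsto> pr1 C X Z \<odot> y))"
    using sb_env_ext[OF e X Z y', of v] y s sb_sb[of \<Gamma> z e k] z k e by simp
   with y' s X Z show "\<exists>x\<in>arrs C. src C x = src C k \<and> tgt C x = X \<and>
     force C p (src C k) ((sb C k (sb C z e))(v \<mapsto> x))"
    by (intro bexI[of _ "pr1 C X Z \<odot> y"]) auto
  next
   assume "\<exists>x\<in>arrs C. src C x = src C k \<and> tgt C x = X \<and> force C p (src C k) ((sb C k (sb C z e))(v \<mapsto> x))"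
   then obtain x where x: "x \<in> arrs C" "src C x = src C k" "tgt C x = X"
    "force C p (src C k) ((sb C k (sb C z e))(v \<mapsto> x))" by blast
   \<comment> \<open>A value \<open>x\<close> for the bound variable at the stage
     \<open>src C k\<close> is the same as an element of \<open>X \<times> Z\<close> lying over
     \<open>z \<odot> k\<close>.\<close>
   let ?y = "pair X Z x (z \<odot> k)"
   have y: "?y \<in> arrs C" "src C ?y = src C k" "tgt C ?y = prd C X Z"
    "pr1 C X Z \<odot> ?y = x" "pr2 C X Z \<odot> ?y = z \<odot> k"
    using x z k by auto
   have "force C p (src C ?y) (sb C ?y (env_ext C v X Z e))"
    using sb_env_ext[OF e X Z y(1,3), of v] y x sb_sb[of \<Gamma> z e k] z k e by simp
   then have "mem C ?y ?V"
    using p y by blast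
   with y show "\<exists>y. pr2 C X Z \<odot> y = z \<odot> k \<and> mem C y ?V" by blast
  qed
  ultimately show ?thesis
   using cvr_cong[of "src C z" "\<lambda>k. \<exists>y. pr2 C X Z \<odot> y = z \<odot> k \<and> mem C y ?V"] by simp
 qed
 then show ?case
  using p ex_im_closed[of "pr2 C X Z" ?V] X Z by simp
next
 case (FAll v X p)
 then have X: "X \<in> objs C" and wf: "wf_fml C (\<Gamma>(v \<mapsto> X)) p" by auto
 note Z = FAll.prems(3) and e = FAll.prems(2)
 have P: "prd C X Z \<in> objs C" using X Z by simp
 let ?V = "fml_val C p (prd C X Z) (env_ext C v X Z e)"
 note p = FAll.IH[OF wf env_ok_ext[OF e X Z] P]
 have "mem C z (all_im C (pr2 C X Z) ?V) \<longleftrightarrow> force C (FAll v X p) (src C z) (sb C z e)"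
  if z: "z \<in> arrs C" "tgt C z = Z" for z
 proof -
  have "mem C z (all_im C (pr2 C X Z) ?V) \<longleftrightarrow> (\<forall>k \<in> arrs C. tgt C k = src C z \<longrightarrow>
    (\<forall>y \<in> arrs C. tgt C y = src C (pr2 C X Z) \<longrightarrow> pr2 C X Z \<odot> y = z \<odot> k \<longrightarrow> mem C y ?V))"
   by (rule mem_all_im) (use X Z z p in auto)
  moreover have "(\<forall>y \<in> arrs C. tgt C y = src C (pr2 C X Z) \<longrightarrow> pr2 C X Z \<odot> y = z \<odot> k \<longrightarrow> mem C y ?V) \<longleftrightarrow>
    (\<forall>x\<in>arrs C. src C x = src C k \<longrightarrow> tgt C x = X \<longrightarrow> force C p (src C k) ((sb C k (sb C z e))(v \<mapsto> x)))"
   if k: "k \<in> arrs C" "tgt C k = src C z" for k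
  proof (intro iffI ballI impI)
   fix y assume *: "\<forall>x\<in>arrs C. src C x = src C k \<longrightarrow> tgt C x = X \<longrightarrow> force C p (src C k) ((sb C k (sb C z e))(v \<mapsto> x))"
    and y: "y \<in> arrs C" "tgt C y = src C (pr2 C X Z)" "pr2 C X Z \<odot> y = z \<odot> k"
   then have y': "y \<in> arrs C" "tgt C y = prd C X Z"
    using X Z by auto
   have "src C y = src C (pr2 C X Z \<odot> y)" using X Z y' by simp
   then have s: "src C y = src C k" unfolding y(3) using z k by simp
   have "force C p (src C k) ((sb C k (sb C z e))(v \<mapsto> pr1 C X Z \<odot> y))"
    using * y' s X Z by simp
   then have "force C p (src C y) (sb C y (env_ext C v X Z e))"
    using sb_env_ext[OF e X Z y', of v] y s sb_sb[of \<Gamma> z e k] z k e by simp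
   then show "mem C y ?V"
    using p y' by blast
  next
   fix x assume *: "\<forall>y \<in> arrs C. tgt C y = src C (pr2 C X Z) \<longrightarrow> pr2 C X Z \<odot> y = z \<odot> k \<longrightarrow> mem C y ?V"
    and x: "x \<in> arrs C" "src C x = src C k" "tgt C x = X"
   let ?y = "pair X Z x (z \<odot> k)"
   have y: "?y \<in> arrs C" "src C ?y = src C k" "tgt C ?y = prd C X Z"
    "pr1 C X Z \<odot> ?y = x" "pr2 C X Z \<odot> ?y = z \<odot> k"
    using x z k by auto
   then have "mem C ?y ?V"
    using * X Z by simp
   then have "force C p (src C ?y) (sb C ?y (env_ext C v X Z e))"
    using p y by blast
   then show "force C p (src C k) ((sb C k (sb C z e))(v \<mapsto> x))"
    using sb_env_ext[OF e X Z y(1,3), of v] y x sb_sb[of \<Gamma> z e k] z k e by simp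
  qed
  ultimately show ?thesis
   by simp
 qed
 then show ?case
  using p all_im_closed[of "pr2 C X Z" ?V] X Z by simp
qed

lemma fml_val_closed:
 "wf_fml C \<Gamma> \<phi> \<Longrightarrow> env_ok C \<Gamma> Z e \<Longrightarrow> Z \<in> objs C \<Longrightarrow> fml_val C \<phi> Z e \<in> subs C Z"
 using kripke_joyal by blast

lemma mem_fml_val:
 assumes "wf_fml C \<Gamma> \<phi>" "env_ok C \<Gamma> (tgt C z) e" "z \<in> arrs C"
 shows "mem C z (fml_val C \<phi> (tgt C z) e) \<longleftrightarrow> force C \<phi> (src C z) (sb C z e)"
 using kripke_joyal[OF assms(1,2)] assms(3) by simp

lemma force_iff_mem:
 assumes "wf_fml C \<Gamma> \<phi>" "env_ok C \<Gamma> Z e" "Z \<in> objs C"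
 shows "force C \<phi> Z e \<longleftrightarrow> mem C (idn C Z) (fml_val C \<phi> Z e)"
 using mem_fml_val[of \<Gamma> \<phi> "idn C Z" e] assms sb_idn[OF assms(2)] by simp

text \<open>Forcing is membership of the identity in the interpretation, so it inherits monotonicity
  from membership. Locality of forcing comes from the same observation.\<close>

lemma force_sb:
 assumes "wf_fml C \<Gamma> \<phi>" "env_ok C \<Gamma> (tgt C k) e" "k \<in> arrs C" "force C \<phi> (tgt C k) e"
 shows "force C \<phi> (src C k) (sb C k e)"
proof -
 have "mem C (idn C (tgt C k) \<odot> k) (fml_val C \<phi> (tgt C k) e)"
  using assms by (intro mem_cmp[where X = "tgt C k"]) (auto simp: force_iff_mem[symmetric] fml_val_closed)
 then show ?thesis
  using assms mem_fml_val[of \<Gamma> \<phi> k e] by simp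
qed

lemma force_local:
 assumes "wf_fml C \<Gamma> \<phi>" "env_ok C \<Gamma> Z e" "Z \<in> objs C" "cvr C Z P"
  and "\<And>k. k \<in> arrs C \<Longrightarrow> tgt C k = Z \<Longrightarrow> P k \<Longrightarrow> force C \<phi> (src C k) (sb C k e)"
 shows "force C \<phi> Z e"
 unfolding force_iff_mem[OF assms(1-3)]
proof (rule cvr_mem)
 show "cvr C (src C (idn C Z)) P" using assms by simp
 fix k assume "k \<in> arrs C" "tgt C k = src C (idn C Z)" "P k"
 then show "mem C (idn C Z \<odot> k) (fml_val C \<phi> Z e)"
  using assms mem_fml_val[OF assms(1), of k e] by simp
qed (use assms fml_val_closed in auto)

lemma holds_iff:
 assumes "wf_fml C Map.empty \<phi>"
 shows "holds C \<phi> \<longleftrightarrow> force C \<phi> (one C) Map.empty"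
 unfolding holds_def truth_value_def
 using eq_top_iff[of "one C" "fml_val C \<phi> (one C) Map.empty"] force_iff_mem[OF assms env_ok_empty]
  fml_val_closed[OF assms env_ok_empty]
 by simp

end

section \<open>Blocks of quantifiers and freshness of variables\<close>

definition env_typed :: "('o, 'm) cat \<Rightarrow> 'o \<Rightarrow> ('v \<rightharpoonup> 'm) \<Rightarrow> bool" where
 "env_typed C T e \<longleftrightarrow> (\<forall>v g. e v = Some g \<longrightarrow> g \<in> arrs C \<and> src C g = T)"

text \<open>The context is recovered from the targets of the arrows, so that no separate context has
  to accompany an environment.\<close>

definition env_sort :: "('o, 'm) cat \<Rightarrow> ('v \<rightharpoonup> 'm) \<Rightarrow> ('v \<rightharpoonup> 'o)" where
 "env_sort C e = (\<lambda>v. map_option (tgt C) (e v))"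

lemma env_ok_sort: "env_typed C T e \<Longrightarrow> env_ok C (env_sort C e) T e"
 by (auto simp: env_ok_def env_typed_def env_sort_def)

lemma env_typed_empty [simp]: "env_typed C T Map.empty"
 by (simp add: env_typed_def)

lemma env_typed_upd [simp]:
 "env_typed C T e \<Longrightarrow> x \<in> arrs C \<Longrightarrow> src C x = T \<Longrightarrow> env_typed C T (e(v \<mapsto> x))"
 by (simp add: env_typed_def)

lemma env_sort_empty [simp]: "env_sort C Map.empty = Map.empty"
 by (simp add: env_sort_def)

lemma env_sort_upd [simp]: "env_sort C (e(v \<mapsto> x)) = (env_sort C e)(v \<mapsto> tgt C x)"
 by (auto simp: env_sort_def)

text \<open>Polymorphic in the values: the same function extends an environment by arrows and a
  context by sorts.\<close>

fun upds :: "('v \<rightharpoonup> 'a) \<Rightarrow> ('v \<times> 'o) list \<Rightarrow> 'a list \<Rightarrow> ('v \<rightharpoonup> 'a)" where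
 "upds e ((v, X) # vs) (x # xs) = upds (e(v \<mapsto> x)) vs xs"
| "upds e _ _ = e"

definition ok_args :: "('o, 'm) cat \<Rightarrow> 'o \<Rightarrow> ('v \<times> 'o) list \<Rightarrow> 'm list \<Rightarrow> bool" where
 "ok_args C T vs xs \<longleftrightarrow> list_all2 (\<lambda>(v, X) x. x \<in> arrs C \<and> src C x = T \<and> tgt C x = X) vs xs"

lemma ok_args_simps [simp]:
 "ok_args C T [] xs \<longleftrightarrow> xs = []"
 "ok_args C T ((v, X) # vs) xs \<longleftrightarrow>
  (\<exists>y ys. xs = y # ys \<and> y \<in> arrs C \<and> src C y = T \<and> tgt C y = X \<and> ok_args C T vs ys)"
 "ok_args C T vs [] \<longleftrightarrow> vs = []"
 by (auto simp: ok_args_def list_all2_Cons1)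

lemma env_typed_upds:
 "env_typed C T e \<Longrightarrow> ok_args C T vs xs \<Longrightarrow> env_typed C T (upds e vs xs)"
 by (induction e vs xs rule: upds.induct) auto

lemma env_sort_upds:
 "ok_args C T vs xs \<Longrightarrow> env_sort C (upds e vs xs) = upds (env_sort C e) vs (map snd vs)"
 by (induction e vs xs rule: upds.induct) (auto simp del: fun_upd_apply)

lemma sb_upds: "sb C k (upds e vs xs) = upds (sb C k e) vs (map (\<lambda>x. x \<odot>\<^bsub>C\<^esub> k) xs)"
 by (induction e vs xs rule: upds.induct) (auto simp del: fun_upd_apply)

lemma trm_val_cong:
 "(\<And>v. v \<in> set1_trm t \<Longrightarrow> e v = e' v) \<Longrightarrow> trm_val C T e t = trm_val C T e' t"
 by (induction t) auto

lemma has_sort_cong: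
 "(\<And>v. v \<in> set1_trm t \<Longrightarrow> \<Gamma> v = \<Gamma>' v) \<Longrightarrow> has_sort C \<Gamma> t X \<longleftrightarrow> has_sort C \<Gamma>' t X"
 by (induction t arbitrary: X) auto

text \<open>Replaces quantification over argument lists by nested quantifiers. The recursive
  equation asks for a further entry \<open>w\<close>, so that it does not overlap with the equation
  that ends the recursion.\<close>

lemma all_ok_args:
 "(\<forall>xs. ok_args C T [(v, X)] xs \<longrightarrow> P xs) \<longleftrightarrow>
  (\<forall>a. a \<in> arrs C \<longrightarrow> src C a = T \<longrightarrow> tgt C a = X \<longrightarrow> P [a])"
 "(\<forall>xs. ok_args C T ((v, X) # w # vs) xs \<longrightarrow> P xs) \<longleftrightarrow>
  (\<forall>a. a \<in> arrs C \<longrightarrow> src C a = T \<longrightarrow> tgt C a = X \<longrightarrow>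
   (\<forall>xs. ok_args C T (w # vs) xs \<longrightarrow> P (a # xs)))"
 by auto

abbreviation FAlls :: "('v \<times> 'o) list \<Rightarrow> ('v, 'o, 'm) fml \<Rightarrow> ('v, 'o, 'm) fml" where
 "FAlls vs p \<equiv> foldr (\<lambda>(v, X). FAll v X) vs p"

context category
begin

lemma env_typed_sb: "env_typed C (tgt C k) e \<Longrightarrow> k \<in> arrs C \<Longrightarrow> env_typed C (src C k) (sb C k e)"
 unfolding env_typed_def sb_def by fastforce

lemma env_sort_sb: "env_typed C (tgt C k) e \<Longrightarrow> k \<in> arrs C \<Longrightarrow> env_sort C (sb C k e) = env_sort C e"
 unfolding env_typed_def sb_def env_sort_def by (auto simp: fun_eq_iff option.map_comp intro!: map_option_cong)

lemma ok_args_sb: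
 "ok_args C (tgt C k) vs xs \<Longrightarrow> k \<in> arrs C \<Longrightarrow> ok_args C (src C k) vs (map (\<lambda>x. x \<odot> k) xs)"
 unfolding ok_args_def by (fastforce simp: list_all2_conv_all_nth)

end

context heyting_category
begin

text \<open>Each universal quantifier brings its own change of stage, but successive changes
  compose; for a whole block a single one suffices.\<close>

lemma force_FAlls:
 assumes "T \<in> objs C" "env_typed C T e" "wf_fml C (upds (env_sort C e) vs (map snd vs)) p"
 shows "force C (FAlls vs p) T e \<longleftrightarrow> (\<forall>k \<in> arrs C. tgt C k = T \<longrightarrow>
  (\<forall>xs. ok_args C (src C k) vs xs \<longrightarrow> force C p (src C k) (upds (sb C k e) vs xs)))"
 using assms
proof (induction vs arbitrary: T e)
 case Nil
 have ok: "env_ok C (env_sort C e) T e" using env_ok_sort[OF Nil(2)] .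
 have wf: "wf_fml C (env_sort C e) p" using Nil(3) by simp
 have "force C p (src C k) (sb C k e)" if "force C p T e" "k \<in> arrs C" "tgt C k = T" for k
  using force_sb[OF wf, of k e] ok that by simp
 moreover have "force C p T e" if "force C p (src C (idn C T)) (sb C (idn C T) e)"
  using that sb_idn[OF ok] Nil(1) by simp
 ultimately show ?case
  using Nil(1) by (auto dest!: bspec[of _ _ "idn C T"])
next
 case (Cons vX vs)
 obtain v X where [simp]: "vX = (v, X)" by fastforce
 have IH: "force C (FAlls vs p) (src C k) ((sb C k e)(v \<mapsto> x)) \<longleftrightarrow>
   (\<forall>l \<in> arrs C. tgt C l = src C k \<longrightarrow> (\<forall>xs. ok_args C (src C l) vs xs \<longrightarrow>
    force C p (src C l) (upds ((sb C (k \<odot> l) e)(v \<mapsto> x \<odot> l)) vs xs)))"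
  if "k \<in> arrs C" "tgt C k = T" "x \<in> arrs C" "src C x = src C k" "tgt C x = X" for k x
 proof -
  have et: "env_typed C (src C k) ((sb C k e)(v \<mapsto> x))"
   using env_typed_sb[of k e] that Cons.prems by simp
  have wf: "wf_fml C (upds (env_sort C ((sb C k e)(v \<mapsto> x))) vs (map snd vs)) p"
   using env_sort_sb[of k e] that Cons.prems by simp
  have "force C (FAlls vs p) (src C k) ((sb C k e)(v \<mapsto> x)) \<longleftrightarrow>
   (\<forall>l \<in> arrs C. tgt C l = src C k \<longrightarrow> (\<forall>xs. ok_args C (src C l) vs xs \<longrightarrow>
    force C p (src C l) (upds (sb C l ((sb C k e)(v \<mapsto> x))) vs xs)))"
   by (rule Cons.IH[OF _ et wf]) (use that in simp)
  moreover have "sb C l (sb C k e) = sb C (k \<odot> l) e" if "l \<in> arrs C" "tgt C l = src C k" for l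
   using sb_sb[OF env_ok_sort, of k e l] that \<open>k \<in> arrs C\<close> \<open>tgt C k = T\<close> Cons.prems(2) by simp
  ultimately show ?thesis by simp
 qed
 show ?case
 proof (intro iffI ballI impI allI)
  fix k xs assume *: "force C (FAlls (vX # vs) p) T e" and k: "k \<in> arrs C" "tgt C k = T"
   and "ok_args C (src C k) (vX # vs) xs"
  then obtain y ys where y: "xs = y # ys" "y \<in> arrs C" "src C y = src C k" "tgt C y = X"
   "ok_args C (src C k) vs ys" by auto
  have "force C (FAlls vs p) (src C k) ((sb C k e)(v \<mapsto> y))"
   using * k y by auto
  then have "\<forall>l \<in> arrs C. tgt C l = src C k \<longrightarrow> (\<forall>xs. ok_args C (src C l) vs xs \<longrightarrow>
    force C p (src C l) (upds ((sb C (k \<odot> l) e)(v \<mapsto> y \<odot> l)) vs xs))"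
   using IH[OF k y(2-4)] by blast
  from this[rule_format, of "idn C (src C k)" ys] k y
  show "force C p (src C k) (upds (sb C k e) (vX # vs) xs)" by simp
 next
  assume *: "\<forall>k \<in> arrs C. tgt C k = T \<longrightarrow> (\<forall>xs. ok_args C (src C k) (vX # vs) xs \<longrightarrow>
   force C p (src C k) (upds (sb C k e) (vX # vs) xs))"
  have "force C (FAlls vs p) (src C k) ((sb C k e)(v \<mapsto> x))"
   if "k \<in> arrs C" "tgt C k = T" "x \<in> arrs C" "src C x = src C k" "tgt C x = X" for k x
   unfolding IH[OF that]
  proof (intro ballI impI allI)
   fix l xs assume "l \<in> arrs C" "tgt C l = src C k" "ok_args C (src C l) vs xs"
   with *[rule_format, of "k \<odot> l" "x \<odot> l # xs"] that
   show "force C p (src C l) (upds ((sb C (k \<odot> l) e)(v \<mapsto> x \<odot> l)) vs xs)" by simp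
  qed
  then show "force C (FAlls (vX # vs) p) T e" by simp
 qed
qed

text \<open>The change of stage belonging to the implication is absorbed by that of the quantifiers
  in front of it: arguments can be restricted as well.\<close>

lemma force_FAlls_FImp:
 assumes "T \<in> objs C" "env_typed C T e" "wf_fml C (upds (env_sort C e) vs (map snd vs)) (FImp p q)"
 shows "force C (FAlls vs (FImp p q)) T e \<longleftrightarrow> (\<forall>k \<in> arrs C. tgt C k = T \<longrightarrow>
  (\<forall>xs. ok_args C (src C k) vs xs \<longrightarrow> force C p (src C k) (upds (sb C k e) vs xs) \<longrightarrow>
   force C q (src C k) (upds (sb C k e) vs xs)))"
 unfolding force_FAlls[OF assms]
proof (intro iffI ballI impI allI)
 fix k xs assume *: "\<forall>k \<in> arrs C. tgt C k = T \<longrightarrow>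
  (\<forall>xs. ok_args C (src C k) vs xs \<longrightarrow> force C (FImp p q) (src C k) (upds (sb C k e) vs xs))"
  and k: "k \<in> arrs C" "tgt C k = T" "ok_args C (src C k) vs xs"
  "force C p (src C k) (upds (sb C k e) vs xs)"
 have "env_typed C (src C k) (upds (sb C k e) vs xs)"
  using k assms(2) by (intro env_typed_upds env_typed_sb) auto
 then have "sb C (idn C (src C k)) (upds (sb C k e) vs xs) = upds (sb C k e) vs xs"
  using sb_idn env_ok_sort by metis
 with *[rule_format, OF k(1-3)] k show "force C q (src C k) (upds (sb C k e) vs xs)"
  by (auto dest!: bspec[of _ _ "idn C (src C k)"])
next
 fix k xs assume *: "\<forall>k \<in> arrs C. tgt C k = T \<longrightarrow>
  (\<forall>xs. ok_args C (src C k) vs xs \<longrightarrow> force C p (src C k) (upds (sb C k e) vs xs) \<longrightarrow>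
   force C q (src C k) (upds (sb C k e) vs xs))"
  and k: "k \<in> arrs C" "tgt C k = T" "ok_args C (src C k) vs xs"
 show "force C (FImp p q) (src C k) (upds (sb C k e) vs xs)"
  unfolding force.simps
 proof (intro ballI impI)
  fix l assume l: "l \<in> arrs C" "tgt C l = src C k"
  have "sb C l (upds (sb C k e) vs xs) = upds (sb C (k \<odot> l) e) vs (map (\<lambda>x. x \<odot> l) xs)"
   using sb_sb[OF env_ok_sort, of k e l] k l assms(2) by (simp add: sb_upds)
  moreover have "ok_args C (src C (k \<odot> l)) vs (map (\<lambda>x. x \<odot> l) xs)"
   using ok_args_sb[of l vs xs] k l by simp
  moreover assume "force C p (src C l) (sb C l (upds (sb C k e) vs xs))"
  ultimately show "force C q (src C l) (sb C l (upds (sb C k e) vs xs))"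
   using *[rule_format, of "k \<odot> l" "map (\<lambda>x. x \<odot> l) xs"] k l by simp
 qed
qed

text \<open>Every object has an arrow to the terminal one, so truth of a closed formula is a
  statement about all stages.\<close>

lemma all_stages: "(\<forall>k \<in> arrs C. tgt C k = one C \<longrightarrow> P (src C k)) \<longleftrightarrow> (\<forall>T \<in> objs C. P T)"
 using terminal_arr[OF one_terminal] src_obj by metis

lemma mem_compr:
 assumes "wf_fml C [v \<mapsto> X] p" "X \<in> objs C"
 shows "compr C v X p \<in> subs C X"
  and "mem C z (compr C v X p) \<longleftrightarrow> z \<in> arrs C \<and> tgt C z = X \<and> force C p (src C z) [v \<mapsto> z]"
proof -
 have e: "env_ok C [v \<mapsto> X] X [v \<mapsto> idn C X]"
  using assms(2) by simp
 show c: "compr C v X p \<in> subs C X"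
  unfolding compr_def by (rule fml_val_closed[OF assms(1) e assms(2)])
 show "mem C z (compr C v X p) \<longleftrightarrow> z \<in> arrs C \<and> tgt C z = X \<and> force C p (src C z) [v \<mapsto> z]"
  using mem_fml_val[OF assms(1), of z "[v \<mapsto> idn C X]"] e mem_tgt[OF _ c, of z] mem_arr[of C z]
  unfolding compr_def by auto
qed

end

text \<open>The formulas for application bind auxiliary variables counted upwards from
  \<open>n\<close>; such bindings do not disturb this relation.\<close>

definition agree :: "nat \<Rightarrow> (nat + nat \<rightharpoonup> 'm) \<Rightarrow> (nat + nat \<rightharpoonup> 'm) \<Rightarrow> bool" where
 "agree n e' e \<longleftrightarrow> (\<forall>i < n. e' (Inl i) = e (Inl i)) \<and> (\<forall>x. e' (Inr x) = e (Inr x))"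

text \<open>Excludes the variables \<open>Inr x\<close> altogether: rebinding a variable of the
  formula that is being realized leaves such a term unchanged.\<close>

definition below :: "nat \<Rightarrow> (nat + nat, 'o, 'm) trm \<Rightarrow> bool" where
 "below n t \<longleftrightarrow> (\<forall>v \<in> set1_trm t. \<exists>i < n. v = Inl i)"

lemma below_simps [simp]:
 "below n (TVar (Inl i)) \<longleftrightarrow> i < n"
 "\<not> below n (TVar (Inr x))"
 "below n (TApp f t) \<longleftrightarrow> below n t"
 "below n (TUnit T)"
 "below n (TPair p q t s) \<longleftrightarrow> below n t \<and> below n s"
 by (auto simp: below_def)

lemma below_mono: "below n t \<Longrightarrow> n \<le> m \<Longrightarrow> below m t"
 by (fastforce simp: below_def)

lemma agree_refl [simp]: "agree n e e"
 by (simp add: agree_def)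

lemma agree_upd: "agree (Suc n) e' (e(Inl n \<mapsto> d)) \<Longrightarrow> agree n e' e"
 by (simp add: agree_def)

lemma agree_upd_self [simp]: "agree n (e(Inl n \<mapsto> d)) e"
 by (simp add: agree_def)

lemma trm_val_agree:
 assumes "agree n e' e" "below n t"
 shows "trm_val C T e' t = trm_val C T e t"
proof (rule trm_val_cong)
 fix v assume "v \<in> set1_trm t"
 with assms show "e' v = e v" by (auto simp: agree_def below_def)
qed

lemma has_sort_agree:
 assumes "agree n \<Gamma>' \<Gamma>" "below n t"
 shows "has_sort C \<Gamma>' t X \<longleftrightarrow> has_sort C \<Gamma> t X"
proof (rule has_sort_cong)
 fix v assume "v \<in> set1_trm t"
 with assms show "\<Gamma>' v = \<Gamma> v" by (auto simp: agree_def below_def)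
qed

lemma below_args_upd:
 assumes "\<forall>s \<in> set ss. has_sort C \<Gamma> s X \<and> below n s"
 shows "\<forall>s \<in> set ss. has_sort C (\<Gamma>(Inl n \<mapsto> Y)) s X \<and> below (Suc n) s"
 using assms has_sort_agree[OF agree_upd_self] below_mono[of n _ "Suc n"] by fastforce

lemma trm_val_upd: "below n t \<Longrightarrow> trm_val C T (e(Inl n \<mapsto> d)) t = trm_val C T e t"
 by (rule trm_val_agree[OF agree_upd_self])

lemma agree_env_sort: "agree n e' e \<Longrightarrow> agree n (env_sort C e') (env_sort C e)"
 by (auto simp: agree_def env_sort_def)

section \<open>Partial application on generalized elements\<close>

locale pas_category = heyting_category C for C :: "('o, 'm) cat" (structure) +
 fixes S :: "('o, 'm) pas"
 assumes pas: "is_pas C S"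
begin

abbreviation "A \<equiv> elts S"

definition app_rel :: "'m \<Rightarrow> 'm \<Rightarrow> 'm \<Rightarrow> bool" where
 "app_rel x y d \<longleftrightarrow> x \<in> arrs C \<and> y \<in> arrs C \<and> src C x = src C y \<and> tgt C x = A \<and>
  tgt C y = A \<and> d \<in> arrs C \<and> src C d = src C y \<and> tgt C d = src C (app_dom S) \<and>
  app_dom S \<odot> d = pair (A) (A) x y"

text \<open>The witness \<open>d\<close> is unique because the domain of application is given by a
  monomorphism, so the description picks the only possible value.\<close>

definition ap :: "'m \<Rightarrow> 'm \<Rightarrow> 'm option" where
 "ap x y = (if \<exists>d. app_rel x y d then Some (app_map S \<odot> (THE d. app_rel x y d)) else None)"

fun apl :: "'m \<Rightarrow> 'm list \<Rightarrow> 'm option" where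
 "apl x [] = Some x"
| "apl x (y # ys) = (case ap x y of None \<Rightarrow> None | Some v \<Rightarrow> apl v ys)"

lemma apl_append: "apl x (ys @ zs) = (case apl x ys of None \<Rightarrow> None | Some v \<Rightarrow> apl v zs)"
 by (induction ys arbitrary: x) (auto split: option.splits)

definition els :: "'o \<Rightarrow> 'm set" where
 "els T = {x \<in> arrs C. src C x = T \<and> tgt C x = A}"

lemma els_iff: "x \<in> els T \<longleftrightarrow> x \<in> arrs C \<and> src C x = T \<and> tgt C x = A"
 by (simp add: els_def)

lemma ball_els:
 "(\<forall>x \<in> els T. P x) \<longleftrightarrow> (\<forall>x. x \<in> arrs C \<longrightarrow> src C x = T \<longrightarrow> tgt C x = A \<longrightarrow> P x)"
 by (auto simp: els_iff)

lemma A_obj [simp]: "A \<in> objs C"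
 using pas by (simp add: is_pas_def)

lemma dom_simps [simp]:
 "monic C (app_dom S)" "app_dom S \<in> arrs C" "tgt C (app_dom S) = prd C A A"
 "app_map S \<in> arrs C" "src C (app_map S) = src C (app_dom S)" "tgt C (app_map S) = A"
 using pas by (auto simp: is_pas_def partial_mor_def)

lemma app_rel_unique: "app_rel x y d \<Longrightarrow> app_rel x y d' \<Longrightarrow> d = d'"
 by (rule monicD[OF dom_simps(1)]) (auto simp: app_rel_def)

lemma ap_Some: "ap x y = Some v \<longleftrightarrow> (\<exists>d. app_rel x y d \<and> v = app_map S \<odot> d)"
proof -
 have "(THE d. app_rel x y d) = d" if "app_rel x y d" for d
  using that app_rel_unique by blast
 then show ?thesis by (auto simp: ap_def)
qed

lemma apD:
 assumes "ap x y = Some v"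
 shows "x \<in> arrs C" "y \<in> arrs C" "v \<in> arrs C" "src C x = src C y" "src C v = src C y"
  "tgt C x = A" "tgt C y = A" "tgt C v = A"
 using assms by (auto simp: ap_Some app_rel_def)

lemma ap_defined_iff:
 assumes "x \<in> els T" "y \<in> els T"
 shows "ap x y \<noteq> None \<longleftrightarrow>
  mem C (pair A A x y) (sub_of C (app_dom S))"
 using assms by (simp add: ap_def mem_sub_of app_rel_def els_iff) metis

lemma app_dom_sub: "sub_of C (app_dom S) \<in> subs C (prd C A A)"
 by (rule sub_of_carrier) auto

lemma els_cmp: "x \<in> els T \<Longrightarrow> k \<in> arrs C \<Longrightarrow> tgt C k = T \<Longrightarrow> x \<odot> k \<in> els (src C k)"
 by (auto simp: els_iff)

lemma ap_els: "ap x y = Some v \<Longrightarrow> y \<in> els T \<Longrightarrow> v \<in> els T"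
 by (auto simp: els_iff dest: apD)

lemma ap_cmp:
 assumes "ap x y = Some v" "k \<in> arrs C" "tgt C k = src C y"
 shows "ap (x \<odot> k) (y \<odot> k) = Some (v \<odot> k)"
proof -
 from assms(1) obtain d where d: "app_rel x y d" "v = app_map S \<odot> d"
  by (auto simp: ap_Some)
 then have d': "x \<in> arrs C" "y \<in> arrs C" "src C x = src C y" "tgt C x = A" "tgt C y = A" "d \<in> arrs C"
  "src C d = src C y" "tgt C d = src C (app_dom S)"
  "app_dom S \<odot> d = pair A A x y"
  by (auto simp: app_rel_def)
 have "app_dom S \<odot> (d \<odot> k) = pair A A x y \<odot> k"
  by (rule cmp_reassoc[OF d'(9)]) (use d' assms in simp_all)
 also have "\<dots> = pair A A (x \<odot> k) (y \<odot> k)"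
  by (rule pair_cmp) (use d' assms in simp_all)
 finally have "app_rel (x \<odot> k) (y \<odot> k) (d \<odot> k)"
  using d' assms by (simp add: app_rel_def)
 moreover have "v \<odot> k = app_map S \<odot> (d \<odot> k)"
  using d d' assms by simp
 ultimately show ?thesis
  unfolding ap_Some by blast
qed

text \<open>An application is defined when the pair of its arguments lies in the domain of
  application. This is membership in a subobject, hence local.\<close>

lemma ap_local:
 assumes "x \<in> els T" "y \<in> els T" "cvr C T P"
  and "\<And>k. k \<in> arrs C \<Longrightarrow> tgt C k = T \<Longrightarrow> P k \<Longrightarrow> ap (x \<odot> k) (y \<odot> k) \<noteq> None"
 shows "ap x y \<noteq> None"
 unfolding ap_defined_iff[OF assms(1,2)]
proof (rule cvr_mem[where P = P])
 let ?t = "pair A A x y"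
 have t: "?t \<in> arrs C" "src C ?t = T" "tgt C ?t = prd C A A"
  using assms by (auto simp: els_iff)
 show "cvr C (src C ?t) P" "?t \<in> arrs C" "sub_of C (app_dom S) \<in> subs C (tgt C ?t)"
  using t assms(3) app_dom_sub by auto
 fix k assume k: "k \<in> arrs C" "tgt C k = src C ?t" "P k"
 then have "ap (x \<odot> k) (y \<odot> k) \<noteq> None"
  using assms(4) t by simp
 then have "mem C (pair A A (x \<odot> k) (y \<odot> k)) (sub_of C (app_dom S))"
  using ap_defined_iff[of "x \<odot> k" "src C k" "y \<odot> k"] els_cmp assms(1,2) k t by simp
 moreover have "?t \<odot> k = pair A A (x \<odot> k) (y \<odot> k)"
  by (rule pair_cmp) (use assms(1,2) k t in \<open>auto simp: els_iff\<close>)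
 ultimately show "mem C (?t \<odot> k) (sub_of C (app_dom S))" by simp
qed

lemma apl_els: "apl x ys = Some v \<Longrightarrow> x \<in> els T \<Longrightarrow> set ys \<subseteq> els T \<Longrightarrow> v \<in> els T"
 by (induction ys arbitrary: x) (auto split: option.splits dest: ap_els)

lemma apl_cmp:
 assumes "apl x ys = Some v" "x \<in> els T" "set ys \<subseteq> els T" "k \<in> arrs C" "tgt C k = T"
 shows "apl (x \<odot> k) (map (\<lambda>y. y \<odot> k) ys) = Some (v \<odot> k)"
 using assms
proof (induction ys arbitrary: x)
 case (Cons y ys)
 from Cons.prems(1) obtain w where w: "ap x y = Some w" "apl w ys = Some v"
  by (auto split: option.splits)
 then have "w \<in> els T" using ap_els Cons.prems by auto
 moreover have "ap (x \<odot> k) (y \<odot> k) = Some (w \<odot> k)"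
  by (rule ap_cmp[OF w(1)]) (use Cons.prems in \<open>auto simp: els_iff\<close>)
 ultimately show ?case
  using Cons.IH[OF w(2)] Cons.prems by simp
qed auto

text \<open>The first application is defined by locality; its value restricts to the values found on
  the cover, so the remaining applications can be treated in the same way.\<close>

lemma apl_local:
 assumes "x \<in> els T" "set ys \<subseteq> els T" "cvr C T P"
  and "\<And>k. k \<in> arrs C \<Longrightarrow> tgt C k = T \<Longrightarrow> P k \<Longrightarrow> apl (x \<odot> k) (map (\<lambda>y. y \<odot> k) ys) \<noteq> None"
 shows "apl x ys \<noteq> None"
 using assms
proof (induction ys arbitrary: x)
 case (Cons y ys)
 have "ap x y \<noteq> None"
 proof (rule ap_local[OF _ _ Cons.prems(3)])
  fix k assume k: "k \<in> arrs C" "tgt C k = T" "P k"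
  from Cons.prems(4)[OF k] show "ap (x \<odot> k) (y \<odot> k) \<noteq> None"
   by (auto split: option.splits)
 qed (use Cons.prems in auto)
 then obtain v where v: "ap x y = Some v" by blast
 then have vT: "v \<in> els T" using ap_els Cons.prems by auto
 have "apl v ys \<noteq> None"
 proof (rule Cons.IH[OF vT])
  fix k assume k: "k \<in> arrs C" "tgt C k = T" "P k"
  have "ap (x \<odot> k) (y \<odot> k) = Some (v \<odot> k)"
   by (rule ap_cmp[OF v]) (use k Cons.prems in \<open>auto simp: els_iff\<close>)
  with Cons.prems(4)[OF k] show "apl (v \<odot> k) (map (\<lambda>y. y \<odot> k) ys) \<noteq> None" by simp
 qed (use Cons.prems in auto)
 with v show ?case by simp
qed simp

lemma wf_dot:
 assumes "has_sort C \<Gamma> t A" "has_sort C \<Gamma> s A" "below n t" "below n s"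
  and "wf_fml C (\<Gamma>(Inl n \<mapsto> src C (app_dom S))) (K (TApp (app_map S) (rv n)))"
 shows "wf_fml C \<Gamma> (dot C S n t s K)"
proof -
 have a: "agree n (\<Gamma>(Inl n \<mapsto> src C (app_dom S))) \<Gamma>" by (simp add: agree_def)
 have "is_product C (pr1 C A A) (pr2 C A A)" by (rule prod_cone) auto
 with has_sort_agree[OF agree_upd_self assms(3)] has_sort_agree[OF agree_upd_self assms(4)] assms show ?thesis
  by (auto simp: dot_def pair_trm_def)
qed

text \<open>An existential quantifier is in general witnessed only on a cover. Here the witness is
  unique: local witnesses make the application defined at the stage itself, and they agree with the
  restrictions of the resulting \<open>d\<close>. Hence no cover remains.\<close>

lemma force_dot:
 assumes T: "T \<in> objs C" and e: "env_typed C T e"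
  and t: "has_sort C (env_sort C e) t A" and s: "has_sort C (env_sort C e) s A"
  and b: "below n t" "below n s"
  and wf: "wf_fml C ((env_sort C e)(Inl n \<mapsto> src C (app_dom S))) (K (TApp (app_map S) (rv n)))"
 shows "force C (dot C S n t s K) T e \<longleftrightarrow> (\<exists>d. app_rel (trm_val C T e t) (trm_val C T e s) d \<and>
  force C (K (TApp (app_map S) (rv n))) T (e(Inl n \<mapsto> d)))"
proof -
 note ok = env_ok_sort[OF e]
 note t' = trm_val_typed[OF t ok T] and s' = trm_val_typed[OF s ok T]
 let ?x = "trm_val C T e t" and ?y = "trm_val C T e s" and ?K = "K (TApp (app_map S) (rv n))"
 let ?D = "src C (app_dom S)"
 have D: "?D \<in> objs C" by simp
 have body: "(x \<in> arrs C \<and> src C x = src C k \<and> tgt C x = ?D \<and> force C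
   (FAnd (FEq (TApp (app_dom S) (rv n)) (pair_trm C A A t s)) ?K) (src C k) ((sb C k e)(Inl n \<mapsto> x))) \<longleftrightarrow>
   app_rel (?x \<odot> k) (?y \<odot> k) x \<and> force C ?K (src C k) ((sb C k e)(Inl n \<mapsto> x))"
  if k: "k \<in> arrs C" "tgt C k = T" for k x
  using trm_val_upd[OF b(1)] trm_val_upd[OF b(2)]
   trm_val_sb[OF t, of k e] trm_val_sb[OF s, of k e] k ok t' s'
  by (auto simp: pair_trm_def app_rel_def)
 have eq: "force C (dot C S n t s K) T e \<longleftrightarrow> cvr C T (\<lambda>k. \<exists>x. app_rel (?x \<odot> k) (?y \<odot> k) x \<and>
   force C ?K (src C k) ((sb C k e)(Inl n \<mapsto> x)))"
  unfolding dot_def force.simps(8)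
 proof (rule cvr_cong)
  fix k assume k: "k \<in> arrs C" "tgt C k = T"
  from body[OF k] show "(\<exists>x\<in>arrs C. src C x = src C k \<and> tgt C x = ?D \<and> force C
   (FAnd (FEq (TApp (app_dom S) (rv n)) (pair_trm C A A t s)) ?K) (src C k) ((sb C k e)(Inl n \<mapsto> x))) \<longleftrightarrow>
   (\<exists>x. app_rel (?x \<odot> k) (?y \<odot> k) x \<and> force C ?K (src C k) ((sb C k e)(Inl n \<mapsto> x)))"
   by blast
 qed
 have rel_cmp: "app_rel (?x \<odot> k) (?y \<odot> k) (d \<odot> k)"
  if k: "k \<in> arrs C" "tgt C k = T" and d: "app_rel ?x ?y d" for k d
 proof -
  have d': "d \<in> arrs C" "src C d = T" "tgt C d = ?D" "app_dom S \<odot> d = pair A A ?x ?y"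
   using d s' by (auto simp: app_rel_def)
  have "app_dom S \<odot> (d \<odot> k) = pair A A ?x ?y \<odot> k"
   by (rule cmp_reassoc[OF d'(4)]) (use d' k in simp_all)
  also have "\<dots> = pair A A (?x \<odot> k) (?y \<odot> k)"
   by (rule pair_cmp) (use t' s' k in simp_all)
  finally show ?thesis
   using d' k t' s' by (simp add: app_rel_def)
 qed
 have okd: "env_ok C ((env_sort C e)(Inl n \<mapsto> ?D)) T (e(Inl n \<mapsto> d))" if "app_rel ?x ?y d" for d
  using env_ok_upd[OF ok, of d ?D] that s' by (simp add: app_rel_def)
 show ?thesis
  unfolding eq
 proof
  assume c: "cvr C T (\<lambda>k. \<exists>x. app_rel (?x \<odot> k) (?y \<odot> k) x \<and> force C ?K (src C k) ((sb C k e)(Inl n \<mapsto> x)))"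
  have "ap ?x ?y \<noteq> None"
   by (rule ap_local[OF _ _ c]) (use t' s' in \<open>auto simp: els_iff ap_def\<close>)
  then obtain d where d: "app_rel ?x ?y d" by (auto simp: ap_Some)
  have "force C ?K T (e(Inl n \<mapsto> d))"
  proof (rule force_local[OF wf okd[OF d] T c])
   fix k assume k: "k \<in> arrs C" "tgt C k = T"
    and "\<exists>x. app_rel (?x \<odot> k) (?y \<odot> k) x \<and> force C ?K (src C k) ((sb C k e)(Inl n \<mapsto> x))"
   then show "force C ?K (src C k) (sb C k (e(Inl n \<mapsto> d)))"
    using app_rel_unique rel_cmp[OF k d] by auto
  qed
  with d show "\<exists>d. app_rel ?x ?y d \<and> force C ?K T (e(Inl n \<mapsto> d))" by blast
 next
  assume "\<exists>d. app_rel ?x ?y d \<and> force C ?K T (e(Inl n \<mapsto> d))"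
  then obtain d where d: "app_rel ?x ?y d" "force C ?K T (e(Inl n \<mapsto> d))" by blast
  show "cvr C T (\<lambda>k. \<exists>x. app_rel (?x \<odot> k) (?y \<odot> k) x \<and> force C ?K (src C k) ((sb C k e)(Inl n \<mapsto> x)))"
  proof (rule cvr_now)
   fix k assume k: "k \<in> arrs C" "tgt C k = T"
   then have "force C ?K (src C k) (sb C k (e(Inl n \<mapsto> d)))"
    using force_sb[OF wf, of k "e(Inl n \<mapsto> d)"] okd[OF d(1)] d(2) by simp
   with rel_cmp[OF k d(1)] show "\<exists>x. app_rel (?x \<odot> k) (?y \<odot> k) x \<and> force C ?K (src C k) ((sb C k e)(Inl n \<mapsto> x))"
    by auto
  qed
 qed
qed

lemma wf_apps:
 assumes "has_sort C \<Gamma> t A" "\<forall>s \<in> set ss. has_sort C \<Gamma> s A \<and> below n s" "below n t"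
  and "\<And>u \<Gamma>'. agree n \<Gamma>' \<Gamma> \<Longrightarrow> has_sort C \<Gamma>' u A \<Longrightarrow> below (n + length ss) u \<Longrightarrow> wf_fml C \<Gamma>' (K u)"
 shows "wf_fml C \<Gamma> (apps C S n t ss K)"
 using assms
proof (induction ss arbitrary: n t \<Gamma>)
 case Nil
 then show ?case by simp
next
 case (Cons s ss)
 let ?G = "\<Gamma>(Inl n \<mapsto> src C (app_dom S))"
 show ?case
  unfolding apps.simps
 proof (rule wf_dot)
  show "wf_fml C ?G (apps C S (Suc n) (TApp (app_map S) (rv n)) ss K)"
  proof (rule Cons.IH)
   show "\<forall>s\<in>set ss. has_sort C ?G s A \<and> below (Suc n) s"
    using Cons.prems(2) by (intro below_args_upd) simp
   fix u \<Gamma>' assume "agree (Suc n) \<Gamma>' ?G" "has_sort C \<Gamma>' u A" "below (Suc n + length ss) u"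
   then show "wf_fml C \<Gamma>' (K u)"
    using Cons.prems(4)[of \<Gamma>' u] agree_upd by fastforce
  qed auto
 qed (use Cons.prems in auto)
qed

text \<open>The continuation \<open>K\<close> is a function on terms, not a formula with a hole. Its
  meaning \<open>K'\<close> is therefore required for every term and environment that the recursion
  may reach, namely those extending \<open>e\<close> by auxiliary variables from \<open>n\<close>
  on.\<close>

lemma force_apps:
 assumes "T \<in> objs C" "env_typed C T e" "has_sort C (env_sort C e) t A"
  "\<forall>s \<in> set ss. has_sort C (env_sort C e) s A \<and> below n s" "below n t"
  and "\<And>u \<Gamma>'. agree n \<Gamma>' (env_sort C e) \<Longrightarrow> has_sort C \<Gamma>' u A \<Longrightarrow> below (n + length ss) u \<Longrightarrow> wf_fml C \<Gamma>' (K u)"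
  and "\<And>u e'. env_typed C T e' \<Longrightarrow> agree n e' e \<Longrightarrow> has_sort C (env_sort C e') u A \<Longrightarrow>
   below (n + length ss) u \<Longrightarrow> force C (K u) T e' \<longleftrightarrow> K' (trm_val C T e' u)"
 shows "force C (apps C S n t ss K) T e \<longleftrightarrow>
  (\<exists>v. apl (trm_val C T e t) (map (trm_val C T e) ss) = Some v \<and> K' v)"
 using assms
proof (induction ss arbitrary: n t e)
 case Nil
 then show ?case by simp
next
 case (Cons s ss)
 let ?D = "src C (app_dom S)" and ?u = "TApp (app_map S) (rv n)"
 have wf: "wf_fml C ((env_sort C e)(Inl n \<mapsto> ?D)) (apps C S (Suc n) ?u ss K)"
 proof (rule wf_apps)
  show "\<forall>s\<in>set ss. has_sort C ((env_sort C e)(Inl n \<mapsto> ?D)) s A \<and> below (Suc n) s"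
   using Cons.prems(4) unfolding env_sort_upd by (intro below_args_upd) simp
  fix u \<Gamma>' assume "agree (Suc n) \<Gamma>' ((env_sort C e)(Inl n \<mapsto> ?D))" "has_sort C \<Gamma>' u A" "below (Suc n + length ss) u"
  then show "wf_fml C \<Gamma>' (K u)"
   using Cons.prems(6)[of \<Gamma>' u] agree_upd by fastforce
 qed auto
 have IH: "force C (apps C S (Suc n) ?u ss K) T (e(Inl n \<mapsto> d)) \<longleftrightarrow>
   (\<exists>v. apl (app_map S \<odot> d) (map (trm_val C T e) ss) = Some v \<and> K' v)"
  if d: "app_rel (trm_val C T e t) (trm_val C T e s) d" for d
 proof -
  have sT: "src C (trm_val C T e s) = T"
   using trm_val_typed[of "env_sort C e" s A T e] Cons.prems env_ok_sort[of C T e] by simp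
  have d': "d \<in> arrs C" "src C d = T" "tgt C d = ?D"
   using d sT by (auto simp: app_rel_def)
  have "force C (apps C S (Suc n) ?u ss K) T (e(Inl n \<mapsto> d)) \<longleftrightarrow>
   (\<exists>v. apl (trm_val C T (e(Inl n \<mapsto> d)) ?u) (map (trm_val C T (e(Inl n \<mapsto> d))) ss) = Some v \<and> K' v)"
  proof (rule Cons.IH)
   show "env_typed C T (e(Inl n \<mapsto> d))" using Cons.prems d' by simp
   show "has_sort C (env_sort C (e(Inl n \<mapsto> d))) ?u A" using d' by simp
   show "\<forall>s\<in>set ss. has_sort C (env_sort C (e(Inl n \<mapsto> d))) s A \<and> below (Suc n) s"
    using Cons.prems(4) unfolding env_sort_upd by (intro below_args_upd) simp
   show "wf_fml C \<Gamma>' (K u)" if "agree (Suc n) \<Gamma>' (env_sort C (e(Inl n \<mapsto> d)))" "has_sort C \<Gamma>' u A" "below (Suc n + length ss) u" for \<Gamma>' u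
    using Cons.prems(6)[of \<Gamma>' u] agree_upd[of n \<Gamma>' "env_sort C e"] that by simp
   show "force C (K u) T e' \<longleftrightarrow> K' (trm_val C T e' u)"
    if "env_typed C T e'" "agree (Suc n) e' (e(Inl n \<mapsto> d))" "has_sort C (env_sort C e') u A" "below (Suc n + length ss) u" for e' u
    using Cons.prems(7)[of e' u] agree_upd[of n e' e] that by simp
  qed (use Cons.prems in auto)
  moreover have "map (trm_val C T (e(Inl n \<mapsto> d))) ss = map (trm_val C T e) ss"
   using Cons.prems(4) by (intro map_cong) (auto simp: trm_val_upd)
  ultimately show ?thesis by simp
 qed
 have "force C (apps C S n t (s # ss) K) T e \<longleftrightarrow> (\<exists>d. app_rel (trm_val C T e t) (trm_val C T e s) d \<and>
   force C (apps C S (Suc n) ?u ss K) T (e(Inl n \<mapsto> d)))"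
  unfolding apps.simps by (rule force_dot) (use Cons.prems wf in auto)
 also have "\<dots> \<longleftrightarrow> (\<exists>d. app_rel (trm_val C T e t) (trm_val C T e s) d \<and>
   (\<exists>v. apl (app_map S \<odot> d) (map (trm_val C T e) ss) = Some v \<and> K' v))"
  using IH by blast
 also have "\<dots> \<longleftrightarrow> (\<exists>v. apl (trm_val C T e t) (map (trm_val C T e) (s # ss)) = Some v \<and> K' v)"
  by (auto simp: ap_Some split: option.splits) (metis ap_Some option.distinct(1) option.sel)+
 finally show ?case .
qed

lemma wf_dot_body:
 assumes "has_sort C \<Gamma> t A" "has_sort C \<Gamma> s A" "below n t" "below n s"
  and "\<And>u \<Gamma>'. agree n \<Gamma>' \<Gamma> \<Longrightarrow> has_sort C \<Gamma>' u A \<Longrightarrow> below (Suc n) u \<Longrightarrow> wf_fml C \<Gamma>' (K u)"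
 shows "wf_fml C \<Gamma> (dot C S n t s K)"
 using wf_apps[of \<Gamma> t "[s]" n K] assms by simp

lemma force_dot_body:
 assumes "T \<in> objs C" "env_typed C T e" "has_sort C (env_sort C e) t A" "has_sort C (env_sort C e) s A"
  "below n t" "below n s"
  and "\<And>u \<Gamma>'. agree n \<Gamma>' (env_sort C e) \<Longrightarrow> has_sort C \<Gamma>' u A \<Longrightarrow> below (Suc n) u \<Longrightarrow> wf_fml C \<Gamma>' (K u)"
  and "\<And>u e'. env_typed C T e' \<Longrightarrow> agree n e' e \<Longrightarrow> has_sort C (env_sort C e') u A \<Longrightarrow>
   below (Suc n) u \<Longrightarrow> force C (K u) T e' \<longleftrightarrow> K' (trm_val C T e' u)"
 shows "force C (dot C S n t s K) T e \<longleftrightarrow>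
  (\<exists>c. ap (trm_val C T e t) (trm_val C T e s) = Some c \<and> K' c)"
proof -
 have "force C (apps C S n t [s] K) T e \<longleftrightarrow>
   (\<exists>c. apl (trm_val C T e t) (map (trm_val C T e) [s]) = Some c \<and> K' c)"
  by (rule force_apps[OF assms(1-3)]) (use assms(4-8) in simp_all)
 then show ?thesis by (auto split: option.splits)
qed

lemma wf_FBall_dot:
 assumes "has_sort C \<Gamma> t A" "below n t" "Z \<in> subs C A"
  and "\<And>u \<Gamma>'. agree n \<Gamma>' \<Gamma> \<Longrightarrow> has_sort C \<Gamma>' u A \<Longrightarrow> below (Suc (Suc n)) u \<Longrightarrow>
   wf_fml C \<Gamma>' (K u)"
 shows "wf_fml C \<Gamma> (FBall (Inl n) A Z (dot C S (Suc n) t (rv n) K))"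
proof -
 have "wf_fml C (\<Gamma>(Inl n \<mapsto> A)) (dot C S (Suc n) t (rv n) K)"
  by (rule wf_dot_body)
   (use assms(1-3) assms(4)[OF agree_upd] has_sort_agree[OF agree_upd_self assms(2)] below_mono[OF assms(2), of "Suc n"] in auto)
 with assms(3) show ?thesis by (simp add: FBall_def)
qed

end

section \<open>Filters and functional completeness\<close>

lemma upds_index:
 "length xs = n - a \<Longrightarrow> upds e (map (\<lambda>i. (Inl i, X)) [a..<n]) xs (Inl i) =
  (if a \<le> i \<and> i < n then Some (xs ! (i - a)) else e (Inl i))"
proof (induction xs arbitrary: a e)
 case Nil
 then show ?case by auto
next
 case (Cons x xs)
 then have "[a..<n] = a # [Suc a..<n]" "length xs = n - Suc a"
  by (auto simp: upt_conv_Cons)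
 with Cons.IH[of "Suc a" "e(Inl a \<mapsto> x)"] show ?case
  by (auto simp: nth_Cons' not_less_eq_eq simp del: fun_upd_apply) (auto simp: less_Suc_eq_le)
qed

lemma wf_FAlls:
 "wf_fml C \<Gamma> (FAlls vs p) \<longleftrightarrow> list_all (\<lambda>vX. snd vX \<in> objs C) vs \<and> wf_fml C (upds \<Gamma> vs (map snd vs)) p"
 by (induction vs arbitrary: \<Gamma>) auto

definition ins :: "('o, 'm) cat \<Rightarrow> 'o \<Rightarrow> 'm list \<Rightarrow> 'm set list \<Rightarrow> bool" where
 "ins C T cs Fs \<longleftrightarrow> list_all2 (\<lambda>c F. mem C c F \<and> src C c = T) cs Fs"

lemma ins_simps [simp]:
 "ins C T cs [] \<longleftrightarrow> cs = []"
 "ins C T cs (F # Fs) \<longleftrightarrow> (\<exists>d ds. cs = d # ds \<and> mem C d F \<and> src C d = T \<and> ins C T ds Fs)"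
 by (auto simp: ins_def list_all2_Cons2)

lemma ins_length: "ins C T cs Fs \<Longrightarrow> length cs = length Fs"
 by (auto simp: ins_def list_all2_lengthD)

text \<open>Applicative polynomials. \<open>PV i\<close> is an entry of one argument list, in which
  parameters from members of \<open>\<phi>\<close> precede the proper arguments.\<close>

datatype pterm = PV nat | PA pterm pterm

primrec pvars_below :: "nat \<Rightarrow> pterm \<Rightarrow> bool" where
 "pvars_below n (PV i) \<longleftrightarrow> i < n"
| "pvars_below n (PA s t) \<longleftrightarrow> pvars_below n s \<and> pvars_below n t"

context pas_category
begin

primrec peval :: "'m list \<Rightarrow> pterm \<Rightarrow> 'm option" where
 "peval xs (PV i) = Some (xs ! i)"
| "peval xs (PA s t) = (case peval xs s of None \<Rightarrow> None | Some u \<Rightarrow>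
  (case peval xs t of None \<Rightarrow> None | Some v \<Rightarrow> ap u v))"

text \<open>The typing conditions belong to the relation, so that a single fact
  \<open>rel G V a g\<close> fixes all sources and targets.\<close>

definition rel :: "'o \<Rightarrow> 'm set \<Rightarrow> 'm \<Rightarrow> 'm \<Rightarrow> bool" where
 "rel G V a g \<longleftrightarrow> a \<in> arrs C \<and> g \<in> arrs C \<and> src C a = src C g \<and> tgt C a = A \<and> tgt C g = G \<and>
  mem C (pair (A) G a g) V"

end

locale pca_filter = pas_category C S for C :: "('o, 'm) cat" (structure) and S +
 fixes \<phi> :: "'m set set"
 assumes filter: "is_pas_filter C S \<phi>"
  and complete: "combinatory_complete C S \<phi>"
begin

lemma filter_carrier: "R \<in> \<phi> \<Longrightarrow> R \<in> subs C A"
 using filter by (auto simp: is_pas_filter_def)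

lemma filter_up: "R \<in> \<phi> \<Longrightarrow> V \<in> subs C A \<Longrightarrow> (\<And>r. mem C r R \<Longrightarrow> mem C r V) \<Longrightarrow> V \<in> \<phi>"
 using filter filter_carrier[of R] Sub_le_iff[of R A V] unfolding is_pas_filter_def by blast

lemma filter_els: "mem C r R \<Longrightarrow> R \<in> \<phi> \<Longrightarrow> r \<in> els (src C r)"
 using mem_tgt filter_carrier mem_arr by (auto simp: els_iff)

text \<open>A regular epimorphism is not contained in a proper subobject of its codomain, so the
 image of an inhabited object in \<open>1\<close> is everything.\<close>

lemma filter_inhabited:
 assumes "R \<in> \<phi>" "T \<in> objs C"
 shows "cvr C T (\<lambda>k. \<exists>r. mem C r R \<and> src C r = src C k)"
proof -
 have "inhabited_sub C R"
  using assms filter by (auto simp: is_pas_filter_def)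
 then obtain m where m: "m \<in> R" "regular_epi C (bang C (src C m) (one C))"
  by (auto simp: inhabited_sub_def inhabited_def)
 note R = in_carrierD[OF filter_carrier[OF assms(1)] m(1)]
 let ?e = "bang C (src C m) (one C)"
 have D: "src C m \<in> objs C" using R by simp
 note e = terminal_arr[OF one_terminal D]
 let ?I = "ex_im C ?e (\<top>\<^bsub>Sub C (src C m)\<^esub>)"
 have tc: "\<top>\<^bsub>Sub C (src C m)\<^esub> \<in> subs C (src C ?e)"
  using top_carrier[OF D] e by simp
 have I: "?I \<in> subs C (one C)"
  using ex_im_closed[OF e(1) tc] e by simp
 obtain n where n: "monic C n" "tgt C n = one C" "?I = sub_of C n"
  using I by (rule carrier_SubE)
 have "mem C (idn C (src C m)) (\<top>\<^bsub>Sub C (src C m)\<^esub>)"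
  using D by (simp add: mem_top)
 then have "mem C ?e ?I"
  using mem_ex_imI[OF e(1) tc] e by fastforce
 then obtain h where h: "h \<in> arrs C" "src C h = src C m" "tgt C h = src C n" "n \<odot> h = ?e"
  using e unfolding n(3) mem_sub_of[OF n(1)] by auto
 obtain W f g where fg: "f \<in> Hom C W (src C m)" "g \<in> Hom C W (src C m)" "?e \<odot> f = ?e \<odot> g"
  and univ: "\<And>Z k. k \<in> Hom C (src C m) Z \<Longrightarrow> k \<odot> f = k \<odot> g \<Longrightarrow>
   \<exists>!l. l \<in> Hom C (tgt C ?e) Z \<and> l \<odot> ?e = k"
  using m(2) unfolding regular_epi_def e(2) by blast
 \<comment> \<open>Since \<open>n\<close> is monic, \<open>h\<close> identifies the two arrows
   coequalized by \<open>?e\<close>. It thus factors through the codomain \<open>1\<close>, which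
   gives a section \<open>l\<close> of \<open>n\<close>, and the image \<open>?I\<close> is
   everything.\<close>
 have "n \<odot> (h \<odot> f) = n \<odot> (h \<odot> g)"
  using fg cmp_reassoc[OF h(4), of f] cmp_reassoc[OF h(4), of g] h n(1) monic_arr by simp
 then have "h \<odot> f = h \<odot> g"
  by (rule monicD[OF n(1)]) (use fg h in simp_all)
 then have "\<exists>!l. l \<in> Hom C (tgt C ?e) (src C n) \<and> l \<odot> ?e = h"
  using univ[of h "src C n"] h by simp
 then obtain l where "l \<in> Hom C (one C) (src C n)" "l \<odot> ?e = h"
  unfolding e(3) by blast
 then have l: "l \<in> arrs C" "src C l = one C" "tgt C l = src C n"
  by auto
 have "n \<odot> l = idn C (one C)"
  by (rule terminal_eq[OF one_terminal]) (use l n in simp_all)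
 then have "mem C (idn C (one C)) ?I"
  unfolding n(3) mem_sub_of[OF n(1)] using l by (intro conjI bexI[of _ l]) auto
 then have "mem C (idn C (one C) \<odot> bang C T (one C)) ?I"
  using terminal_arr[OF one_terminal assms(2)] by (intro mem_cmp[OF _ I]) auto
 then have "mem C (bang C T (one C)) ?I"
  using terminal_arr[OF one_terminal assms(2)] by simp
 then have "cvr C T (\<lambda>k. \<exists>y. ?e \<odot> y = bang C T (one C) \<odot> k \<and> mem C y (\<top>\<^bsub>Sub C (src C m)\<^esub>))"
  using mem_ex_im[of "bang C T (one C)" ?e] terminal_arr[OF one_terminal assms(2)] e tc by simp
 then show ?thesis
 proof (rule cvr_mono)
  fix k assume k: "k \<in> arrs C" "tgt C k = T"
   "\<exists>y. ?e \<odot> y = bang C T (one C) \<odot> k \<and> mem C y (\<top>\<^bsub>Sub C (src C m)\<^esub>)"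
  then obtain y where y: "?e \<odot> y = bang C T (one C) \<odot> k" "y \<in> arrs C" "tgt C y = src C m"
   using D by (auto simp: mem_top)
  have "src C (?e \<odot> y) = src C k"
   unfolding y(1) using k terminal_arr[OF one_terminal assms(2)] by simp
  then have "src C y = src C k" using y(2,3) e by simp
  moreover have "mem C m R"
   unfolding R(3) by (rule mem_self[OF R(1)])
  then have "mem C (m \<odot> y) R"
   by (rule mem_cmp[OF _ filter_carrier[OF assms(1)]]) (use y in simp_all)
  ultimately show "\<exists>r. mem C r R \<and> src C r = src C k"
   using y R by (intro exI[of _ "m \<odot> y"]) simp
 qed
qed

text \<open>Definedness for all pairs of elements is the inclusion of \<open>E \<times> F\<close> in
  the domain, tested on its generic element. Being an image, the result consists of elements that
  are applications on a cover only.\<close>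

lemma filter_app:
 assumes E: "E \<in> \<phi>" and F: "F \<in> \<phi>"
  and *: "\<And>e f. mem C e E \<Longrightarrow> mem C f F \<Longrightarrow> src C e = src C f \<Longrightarrow> ap e f \<noteq> None"
 shows "app_image C S E F \<in> \<phi>"
  and "mem C y (app_image C S E F) \<Longrightarrow>
   cvr C (src C y) (\<lambda>k. \<exists>e f. mem C e E \<and> mem C f F \<and> ap e f = Some (y \<odot> k))"
proof -
 let ?P = "sub_prod C A A E F"
 note c = filter_carrier[OF E] filter_carrier[OF F]
 have i: "inv_im C (pr1 C A A) E \<in> subs C (prd C A A)" "inv_im C (pr2 C A A) F \<in> subs C (prd C A A)"
  using inv_im_closed[of "pr1 C A A" E] inv_im_closed[of "pr2 C A A" F] c by simp_all
 have P: "?P \<in> subs C (prd C A A)"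
  unfolding sub_prod_def using ops_closed(1)[OF _ i] by simp
 have memP: "mem C z ?P \<longleftrightarrow> z \<in> arrs C \<and> tgt C z = prd C A A \<and> mem C (pr1 C A A \<odot> z) E \<and> mem C (pr2 C A A \<odot> z) F" for z
 proof (cases "z \<in> arrs C \<and> tgt C z = prd C A A")
  case True
  then show ?thesis
   using mem_meet[of z "inv_im C (pr1 C A A) E" "inv_im C (pr2 C A A) F"] i c
    mem_inv[of "pr1 C A A" E z] mem_inv[of "pr2 C A A" F z]
   by (simp add: sub_prod_def)
 next
  case False
  then show ?thesis using mem_tgt[OF _ P] mem_arr by blast
 qed
 have eta: "pair A A (pr1 C A A \<odot> z) (pr2 C A A \<odot> z) = z"
  if "z \<in> arrs C" "tgt C z = prd C A A" for z
  using pair_eta[of A A z] that by simp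
 have "?P \<sqsubseteq>\<^bsub>Sub C (prd C A A)\<^esub> sub_of C (app_dom S)"
  unfolding Sub_le_iff[OF P app_dom_sub]
 proof (intro allI impI)
  fix z assume z: "mem C z ?P"
  then have "ap (pr1 C A A \<odot> z) (pr2 C A A \<odot> z) \<noteq> None"
   using * by (auto simp: memP)
  then show "mem C z (sub_of C (app_dom S))"
   using ap_defined_iff[of "pr1 C A A \<odot> z" "src C z" "pr2 C A A \<odot> z"] eta z
   by (simp add: memP els_iff)
 qed
 then show "app_image C S E F \<in> \<phi>"
  using filter E F unfolding is_pas_filter_def by blast
 have W: "inv_im C (app_dom S) ?P \<in> subs C (src C (app_map S))"
  using inv_im_closed[of "app_dom S" ?P] P by simp
 assume y: "mem C y (app_image C S E F)"
 have "tgt C y = A"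
  using mem_tgt[OF y] ex_im_closed[OF _ W] by (simp add: app_image_def)
 with y have "cvr C (src C y) (\<lambda>k. \<exists>d. app_map S \<odot> d = y \<odot> k \<and> mem C d (inv_im C (app_dom S) ?P))"
  using mem_ex_im[of y "app_map S", OF _ _ _ W] by (auto simp: app_image_def)
 then show "cvr C (src C y) (\<lambda>k. \<exists>e f. mem C e E \<and> mem C f F \<and> ap e f = Some (y \<odot> k))"
 proof (rule cvr_mono)
  fix k assume "\<exists>d. app_map S \<odot> d = y \<odot> k \<and> mem C d (inv_im C (app_dom S) ?P)"
  then obtain d where d: "app_map S \<odot> d = y \<odot> k" "d \<in> arrs C" "tgt C d = src C (app_dom S)"
   "mem C (app_dom S \<odot> d) ?P"
   using mem_inv[of "app_dom S" ?P] P by auto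
  have "app_rel (pr1 C A A \<odot> app_dom S \<odot> d) (pr2 C A A \<odot> app_dom S \<odot> d) d"
   using d eta[of "app_dom S \<odot> d"] by (simp add: app_rel_def)
  with d show "\<exists>e f. mem C e E \<and> mem C f F \<and> ap e f = Some (y \<odot> k)"
   unfolding memP ap_Some by metis
 qed
qed

text \<open>Turns the two internal sentences of computability into facts about generalized elements.
  The total part of the definition concerns one argument less than the arity, hence
  \<open>length ps - 1\<close>.\<close>

lemma computableD:
 assumes comp: "computable C S \<phi> ps m f" and ps: "set ps \<subseteq> Hom C P A" "ps \<noteq> []"
  and mf: "m \<in> arrs C" "tgt C m = P" "f \<in> arrs C" "src C f = src C m" "tgt C f = A"
 obtains R where "R \<in> \<phi>"
  "\<And>r xs. mem C r R \<Longrightarrow> set xs \<subseteq> els (src C r) \<Longrightarrow> length xs = length ps - 1 \<Longrightarrow> apl r xs \<noteq> None"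
  "\<And>r d. mem C r R \<Longrightarrow> d \<in> arrs C \<Longrightarrow> src C d = src C r \<Longrightarrow> tgt C d = src C m \<Longrightarrow>
   apl r (map (\<lambda>p. p \<odot> m \<odot> d) ps) = Some (f \<odot> d)"
proof -
 let ?n = "length ps"
 let ?vs = "map (\<lambda>i. (Inl i :: nat + nat, A)) [1..<?n]"
 let ?q1 = "apps C S ?n (rv 0) (map rv [1..<?n]) (\<lambda>u. FTop)"
 let ?q2 = "apps C S 2 (rv 0) (map (\<lambda>p. TApp p (TApp m (rv 1))) ps) (\<lambda>u. FEq u (TApp f (rv 1)))"
 let ?w = "[(Inl 1 :: nat + nat, src C m)]"
 have n: "0 < ?n" using ps by simp
 have f1: "FBall (Inl 0) A R (foldr (\<lambda>i. FAll (Inl i) A) [1..<?n] q) =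
   FAlls [(Inl 0, A)] (FImp (FMem A R (rv 0)) (FAlls ?vs q))" for R and q :: "('o, 'm) bfml"
  by (simp add: FBall_def foldr_map comp_def)
 have f2: "FBall (Inl 0) A R (FAll (Inl 1) (src C m) q) =
   FAlls [(Inl 0, A)] (FImp (FMem A R (rv 0)) (FAlls ?w q))" for R and q :: "('o, 'm) bfml"
  by (simp add: FBall_def)
 from comp obtain R where R: "R \<in> \<phi>"
  and h1: "holds C (FAlls [(Inl 0, A)] (FImp (FMem A R (rv 0)) (FAlls ?vs ?q1)))"
  and h2: "holds C (FAlls [(Inl 0, A)] (FImp (FMem A R (rv 0)) (FAlls ?w ?q2)))"
  unfolding computable_def Let_def f1 f2 by blast
 note Rc = filter_carrier[OF R]
 let ?\<Gamma> = "[Inl 0 \<mapsto> A] :: nat + nat \<rightharpoonup> 'o"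
 let ?\<Gamma>1 = "upds ?\<Gamma> ?vs (map snd ?vs)"
 have msnd: "map snd ?vs = replicate (?n - 1) A"
  by (intro nth_equalityI) auto
 have \<Gamma>1: "?\<Gamma>1 (Inl i) = (if i < ?n then Some A else None)" for i
  unfolding msnd using upds_index[of "replicate (?n - 1) A" ?n 1 ?\<Gamma> A i] n by auto
 have wfq1: "wf_fml C ?\<Gamma>1 ?q1"
  by (rule wf_apps) (use n \<Gamma>1 in auto)
 have wf1: "wf_fml C ?\<Gamma> (FAlls ?vs ?q1)"
  unfolding wf_FAlls using wfq1 by (simp add: list_all_iff)
 have wfq2: "wf_fml C (upds ?\<Gamma> ?w (map snd ?w)) ?q2"
 proof (rule wf_apps)
  fix u :: "('o, 'm) btrm" and \<Gamma>' :: "nat + nat \<rightharpoonup> 'o"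
  assume a: "agree 2 \<Gamma>' (upds ?\<Gamma> ?w (map snd ?w))" and u: "has_sort C \<Gamma>' u A"
  have "has_sort C \<Gamma>' (TApp f (rv 1)) A"
   using a mf by (simp add: agree_def)
  with u show "wf_fml C \<Gamma>' (FEq u (TApp f (rv 1)))" by auto
 qed (use ps mf in auto)
 have wf2: "wf_fml C ?\<Gamma> (FAlls ?w ?q2)"
  unfolding wf_FAlls using wfq2 mf by simp
 \<comment> \<open>Both sentences start by quantifying over \<open>R\<close>. They hold over
   \<open>1\<close>; pulling them back along the arrow from \<open>src C r\<close> to
   \<open>1\<close> allows the instance \<open>r\<close>.\<close>
 have outer: "force C q (src C r) [Inl 0 \<mapsto> r]"
  if h: "holds C (FAlls [(Inl 0, A)] (FImp (FMem A R (rv 0)) q))" and wf: "wf_fml C ?\<Gamma> q" and r: "mem C r R" for q r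
 proof -
  have r': "r \<in> arrs C" "tgt C r = A" using filter_els[OF r R] by (auto simp: els_iff)
  have b: "bang C (src C r) (one C) \<in> arrs C" "src C (bang C (src C r) (one C)) = src C r"
   "tgt C (bang C (src C r) (one C)) = one C"
   using terminal_arr[OF one_terminal] r' by auto
  have wfi: "wf_fml C (upds (env_sort C Map.empty) [(Inl 0, A)] (map snd [(Inl 0 :: nat + nat, A)])) (FImp (FMem A R (rv 0)) q)"
   using wf Rc by simp
  have "force C (FAlls [(Inl 0, A)] (FImp (FMem A R (rv 0)) q)) (one C) Map.empty"
   using h holds_iff[of "FAlls [(Inl 0, A)] (FImp (FMem A R (rv 0)) q)"] wf Rc by simp
  from this[unfolded force_FAlls_FImp[OF one_obj env_typed_empty wfi], rule_format,
    of "bang C (src C r) (one C)" "[r]"]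
  show ?thesis
   using b r r' by simp
 qed
 show ?thesis
 proof (rule that[OF R])
  fix r xs assume r: "mem C r R" and xs: "set xs \<subseteq> els (src C r)" "length xs = ?n - 1"
  have r': "r \<in> arrs C" "tgt C r = A" using filter_els[OF r R] by (auto simp: els_iff)
  let ?e = "[Inl 0 \<mapsto> r] :: nat + nat \<rightharpoonup> 'm"
  let ?E = "upds ?e ?vs xs"
  have ok: "ok_args C (src C r) ?vs xs"
   unfolding ok_args_def list_all2_conv_all_nth
  proof (intro conjI allI impI)
   fix i assume i: "i < length ?vs"
   then have "xs ! i \<in> els (src C r)"
    using xs nth_mem[of i xs] by auto
   with i show "(case ?vs ! i of (v, X) \<Rightarrow> \<lambda>x. x \<in> arrs C \<and> src C x = src C r \<and> tgt C x = X) (xs ! i)"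
    by (simp add: els_iff)
  qed (use xs in simp)
  have sid: "sb C (idn C (src C r)) ?e = ?e" using r' by simp
  have "force C ?q1 (src C r) ?E"
  proof -
   have et: "src C r \<in> objs C" "env_typed C (src C r) ?e" using r' by auto
   have "wf_fml C (upds (env_sort C ?e) ?vs (map snd ?vs)) ?q1"
    using wfq1 r' by simp
   from force_FAlls[OF et this] outer[OF h1 wf1 r]
   have "\<forall>k\<in>arrs C. tgt C k = src C r \<longrightarrow> (\<forall>xs. ok_args C (src C k) ?vs xs \<longrightarrow>
    force C ?q1 (src C k) (upds (sb C k ?e) ?vs xs))" by blast
   from this[rule_format, of "idn C (src C r)" xs] show ?thesis
    using et ok sid by simp
  qed
  moreover have E: "?E (Inl i) = (if i < ?n then Some ((r # xs) ! i) else None)" for i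
   using upds_index[of xs ?n 1 ?e A i] n xs by (auto simp: nth_Cons')
  have es: "env_sort C ?E = ?\<Gamma>1"
   using env_sort_upds[OF ok, of ?e] r' by simp
  have "force C ?q1 (src C r) ?E \<longleftrightarrow> (\<exists>v. apl (trm_val C (src C r) ?E (rv 0))
   (map (trm_val C (src C r) ?E) (map rv [1..<?n])) = Some v \<and> True)"
   by (rule force_apps) (use r' \<Gamma>1 n es env_typed_upds[OF _ ok, of ?e] in auto)
  moreover have "map (trm_val C (src C r) ?E) (map rv [1..<?n]) = xs"
   using xs n by (intro nth_equalityI) (auto simp: E simp del: One_nat_def)
  ultimately show "apl r xs \<noteq> None"
   using E[of 0] n by simp
 next
  fix r d assume r: "mem C r R" and d: "d \<in> arrs C" "src C d = src C r" "tgt C d = src C m"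
  have r': "r \<in> arrs C" "tgt C r = A" using filter_els[OF r R] by (auto simp: els_iff)
  let ?e = "[Inl 0 \<mapsto> r] :: nat + nat \<rightharpoonup> 'm"
  let ?E = "[Inl 0 \<mapsto> r, Inl 1 \<mapsto> d] :: nat + nat \<rightharpoonup> 'm"
  have sid: "sb C (idn C (src C r)) ?e = ?e" using r' by simp
  have "force C ?q2 (src C r) ?E"
  proof -
   have et: "src C r \<in> objs C" "env_typed C (src C r) ?e" using r' by auto
   have "wf_fml C (upds (env_sort C ?e) ?w (map snd ?w)) ?q2"
    using wfq2 r' by simp
   from force_FAlls[OF et this] outer[OF h2 wf2 r]
   have "\<forall>k\<in>arrs C. tgt C k = src C r \<longrightarrow> (\<forall>xs. ok_args C (src C k) ?w xs \<longrightarrow>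
    force C ?q2 (src C k) (upds (sb C k ?e) ?w xs))" by blast
   from this[rule_format, of "idn C (src C r)" "[d]"] show ?thesis
    using et d sid by simp
  qed
  moreover have "force C ?q2 (src C r) ?E \<longleftrightarrow> (\<exists>v. apl (trm_val C (src C r) ?E (rv 0))
   (map (trm_val C (src C r) ?E) (map (\<lambda>p. TApp p (TApp m (rv 1))) ps)) = Some v \<and> v = f \<odot> d)"
  proof (rule force_apps)
   fix u :: "('o, 'm) btrm" and \<Gamma>' :: "nat + nat \<rightharpoonup> 'o"
   assume a: "agree 2 \<Gamma>' (env_sort C ?E)" and u: "has_sort C \<Gamma>' u A"
   have "has_sort C \<Gamma>' (TApp f (rv 1)) A"
    using a mf d by (simp add: agree_def)
   with u show "wf_fml C \<Gamma>' (FEq u (TApp f (rv 1)))" by auto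
  next
   fix u :: "('o, 'm) btrm" and e' :: "nat + nat \<rightharpoonup> 'm"
   assume "agree 2 e' ?E"
   then show "force C (FEq u (TApp f (rv 1))) (src C r) e' \<longleftrightarrow> trm_val C (src C r) e' u = f \<odot> d"
    by (simp add: agree_def)
  qed (use ps mf d r' in auto)
  ultimately show "apl r (map (\<lambda>p. p \<odot> m \<odot> d) ps) = Some (f \<odot> d)"
   by (simp add: comp_def)
 qed
qed

text \<open>Built as \<open>A \<times> P\<close> from a smaller power \<open>P\<close>. The base
  case is \<open>A\<close> with its identity and not the empty power, since combinatory completeness
  speaks of arities at least one.\<close>

lemma power_exists: "\<exists>P ps. is_power C A P ps \<and> length ps = Suc n"
proof (induction n)
 case 0
 have "is_power C A A [idn C A]"
  unfolding is_power_def
 proof (intro conjI ballI allI impI)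
  fix Z fs assume "Z \<in> objs C" and fs: "length fs = length [idn C A] \<and> set fs \<subseteq> Hom C Z A"
  then obtain f where f: "fs = [f]" "f \<in> Hom C Z A"
   by (auto simp: length_Suc_conv)
  have "map (\<lambda>p. p \<odot> h) [idn C A] = fs \<longleftrightarrow> h = f" if "h \<in> Hom C Z A" for h
   unfolding f(1) using that by simp
  with f(2) show "\<exists>!h. h \<in> Hom C Z A \<and> map (\<lambda>p. p \<odot> h) [idn C A] = fs"
   by blast
 qed auto
 then show ?case by fastforce
next
 case (Suc n)
 then obtain P ps where P: "is_power C A P ps" "length ps = Suc n" by blast
 then have o: "P \<in> objs C" "set ps \<subseteq> Hom C P A"
  and ex: "\<And>Z fs. Z \<in> objs C \<Longrightarrow> length fs = length ps \<Longrightarrow> set fs \<subseteq> Hom C Z A \<Longrightarrow>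
   \<exists>!h. h \<in> Hom C Z P \<and> map (\<lambda>p. p \<odot> h) ps = fs"
  by (auto simp: is_power_def)
 let ?qs = "pr1 C A P # map (\<lambda>p. p \<odot> pr2 C A P) ps"
 have "is_power C A (prd C A P) ?qs"
  unfolding is_power_def
 proof (intro conjI ballI allI impI)
  show "set ?qs \<subseteq> Hom C (prd C A P) A" using o by auto
  fix Z fs assume Z: "Z \<in> objs C" and "length fs = length ?qs \<and> set fs \<subseteq> Hom C Z A"
  then obtain f gs where fs: "fs = f # gs" "f \<in> Hom C Z A" "length gs = length ps" "set gs \<subseteq> Hom C Z A"
   by (cases fs) auto
  from ex[OF Z fs(3,4)] obtain g where g: "g \<in> Hom C Z P" "map (\<lambda>p. p \<odot> g) ps = gs"
   and u: "\<And>h. h \<in> Hom C Z P \<Longrightarrow> map (\<lambda>p. p \<odot> h) ps = gs \<Longrightarrow> h = g" by blast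
  let ?t = "pair A P f g"
  have t: "?t \<in> arrs C" "src C ?t = Z" "tgt C ?t = prd C A P" "pr1 C A P \<odot> ?t = f" "pr2 C A P \<odot> ?t = g"
   using fs g by auto
  have m: "map (\<lambda>p. p \<odot> h) (map (\<lambda>p. p \<odot> pr2 C A P) ps) = map (\<lambda>p. p \<odot> (pr2 C A P \<odot> h)) ps"
   if "h \<in> Hom C Z (prd C A P)" for h
   using that o by (auto simp: subset_iff)
  show "\<exists>!h. h \<in> Hom C Z (prd C A P) \<and> map (\<lambda>p. p \<odot> h) ?qs = fs"
  proof (rule ex1I[of _ ?t])
   show "?t \<in> Hom C Z (prd C A P) \<and> map (\<lambda>p. p \<odot> ?t) ?qs = fs"
    using t m[of ?t] g fs by simp
   fix h assume h: "h \<in> Hom C Z (prd C A P) \<and> map (\<lambda>p. p \<odot> h) ?qs = fs"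
   then have "map (\<lambda>p. p \<odot> (pr2 C A P \<odot> h)) ps = gs"
    using m[of h] fs by simp
   then have h2: "pr2 C A P \<odot> h = g"
    using h o by (intro u) auto
   have h1: "h \<in> arrs C" "src C h = Z" "tgt C h = prd C A P" "pr1 C A P \<odot> h = f"
    using h fs(1) by auto
   show "h = ?t"
    by (rule product_eqI[OF prod_cone(1)[of A P]]) (use h1 h2 t o(1) in simp_all)
  qed
 qed (use o in auto)
 with P(2) show ?case by (intro exI[of _ "prd C A P"] exI[of _ ?qs]) simp
qed

lemma peval_els:
 "peval xs t = Some v \<Longrightarrow> pvars_below (length xs) t \<Longrightarrow> set xs \<subseteq> els T \<Longrightarrow> v \<in> els T"
 by (induction t arbitrary: v) (auto split: option.splits dest: ap_els)

text \<open>Each constructor of polynomials corresponds to one of the closure properties of a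
  combinatory complete filter. The domain of the span is not determined exactly: it is enough that
  every tuple at which the polynomial is defined factors through it, with the right value.\<close>

lemma polynomial_computable:
 assumes P: "is_power C A P ps" "ps \<noteq> []" and t: "pvars_below (length ps) t"
 shows "\<exists>m f. partial_mor C P A m f \<and> computable C S \<phi> ps m f \<and>
  (\<forall>x \<in> arrs C. tgt C x = P \<longrightarrow> (\<forall>v. peval (map (\<lambda>p. p \<odot> x) ps) t = Some v \<longrightarrow>
   (\<exists>d \<in> arrs C. src C d = src C x \<and> tgt C d = src C m \<and> m \<odot> d = x \<and> f \<odot> d = v)))"
 using t
proof (induction t)
 case (PV i)
 then have p: "ps ! i \<in> set ps" by simp
 have o: "P \<in> objs C" "ps ! i \<in> Hom C P A" using P p by (auto simp: is_power_def)
 have "computable C S \<phi> ps (idn C P) (ps ! i)"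
  using complete P p unfolding combinatory_complete_def by blast
 moreover have "partial_mor C P A (idn C P) (ps ! i)"
  using o monic_idn by (simp add: partial_mor_def)
 ultimately show ?case
  using o PV by (intro exI[of _ "idn C P"] exI[of _ "ps ! i"]) auto
next
 case (PA s t)
 then obtain m1 f1 m2 f2 where 1: "partial_mor C P A m1 f1" "computable C S \<phi> ps m1 f1"
  and 2: "partial_mor C P A m2 f2" "computable C S \<phi> ps m2 f2"
  and v1: "\<And>x v. x \<in> arrs C \<Longrightarrow> tgt C x = P \<Longrightarrow> peval (map (\<lambda>p. p \<odot> x) ps) s = Some v \<Longrightarrow>
   \<exists>d \<in> arrs C. src C d = src C x \<and> tgt C d = src C m1 \<and> m1 \<odot> d = x \<and> f1 \<odot> d = v"
  and v2: "\<And>x v. x \<in> arrs C \<Longrightarrow> tgt C x = P \<Longrightarrow> peval (map (\<lambda>p. p \<odot> x) ps) t = Some v \<Longrightarrow>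
   \<exists>d \<in> arrs C. src C d = src C x \<and> tgt C d = src C m2 \<and> m2 \<odot> d = x \<and> f2 \<odot> d = v"
  by fastforce
 have m1: "monic C m1" "tgt C m1 = P" "f1 \<in> arrs C" "src C f1 = src C m1" "tgt C f1 = A" "m1 \<in> arrs C"
  and m2: "monic C m2" "tgt C m2 = P" "f2 \<in> arrs C" "src C f2 = src C m2" "tgt C f2 = A" "m2 \<in> arrs C"
  using 1 2 monic_arr by (auto simp: partial_mor_def)
 obtain d1 d2 where pb1: "is_pullback C d1 d2 m1 m2"
  using pullback_exists[of m1 m2] m1 m2 by auto
 then have d: "d1 \<in> arrs C" "tgt C d1 = src C m1" "d2 \<in> arrs C" "src C d2 = src C d1" "tgt C d2 = src C m2"
  "m1 \<odot> d1 = m2 \<odot> d2"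
  and ex1: "\<And>Z u v. u \<in> Hom C Z (src C m1) \<Longrightarrow> v \<in> Hom C Z (src C m2) \<Longrightarrow> m1 \<odot> u = m2 \<odot> v \<Longrightarrow>
   \<exists>!h. h \<in> Hom C Z (src C d1) \<and> d1 \<odot> h = u \<and> d2 \<odot> h = v"
  by (auto simp: is_pullback_def)
 let ?t = "pair A A (f1 \<odot> d1) (f2 \<odot> d2)"
 have t: "?t \<in> arrs C" "src C ?t = src C d1" "tgt C ?t = prd C A A"
  using d m1 m2 by auto
 obtain b1 b2 where pb2: "is_pullback C b1 b2 ?t (app_dom S)"
  using pullback_exists[of ?t "app_dom S"] t by auto
 then have b: "b1 \<in> arrs C" "tgt C b1 = src C d1" "b2 \<in> arrs C" "src C b2 = src C b1"
  "tgt C b2 = src C (app_dom S)" "?t \<odot> b1 = app_dom S \<odot> b2"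
  and ex2: "\<And>Z u v. u \<in> Hom C Z (src C ?t) \<Longrightarrow> v \<in> Hom C Z (src C (app_dom S)) \<Longrightarrow> ?t \<odot> u = app_dom S \<odot> v \<Longrightarrow>
   \<exists>!h. h \<in> Hom C Z (src C b1) \<and> b1 \<odot> h = u \<and> b2 \<odot> h = v"
  using t by (auto simp: is_pullback_def)
 let ?m = "m1 \<odot> (d1 \<odot> b1)" and ?f = "app_map S \<odot> b2"
 have pa: "pointwise_app C S m1 f1 m2 f2 ?m ?f"
  unfolding pointwise_app_def using pb1 pb2 by blast
 note closed = spec[OF spec[OF complete[unfolded combinatory_complete_def], of P], of ps, THEN mp,
   OF conjI[OF P(2,1)], THEN conjunct2, rule_format]
 have comp: "computable C S \<phi> ps ?m ?f"
  by (rule closed) (use 1 2 pa in blast)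
 have "monic C d1" "monic C b1"
  by (rule mem_inv_im_aux(1)[OF pb1 m2(1)], rule mem_inv_im_aux(1)[OF pb2 dom_simps(1)])
 then have mm: "monic C ?m"
  using d b m1(1) by (simp add: monic_cmp)
 then have pm: "partial_mor C P A ?m ?f"
  unfolding partial_mor_def using d(1,2) b(1-5) m1(2,6) by simp
 \<comment> \<open>Factor first through the intersection of the two domains, by \<open>h\<close>,
   and then through the preimage of the domain of application, by \<open>g\<close>.\<close>
 have "\<exists>z \<in> arrs C. src C z = src C x \<and> tgt C z = src C ?m \<and> ?m \<odot> z = x \<and> ?f \<odot> z = v"
  if x: "x \<in> arrs C" "tgt C x = P" and v: "peval (map (\<lambda>p. p \<odot> x) ps) (PA s t) = Some v" for x v
 proof -
  from v obtain u w where u: "peval (map (\<lambda>p. p \<odot> x) ps) s = Some u"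
   and w: "peval (map (\<lambda>p. p \<odot> x) ps) t = Some w" and a: "ap u w = Some v"
   by (auto split: option.splits)
  obtain e1 where e1: "e1 \<in> arrs C" "src C e1 = src C x" "tgt C e1 = src C m1" "m1 \<odot> e1 = x" "f1 \<odot> e1 = u"
   using v1[OF x u] by blast
  obtain e2 where e2: "e2 \<in> arrs C" "src C e2 = src C x" "tgt C e2 = src C m2" "m2 \<odot> e2 = x" "f2 \<odot> e2 = w"
   using v2[OF x w] by blast
  obtain h where "h \<in> Hom C (src C x) (src C d1)" and h2: "d1 \<odot> h = e1" "d2 \<odot> h = e2"
   using ex1[of e1 "src C x" e2] e1 e2 by auto
  then have h: "h \<in> arrs C" "src C h = src C x" "tgt C h = src C d1" by auto
  from a obtain \<delta> where \<delta>: "app_rel u w \<delta>" "v = app_map S \<odot> \<delta>"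
   by (auto simp: ap_Some)
  have w': "src C w = src C x" using e2(5)[symmetric] e2(1-3) m2 by simp
  have \<delta>': "\<delta> \<in> arrs C" "src C \<delta> = src C x" "tgt C \<delta> = src C (app_dom S)"
   "app_dom S \<odot> \<delta> = pair A A u w"
   using \<delta>(1) w' by (auto simp: app_rel_def)
  have "?t \<odot> h = pair A A ((f1 \<odot> d1) \<odot> h) ((f2 \<odot> d2) \<odot> h)"
   by (rule pair_cmp) (use d m1 m2 h in simp_all)
  also have "\<dots> = pair A A u w"
   using d m1 m2 h h2 e1 e2 by simp
  finally have "?t \<odot> h = app_dom S \<odot> \<delta>"
   using \<delta>' by simp
  then obtain g where "g \<in> Hom C (src C x) (src C b1)" and g2: "b1 \<odot> g = h" "b2 \<odot> g = \<delta>"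
   using ex2[of h "src C x" \<delta>] h t \<delta>' by auto
  then have g: "g \<in> arrs C" "src C g = src C x" "tgt C g = src C b1" by auto
  have "?m \<odot> g = x"
   using g g2 h2 h e1 d b m1 by simp
  moreover have "?f \<odot> g = v"
   using g g2 b \<delta>(2) by simp
  ultimately show ?thesis
   using g d b m1 by (intro bexI[of _ g]) auto
 qed
 with pm comp show ?case by blast
qed

text \<open>The tuple of arguments is an element of the power of \<open>A\<close>, and wherever the
  polynomial is defined there this element lies in the domain of the computable partial morphism
  that interprets it.\<close>

theorem functional_completeness:
 assumes "n > 0" "pvars_below n t"
 obtains R where "R \<in> \<phi>"
  "\<And>r xs. mem C r R \<Longrightarrow> set xs \<subseteq> els (src C r) \<Longrightarrow> length xs < n \<Longrightarrow> apl r xs \<noteq> None"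
  "\<And>r xs v. mem C r R \<Longrightarrow> set xs \<subseteq> els (src C r) \<Longrightarrow> length xs = n \<Longrightarrow>
   peval xs t = Some v \<Longrightarrow> apl r xs = Some v"
proof -
 obtain P ps where P: "is_power C A P ps" "length ps = n"
  using power_exists[of "n - 1"] assms by auto
 then have ps: "ps \<noteq> []" "set ps \<subseteq> Hom C P A" using assms by (auto simp: is_power_def)
 obtain m f where mf: "partial_mor C P A m f" "computable C S \<phi> ps m f"
  and val: "\<And>x v. x \<in> arrs C \<Longrightarrow> tgt C x = P \<Longrightarrow> peval (map (\<lambda>p. p \<odot> x) ps) t = Some v \<Longrightarrow>
   \<exists>d \<in> arrs C. src C d = src C x \<and> tgt C d = src C m \<and> m \<odot> d = x \<and> f \<odot> d = v"
  using polynomial_computable[OF P(1) ps(1), of t] assms P(2) by auto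
 have m: "m \<in> arrs C" "tgt C m = P" "f \<in> arrs C" "src C f = src C m" "tgt C f = A"
  using mf(1) monic_arr by (auto simp: partial_mor_def)
 obtain R where R: "R \<in> \<phi>"
  and 1: "\<And>r xs. mem C r R \<Longrightarrow> set xs \<subseteq> els (src C r) \<Longrightarrow> length xs = length ps - 1 \<Longrightarrow> apl r xs \<noteq> None"
  and 2: "\<And>r d. mem C r R \<Longrightarrow> d \<in> arrs C \<Longrightarrow> src C d = src C r \<Longrightarrow> tgt C d = src C m \<Longrightarrow>
   apl r (map (\<lambda>p. p \<odot> m \<odot> d) ps) = Some (f \<odot> d)"
  using computableD[OF mf(2) ps(2,1) m] by blast
 show ?thesis
 proof (rule that[OF R])
  fix r xs assume r: "mem C r R" and xs: "set xs \<subseteq> els (src C r)" "length xs < n"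
  \<comment> \<open>Computability asserts definedness for exactly \<open>n - 1\<close> arguments.
    Shorter lists are padded with copies of \<open>r\<close>, and every prefix of a defined
    application is defined.\<close>
  have "apl r (xs @ replicate (n - 1 - length xs) r) \<noteq> None"
   using xs filter_els[OF r R] P(2) by (intro 1[OF r]) auto
  then show "apl r xs \<noteq> None"
   by (auto simp: apl_append split: option.splits)
 next
  fix r xs v assume r: "mem C r R" and xs: "set xs \<subseteq> els (src C r)" "length xs = n"
   and v: "peval xs t = Some v"
  have T: "src C r \<in> objs C" using r mem_arr by auto
  have sub: "set xs \<subseteq> Hom C (src C r) A" using xs by (auto simp: els_iff)
  have "\<exists>!h. h \<in> Hom C (src C r) P \<and> map (\<lambda>p. p \<odot> h) ps = xs"
   by (rule P(1)[unfolded is_power_def, THEN conjunct2, THEN conjunct2, rule_format, OF T])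
    (use sub P(2) xs(2) in simp)
  then obtain x where "x \<in> Hom C (src C r) P" "map (\<lambda>p. p \<odot> x) ps = xs" by blast
  then have x: "x \<in> arrs C" "src C x = src C r" "tgt C x = P" "map (\<lambda>p. p \<odot> x) ps = xs" by auto
  obtain d where d: "d \<in> arrs C" "src C d = src C x" "tgt C d = src C m" "m \<odot> d = x" "f \<odot> d = v"
   using val[OF x(1,3), of v] v x(4) by auto
  show "apl r xs = Some v"
   using 2[OF r d(1)] d x by simp
 qed
qed

text \<open>Parameters are supplied one at a time by replacing \<open>R\<close> with the image of
  \<open>R \<times> F\<close>, which stays in \<open>\<phi>\<close>. Elements of this image are
  applications only on a cover, so the desired property \<open>\<Phi>\<close> has to be
  local.\<close>

lemma filter_params:
 assumes "set Fs \<subseteq> \<phi>" "R \<in> \<phi>"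
  and "\<And>r xs. mem C r R \<Longrightarrow> set xs \<subseteq> els (src C r) \<Longrightarrow> length xs \<le> length Fs \<Longrightarrow> apl r xs \<noteq> None"
  and "\<And>r cs v. mem C r R \<Longrightarrow> ins C (src C r) cs Fs \<Longrightarrow> apl r cs = Some v \<Longrightarrow> \<Phi> v"
  and loc: "\<And>y P. y \<in> els (src C y) \<Longrightarrow> cvr C (src C y) (\<lambda>k. \<Phi> (y \<odot> k)) \<Longrightarrow> \<Phi> y"
 shows "\<exists>R' \<in> \<phi>. \<forall>y. mem C y R' \<longrightarrow> \<Phi> y"
 using assms(1-4)
proof (induction Fs arbitrary: R)
 case Nil
 then show ?case by (intro bexI[of _ R]) auto
next
 case (Cons F Fs)
 have F: "F \<in> \<phi>" using Cons.prems by simp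
 have df: "ap e f \<noteq> None" if "mem C e R" "mem C f F" "src C e = src C f" for e f
  using Cons.prems(3)[OF that(1), of "[f]"] that filter_els[OF that(2) F] by (auto split: option.splits)
 let ?R = "app_image C S R F"
 note R = filter_app(1)[OF Cons.prems(2) F df] and loc_R = filter_app(2)[OF Cons.prems(2) F df]
 show ?case
 proof (rule Cons.IH[of ?R])
  show "set Fs \<subseteq> \<phi>" using Cons.prems by simp
  show "?R \<in> \<phi>" using R by blast
  fix r assume r: "mem C r ?R"
  note rT = filter_els[OF r \<open>?R \<in> \<phi>\<close>]
  note c = loc_R[OF _ _ _ r]
  have c: "cvr C (src C r) (\<lambda>k. \<exists>e f. mem C e R \<and> mem C f F \<and> ap e f = Some (r \<odot> k))"
   using c by blast
  {
   fix xs assume xs: "set xs \<subseteq> els (src C r)" "length xs \<le> length Fs"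
   show "apl r xs \<noteq> None"
   proof (rule apl_local[OF rT xs(1) c])
    fix k assume k: "k \<in> arrs C" "tgt C k = src C r"
     and "\<exists>e f. mem C e R \<and> mem C f F \<and> ap e f = Some (r \<odot> k)"
    then obtain e f where ef: "mem C e R" "mem C f F" "ap e f = Some (r \<odot> k)" by blast
    have s: "src C e = src C k" "src C f = src C k"
     using apD[OF ef(3)] rT k by (auto simp: els_iff)
    have "apl e (f # map (\<lambda>y. y \<odot> k) xs) \<noteq> None"
     by (rule Cons.prems(3)[OF ef(1)])
      (use xs k s filter_els[OF ef(2) F] els_cmp in \<open>fastforce+\<close>)
    then show "apl (r \<odot> k) (map (\<lambda>y. y \<odot> k) xs) \<noteq> None"
     using ef by simp
   qed
  }
  fix cs v assume cs: "ins C (src C r) cs Fs" and v: "apl r cs = Some v"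
  have FsC: "F' \<in> set Fs \<Longrightarrow> F' \<in> \<phi>" for F' using Cons.prems(1) by auto
  have csT: "set cs \<subseteq> els (src C r)"
  proof
   fix c' assume "c' \<in> set cs"
   then obtain F' where "F' \<in> set Fs" "mem C c' F'" "src C c' = src C r"
    using cs unfolding ins_def list_all2_conv_all_nth by (metis in_set_conv_nth nth_mem)
   then show "c' \<in> els (src C r)"
    using filter_els FsC by metis
  qed
  have vT: "v \<in> els (src C r)" by (rule apl_els[OF v rT csT])
  show "\<Phi> v"
  proof (rule loc)
   show "v \<in> els (src C v)" using vT by (simp add: els_iff)
   have "cvr C (src C r) (\<lambda>k. \<Phi> (v \<odot> k))"
    using c
   proof (rule cvr_mono)
    fix k assume k: "k \<in> arrs C" "tgt C k = src C r"
     and "\<exists>e f. mem C e R \<and> mem C f F \<and> ap e f = Some (r \<odot> k)"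
    then obtain e f where ef: "mem C e R" "mem C f F" "ap e f = Some (r \<odot> k)" by blast
    have s: "src C e = src C k" "src C f = src C k"
     using apD[OF ef(3)] rT k by (auto simp: els_iff)
    have "ins C (src C e) (f # map (\<lambda>y. y \<odot> k) cs) (F # Fs)"
    proof -
     have "list_all2 (\<lambda>c' F'. mem C c' F' \<and> src C c' = src C k) (map (\<lambda>y. y \<odot> k) cs) Fs"
      unfolding list_all2_conv_all_nth
     proof (intro conjI allI impI)
      show l: "length (map (\<lambda>y. y \<odot> k) cs) = length Fs"
       using ins_length[OF cs] by simp
      fix i assume i: "i < length (map (\<lambda>y. y \<odot> k) cs)"
      then have ci: "mem C (cs ! i) (Fs ! i)" "src C (cs ! i) = src C r" "Fs ! i \<in> \<phi>"
       using cs l FsC by (auto simp: ins_def list_all2_conv_all_nth)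
      have "mem C (cs ! i \<odot> k) (Fs ! i)"
       by (rule mem_cmp[OF ci(1) filter_carrier[OF ci(3)]]) (use k ci in simp_all)
      then show "mem C (map (\<lambda>y. y \<odot> k) cs ! i) (Fs ! i)" using i by simp
      show "src C (map (\<lambda>y. y \<odot> k) cs ! i) = src C k"
       using i ci k mem_arr[OF ci(1)] by simp
     qed
     with s ef(2) show ?thesis by (simp add: ins_def)
    qed
    moreover have "apl e (f # map (\<lambda>y. y \<odot> k) cs) = Some (v \<odot> k)"
     using apl_cmp[OF v rT csT k] ef by simp
    ultimately show "\<Phi> (v \<odot> k)"
     by (rule Cons.prems(4)[OF ef(1)])
   qed
   then show "cvr C (src C v) (\<lambda>k. \<Phi> (v \<odot> k))"
    using vT by (simp add: els_iff)
  qed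
 qed
qed

lemma rel_arr:
 assumes "rel G V a g"
 shows "a \<in> arrs C" "g \<in> arrs C" "src C a = src C g" "tgt C a = A" "tgt C g = G" "a \<in> els (src C g)"
 using assms by (auto simp: rel_def els_iff)

lemma rel_cmp:
 assumes "rel G V a g" "V \<in> subs C (prd C A G)" "k \<in> arrs C" "tgt C k = src C g"
 shows "rel G V (a \<odot> k) (g \<odot> k)"
proof -
 note a = rel_arr[OF assms(1)]
 have G: "G \<in> objs C" using a by auto
 let ?t = "pair A G a g"
 have "mem C (?t \<odot> k) V"
  by (rule mem_cmp[OF _ assms(2,3)]) (use assms(1,4) a in \<open>simp_all add: rel_def\<close>)
 moreover have "?t \<odot> k = pair A G (a \<odot> k) (g \<odot> k)"
  by (rule pair_cmp) (use a assms in simp_all)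
 ultimately show ?thesis
  using a assms by (simp add: rel_def)
qed

lemma rel_local:
 assumes "a \<in> els T" "g \<in> arrs C" "src C g = T" "tgt C g = G" "V \<in> subs C (prd C A G)" "cvr C T P"
  and *: "\<And>k. k \<in> arrs C \<Longrightarrow> tgt C k = T \<Longrightarrow> P k \<Longrightarrow> rel G V (a \<odot> k) (g \<odot> k)"
 shows "rel G V a g"
proof -
 let ?t = "pair A G a g"
 have a: "a \<in> arrs C" "src C a = T" "tgt C a = A" using assms by (auto simp: els_iff)
 have t: "?t \<in> arrs C" "src C ?t = T" "tgt C ?t = prd C A G" using a assms by auto
 have "mem C ?t V"
 proof (rule cvr_mem)
  show "cvr C (src C ?t) P" using t assms by simp
  fix k assume k: "k \<in> arrs C" "tgt C k = src C ?t" "P k"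
  then have "mem C (pair A G (a \<odot> k) (g \<odot> k)) V"
   using * t by (simp add: rel_def)
  moreover have "?t \<odot> k = pair A G (a \<odot> k) (g \<odot> k)"
   by (rule pair_cmp) (use a assms k t in simp_all)
  ultimately show "mem C (?t \<odot> k) V" by simp
 qed (use t assms in auto)
 with a assms show ?thesis by (simp add: rel_def)
qed

text \<open>The tool by which realizers are produced: a pointwise computation with a polynomial
  becomes one member of \<open>\<phi>\<close>. Functional completeness treats parameters and
  arguments alike; afterwards the parameters are absorbed into the filter. \<open>H\<close> must be
  stable under change of stage because the conclusion is transported along covers.\<close>

theorem realizer:
 assumes Fs: "set Fs \<subseteq> \<phi>" and n: "n > 0" and t: "pvars_below (length Fs + n) t"
  and V: "V \<in> subs C (prd C A G)"
  and H: "\<And>xs g k. H xs g \<Longrightarrow> set xs \<subseteq> els (src C g) \<Longrightarrow> g \<in> arrs C \<Longrightarrow> tgt C g = G \<Longrightarrow>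
   k \<in> arrs C \<Longrightarrow> tgt C k = src C g \<Longrightarrow> H (map (\<lambda>x. x \<odot> k) xs) (g \<odot> k)"
  and step: "\<And>cs xs g. ins C (src C g) cs Fs \<Longrightarrow> set xs \<subseteq> els (src C g) \<Longrightarrow> length xs = n \<Longrightarrow>
   g \<in> arrs C \<Longrightarrow> tgt C g = G \<Longrightarrow> H xs g \<Longrightarrow> \<exists>v. peval (cs @ xs) t = Some v \<and> rel G V v g"
 obtains R where "R \<in> \<phi>"
  "\<And>r xs. mem C r R \<Longrightarrow> set xs \<subseteq> els (src C r) \<Longrightarrow> length xs < n \<Longrightarrow> apl r xs \<noteq> None"
  "\<And>r xs g. mem C r R \<Longrightarrow> set xs \<subseteq> els (src C r) \<Longrightarrow> length xs = n \<Longrightarrow>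
   g \<in> arrs C \<Longrightarrow> src C g = src C r \<Longrightarrow> tgt C g = G \<Longrightarrow> H xs g \<Longrightarrow>
   \<exists>v. apl r xs = Some v \<and> rel G V v g"
proof -
 obtain R where R: "R \<in> \<phi>"
  and 1: "\<And>r xs. mem C r R \<Longrightarrow> set xs \<subseteq> els (src C r) \<Longrightarrow> length xs < length Fs + n \<Longrightarrow> apl r xs \<noteq> None"
  and 2: "\<And>r xs v. mem C r R \<Longrightarrow> set xs \<subseteq> els (src C r) \<Longrightarrow> length xs = length Fs + n \<Longrightarrow>
   peval xs t = Some v \<Longrightarrow> apl r xs = Some v"
  using functional_completeness[OF _ t] n by auto
 \<comment> \<open>The quantifier over \<open>l\<close> makes the property stable under change of
   stage. Otherwise it could not be shown to be local.\<close>
 define \<Phi> where "\<Phi> y \<longleftrightarrow> (\<forall>l \<in> arrs C. tgt C l = src C y \<longrightarrow>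
   (\<forall>xs. set xs \<subseteq> els (src C l) \<longrightarrow> (length xs < n \<longrightarrow> apl (y \<odot> l) xs \<noteq> None) \<and>
    (\<forall>g \<in> arrs C. length xs = n \<longrightarrow> src C g = src C l \<longrightarrow> tgt C g = G \<longrightarrow> H xs g \<longrightarrow>
     (\<exists>v. apl (y \<odot> l) xs = Some v \<and> rel G V v g))))" for y
 have "\<exists>R' \<in> \<phi>. \<forall>y. mem C y R' \<longrightarrow> \<Phi> y"
 proof (rule filter_params[OF Fs R])
  show "apl r xs \<noteq> None" if "mem C r R" "set xs \<subseteq> els (src C r)" "length xs \<le> length Fs" for r xs
   using 1[OF that(1,2)] that(3) n by simp
 next
  fix r cs v assume r: "mem C r R" and cs: "ins C (src C r) cs Fs" and v: "apl r cs = Some v"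
  have rT: "r \<in> els (src C r)" by (rule filter_els[OF r R])
  have cs_nth: "mem C (cs ! i) (Fs ! i)" "src C (cs ! i) = src C r" "Fs ! i \<in> \<phi>" if "i < length Fs" for i
   using cs Fs that by (auto simp: ins_def list_all2_conv_all_nth)
  have csT: "set cs \<subseteq> els (src C r)"
  proof
   fix x assume "x \<in> set cs"
   then obtain i where "x = cs ! i" "i < length Fs"
    using ins_length[OF cs] by (auto simp: in_set_conv_nth)
   then show "x \<in> els (src C r)"
    using filter_els cs_nth by metis
  qed
  have vT: "v \<in> els (src C r)" by (rule apl_els[OF v rT csT])
  show "\<Phi> v"
   unfolding \<Phi>_def
  proof (intro ballI allI impI conjI)
   fix l xs assume l: "l \<in> arrs C" "tgt C l = src C v" and xs: "set xs \<subseteq> els (src C l)"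
   have l': "tgt C l = src C r" using l vT by (simp add: els_iff)
   have rl: "mem C (r \<odot> l) R" "src C (r \<odot> l) = src C l"
    using mem_cmp[OF r filter_carrier[OF R] l(1) l'] l l' rT by (auto simp: els_iff)
   let ?cs = "map (\<lambda>c. c \<odot> l) cs"
   have cl: "set (?cs @ xs) \<subseteq> els (src C (r \<odot> l))"
    using csT xs els_cmp l(1) l' rl(2) by auto
   have a: "apl (r \<odot> l) ?cs = Some (v \<odot> l)"
    by (rule apl_cmp[OF v rT csT l(1) l'])
   have len: "length ?cs = length Fs" using ins_length[OF cs] by simp
   {
    assume "length xs < n"
    then have "apl (r \<odot> l) (?cs @ xs) \<noteq> None"
     using 1[OF rl(1) cl] len by simp
    then show "apl (v \<odot> l) xs \<noteq> None"
     using a by (simp add: apl_append)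
   }
   fix g assume g: "g \<in> arrs C" "length xs = n" "src C g = src C l" "tgt C g = G" "H xs g"
   have "ins C (src C g) ?cs Fs"
    unfolding ins_def list_all2_conv_all_nth
   proof (intro conjI allI impI)
    fix i assume i: "i < length ?cs"
    note ci = cs_nth[of i]
    show "mem C (?cs ! i) (Fs ! i)"
     using mem_cmp[OF ci(1) filter_carrier[OF ci(3)] l(1)] i len ci(2) l' by simp
    show "src C (?cs ! i) = src C g"
     using i len ci l(1) l' g(3) mem_arr[OF ci(1)] by simp
   qed (rule len)
   then obtain w where w: "peval (?cs @ xs) t = Some w" "rel G V w g"
    using step[of g ?cs xs] xs g by auto
   have "apl (r \<odot> l) (?cs @ xs) = Some w"
    using 2[OF rl(1) cl _ w(1)] len g(2) by simp
   then show "\<exists>v'. apl (v \<odot> l) xs = Some v' \<and> rel G V v' g"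
    using a w(2) by (simp add: apl_append)
  qed
 next
  fix y assume y: "y \<in> els (src C y)" and c: "cvr C (src C y) (\<lambda>k. \<Phi> (y \<odot> k))"
  show "\<Phi> y"
   unfolding \<Phi>_def
  proof (intro ballI allI impI conjI)
   fix l xs assume l: "l \<in> arrs C" "tgt C l = src C y" and xs: "set xs \<subseteq> els (src C l)"
   have cl: "cvr C (src C l) (\<lambda>k. \<Phi> (y \<odot> (l \<odot> k)))"
    by (rule cvr_stable[OF c l])
   have yl: "y \<odot> l \<in> els (src C l)" by (rule els_cmp[OF y l])
   have *: "(length xs < n \<longrightarrow> apl ((y \<odot> l) \<odot> k) (map (\<lambda>x. x \<odot> k) xs) \<noteq> None) \<and>
    (\<forall>g \<in> arrs C. length xs = n \<longrightarrow> src C g = src C k \<longrightarrow> tgt C g = G \<longrightarrow> H (map (\<lambda>x. x \<odot> k) xs) g \<longrightarrow>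
     (\<exists>v. apl ((y \<odot> l) \<odot> k) (map (\<lambda>x. x \<odot> k) xs) = Some v \<and> rel G V v g))"
    if k: "k \<in> arrs C" "tgt C k = src C l" and \<Phi>: "\<Phi> (y \<odot> (l \<odot> k))" for k
   proof -
    have ya: "y \<in> arrs C" using y by (simp add: els_iff)
    have "set (map (\<lambda>x. x \<odot> k) xs) \<subseteq> els (src C k)"
     using xs els_cmp k by auto
    with \<Phi>[unfolded \<Phi>_def, rule_format, of "idn C (src C k)" "map (\<lambda>x. x \<odot> k) xs"] ya l k
    show ?thesis by simp
   qed
   {
    assume "length xs < n"
    then show "apl (y \<odot> l) xs \<noteq> None"
     using * by (intro apl_local[OF yl xs cl]) blast
   }
   fix g assume g: "g \<in> arrs C" "length xs = n" "src C g = src C l" "tgt C g = G" "H xs g"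
   have **: "\<exists>v. apl ((y \<odot> l) \<odot> k) (map (\<lambda>x. x \<odot> k) xs) = Some v \<and> rel G V v (g \<odot> k)"
    if k: "k \<in> arrs C" "tgt C k = src C l" and \<Phi>: "\<Phi> (y \<odot> (l \<odot> k))" for k
    using *[OF that] H[OF g(5) _ g(1,4) k(1)] xs g k by auto
   have "apl (y \<odot> l) xs \<noteq> None"
    using ** by (intro apl_local[OF yl xs cl]) blast
   then obtain v where v: "apl (y \<odot> l) xs = Some v" by blast
   have vT: "v \<in> els (src C l)" by (rule apl_els[OF v yl xs])
   have "rel G V v g"
   proof (rule rel_local[OF vT g(1,3,4) V cl])
    fix k assume k: "k \<in> arrs C" "tgt C k = src C l" "\<Phi> (y \<odot> (l \<odot> k))"
    have "apl ((y \<odot> l) \<odot> k) (map (\<lambda>x. x \<odot> k) xs) = Some (v \<odot> k)"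
     by (rule apl_cmp[OF v yl xs k(1,2)])
    with **[OF k] show "rel G V (v \<odot> k) (g \<odot> k)" by simp
   qed
   with v show "\<exists>v. apl (y \<odot> l) xs = Some v \<and> rel G V v g" by blast
  qed
 qed
 then obtain R' where R': "R' \<in> \<phi>" and \<Phi>: "\<And>y. mem C y R' \<Longrightarrow> \<Phi> y" by blast
 show ?thesis
 proof (rule that[OF R'])
  fix r xs assume r: "mem C r R'" and xs: "set xs \<subseteq> els (src C r)"
  have ra: "r \<in> arrs C" using r by auto
  note * = \<Phi>[OF r, unfolded \<Phi>_def, rule_format, of "idn C (src C r)" xs]
  show "length xs < n \<Longrightarrow> apl r xs \<noteq> None"
   using * xs ra by simp
  fix g assume "length xs = n" "g \<in> arrs C" "src C g = src C r" "tgt C g = G" "H xs g"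
  then show "\<exists>v. apl r xs = Some v \<and> rel G V v g"
   using * xs ra by simp
 qed
qed

end

section \<open>Realizability predicates\<close>

context pas_category
begin

text \<open>Forcing of a quantifier over \<open>Z\<close> followed by an application.
  \<open>Q\<close> receives the change of stage \<open>k\<close>, because the elements mentioned in
  the condition must be restricted along it.\<close>

definition prj :: "'m set \<Rightarrow> 'm \<Rightarrow> ('m \<Rightarrow> 'm \<Rightarrow> bool) \<Rightarrow> bool" where
 "prj Z a Q \<longleftrightarrow> (\<forall>k \<in> arrs C. tgt C k = src C a \<longrightarrow> (\<forall>z. mem C z Z \<longrightarrow> src C z = src C k \<longrightarrow>
  (\<exists>c. ap (a \<odot> k) z = Some c \<and> Q k c)))"

lemma prj_mono:
 "prj Z a Q \<Longrightarrow> (\<And>k c. k \<in> arrs C \<Longrightarrow> tgt C k = src C a \<Longrightarrow> Q k c \<Longrightarrow> Q' k c) \<Longrightarrow> prj Z a Q'"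
 unfolding prj_def by blast

text \<open>Comprehension in two variables: \<open>Inl 0\<close> stands for the realizer and
  \<open>Inl 1\<close> for the realized element.\<close>

definition relset :: "'o \<Rightarrow> ('o, 'm) bfml \<Rightarrow> 'm set" where
 "relset G p = fml_val C p (prd C (A) G)
  [Inl 0 \<mapsto> pr1 C (A) G, Inl 1 \<mapsto> pr2 C (A) G]"

abbreviation "F0 \<equiv> zero_sub C S"
abbreviation "F1 \<equiv> one_sub C S"
abbreviation "FRel G V t s \<equiv> FMem (prd C A G) V (pair_trm C A G t s)"
abbreviation "FPrj Z K \<equiv> FBall (Inl 2) A Z (dot C S (Suc 2) (rv 0) (rv 2) K)"
abbreviation "rels G \<equiv> subs C (prd C A G)"

lemma relset:
 assumes "wf_fml C [Inl 0 \<mapsto> A, Inl 1 \<mapsto> G] p" "G \<in> objs C"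
 shows relset_closed: "relset G p \<in> rels G"
  and rel_relset: "rel G (relset G p) a g \<longleftrightarrow>
   a \<in> els (src C g) \<and> g \<in> arrs C \<and> tgt C g = G \<and> force C p (src C g) [Inl 0 \<mapsto> a, Inl 1 \<mapsto> g]"
proof -
 let ?e = "[Inl 0 \<mapsto> pr1 C A G, Inl 1 \<mapsto> pr2 C A G] :: nat + nat \<rightharpoonup> 'm"
 have e: "env_ok C [Inl 0 \<mapsto> A, Inl 1 \<mapsto> G] (prd C A G) ?e"
  using assms(2) by simp
 have P: "prd C A G \<in> objs C" using assms(2) by simp
 show "relset G p \<in> rels G"
  unfolding relset_def by (rule fml_val_closed[OF assms(1) e P])
 show "rel G (relset G p) a g \<longleftrightarrow>
   a \<in> els (src C g) \<and> g \<in> arrs C \<and> tgt C g = G \<and> force C p (src C g) [Inl 0 \<mapsto> a, Inl 1 \<mapsto> g]"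
 proof (cases "a \<in> els (src C g) \<and> g \<in> arrs C \<and> tgt C g = G")
  case True
  let ?t = "pair A G a g"
  have t: "?t \<in> arrs C" "src C ?t = src C g" "tgt C ?t = prd C A G" "pr1 C A G \<odot> ?t = a" "pr2 C A G \<odot> ?t = g"
   using True by (auto simp: els_iff)
  have "mem C ?t (relset G p) \<longleftrightarrow> force C p (src C g) [Inl 0 \<mapsto> a, Inl 1 \<mapsto> g]"
   unfolding relset_def using mem_fml_val[OF assms(1), of ?t ?e] e t by simp
  with True show ?thesis by (auto simp: rel_def els_iff)
 next
  case False
  then show ?thesis by (auto simp: rel_def els_iff)
 qed
qed

lemma force_prj:
 assumes T: "T \<in> objs C" and e: "env_typed C T e" and t: "has_sort C (env_sort C e) t A" "below n t"
  and Z: "Z \<in> subs C A"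
  and wf: "\<And>u \<Gamma>'. agree n \<Gamma>' (env_sort C e) \<Longrightarrow> has_sort C \<Gamma>' u A \<Longrightarrow> below (Suc (Suc n)) u \<Longrightarrow>
   wf_fml C \<Gamma>' (K u)"
  and sem: "\<And>u k e'. k \<in> arrs C \<Longrightarrow> tgt C k = T \<Longrightarrow> env_typed C (src C k) e' \<Longrightarrow> agree n e' (sb C k e) \<Longrightarrow>
   has_sort C (env_sort C e') u A \<Longrightarrow> below (Suc (Suc n)) u \<Longrightarrow>
   force C (K u) (src C k) e' \<longleftrightarrow> K' k (trm_val C (src C k) e' u)"
 shows "force C (FBall (Inl n) A Z (dot C S (Suc n) t (rv n) K)) T e \<longleftrightarrow> prj Z (trm_val C T e t) K'"
proof -
 let ?D = "dot C S (Suc n) t (rv n) K" and ?vs = "[(Inl n, A)] :: ((nat + nat) \<times> 'o) list"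
 have st: "src C (trm_val C T e t) = T"
  by (rule trm_val_typed[OF t(1) env_ok_sort[OF e] T])
 have fm: "FBall (Inl n) A Z ?D = FAlls ?vs (FImp (FMem A Z (rv n)) ?D)"
  by (simp add: FBall_def)
 have "wf_fml C (env_sort C e) (FBall (Inl n) A Z ?D)"
  by (rule wf_FBall_dot[OF t Z wf])
 then have wfi: "wf_fml C (upds (env_sort C e) ?vs (map snd ?vs)) (FImp (FMem A Z (rv n)) ?D)"
  unfolding fm wf_FAlls by blast
 have body: "force C ?D (src C k) ((sb C k e)(Inl n \<mapsto> z)) \<longleftrightarrow>
   (\<exists>c. ap (trm_val C T e t \<odot> k) z = Some c \<and> K' k c)"
  if k: "k \<in> arrs C" "tgt C k = T" and z: "z \<in> arrs C" "src C z = src C k" "tgt C z = A" for k z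
 proof -
  let ?e = "(sb C k e)(Inl n \<mapsto> z)"
  have e': "env_typed C (src C k) ?e" "env_sort C ?e = (env_sort C e)(Inl n \<mapsto> A)"
   using env_typed_sb[of k e] env_sort_sb[of k e] k e z by simp_all
  have v: "trm_val C (src C k) ?e t = trm_val C T e t \<odot> k"
   using trm_val_upd[OF t(2)] trm_val_sb[OF t(1), of k e] env_ok_sort[OF e] k by simp
  have "force C ?D (src C k) ?e \<longleftrightarrow>
   (\<exists>c. ap (trm_val C (src C k) ?e t) (trm_val C (src C k) ?e (rv n)) = Some c \<and> K' k c)"
  proof (rule force_dot_body[OF _ e'(1)])
   show "has_sort C (env_sort C ?e) t A" "has_sort C (env_sort C ?e) (rv n) A"
    unfolding e'(2) using has_sort_agree[OF agree_upd_self t(2)] t(1) by auto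
   show "wf_fml C \<Gamma>' (K u)" if "agree (Suc n) \<Gamma>' (env_sort C ?e)" "has_sort C \<Gamma>' u A" "below (Suc (Suc n)) u" for u \<Gamma>'
    by (rule wf[OF agree_upd[OF that(1)[unfolded e'(2)]] that(2,3)])
   show "force C (K u) (src C k) f \<longleftrightarrow> K' k (trm_val C (src C k) f u)"
    if "env_typed C (src C k) f" "agree (Suc n) f ?e" "has_sort C (env_sort C f) u A" "below (Suc (Suc n)) u" for u f
    by (rule sem[OF k that(1) agree_upd[OF that(2)] that(3,4)])
  qed (use k below_mono[OF t(2), of "Suc n"] in simp_all)
  then show ?thesis unfolding v by simp
 qed
 have "z \<in> arrs C \<and> tgt C z = A" if "mem C z Z" for z
  using mem_tgt[OF that Z] mem_arr[OF that] by blast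
 then show ?thesis
  unfolding fm force_FAlls_FImp[OF T e wfi] all_ok_args upds.simps prj_def st
  using body by fastforce
qed

lemma wf_pair:
 assumes "has_sort C \<Gamma> t A" "has_sort C \<Gamma> s G" "G \<in> objs C" "V \<in> rels G"
 shows "wf_fml C \<Gamma> (FRel G V t s)"
 using assms prod_cone(1)[of A G] by (simp add: pair_trm_def)

lemma force_pair:
 assumes "T \<in> objs C" "env_typed C T e" "has_sort C (env_sort C e) t A" "has_sort C (env_sort C e) s G"
 shows "force C (FRel G V t s) T e \<longleftrightarrow>
  rel G V (trm_val C T e t) (trm_val C T e s)"
 using trm_val_typed[OF assms(3) env_ok_sort[OF assms(2)] assms(1)]
  trm_val_typed[OF assms(4) env_ok_sort[OF assms(2)] assms(1)]
 by (simp add: pair_trm_def rel_def)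

lemma all_rel:
 "(\<forall>b. b \<in> arrs C \<longrightarrow> src C b = T \<longrightarrow> tgt C b = A \<longrightarrow> (\<forall>z. z \<in> arrs C \<longrightarrow> src C z = T \<longrightarrow> tgt C z = G \<longrightarrow>
   rel G U b z \<longrightarrow> Q b z)) \<longleftrightarrow> (\<forall>b z. src C z = T \<longrightarrow> rel G U b z \<longrightarrow> Q b z)"
 by (auto simp: rel_def)

lemma wf_dot_rel:
 assumes "has_sort C \<Gamma> t A" "has_sort C \<Gamma> r A" "has_sort C \<Gamma> s G" "below n t" "below n r" "below n s"
  "G \<in> objs C" "V \<in> rels G"
 shows "wf_fml C \<Gamma> (dot C S n t r (\<lambda>c. FRel G V c s))"
proof (rule wf_dot_body[OF assms(1,2,4,5)])
 show "wf_fml C \<Gamma>' (FRel G V u s)" if "agree n \<Gamma>' \<Gamma>" "has_sort C \<Gamma>' u A" for u \<Gamma>'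
  using has_sort_agree[OF that(1) assms(6)] assms that(2) by (intro wf_pair) simp_all
qed

lemma force_dot_rel:
 assumes e: "T \<in> objs C" "env_typed C T e" and "has_sort C (env_sort C e) t A" "has_sort C (env_sort C e) r A"
  and s: "has_sort C (env_sort C e) s G" and "below n t" "below n r" and b: "below n s" and GV: "G \<in> objs C" "V \<in> rels G"
 shows "force C (dot C S n t r (\<lambda>c. FRel G V c s)) T e \<longleftrightarrow>
  (\<exists>c. ap (trm_val C T e t) (trm_val C T e r) = Some c \<and> rel G V c (trm_val C T e s))"
proof (rule force_dot_body[OF assms(1-4,6,7)])
 show "wf_fml C \<Gamma>' (FRel G V u s)"
  if "agree n \<Gamma>' (env_sort C e)" "has_sort C \<Gamma>' u A" for u \<Gamma>'
  using has_sort_agree[OF that(1) b] s GV that(2) by (intro wf_pair) simp_all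
 show "force C (FRel G V u s) T e' \<longleftrightarrow> rel G V (trm_val C T e' u) (trm_val C T e s)"
  if "env_typed C T e'" "agree n e' e" "has_sort C (env_sort C e') u A" for u e'
  using force_pair[OF e(1) that(1,3), of s G V] has_sort_agree[OF agree_env_sort[OF that(2), of C] b] s
   trm_val_agree[OF that(2) b, of C T] by simp
qed

text \<open>The two selectors differ only in the variable that is returned; \<open>i\<close> is its
  index, \<open>1\<close> for \<open>F0\<close> and \<open>2\<close> for \<open>F1\<close>.\<close>

lemma mem_select:
 fixes i :: nat
 assumes i: "i = 1 \<or> i = 2"
 defines "Z \<equiv> compr C (Inl 0 :: nat + nat) A (FAll (Inl 1) A (FAll (Inl 2) A
  (apps C S 3 (rv 0) [rv 1, rv 2] (\<lambda>u. FEq u (rv i)))))"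
 shows "Z \<in> subs C A"
  and "mem C z Z \<longleftrightarrow> z \<in> arrs C \<and> tgt C z = A \<and> (\<forall>k \<in> arrs C. tgt C k = src C z \<longrightarrow>
   (\<forall>x \<in> els (src C k). \<forall>y \<in> els (src C k).
    apl (z \<odot> k) [x, y] = Some (if i = 1 then x else y)))"
proof -
 let ?vs = "[(Inl 1, A), (Inl 2, A)] :: ((nat + nat) \<times> 'o) list"
 let ?q = "apps C S 3 (rv 0) [rv 1, rv 2] (\<lambda>u. FEq u (rv i))"
 have f: "FAll (Inl 1) A (FAll (Inl 2) A ?q) = FAlls ?vs ?q" by simp
 have wfq: "wf_fml C (upds [Inl 0 \<mapsto> A] ?vs (map snd ?vs)) ?q"
 proof (rule wf_apps)
  fix u :: "('o, 'm) btrm" and \<Gamma>' :: "nat + nat \<rightharpoonup> 'o"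
  assume a: "agree 3 \<Gamma>' (upds [Inl 0 \<mapsto> A] ?vs (map snd ?vs))" and u: "has_sort C \<Gamma>' u A"
  have "has_sort C \<Gamma>' (rv i) A" using a i by (auto simp: agree_def)
  with u show "wf_fml C \<Gamma>' (FEq u (rv i))" by auto
 qed auto
 have wf: "wf_fml C [Inl 0 \<mapsto> A] (FAlls ?vs ?q)"
  unfolding wf_FAlls using wfq by simp
 show "Z \<in> subs C A"
  unfolding Z_def f by (rule mem_compr(1)[OF wf]) simp
 have sem: "force C ?q T [Inl 0 \<mapsto> z, Inl 1 \<mapsto> x, Inl 2 \<mapsto> y] \<longleftrightarrow>
   apl z [x, y] = Some (if i = 1 then x else y)"
  if "T \<in> objs C" "z \<in> els T" "x \<in> els T" "y \<in> els T" for T z x y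
 proof -
  let ?e = "[Inl 0 \<mapsto> z, Inl 1 \<mapsto> x, Inl 2 \<mapsto> y] :: nat + nat \<rightharpoonup> 'm"
  have "force C ?q T ?e \<longleftrightarrow> (\<exists>v. apl (trm_val C T ?e (rv 0)) (map (trm_val C T ?e) [rv 1, rv 2]) = Some v \<and>
    v = (if i = 1 then x else y))"
  proof (rule force_apps)
   fix u :: "('o, 'm) btrm" and \<Gamma>' :: "nat + nat \<rightharpoonup> 'o"
   assume a: "agree 3 \<Gamma>' (env_sort C ?e)" and u: "has_sort C \<Gamma>' u A"
   have "has_sort C \<Gamma>' (rv i) A" using a i that by (auto simp: agree_def els_iff)
   with u show "wf_fml C \<Gamma>' (FEq u (rv i))" by auto
  next
   fix u :: "('o, 'm) btrm" and e' :: "nat + nat \<rightharpoonup> 'm"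
   assume "agree 3 e' ?e"
   then show "force C (FEq u (rv i)) T e' \<longleftrightarrow> trm_val C T e' u = (if i = 1 then x else y)"
    using i by (auto simp: agree_def)
  qed (use that in \<open>auto simp: els_iff\<close>)
  then show ?thesis by simp
 qed
 have "force C (FAlls ?vs ?q) (src C z) [Inl 0 \<mapsto> z] \<longleftrightarrow> (\<forall>k \<in> arrs C. tgt C k = src C z \<longrightarrow>
   (\<forall>x \<in> els (src C k). \<forall>y \<in> els (src C k).
    apl (z \<odot> k) [x, y] = Some (if i = 1 then x else y)))"
  if z: "z \<in> arrs C" "tgt C z = A"
 proof -
  have et: "src C z \<in> objs C" "env_typed C (src C z) [Inl 0 \<mapsto> z]" using z by auto
  have "wf_fml C (upds (env_sort C [Inl 0 \<mapsto> z]) ?vs (map snd ?vs)) ?q"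
   using wfq z by simp
  note F = force_FAlls[OF et this]
  have b: "force C ?q (src C k) [Inl 0 \<mapsto> z \<odot> k, Inl 1 \<mapsto> x, Inl 2 \<mapsto> y] \<longleftrightarrow>
    apl (z \<odot> k) [x, y] = Some (if i = 1 then x else y)"
   if "k \<in> arrs C" "tgt C k = src C z" "x \<in> els (src C k)" "y \<in> els (src C k)" for k x y
   using sem[of "src C k" "z \<odot> k" x y] that z by (simp add: els_iff del: apps.simps apl.simps)
  show ?thesis
   unfolding F all_ok_args upds.simps sb_upd sb_empty ball_els
   using b unfolding els_iff by blast
 qed
 then show "mem C z Z \<longleftrightarrow> z \<in> arrs C \<and> tgt C z = A \<and> (\<forall>k \<in> arrs C. tgt C k = src C z \<longrightarrow>
   (\<forall>x \<in> els (src C k). \<forall>y \<in> els (src C k).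
    apl (z \<odot> k) [x, y] = Some (if i = 1 then x else y)))"
  unfolding Z_def f mem_compr(2)[OF wf A_obj] by blast
qed

lemma F_closed: "F0 \<in> subs C A" "F1 \<in> subs C A"
 unfolding zero_sub_def one_sub_def using mem_select(1)[of 1] mem_select(1)[of 2] by auto

lemma mem_F0: "mem C z F0 \<longleftrightarrow> z \<in> arrs C \<and> tgt C z = A \<and> (\<forall>k \<in> arrs C. tgt C k = src C z \<longrightarrow>
   (\<forall>x \<in> els (src C k). \<forall>y \<in> els (src C k). apl (z \<odot> k) [x, y] = Some x))"
 unfolding zero_sub_def using mem_select(2)[of 1 z] by simp

lemma mem_F1: "mem C z F1 \<longleftrightarrow> z \<in> arrs C \<and> tgt C z = A \<and> (\<forall>k \<in> arrs C. tgt C k = src C z \<longrightarrow>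
   (\<forall>x \<in> els (src C k). \<forall>y \<in> els (src C k). apl (z \<odot> k) [x, y] = Some y))"
 unfolding one_sub_def using mem_select(2)[of 2 z] by simp

lemma F_apply:
 assumes "x \<in> els (src C z)" "y \<in> els (src C z)"
 shows "mem C z F0 \<Longrightarrow> apl z [x, y] = Some x" "mem C z F1 \<Longrightarrow> apl z [x, y] = Some y"
proof -
 show "apl z [x, y] = Some x" if "mem C z F0"
  using that[unfolded mem_F0, THEN conjunct2, THEN conjunct2, rule_format, of "idn C (src C z)" x y]
   that assms mem_arr[OF that] by (simp del: apl.simps)
 show "apl z [x, y] = Some y" if "mem C z F1"
  using that[unfolded mem_F1, THEN conjunct2, THEN conjunct2, rule_format, of "idn C (src C z)" x y]
   that assms mem_arr[OF that] by (simp del: apl.simps)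
qed

lemma F_els: "mem C z F0 \<Longrightarrow> z \<in> els (src C z)" "mem C z F1 \<Longrightarrow> z \<in> els (src C z)"
 by (auto simp: mem_F0 mem_F1 els_iff)

text \<open>Membership in \<open>A2\<close> asks for definedness on the join of the two selectors.
  An element of the join lies on a cover in one of them, and definedness is local, so the condition
  splits.\<close>

lemma A2_iff:
 shows "A2_sub C S \<in> subs C A"
  and "mem C a (A2_sub C S) \<longleftrightarrow> a \<in> arrs C \<and> tgt C a = A \<and> prj F0 a (\<lambda>k c. True) \<and> prj F1 a (\<lambda>k c. True)"
proof -
 let ?J = "F0 \<squnion>\<^bsub>Sub C A\<^esub> F1"
 let ?p = "FBall (Inl 1) A ?J (dot C S (Suc 1) (rv 0) (rv 1) (\<lambda>u. FTop)) :: ('o, 'm) bfml"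
 have J: "?J \<in> subs C A"
  using ops_closed(2)[OF A_obj F_closed] .
 have wf: "wf_fml C [Inl 0 \<mapsto> A] ?p"
  by (rule wf_FBall_dot) (use J in auto)
 have eq: "A2_sub C S = compr C (Inl 0) A ?p"
  by (simp add: A2_sub_def numeral_2_eq_2)
 show "A2_sub C S \<in> subs C A"
  unfolding eq by (rule mem_compr(1)[OF wf A_obj])
 have memJ: "mem C z ?J \<longleftrightarrow> z \<in> arrs C \<and> tgt C z = A \<and> cvr C (src C z) (\<lambda>k. mem C (z \<odot> k) F0 \<or> mem C (z \<odot> k) F1)" for z
  using mem_join[of z F0 F1] F_closed mem_tgt[OF _ J, of z] mem_arr[of C z ?J] by auto
 have "prj ?J a (\<lambda>k c. True) \<longleftrightarrow> prj F0 a (\<lambda>k c. True) \<and> prj F1 a (\<lambda>k c. True)"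
  if a: "a \<in> arrs C" "tgt C a = A"
 proof
  have J': "mem C z F0 \<or> mem C z F1 \<Longrightarrow> mem C z ?J" for z
   unfolding memJ using mem_cmp F_closed by (auto simp: mem_F0 mem_F1 intro!: cvr_now)
  assume "prj ?J a (\<lambda>k c. True)"
  with J' show "prj F0 a (\<lambda>k c. True) \<and> prj F1 a (\<lambda>k c. True)"
   unfolding prj_def by blast
 next
  assume *: "prj F0 a (\<lambda>k c. True) \<and> prj F1 a (\<lambda>k c. True)"
  show "prj ?J a (\<lambda>k c. True)"
   unfolding prj_def
  proof (intro ballI impI allI)
   fix k z assume k: "k \<in> arrs C" "tgt C k = src C a" and z: "mem C z ?J" "src C z = src C k"
   have "ap (a \<odot> k) z \<noteq> None"
   proof (rule ap_local)
    show "a \<odot> k \<in> els (src C k)" "z \<in> els (src C k)"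
     using a k z by (auto simp: els_iff memJ)
    show "cvr C (src C k) (\<lambda>k. mem C (z \<odot> k) F0 \<or> mem C (z \<odot> k) F1)"
     using z by (simp add: memJ)
    fix l assume l: "l \<in> arrs C" "tgt C l = src C k" "mem C (z \<odot> l) F0 \<or> mem C (z \<odot> l) F1"
    have "src C (z \<odot> l) = src C (k \<odot> l)" using l z k by (simp add: memJ)
    with * l k a have "\<exists>c. ap (a \<odot> (k \<odot> l)) (z \<odot> l) = Some c"
     unfolding prj_def by (auto dest!: bspec[of _ _ "k \<odot> l"])
    with a k l show "ap ((a \<odot> k) \<odot> l) (z \<odot> l) \<noteq> None" by simp
   qed
   then show "\<exists>c. ap (a \<odot> k) z = Some c \<and> True" by simp
  qed
 qed
 moreover have "force C ?p (src C a) [Inl 0 \<mapsto> a] \<longleftrightarrow> prj ?J a (\<lambda>k c. True)"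
  if a: "a \<in> arrs C" "tgt C a = A"
  using force_prj[of "src C a" "[Inl 0 \<mapsto> a]" "rv 0" 1 ?J "\<lambda>u. FTop" "\<lambda>k c. True"] a J by simp
 ultimately show "mem C a (A2_sub C S) \<longleftrightarrow> a \<in> arrs C \<and> tgt C a = A \<and> prj F0 a (\<lambda>k c. True) \<and> prj F1 a (\<lambda>k c. True)"
  unfolding eq mem_compr(2)[OF wf A_obj] by auto
qed

section \<open>Logical operations on realizability predicates\<close>

text \<open>The clause for conjunction. The condition \<open>a \<in> A2\<close> is omitted because
  the two projections already imply it.\<close>

definition pairs :: "'o \<Rightarrow> 'm set \<Rightarrow> 'm set \<Rightarrow> 'm set" where
 "pairs G U V = relset G (FAnd
  (FPrj F0 (\<lambda>c. FRel G U c (rv 1)))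
  (FPrj F1 (\<lambda>c. FRel G V c (rv 1))))"

lemma
 assumes "Z \<in> subs C A" "G \<in> objs C" "V \<in> rels G"
 shows wf_prj_rel: "wf_fml C [Inl 0 \<mapsto> A, Inl 1 \<mapsto> G]
   (FPrj Z (\<lambda>c. FRel G V c (rv 1)))"
  and force_prj_rel: "a \<in> els (src C g) \<Longrightarrow> g \<in> arrs C \<Longrightarrow> tgt C g = G \<Longrightarrow>
   force C (FPrj Z (\<lambda>c. FRel G V c (rv 1)))
    (src C g) [Inl 0 \<mapsto> a, Inl 1 \<mapsto> g] \<longleftrightarrow> prj Z a (\<lambda>k c. rel G V c (g \<odot> k))"
proof -
 show "wf_fml C [Inl 0 \<mapsto> A, Inl 1 \<mapsto> G]
   (FPrj Z (\<lambda>c. FRel G V c (rv 1)))"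
 proof (rule wf_FBall_dot)
  fix u :: "('o, 'm) btrm" and \<Gamma>' :: "nat + nat \<rightharpoonup> 'o"
  assume "agree 2 \<Gamma>' [Inl 0 \<mapsto> A, Inl 1 \<mapsto> G]" "has_sort C \<Gamma>' u A"
  then show "wf_fml C \<Gamma>' (FRel G V u (rv 1))"
   using assms by (intro wf_pair) (auto simp: agree_def)
 qed (use assms in auto)
 assume a: "a \<in> els (src C g)" "g \<in> arrs C" "tgt C g = G"
 let ?e = "[Inl 0 \<mapsto> a, Inl 1 \<mapsto> g] :: nat + nat \<rightharpoonup> 'm"
 have "force C (FPrj Z (\<lambda>c. FRel G V c (rv 1)))
    (src C g) ?e \<longleftrightarrow> prj Z (trm_val C (src C g) ?e (rv 0)) (\<lambda>k c. rel G V c (g \<odot> k))"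
 proof (rule force_prj)
  fix u :: "('o, 'm) btrm" and \<Gamma>' :: "nat + nat \<rightharpoonup> 'o"
  assume "agree 2 \<Gamma>' (env_sort C ?e)" "has_sort C \<Gamma>' u A"
  then show "wf_fml C \<Gamma>' (FRel G V u (rv 1))"
   using assms a by (intro wf_pair) (auto simp: agree_def)
 next
  fix u :: "('o, 'm) btrm" and e' :: "nat + nat \<rightharpoonup> 'm" and k
  assume k: "k \<in> arrs C" "tgt C k = src C g" and e': "env_typed C (src C k) e'" "agree 2 e' (sb C k ?e)"
   "has_sort C (env_sort C e') u A"
  have 1: "e' (Inl 1) = Some (g \<odot> k)" using e'(2) by (simp add: agree_def)
  have s: "has_sort C (env_sort C e') (rv 1) G"
   using 1 a k by (simp add: env_sort_def)
  from force_pair[OF _ e'(1,3) s, of V] 1 k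
  show "force C (FRel G V u (rv 1)) (src C k) e' \<longleftrightarrow>
   rel G V (trm_val C (src C k) e' u) (g \<odot> k)"
   by simp
 qed (use assms a in \<open>auto simp: els_iff\<close>)
 then show "force C (FPrj Z (\<lambda>c. FRel G V c (rv 1)))
    (src C g) ?e \<longleftrightarrow> prj Z a (\<lambda>k c. rel G V c (g \<odot> k))"
  by simp
qed

lemma
 assumes "G \<in> objs C" "U \<in> rels G" "V \<in> rels G"
 shows pairs_closed: "pairs G U V \<in> rels G"
  and rel_pairs: "rel G (pairs G U V) a g \<longleftrightarrow> a \<in> els (src C g) \<and> g \<in> arrs C \<and> tgt C g = G \<and>
   prj F0 a (\<lambda>k c. rel G U c (g \<odot> k)) \<and> prj F1 a (\<lambda>k c. rel G V c (g \<odot> k))"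
proof -
 note wf = wf_prj_rel[OF F_closed(1) assms(1,2)] wf_prj_rel[OF F_closed(2) assms(1,3)]
 have wf': "wf_fml C [Inl 0 \<mapsto> A, Inl 1 \<mapsto> G] (FAnd
  (FPrj F0 (\<lambda>c. FRel G U c (rv 1)))
  (FPrj F1 (\<lambda>c. FRel G V c (rv 1))))"
  using wf by simp
 show "pairs G U V \<in> rels G"
  unfolding pairs_def by (rule relset_closed[OF wf' assms(1)])
 show "rel G (pairs G U V) a g \<longleftrightarrow> a \<in> els (src C g) \<and> g \<in> arrs C \<and> tgt C g = G \<and>
   prj F0 a (\<lambda>k c. rel G U c (g \<odot> k)) \<and> prj F1 a (\<lambda>k c. rel G V c (g \<odot> k))"
  unfolding pairs_def rel_relset[OF wf' assms(1)] force.simps(5)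
  using force_prj_rel[OF F_closed(1) assms(1,2), of a g] force_prj_rel[OF F_closed(2) assms(1,3), of a g]
  by blast
qed

text \<open>The clause for disjunction: the component obtained from \<open>F0\<close> is a tag, in
  \<open>F0\<close> for the left disjunct and in \<open>F1\<close> for the right one; the component
  obtained from \<open>F1\<close> is the realizer proper.\<close>

definition orr :: "'o \<Rightarrow> 'm set \<Rightarrow> 'm set \<Rightarrow> 'm set" where
 "orr G U V = relset G (FOr
  (FAnd (FPrj F0 (FMem A F0))
   (FPrj F1 (\<lambda>c. FRel G U c (rv 1))))
  (FAnd (FPrj F0 (FMem A F1))
   (FPrj F1 (\<lambda>c. FRel G V c (rv 1)))))"

lemma
 assumes "Z \<in> subs C A" "Z' \<in> subs C A"
 shows wf_prj_mem: "wf_fml C [Inl 0 \<mapsto> A, Inl 1 \<mapsto> G] (FPrj Z (FMem A Z'))"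
  and force_prj_mem: "a \<in> els (src C g) \<Longrightarrow> g \<in> arrs C \<Longrightarrow>
   force C (FPrj Z (FMem A Z')) (src C g) [Inl 0 \<mapsto> a, Inl 1 \<mapsto> g] \<longleftrightarrow>
   prj Z a (\<lambda>k c. mem C c Z')"
proof -
 show "wf_fml C [Inl 0 \<mapsto> A, Inl 1 \<mapsto> G] (FPrj Z (FMem A Z'))"
  by (rule wf_FBall_dot) (use assms in auto)
 assume a: "a \<in> els (src C g)" "g \<in> arrs C"
 show "force C (FPrj Z (FMem A Z')) (src C g) [Inl 0 \<mapsto> a, Inl 1 \<mapsto> g] \<longleftrightarrow>
   prj Z a (\<lambda>k c. mem C c Z')"
  using force_prj[of "src C g" "[Inl 0 \<mapsto> a, Inl 1 \<mapsto> g]" "rv 0" 2 Z "FMem A Z'" "\<lambda>k c. mem C c Z'"]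
   a assms by (auto simp: els_iff)
qed

lemma
 assumes "G \<in> objs C" "U \<in> rels G" "V \<in> rels G"
 shows orr_closed: "orr G U V \<in> rels G"
  and rel_orr: "rel G (orr G U V) a g \<longleftrightarrow> a \<in> els (src C g) \<and> g \<in> arrs C \<and> tgt C g = G \<and>
   cvr C (src C g) (\<lambda>k.
    (prj F0 (a \<odot> k) (\<lambda>l c. mem C c F0) \<and> prj F1 (a \<odot> k) (\<lambda>l c. rel G U c ((g \<odot> k) \<odot> l))) \<or>
    (prj F0 (a \<odot> k) (\<lambda>l c. mem C c F1) \<and> prj F1 (a \<odot> k) (\<lambda>l c. rel G V c ((g \<odot> k) \<odot> l))))"
proof -
 let ?p1 = "FAnd (FPrj F0 (FMem A F0))
   (FPrj F1 (\<lambda>c. FRel G U c (rv 1)))"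
 let ?p2 = "FAnd (FPrj F0 (FMem A F1))
   (FPrj F1 (\<lambda>c. FRel G V c (rv 1)))"
 have wf: "wf_fml C [Inl 0 \<mapsto> A, Inl 1 \<mapsto> G] (FOr ?p1 ?p2)"
  using wf_prj_rel[OF F_closed(2) assms(1,2)] wf_prj_rel[OF F_closed(2) assms(1,3)]
   wf_prj_mem[OF F_closed(1) F_closed(1)] wf_prj_mem[OF F_closed(1) F_closed(2)] by simp
 show "orr G U V \<in> rels G"
  unfolding orr_def by (rule relset_closed[OF wf assms(1)])
 have "force C (FOr ?p1 ?p2) (src C g) [Inl 0 \<mapsto> a, Inl 1 \<mapsto> g] \<longleftrightarrow> cvr C (src C g) (\<lambda>k.
    (prj F0 (a \<odot> k) (\<lambda>l c. mem C c F0) \<and> prj F1 (a \<odot> k) (\<lambda>l c. rel G U c ((g \<odot> k) \<odot> l))) \<or>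
    (prj F0 (a \<odot> k) (\<lambda>l c. mem C c F1) \<and> prj F1 (a \<odot> k) (\<lambda>l c. rel G V c ((g \<odot> k) \<odot> l))))"
  if a: "a \<in> els (src C g)" "g \<in> arrs C" "tgt C g = G"
  unfolding force.simps(6)
 proof (rule cvr_cong)
  fix k assume k: "k \<in> arrs C" "tgt C k = src C g"
  have a': "a \<odot> k \<in> els (src C (g \<odot> k))" "g \<odot> k \<in> arrs C" "tgt C (g \<odot> k) = G"
   "src C (g \<odot> k) = src C k"
   using a k els_cmp by auto
  show "(force C ?p1 (src C k) (sb C k [Inl 0 \<mapsto> a, Inl 1 \<mapsto> g]) \<or> force C ?p2 (src C k) (sb C k [Inl 0 \<mapsto> a, Inl 1 \<mapsto> g])) \<longleftrightarrow>
   (prj F0 (a \<odot> k) (\<lambda>l c. mem C c F0) \<and> prj F1 (a \<odot> k) (\<lambda>l c. rel G U c ((g \<odot> k) \<odot> l))) \<or>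
    (prj F0 (a \<odot> k) (\<lambda>l c. mem C c F1) \<and> prj F1 (a \<odot> k) (\<lambda>l c. rel G V c ((g \<odot> k) \<odot> l)))"
   using force_prj_rel[OF F_closed(2) assms(1,2) a'(1-3)] force_prj_rel[OF F_closed(2) assms(1,3) a'(1-3)]
    force_prj_mem[OF F_closed(1) F_closed(1) a'(1,2)] force_prj_mem[OF F_closed(1) F_closed(2) a'(1,2)] a'(4)
   by simp
 qed
 then show "rel G (orr G U V) a g \<longleftrightarrow> a \<in> els (src C g) \<and> g \<in> arrs C \<and> tgt C g = G \<and>
   cvr C (src C g) (\<lambda>k.
    (prj F0 (a \<odot> k) (\<lambda>l c. mem C c F0) \<and> prj F1 (a \<odot> k) (\<lambda>l c. rel G U c ((g \<odot> k) \<odot> l))) \<or>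
    (prj F0 (a \<odot> k) (\<lambda>l c. mem C c F1) \<and> prj F1 (a \<odot> k) (\<lambda>l c. rel G V c ((g \<odot> k) \<odot> l))))"
  unfolding orr_def rel_relset[OF wf assms(1)] by blast
qed

text \<open>Inverse image along \<open>id \<times> f\<close>, written as a formula so that its
  elements are found by forcing.\<close>

definition reix :: "'m \<Rightarrow> 'm set \<Rightarrow> 'm set" where
 "reix f V = relset (src C f) (FRel (tgt C f) V (rv 0) (TApp f (rv 1)))"

lemma
 assumes "f \<in> arrs C" "V \<in> rels (tgt C f)"
 shows reix_closed: "reix f V \<in> rels (src C f)"
  and rel_reix: "rel (src C f) (reix f V) a g \<longleftrightarrow>
   g \<in> arrs C \<and> tgt C g = src C f \<and> rel (tgt C f) V a (f \<odot> g)"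
proof -
 let ?p = "FRel (tgt C f) V (rv 0) (TApp f (rv 1)) :: ('o, 'm) bfml"
 have wf: "wf_fml C [Inl 0 \<mapsto> A, Inl 1 \<mapsto> src C f] ?p"
  using assms by (intro wf_pair) auto
 have o: "src C f \<in> objs C" using assms by simp
 show "reix f V \<in> rels (src C f)"
  unfolding reix_def by (rule relset_closed[OF wf o])
 have "force C ?p (src C g) [Inl 0 \<mapsto> a, Inl 1 \<mapsto> g] \<longleftrightarrow> rel (tgt C f) V a (f \<odot> g)"
  if "a \<in> els (src C g)" "g \<in> arrs C" "tgt C g = src C f"
  using force_pair[of "src C g" "[Inl 0 \<mapsto> a, Inl 1 \<mapsto> g]" "rv 0" "TApp f (rv 1)" "tgt C f" V] that assms
  by (simp add: els_iff)
 moreover have "rel (tgt C f) V a (f \<odot> g) \<Longrightarrow> g \<in> arrs C \<Longrightarrow> tgt C g = src C f \<Longrightarrow> a \<in> els (src C g)"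
  using assms by (auto simp: rel_def els_iff)
 ultimately show "rel (src C f) (reix f V) a g \<longleftrightarrow>
   g \<in> arrs C \<and> tgt C g = src C f \<and> rel (tgt C f) V a (f \<odot> g)"
  unfolding reix_def rel_relset[OF wf o] by blast
qed

text \<open>Shares its body with the construction of \<open>E\<close> for a representing
  monomorphism; at the same time it is the left adjoint of reindexing along
  \<open>q\<close>.\<close>

definition im :: "'m \<Rightarrow> 'm set \<Rightarrow> 'm set" where
 "im q W = ex_im C (prod_map C (idn C A) q) W"

lemma
 assumes q: "q \<in> arrs C" and W: "W \<in> rels (src C q)"
 shows im_closed: "im q W \<in> rels (tgt C q)"
  and rel_im: "rel (tgt C q) (im q W) a g \<longleftrightarrow> a \<in> els (src C g) \<and> g \<in> arrs C \<and> tgt C g = tgt C q \<and>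
   cvr C (src C g) (\<lambda>k. \<exists>z. q \<odot> z = g \<odot> k \<and> rel (src C q) W (a \<odot> k) z)"
proof -
 let ?P = "src C q" and ?G = "tgt C q"
 let ?m = "prod_map C (idn C A) q"
 have o: "?P \<in> objs C" "?G \<in> objs C" using q by auto
 have m: "?m \<in> arrs C" "src C ?m = prd C A ?P" "tgt C ?m = prd C A ?G"
  and m1: "pr1 C A ?G \<odot> ?m = idn C A \<odot> pr1 C A ?P" and m2: "pr2 C A ?G \<odot> ?m = q \<odot> pr2 C A ?P"
  unfolding prod_map_def using q o by simp_all
 show "im q W \<in> rels ?G"
  unfolding im_def using ex_im_closed[OF m(1)] W m by simp
 have key: "?m \<odot> y = pair A ?G (pr1 C A ?P \<odot> y) (q \<odot> (pr2 C A ?P \<odot> y))"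
  if y: "y \<in> arrs C" "tgt C y = prd C A ?P" for y
 proof (rule tuple_eqI[OF prod_cone(1)[of A ?G], symmetric])
  show "pr1 C A ?G \<odot> ?m \<odot> y = pr1 C A ?P \<odot> y"
   using cmp_reassoc[OF m1, of y] y m o by simp
  show "pr2 C A ?G \<odot> ?m \<odot> y = q \<odot> pr2 C A ?P \<odot> y"
   using cmp_reassoc[OF m2, of y] y m o q by simp
 qed (use m y o in simp_all)
 have "mem C (pair A ?G a g) (im q W) \<longleftrightarrow>
   cvr C (src C g) (\<lambda>k. \<exists>z. q \<odot> z = g \<odot> k \<and> rel ?P W (a \<odot> k) z)"
  if a: "a \<in> els (src C g)" "g \<in> arrs C" "tgt C g = ?G"
 proof -
  let ?t = "pair A ?G a g"
  have a': "a \<in> arrs C" "src C a = src C g" "tgt C a = A" using a by (auto simp: els_iff)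
  have t: "?t \<in> arrs C" "src C ?t = src C g" "tgt C ?t = prd C A ?G" using a a' by auto
  have "mem C ?t (im q W) \<longleftrightarrow> cvr C (src C ?t) (\<lambda>k. \<exists>y. ?m \<odot> y = ?t \<odot> k \<and> mem C y W)"
   unfolding im_def by (rule mem_ex_im) (use t m W in simp_all)
  also have "\<dots> \<longleftrightarrow> cvr C (src C g) (\<lambda>k. \<exists>z. q \<odot> z = g \<odot> k \<and> rel ?P W (a \<odot> k) z)"
   unfolding t(2)
  proof (rule cvr_cong)
   fix k assume k: "k \<in> arrs C" "tgt C k = src C g"
   have tk: "?t \<odot> k = pair A ?G (a \<odot> k) (g \<odot> k)"
    by (rule pair_cmp) (use a a' k in simp_all)
   have tk': "pr1 C A ?G \<odot> (?t \<odot> k) = a \<odot> k" "pr2 C A ?G \<odot> (?t \<odot> k) = g \<odot> k"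
    unfolding tk using a a' k by simp_all
   show "(\<exists>y. ?m \<odot> y = ?t \<odot> k \<and> mem C y W) \<longleftrightarrow> (\<exists>z. q \<odot> z = g \<odot> k \<and> rel ?P W (a \<odot> k) z)"
   proof
    assume "\<exists>y. ?m \<odot> y = ?t \<odot> k \<and> mem C y W"
    then obtain y where y: "?m \<odot> y = ?t \<odot> k" "mem C y W" by blast
    then have y': "y \<in> arrs C" "tgt C y = prd C A ?P"
     using mem_tgt[OF y(2) W] by auto
    have "pr1 C A ?G \<odot> (?m \<odot> y) = pr1 C A ?P \<odot> y" "pr2 C A ?G \<odot> (?m \<odot> y) = q \<odot> (pr2 C A ?P \<odot> y)"
     unfolding key[OF y'] using y' o q by simp_all
    then have e: "pr1 C A ?P \<odot> y = a \<odot> k" "q \<odot> (pr2 C A ?P \<odot> y) = g \<odot> k"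
     unfolding y(1) tk' by simp_all
    have "rel ?P W (pr1 C A ?P \<odot> y) (pr2 C A ?P \<odot> y)"
     unfolding rel_def using y y' o pair_eta[of A ?P y] by simp
    with e show "\<exists>z. q \<odot> z = g \<odot> k \<and> rel ?P W (a \<odot> k) z" by auto
   next
    assume "\<exists>z. q \<odot> z = g \<odot> k \<and> rel ?P W (a \<odot> k) z"
    then obtain z where z: "q \<odot> z = g \<odot> k" "rel ?P W (a \<odot> k) z" by blast
    let ?y = "pair A ?P (a \<odot> k) z"
    have y: "mem C ?y W" "?y \<in> arrs C" "tgt C ?y = prd C A ?P"
     "pr1 C A ?P \<odot> ?y = a \<odot> k" "pr2 C A ?P \<odot> ?y = z"
     using z(2) by (auto simp: rel_def)
    have "?m \<odot> ?y = ?t \<odot> k"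
     unfolding key[OF y(2,3)] y(4,5) z(1) tk ..
    with y(1) show "\<exists>y. ?m \<odot> y = ?t \<odot> k \<and> mem C y W" by blast
   qed
  qed
  finally show ?thesis .
 qed
 then show "rel ?G (im q W) a g \<longleftrightarrow> a \<in> els (src C g) \<and> g \<in> arrs C \<and> tgt C g = ?G \<and>
   cvr C (src C g) (\<lambda>k. \<exists>z. q \<odot> z = g \<odot> k \<and> rel ?P W (a \<odot> k) z)"
  by (auto simp: rel_def els_iff)
qed

text \<open>Universal quantification along \<open>q\<close>, relativized to elements with a realizer
  in \<open>U\<close>. For an identity this is implication; for a projection with the existence
  predicate of the bound variable it is the clause for the universal quantifier.\<close>

definition all :: "'m \<Rightarrow> 'm set \<Rightarrow> 'm set \<Rightarrow> 'm set" where
 "all q U V = relset (tgt C q) (FAlls [(Inl 2, A), (Inl 3, src C q)]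
  (FImp (FAnd (FEq (TApp q (rv 3)) (rv 1)) (FRel (src C q) U (rv 2) (rv 3)))
   (dot C S 4 (rv 0) (rv 2) (\<lambda>c. FRel (src C q) V c (rv 3)))))"

lemma
 assumes q: "q \<in> arrs C" and UV: "U \<in> rels (src C q)" "V \<in> rels (src C q)"
 shows all_closed: "all q U V \<in> rels (tgt C q)"
  and rel_all: "rel (tgt C q) (all q U V) a g \<longleftrightarrow> a \<in> els (src C g) \<and> g \<in> arrs C \<and> tgt C g = tgt C q \<and>
   (\<forall>k \<in> arrs C. tgt C k = src C g \<longrightarrow> (\<forall>b z. q \<odot> z = g \<odot> k \<longrightarrow> src C z = src C k \<longrightarrow> rel (src C q) U b z \<longrightarrow>
    (\<exists>c. ap (a \<odot> k) b = Some c \<and> rel (src C q) V c z)))"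
proof -
 let ?P = "src C q" and ?G = "tgt C q"
 let ?vs = "[(Inl 2, A), (Inl 3, ?P)] :: ((nat + nat) \<times> 'o) list"
 let ?p1 = "FAnd (FEq (TApp q (rv 3)) (rv 1)) (FRel ?P U (rv 2) (rv 3)) :: ('o, 'm) bfml"
 let ?p2 = "dot C S 4 (rv 0) (rv 2) (\<lambda>c. FRel ?P V c (rv 3))"
 let ?\<Gamma> = "[Inl 0 \<mapsto> A, Inl 1 \<mapsto> ?G] :: nat + nat \<rightharpoonup> 'o"
 have o: "?P \<in> objs C" "?G \<in> objs C" using q by auto
 have wf2: "wf_fml C (upds ?\<Gamma> ?vs (map snd ?vs)) ?p2"
  by (rule wf_dot_rel) (use o UV in auto)
 have wf1: "wf_fml C (upds ?\<Gamma> ?vs (map snd ?vs)) ?p1"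
  using q o UV wf_pair[of "upds ?\<Gamma> ?vs (map snd ?vs)" "rv 2" "rv 3" ?P U] by auto
 have wfi: "wf_fml C (upds ?\<Gamma> ?vs (map snd ?vs)) (FImp ?p1 ?p2)"
  using wf1 wf2 by simp
 have wf: "wf_fml C ?\<Gamma> (FAlls ?vs (FImp ?p1 ?p2))"
  unfolding wf_FAlls using wfi o by simp
 show "all q U V \<in> rels ?G"
  unfolding all_def by (rule relset_closed[OF wf o(2)])
 have "force C (FAlls ?vs (FImp ?p1 ?p2)) (src C g) [Inl 0 \<mapsto> a, Inl 1 \<mapsto> g] \<longleftrightarrow>
   (\<forall>k \<in> arrs C. tgt C k = src C g \<longrightarrow> (\<forall>b z. q \<odot> z = g \<odot> k \<longrightarrow> src C z = src C k \<longrightarrow> rel ?P U b z \<longrightarrow>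
    (\<exists>c. ap (a \<odot> k) b = Some c \<and> rel ?P V c z)))"
  if a: "a \<in> els (src C g)" "g \<in> arrs C" "tgt C g = ?G"
 proof -
  let ?e = "[Inl 0 \<mapsto> a, Inl 1 \<mapsto> g] :: nat + nat \<rightharpoonup> 'm"
  have et: "src C g \<in> objs C" "env_typed C (src C g) ?e"
   using a by (auto simp: els_iff)
  have es: "env_sort C ?e = ?\<Gamma>" using a by (auto simp: els_iff)
  have body: "(force C ?p1 (src C k) E \<longleftrightarrow> q \<odot> z = g \<odot> k \<and> rel ?P U b z) \<and>
    (force C ?p2 (src C k) E \<longleftrightarrow> (\<exists>c. ap (a \<odot> k) b = Some c \<and> rel ?P V c z))"
   if k: "k \<in> arrs C" "tgt C k = src C g" and b: "b \<in> arrs C" "src C b = src C k" "tgt C b = A"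
    and z: "z \<in> arrs C" "src C z = src C k" "tgt C z = ?P"
    and E: "E = (sb C k ?e)(Inl 2 \<mapsto> b, Inl 3 \<mapsto> z)" for k b z E
  proof -
   have Et: "src C k \<in> objs C" "env_typed C (src C k) E"
    using k b z a unfolding E by (auto simp: els_iff)
   have Es: "env_sort C E = upds ?\<Gamma> ?vs (map snd ?vs)"
    using k b z a unfolding E by (auto simp: els_iff)
   show ?thesis
    using force_pair[OF Et, of "rv 2" "rv 3" ?P U] force_dot_rel[OF Et, of "rv 0" "rv 2" "rv 3" ?P 4 V] UV o
    unfolding Es by (simp add: E)
  qed
  have wfi': "wf_fml C (upds (env_sort C ?e) ?vs (map snd ?vs)) (FImp ?p1 ?p2)"
   unfolding es by (rule wfi)
  have "force C (FAlls ?vs (FImp ?p1 ?p2)) (src C g) ?e \<longleftrightarrow> (\<forall>k \<in> arrs C. tgt C k = src C g \<longrightarrow>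
    (\<forall>b. b \<in> arrs C \<longrightarrow> src C b = src C k \<longrightarrow> tgt C b = A \<longrightarrow> (\<forall>z. z \<in> arrs C \<longrightarrow> src C z = src C k \<longrightarrow> tgt C z = ?P \<longrightarrow>
     rel ?P U b z \<longrightarrow> q \<odot> z = g \<odot> k \<longrightarrow> (\<exists>c. ap (a \<odot> k) b = Some c \<and> rel ?P V c z))))"
   unfolding force_FAlls_FImp[OF et wfi'] all_ok_args upds.simps using body[OF _ _ _ _ _ _ _ _ refl] by blast
  also have "\<dots> \<longleftrightarrow> (\<forall>k \<in> arrs C. tgt C k = src C g \<longrightarrow> (\<forall>b z. q \<odot> z = g \<odot> k \<longrightarrow> src C z = src C k \<longrightarrow> rel ?P U b z \<longrightarrow>
    (\<exists>c. ap (a \<odot> k) b = Some c \<and> rel ?P V c z)))"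
   unfolding all_rel by blast
  finally show ?thesis .
 qed
 then show "rel ?G (all q U V) a g \<longleftrightarrow> a \<in> els (src C g) \<and> g \<in> arrs C \<and> tgt C g = ?G \<and>
   (\<forall>k \<in> arrs C. tgt C k = src C g \<longrightarrow> (\<forall>b z. q \<odot> z = g \<odot> k \<longrightarrow> src C z = src C k \<longrightarrow> rel ?P U b z \<longrightarrow>
    (\<exists>c. ap (a \<odot> k) b = Some c \<and> rel ?P V c z)))"
  unfolding all_def rel_relset[OF wf o(2)] by blast
qed

end

context pas_category
begin

lemma rel_reix':
 "f \<in> arrs C \<Longrightarrow> src C f = P \<Longrightarrow> tgt C f = G \<Longrightarrow> V \<in> rels G \<Longrightarrow>
  rel P (reix f V) a g \<longleftrightarrow> g \<in> arrs C \<and> tgt C g = P \<and> rel G V a (f \<odot> g)"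
 using rel_reix[of f V a g] by simp

lemma reix_closed': "f \<in> arrs C \<Longrightarrow> src C f = P \<Longrightarrow> tgt C f = G \<Longrightarrow> V \<in> rels G \<Longrightarrow> reix f V \<in> rels P"
 using reix_closed[of f V] by simp

lemma prjD:
 assumes "prj Z a Q" "mem C z Z" "src C z = src C a" "a \<in> arrs C"
 shows "\<exists>c. ap a z = Some c \<and> Q (idn C (src C a)) c"
 using assms(1)[unfolded prj_def, rule_format, of "idn C (src C a)" z] assms(2-4) by simp

lemma prj_cmp:
 assumes "prj Z a Q" "k \<in> arrs C" "tgt C k = src C a" "a \<in> arrs C"
 shows "prj Z (a \<odot> k) (\<lambda>l. Q (k \<odot> l))"
 unfolding prj_def
proof (intro ballI impI allI)
 fix l z assume "l \<in> arrs C" "tgt C l = src C (a \<odot> k)" "mem C z Z" "src C z = src C l"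
 with assms(1)[unfolded prj_def, rule_format, of "k \<odot> l" z] assms(2-4)
 show "\<exists>c. ap ((a \<odot> k) \<odot> l) z = Some c \<and> Q (k \<odot> l) c" by simp
qed

end

context pca_filter
begin

lemma ap_rel_local:
 assumes "r \<in> els T" "x \<in> els T" "g \<in> arrs C" "src C g = T" "tgt C g = G" "V \<in> rels G" "cvr C T P"
  and *: "\<And>k. k \<in> arrs C \<Longrightarrow> tgt C k = T \<Longrightarrow> P k \<Longrightarrow> \<exists>v. ap (r \<odot> k) (x \<odot> k) = Some v \<and> rel G V v (g \<odot> k)"
 shows "\<exists>v. ap r x = Some v \<and> rel G V v g"
proof -
 have "ap r x \<noteq> None"
  by (rule ap_local[OF assms(1,2,7)]) (use * in fastforce)
 then obtain v where v: "ap r x = Some v" by blast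
 have "rel G V v g"
 proof (rule rel_local[OF ap_els[OF v assms(2)] assms(3-7)])
  fix k assume k: "k \<in> arrs C" "tgt C k = T" "P k"
  have "ap (r \<odot> k) (x \<odot> k) = Some (v \<odot> k)"
   by (rule ap_cmp[OF v]) (use k assms(2) in \<open>auto simp: els_iff\<close>)
  with *[OF k] show "rel G V (v \<odot> k) (g \<odot> k)" by simp
 qed
 with v show ?thesis by blast
qed

lemma peval_cmp:
 assumes "peval xs t = Some v" "set xs \<subseteq> els T" "pvars_below (length xs) t" "k \<in> arrs C" "tgt C k = T"
 shows "peval (map (\<lambda>x. x \<odot> k) xs) t = Some (v \<odot> k)"
 using assms
proof (induction t arbitrary: v)
 case (PA s t)
 then obtain a b where a: "peval xs s = Some a" and b: "peval xs t = Some b" and v: "ap a b = Some v"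
  by (auto split: option.splits)
 have "src C b = T"
  using peval_els[OF b _ PA.prems(2)] PA.prems(3) by (simp add: els_iff)
 then have "ap (a \<odot> k) (b \<odot> k) = Some (v \<odot> k)"
  using ap_cmp[OF v] PA.prems by simp
 with PA.IH(1)[OF a] PA.IH(2)[OF b] PA.prems show ?case by simp
qed auto

lemma peval_local:
 assumes "set xs \<subseteq> els T" "pvars_below (length xs) t" "cvr C T P"
  and "\<And>k. k \<in> arrs C \<Longrightarrow> tgt C k = T \<Longrightarrow> P k \<Longrightarrow> peval (map (\<lambda>x. x \<odot> k) xs) t \<noteq> None"
 shows "peval xs t \<noteq> None"
 using assms(2,4)
proof (induction t)
 case (PA s t)
 have ne: "peval (map (\<lambda>x. x \<odot> k) xs) s \<noteq> None \<and> peval (map (\<lambda>x. x \<odot> k) xs) t \<noteq> None"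
  if "k \<in> arrs C" "tgt C k = T" "P k" for k
  using PA.prems(2)[OF that] by (auto split: option.splits)
 have "peval xs s \<noteq> None" "peval xs t \<noteq> None"
  by (rule PA.IH; use PA.prems ne in auto)+
 then obtain a b where a: "peval xs s = Some a" and b: "peval xs t = Some b" by blast
 have ab: "a \<in> els T" "b \<in> els T"
  using peval_els[OF a] peval_els[OF b] assms(1) PA.prems by auto
 have "ap a b \<noteq> None"
 proof (rule ap_local[OF ab assms(3)])
  fix k assume k: "k \<in> arrs C" "tgt C k = T" "P k"
  have "peval (map (\<lambda>x. x \<odot> k) xs) s = Some (a \<odot> k)" "peval (map (\<lambda>x. x \<odot> k) xs) t = Some (b \<odot> k)"
   using peval_cmp[OF a assms(1) _ k(1,2)] peval_cmp[OF b assms(1) _ k(1,2)] PA.prems by auto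
  with PA.prems(2)[OF k] show "ap (a \<odot> k) (b \<odot> k) \<noteq> None" by simp
 qed
 with a b show ?case by simp
qed simp

text \<open>Meant for case distinctions that can be made only on a cover: the polynomial is the same
  in all cases, so the local values come from a single value.\<close>

lemma peval_rel_local:
 assumes "set xs \<subseteq> els T" "pvars_below (length xs) t" "cvr C T P"
  "g \<in> arrs C" "src C g = T" "tgt C g = G" "V \<in> rels G"
  and *: "\<And>k. k \<in> arrs C \<Longrightarrow> tgt C k = T \<Longrightarrow> P k \<Longrightarrow>
   \<exists>v. peval (map (\<lambda>x. x \<odot> k) xs) t = Some v \<and> rel G V v (g \<odot> k)"
 shows "\<exists>v. peval xs t = Some v \<and> rel G V v g"
proof -
 have "peval xs t \<noteq> None"
  by (rule peval_local[OF assms(1-3)]) (use * in fastforce)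
 then obtain v where v: "peval xs t = Some v" by blast
 have "rel G V v g"
 proof (rule rel_local[OF peval_els[OF v assms(2,1)] assms(4-7,3)])
  fix k assume k: "k \<in> arrs C" "tgt C k = T" "P k"
  have "peval (map (\<lambda>x. x \<odot> k) xs) t = Some (v \<odot> k)"
   by (rule peval_cmp[OF v assms(1,2) k(1,2)])
  with *[OF k] show "rel G V (v \<odot> k) (g \<odot> k)" by simp
 qed
 with v show ?thesis by blast
qed

section \<open>Uniform entailment between realizability predicates\<close>

text \<open>A proposition of the meta-logic, so that eliminating an entailment delivers a rule that
  can be instantiated directly.\<close>

abbreviation realizes :: "'m set \<Rightarrow> 'o \<Rightarrow> 'm set \<Rightarrow> 'm set \<Rightarrow> prop" where
 "realizes R G U V \<equiv> (\<And>r x g. mem C r R \<Longrightarrow> src C r = src C g \<Longrightarrow> rel G U x g \<Longrightarrow>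
  \<exists>v. ap r x = Some v \<and> rel G V v g)"

text \<open>The preorder of realizability in external form: one member of \<open>\<phi>\<close>
  serves all stages and all elements.\<close>

definition ent :: "'o \<Rightarrow> 'm set \<Rightarrow> 'm set \<Rightarrow> bool" where
 "ent G U V \<longleftrightarrow> (\<exists>R \<in> \<phi>. \<forall>r x g. mem C r R \<longrightarrow> src C r = src C g \<longrightarrow> rel G U x g \<longrightarrow>
  (\<exists>v. ap r x = Some v \<and> rel G V v g))"

lemma entE:
 assumes "ent G U V"
 obtains R where "R \<in> \<phi>"
  "PROP realizes R G U V"
 using assms unfolding ent_def by blast

text \<open>An entailment is proved by writing down its realizer as a polynomial \<open>t\<close>.
  The parameters carry the indices below \<open>length Fs\<close>, the argument carries the index
  \<open>length Fs\<close>.\<close>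

lemma ent_by:
 assumes Fs: "set Fs \<subseteq> \<phi>" and t: "pvars_below (Suc (length Fs)) t" and U: "U \<in> rels G" and V: "V \<in> rels G"
  and step: "\<And>cs x g. ins C (src C g) cs Fs \<Longrightarrow> rel G U x g \<Longrightarrow> \<exists>v. peval (cs @ [x]) t = Some v \<and> rel G V v g"
 shows "ent G U V"
proof -
 obtain R where R: "R \<in> \<phi>"
  "\<And>r xs g. mem C r R \<Longrightarrow> set xs \<subseteq> els (src C r) \<Longrightarrow> length xs = 1 \<Longrightarrow>
   g \<in> arrs C \<Longrightarrow> src C g = src C r \<Longrightarrow> tgt C g = G \<Longrightarrow> (\<exists>x. xs = [x] \<and> rel G U x g) \<Longrightarrow>
   \<exists>v. apl r xs = Some v \<and> rel G V v g"
 proof (rule realizer[OF Fs _ _ V, of 1 t "\<lambda>xs g. \<exists>x. xs = [x] \<and> rel G U x g"])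
  show "pvars_below (length Fs + 1) t" using t by simp
  show "\<exists>x. map (\<lambda>x. x \<odot> k) xs = [x] \<and> rel G U x (g \<odot> k)"
   if "\<exists>x. xs = [x] \<and> rel G U x g" "k \<in> arrs C" "tgt C k = src C g" for xs g k
   using that rel_cmp[OF _ U] by auto
 qed (use step in auto)
 show ?thesis
  unfolding ent_def
 proof (intro bexI[OF _ R(1)] allI impI)
  fix r x g assume r: "mem C r R" "src C r = src C g" and x: "rel G U x g"
  have "\<exists>v. apl r [x] = Some v \<and> rel G V v g"
   by (rule R(2)[OF r(1)]) (use x rel_arr[OF x] r(2) in simp_all)
  then show "\<exists>v. ap r x = Some v \<and> rel G V v g"
   by (auto split: option.splits)
 qed
qed

lemma ins_els: "ins C T cs Fs \<Longrightarrow> set Fs \<subseteq> \<phi> \<Longrightarrow> set cs \<subseteq> els T"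
 unfolding ins_def by (induction rule: list_all2_induct) (auto dest: filter_els)

text \<open>The projections \<open>PV 0\<close> and \<open>PV 1\<close> in two variables are tracked
  by members of \<open>\<phi>\<close>. All elements of these members are selectors, so upward
  closure applies.\<close>

lemma F_filter: "F0 \<in> \<phi>" "F1 \<in> \<phi>"
proof -
 obtain R where R: "R \<in> \<phi>"
  "\<And>r xs v. mem C r R \<Longrightarrow> set xs \<subseteq> els (src C r) \<Longrightarrow> length xs = 2 \<Longrightarrow>
   peval xs (PV 0) = Some v \<Longrightarrow> apl r xs = Some v"
  by (rule functional_completeness[of 2 "PV 0"]) auto
 show "F0 \<in> \<phi>"
 proof (rule filter_up[OF R(1) F_closed(1)])
  fix r assume r: "mem C r R"
  have "apl (r \<odot> k) [x, y] = Some x"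
   if k: "k \<in> arrs C" "tgt C k = src C r" and xy: "x \<in> els (src C k)" "y \<in> els (src C k)" for k x y
  proof -
   have "mem C (r \<odot> k) R" by (rule mem_cmp[OF r filter_carrier[OF R(1)] k])
   then show ?thesis
    using k xy mem_arr[OF r] by (intro R(2)) auto
  qed
  then show "mem C r F0"
   unfolding mem_F0 using filter_els[OF r R(1)] by (auto simp: els_iff simp del: apl.simps)
 qed
 obtain R where R: "R \<in> \<phi>"
  "\<And>r xs v. mem C r R \<Longrightarrow> set xs \<subseteq> els (src C r) \<Longrightarrow> length xs = 2 \<Longrightarrow>
   peval xs (PV 1) = Some v \<Longrightarrow> apl r xs = Some v"
  by (rule functional_completeness[of 2 "PV 1"]) auto
 show "F1 \<in> \<phi>"
 proof (rule filter_up[OF R(1) F_closed(2)])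
  fix r assume r: "mem C r R"
  have "apl (r \<odot> k) [x, y] = Some y"
   if k: "k \<in> arrs C" "tgt C k = src C r" and xy: "x \<in> els (src C k)" "y \<in> els (src C k)" for k x y
  proof -
   have "mem C (r \<odot> k) R" by (rule mem_cmp[OF r filter_carrier[OF R(1)] k])
   then show ?thesis
    using k xy mem_arr[OF r] by (intro R(2)) auto
  qed
  then show "mem C r F1"
   unfolding mem_F1 using filter_els[OF r R(1)] by (auto simp: els_iff simp del: apl.simps)
 qed
qed

abbreviation pairs_up :: "'m set \<Rightarrow> prop" where
 "pairs_up R \<equiv> (\<And>p x y. mem C p R \<Longrightarrow> x \<in> els (src C p) \<Longrightarrow> y \<in> els (src C p) \<Longrightarrow>
  \<exists>u w. ap p x = Some u \<and> ap u y = Some w \<and> w \<in> els (src C p) \<and>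
   prj F0 w (\<lambda>k c. c = x \<odot> k) \<and> prj F1 w (\<lambda>k c. c = y \<odot> k))"

text \<open>Church pairs: a pair waits for a selector and hands it the two components. Functional
  completeness makes the application to two arguments defined before the selector is
  supplied.\<close>

lemma pairing:
 obtains R where "R \<in> \<phi>"
  "PROP pairs_up R"
proof -
 \<comment> \<open>The polynomial \<open>z x y\<close> in the components \<open>x\<close>,
   \<open>y\<close> and the selector \<open>z\<close>, which comes as the third argument.\<close>
 let ?t = "PA (PA (PV 2) (PV 0)) (PV 1)"
 obtain R where R: "R \<in> \<phi>"
  and 1: "\<And>r xs. mem C r R \<Longrightarrow> set xs \<subseteq> els (src C r) \<Longrightarrow> length xs < 3 \<Longrightarrow> apl r xs \<noteq> None"
  and 2: "\<And>r xs v. mem C r R \<Longrightarrow> set xs \<subseteq> els (src C r) \<Longrightarrow> length xs = 3 \<Longrightarrow>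
   peval xs ?t = Some v \<Longrightarrow> apl r xs = Some v"
  by (rule functional_completeness[of 3 ?t]) auto
 show ?thesis
 proof (rule that[OF R])
  fix p x y assume p: "mem C p R" and xy: "x \<in> els (src C p)" "y \<in> els (src C p)"
  have pT: "p \<in> els (src C p)" by (rule filter_els[OF p R])
  obtain w where w: "apl p [x, y] = Some w"
   using 1[OF p, of "[x, y]"] xy by auto
  have wT: "w \<in> els (src C p)"
   using apl_els[OF w pT] xy by auto
  \<comment> \<open>Applying the restricted pair to \<open>z\<close> is an application of
    \<open>p\<close> to three arguments, for which the polynomial is available.\<close>
  have app: "ap (w \<odot> k) z = Some v"
   if k: "k \<in> arrs C" "tgt C k = src C p" and z: "z \<in> els (src C k)" "apl z [x \<odot> k, y \<odot> k] = Some v" for k z v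
  proof -
   have "mem C (p \<odot> k) R" by (rule mem_cmp[OF p filter_carrier[OF R] k])
   moreover have "x \<odot> k \<in> els (src C k)" "y \<odot> k \<in> els (src C k)"
    using xy els_cmp k by auto
   moreover have "peval [x \<odot> k, y \<odot> k, z] ?t = Some v"
    using z(2) by (auto split: option.splits)
   ultimately have "apl (p \<odot> k) [x \<odot> k, y \<odot> k, z] = Some v"
    using z(1) k pT by (intro 2) (auto simp: els_iff)
   moreover have "apl (p \<odot> k) [x \<odot> k, y \<odot> k] = Some (w \<odot> k)"
    using apl_cmp[OF w pT _ k] xy by simp
   ultimately show ?thesis
    using apl_append[of "p \<odot> k" "[x \<odot> k, y \<odot> k]" "[z]"] by (simp del: apl.simps(2)) (simp split: option.splits)
  qed
  have "prj F0 w (\<lambda>k c. c = x \<odot> k)" "prj F1 w (\<lambda>k c. c = y \<odot> k)"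
   unfolding prj_def
  proof (safe)
   fix k z assume k: "k \<in> arrs C" "tgt C k = src C w" and s: "src C z = src C k"
   have k': "tgt C k = src C p" using k wT by (simp add: els_iff)
   have xk: "x \<odot> k \<in> els (src C z)" "y \<odot> k \<in> els (src C z)"
    using xy els_cmp k(1) k' s by auto
   show "\<exists>c. ap (w \<odot> k) z = Some c \<and> c = x \<odot> k" if "mem C z F0"
    using app[OF k(1) k' _ F_apply(1)[OF xk that]] F_els(1)[OF that] s by simp
   show "\<exists>c. ap (w \<odot> k) z = Some c \<and> c = y \<odot> k" if "mem C z F1"
    using app[OF k(1) k' _ F_apply(2)[OF xk that]] F_els(2)[OF that] s by simp
  qed
  with w wT show "\<exists>u w. ap p x = Some u \<and> ap u y = Some w \<and> w \<in> els (src C p) \<and>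
    prj F0 w (\<lambda>k c. c = x \<odot> k) \<and> prj F1 w (\<lambda>k c. c = y \<odot> k)"
   by (auto split: option.splits)
 qed
qed

lemma rel_pairsI:
 assumes "rel G U x g" "rel G V y g" "U \<in> rels G" "V \<in> rels G" "w \<in> els (src C g)"
  "prj F0 w (\<lambda>k c. c = x \<odot> k)" "prj F1 w (\<lambda>k c. c = y \<odot> k)"
 shows "rel G (pairs G U V) w g"
proof -
 have g: "g \<in> arrs C" "tgt C g = G" "G \<in> objs C" "src C w = src C g"
  using rel_arr[OF assms(1)] assms(5) by (auto simp: els_iff)
 show ?thesis
  unfolding rel_pairs[OF g(3) assms(3,4)]
  using g assms(5) prj_mono[OF assms(6)] prj_mono[OF assms(7)]
   rel_cmp[OF assms(1,3)] rel_cmp[OF assms(2,4)] by auto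
qed

lemma rel_pairsD:
 assumes "rel G (pairs G U V) w g" "U \<in> rels G" "V \<in> rels G" "src C z = src C g"
 shows "mem C z F0 \<Longrightarrow> \<exists>c. ap w z = Some c \<and> rel G U c g"
  "mem C z F1 \<Longrightarrow> \<exists>c. ap w z = Some c \<and> rel G V c g"
proof -
 have g: "g \<in> arrs C" "tgt C g = G" "G \<in> objs C" "src C w = src C g" "w \<in> arrs C"
  using rel_arr[OF assms(1)] by auto
 have p: "prj F0 w (\<lambda>k c. rel G U c (g \<odot> k))" "prj F1 w (\<lambda>k c. rel G V c (g \<odot> k))"
  using assms(1) rel_pairs[OF g(3) assms(2,3)] by auto
 show "mem C z F0 \<Longrightarrow> \<exists>c. ap w z = Some c \<and> rel G U c g"
  "mem C z F1 \<Longrightarrow> \<exists>c. ap w z = Some c \<and> rel G V c g"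
  using prjD[OF p(1)] prjD[OF p(2)] g assms(4) by auto
qed

lemma ent_refl: "U \<in> rels G \<Longrightarrow> ent G U U"
 by (rule ent_by[of "[]" "PV 0"]) auto

lemma ent_trans:
 assumes "ent G U V" "ent G V W" "U \<in> rels G" "W \<in> rels G"
 shows "ent G U W"
proof -
 obtain R1 where R1: "R1 \<in> \<phi>" "PROP realizes R1 G U V" using assms(1) by (rule entE) blast
 obtain R2 where R2: "R2 \<in> \<phi>" "PROP realizes R2 G V W" using assms(2) by (rule entE) blast
 show ?thesis
 proof (rule ent_by[of "[R2, R1]" "PA (PV 0) (PA (PV 1) (PV 2))"])
  fix cs x g assume "ins C (src C g) cs [R2, R1]" and x: "rel G U x g"
  then obtain b a where cs: "cs = [b, a]" "mem C b R2" "src C b = src C g" "mem C a R1" "src C a = src C g" by auto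
  from R1(2)[OF cs(4,5) x] obtain v where v: "ap a x = Some v" "rel G V v g" by blast
  from R2(2)[OF cs(2,3) v(2)] v(1)
  show "\<exists>v. peval (cs @ [x]) (PA (PV 0) (PA (PV 1) (PV 2))) = Some v \<and> rel G W v g"
   by (auto simp: cs(1))
 qed (use assms R1 R2 in auto)
qed

lemma
 assumes "U \<in> rels G" "V \<in> rels G" "G \<in> objs C"
 shows ent_fst: "ent G (pairs G U V) U" and ent_snd: "ent G (pairs G U V) V"
proof -
 have c: "pairs G U V \<in> rels G" using pairs_closed assms by simp
 show "ent G (pairs G U V) U"
  by (rule ent_by[of "[F0]" "PA (PV 1) (PV 0)"]) (use assms c F_filter rel_pairsD(1) in auto)
 show "ent G (pairs G U V) V"
  by (rule ent_by[of "[F1]" "PA (PV 1) (PV 0)"]) (use assms c F_filter rel_pairsD(2) in auto)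
qed

lemma ent_pair:
 assumes "ent G U V1" "ent G U V2" "U \<in> rels G" "V1 \<in> rels G" "V2 \<in> rels G" "G \<in> objs C"
 shows "ent G U (pairs G V1 V2)"
proof -
 obtain R1 where R1: "R1 \<in> \<phi>" "PROP realizes R1 G U V1" using assms(1) by (rule entE) blast
 obtain R2 where R2: "R2 \<in> \<phi>" "PROP realizes R2 G U V2" using assms(2) by (rule entE) blast
 obtain P where P: "P \<in> \<phi>" "PROP pairs_up P" using pairing by blast
 let ?t = "PA (PA (PV 0) (PA (PV 1) (PV 3))) (PA (PV 2) (PV 3))"
 show ?thesis
 proof (rule ent_by[of "[P, R1, R2]" ?t])
  fix cs x g assume "ins C (src C g) cs [P, R1, R2]" and x: "rel G U x g"
  then obtain p a b where cs: "cs = [p, a, b]" "mem C p P" "src C p = src C g" "mem C a R1" "src C a = src C g"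
   "mem C b R2" "src C b = src C g" by auto
  from R1(2)[OF cs(4,5) x] obtain u where u: "ap a x = Some u" "rel G V1 u g" by blast
  from R2(2)[OF cs(6,7) x] obtain v where v: "ap b x = Some v" "rel G V2 v g" by blast
  from P(2)[OF cs(2), of u v] obtain q w where w: "ap p u = Some q" "ap q v = Some w"
   "w \<in> els (src C g)" "prj F0 w (\<lambda>k c. c = u \<odot> k)" "prj F1 w (\<lambda>k c. c = v \<odot> k)"
   using rel_arr(6)[OF u(2)] rel_arr(6)[OF v(2)] cs(3) by auto
  have "rel G (pairs G V1 V2) w g"
   by (rule rel_pairsI[OF u(2) v(2) assms(4,5) w(3-5)])
  with u v w show "\<exists>v. peval (cs @ [x]) ?t = Some v \<and> rel G (pairs G V1 V2) v g"
   by (simp add: cs(1) numeral_3_eq_3 numeral_2_eq_2)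
 qed (use assms P R1 R2 pairs_closed in auto)
qed

lemma rel_orrI:
 assumes "rel G W y g" "mem C z F" "src C z = src C g" "W = U \<and> F = F0 \<or> W = V \<and> F = F1"
  "U \<in> rels G" "V \<in> rels G" "w \<in> els (src C g)"
  "prj F0 w (\<lambda>k c. c = z \<odot> k)" "prj F1 w (\<lambda>k c. c = y \<odot> k)"
 shows "rel G (orr G U V) w g"
proof -
 have g: "g \<in> arrs C" "tgt C g = G" "G \<in> objs C" "src C w = src C g" "w \<in> arrs C"
  using rel_arr[OF assms(1)] assms(7) by (auto simp: els_iff)
 have W: "W \<in> rels G" and F: "F \<in> subs C A" using assms(4-6) F_closed by auto
 have "prj F0 (w \<odot> k) (\<lambda>l c. mem C c F) \<and> prj F1 (w \<odot> k) (\<lambda>l c. rel G W c ((g \<odot> k) \<odot> l))"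
  if k: "k \<in> arrs C" "tgt C k = src C g" for k
 proof
  have k': "tgt C k = src C w" using k g by simp
  show "prj F0 (w \<odot> k) (\<lambda>l c. mem C c F)"
   by (rule prj_mono[OF prj_cmp[OF assms(8) k(1) k' g(5)]])
    (use mem_cmp[OF assms(2) F] k k' assms(3) g in auto)
  show "prj F1 (w \<odot> k) (\<lambda>l c. rel G W c ((g \<odot> k) \<odot> l))"
   by (rule prj_mono[OF prj_cmp[OF assms(9) k(1) k' g(5)]])
    (use rel_cmp[OF assms(1) W] k k' g in auto)
 qed
 then show ?thesis
  unfolding rel_orr[OF g(3) assms(5,6)] using g assms(4,7) by (auto intro!: cvr_now)
qed

text \<open>Injections pair the argument with the appropriate selector as tag. For elimination the
  tag is itself a selector, so it picks the realizer of the branch that has to be applied.\<close>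

lemma ent_orr:
 assumes "G \<in> objs C" "U \<in> rels G" "V \<in> rels G" "W \<in> rels G"
 shows "ent G (orr G U V) W \<longleftrightarrow> ent G U W \<and> ent G V W"
proof (intro iffI conjI)
 have c: "orr G U V \<in> rels G" using orr_closed assms by simp
 obtain P where P: "P \<in> \<phi>" "PROP pairs_up P" using pairing by blast
 \<comment> \<open>Both injections at once: \<open>F\<close> is the member of \<open>\<phi>\<close>
   that supplies the tag of \<open>D\<close>.\<close>
 have inj: "ent G D (orr G U V)" if D: "D = U \<and> F = F0 \<or> D = V \<and> F = F1" for D F
 proof (rule ent_by[of "[P, F]" "PA (PA (PV 0) (PV 1)) (PV 2)"])
  fix cs x g assume "ins C (src C g) cs [P, F]" and x: "rel G D x g"
  then obtain p z where cs: "cs = [p, z]" "mem C p P" "src C p = src C g" "mem C z F" "src C z = src C g" by auto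
  have "z \<in> els (src C g)" using D F_els cs by metis
  with P(2)[OF cs(2), of z x] rel_arr(6)[OF x] cs(3) obtain q w where w: "ap p z = Some q" "ap q x = Some w"
   "w \<in> els (src C g)" "prj F0 w (\<lambda>k c. c = z \<odot> k)" "prj F1 w (\<lambda>k c. c = x \<odot> k)"
   by auto
  have "rel G (orr G U V) w g"
   by (rule rel_orrI[OF x cs(4,5) D assms(2,3) w(3-5)])
  with w show "\<exists>v. peval (cs @ [x]) (PA (PA (PV 0) (PV 1)) (PV 2)) = Some v \<and> rel G (orr G U V) v g"
   by (simp add: cs(1) numeral_2_eq_2)
 qed (use assms P F_filter D c in auto)
 assume "ent G (orr G U V) W"
 then show "ent G U W" "ent G V W"
  using inj[of U F0] inj[of V F1] ent_trans assms by blast+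
next
 have c: "orr G U V \<in> rels G" using orr_closed assms by simp
 assume "ent G U W \<and> ent G V W"
 then have e: "ent G U W" "ent G V W" by auto
 obtain R1 where R1: "R1 \<in> \<phi>" "PROP realizes R1 G U W" using e(1) by (rule entE) blast
 obtain R2 where R2: "R2 \<in> \<phi>" "PROP realizes R2 G V W" using e(2) by (rule entE) blast
 \<comment> \<open>With parameters \<open>z0, z1, a, b\<close> and argument \<open>x\<close> this is
   \<open>((x z0) a b) (x z1)\<close>: the tag \<open>x z0\<close> chooses between the realizers
   \<open>a\<close> and \<open>b\<close>, and \<open>x z1\<close> is what the chosen one is applied
   to.\<close>
 let ?t = "PA (PA (PA (PA (PV 4) (PV 0)) (PV 2)) (PV 3)) (PA (PV 4) (PV 1))"
 let ?Fs = "[F0, F1, R1, R2]"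
 have Fs: "set ?Fs \<subseteq> \<phi>" using F_filter R1 R2 by simp
 show "ent G (orr G U V) W"
 proof (rule ent_by[of ?Fs ?t])
  fix cs x g assume ins: "ins C (src C g) cs ?Fs" and x: "rel G (orr G U V) x g"
  then obtain z0 z1 a b where cs: "cs = [z0, z1, a, b]" "mem C z0 F0" "src C z0 = src C g" "mem C z1 F1" "src C z1 = src C g"
   "mem C a R1" "src C a = src C g" "mem C b R2" "src C b = src C g" by auto
  note g = rel_arr[OF x]
  let ?P1 = "\<lambda>k. prj F0 (x \<odot> k) (\<lambda>l c. mem C c F0) \<and> prj F1 (x \<odot> k) (\<lambda>l c. rel G U c ((g \<odot> k) \<odot> l))"
  let ?P2 = "\<lambda>k. prj F0 (x \<odot> k) (\<lambda>l c. mem C c F1) \<and> prj F1 (x \<odot> k) (\<lambda>l c. rel G V c ((g \<odot> k) \<odot> l))"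
  have cov: "cvr C (src C g) (\<lambda>k. ?P1 k \<or> ?P2 k)"
   using x unfolding rel_orr[OF assms(1-3)] by blast
  show "\<exists>v. peval (cs @ [x]) ?t = Some v \<and> rel G W v g"
  \<comment> \<open>Which disjunct is realized is known only on a cover, but the polynomial is the
    same for both.\<close>
  proof (rule peval_rel_local[OF _ _ cov])
   show "set (cs @ [x]) \<subseteq> els (src C g)"
    using ins_els[OF ins Fs] g by simp
   show "pvars_below (length (cs @ [x])) ?t" by (simp add: cs(1))
   fix k assume k: "k \<in> arrs C" "tgt C k = src C g" and P: "?P1 k \<or> ?P2 k"
   have mem: "mem C (z0 \<odot> k) F0" "mem C (z1 \<odot> k) F1" "mem C (a \<odot> k) R1" "mem C (b \<odot> k) R2"
    using mem_cmp[OF cs(2) F_closed(1) k(1)] mem_cmp[OF cs(4) F_closed(2) k(1)]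
     mem_cmp[OF cs(6) filter_carrier[OF R1(1)] k(1)] mem_cmp[OF cs(8) filter_carrier[OF R2(1)] k(1)] k(2) cs by auto
   have s: "src C (z0 \<odot> k) = src C k" "src C (z1 \<odot> k) = src C k" "src C (a \<odot> k) = src C k" "src C (b \<odot> k) = src C k"
    "src C (x \<odot> k) = src C k" "src C (g \<odot> k) = src C k" "x \<odot> k \<in> arrs C" "g \<odot> k \<in> arrs C"
    using k cs g mem_arr by auto
   have ab: "a \<odot> k \<in> els (src C k)" "b \<odot> k \<in> els (src C k)"
    using filter_els[OF mem(3) R1(1)] filter_els[OF mem(4) R2(1)] s by auto
   have sel: "\<exists>v. ap (x \<odot> k) (z0 \<odot> k) = Some v \<and> mem C v F \<and> src C v = src C k"
    if "prj F0 (x \<odot> k) (\<lambda>l c. mem C c F)" for F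
    using prjD[OF that mem(1)] s apD(5) by fastforce
   have val: "\<exists>v. ap (x \<odot> k) (z1 \<odot> k) = Some v \<and> rel G D v (g \<odot> k)"
    if "prj F1 (x \<odot> k) (\<lambda>l c. rel G D c ((g \<odot> k) \<odot> l))" for D
    using prjD[OF that mem(2)] s by simp
   from P show "\<exists>v. peval (map (\<lambda>y. y \<odot> k) (cs @ [x])) ?t = Some v \<and> rel G W v (g \<odot> k)"
   proof
    assume P: "?P1 k"
    then obtain c d where c: "ap (x \<odot> k) (z0 \<odot> k) = Some c" "mem C c F0" "src C c = src C k"
     and d: "ap (x \<odot> k) (z1 \<odot> k) = Some d" "rel G U d (g \<odot> k)"
     using sel val by blast
    have "apl c [a \<odot> k, b \<odot> k] = Some (a \<odot> k)"
     by (rule F_apply(1)) (use ab c in auto)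
    moreover obtain v where "ap (a \<odot> k) d = Some v" "rel G W v (g \<odot> k)"
     using R1(2)[OF mem(3) _ d(2)] s by auto
    ultimately show ?thesis
     using c d by (auto simp: cs(1) eval_nat_numeral split: option.splits)
   next
    assume P: "?P2 k"
    then obtain c d where c: "ap (x \<odot> k) (z0 \<odot> k) = Some c" "mem C c F1" "src C c = src C k"
     and d: "ap (x \<odot> k) (z1 \<odot> k) = Some d" "rel G V d (g \<odot> k)"
     using sel val by blast
    have "apl c [a \<odot> k, b \<odot> k] = Some (b \<odot> k)"
     by (rule F_apply(2)) (use ab c in auto)
    moreover obtain v where "ap (b \<odot> k) d = Some v" "rel G W v (g \<odot> k)"
     using R2(2)[OF mem(4) _ d(2)] s by auto
    ultimately show ?thesis
     using c d by (auto simp: cs(1) eval_nat_numeral split: option.splits)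
   qed
  qed (use g assms in auto)
 qed (use Fs assms c in auto)
qed

text \<open>Wherever \<open>U\<close> has an element the empty family covers, so locality leaves
  nothing to check. Any member of \<open>\<phi>\<close> would serve; \<open>F0\<close> is one at
  hand.\<close>

lemma ent_bot:
 assumes "U \<in> rels G" "V \<in> rels G" "\<And>a g. rel G U a g \<Longrightarrow> cvr C (src C g) (\<lambda>k. False)"
 shows "ent G U V"
 unfolding ent_def
proof (intro bexI[OF _ F_filter(1)] allI impI)
 fix r x g assume r: "mem C r F0" "src C r = src C g" and x: "rel G U x g"
 show "\<exists>v. ap r x = Some v \<and> rel G V v g"
  by (rule ap_rel_local[OF _ _ _ _ _ assms(2) assms(3)[OF x]])
   (use r x rel_arr[OF x] F_els(1)[OF r(1)] in auto)
qed

lemma ent_reix: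
 assumes "ent G U V" "f \<in> arrs C" "src C f = P" "tgt C f = G" "U \<in> rels G" "V \<in> rels G"
 shows "ent P (reix f U) (reix f V)"
proof -
 obtain R where R: "R \<in> \<phi>" "PROP realizes R G U V" using assms(1) by (rule entE) blast
 show ?thesis
  unfolding ent_def
 proof (intro bexI[OF _ R(1)] allI impI)
  fix r x g assume r: "mem C r R" "src C r = src C g" and "rel P (reix f U) x g"
  then have g: "g \<in> arrs C" "tgt C g = P" "rel G U x (f \<odot> g)"
   using rel_reix'[OF assms(2-5)] by auto
  have "src C (f \<odot> g) = src C g" using assms g by simp
  then show "\<exists>v. ap r x = Some v \<and> rel P (reix f V) v g"
   using R(2)[OF r(1) _ g(3)] r(2) g rel_reix'[OF assms(2-4,6)] by simp
 qed
qed

text \<open>The same \<open>R\<close> works on both sides. An element of the image has a preimage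
  under \<open>q\<close> on a cover, and being mapped by \<open>R\<close> to a realizer is
  local.\<close>

lemma ent_im:
 assumes q: "q \<in> arrs C" "src C q = P" "tgt C q = G" and W: "W \<in> rels P" and U: "U \<in> rels G"
 shows "ent G (im q W) U \<longleftrightarrow> ent P W (reix q U)"
proof
 have rel: "rel G (im q W) a g \<longleftrightarrow> a \<in> els (src C g) \<and> g \<in> arrs C \<and> tgt C g = G \<and>
   cvr C (src C g) (\<lambda>k. \<exists>z. q \<odot> z = g \<odot> k \<and> rel P W (a \<odot> k) z)" for a g
  using rel_im[of q W a g] q W by simp
 {
  assume "ent G (im q W) U"
  then obtain R where R: "R \<in> \<phi>" "PROP realizes R G (im q W) U" by (rule entE) blast
  show "ent P W (reix q U)"
   unfolding ent_def
  proof (intro bexI[OF _ R(1)] allI impI)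
   fix r x z assume r: "mem C r R" "src C r = src C z" and x: "rel P W x z"
   note z = rel_arr[OF x]
   have s: "src C (q \<odot> z) = src C z" using z q by simp
   have "rel G (im q W) x (q \<odot> z)"
    unfolding rel
   proof (intro conjI cvr_now)
    fix h assume h: "h \<in> arrs C" "tgt C h = src C (q \<odot> z)"
    then have "q \<odot> (z \<odot> h) = (q \<odot> z) \<odot> h" "rel P W (x \<odot> h) (z \<odot> h)"
     using z q s rel_cmp[OF x W] by auto
    then show "\<exists>y. q \<odot> y = (q \<odot> z) \<odot> h \<and> rel P W (x \<odot> h) y" by blast
   qed (use z q in auto)
   then show "\<exists>v. ap r x = Some v \<and> rel P (reix q U) v z"
    using R(2)[OF r(1), of "q \<odot> z" x] r(2) s z rel_reix'[OF q U] by simp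
  qed
 }
 assume "ent P W (reix q U)"
 then obtain R where R: "R \<in> \<phi>" "PROP realizes R P W (reix q U)" by (rule entE) blast
 show "ent G (im q W) U"
  unfolding ent_def
 proof (intro bexI[OF _ R(1)] allI impI)
  fix r x g assume r: "mem C r R" "src C r = src C g" and x: "rel G (im q W) x g"
  note g = rel_arr[OF x]
  have cov: "cvr C (src C g) (\<lambda>k. \<exists>z. q \<odot> z = g \<odot> k \<and> rel P W (x \<odot> k) z)"
   using x unfolding rel by blast
  show "\<exists>v. ap r x = Some v \<and> rel G U v g"
  proof (rule ap_rel_local[OF _ _ _ _ _ U cov])
   fix k assume k: "k \<in> arrs C" "tgt C k = src C g" and "\<exists>z. q \<odot> z = g \<odot> k \<and> rel P W (x \<odot> k) z"
   then obtain z where z: "q \<odot> z = g \<odot> k" "rel P W (x \<odot> k) z" by blast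
   have "mem C (r \<odot> k) R" by (rule mem_cmp[OF r(1) filter_carrier[OF R(1)] k(1)]) (use k r in simp)
   moreover have "src C (r \<odot> k) = src C z"
    using rel_arr(3)[OF z(2)] mem_arr[OF r(1)] k r g by simp
   ultimately have "\<exists>v. ap (r \<odot> k) (x \<odot> k) = Some v \<and> rel P (reix q U) v z"
    using R(2) z(2) by blast
   then show "\<exists>v. ap (r \<odot> k) (x \<odot> k) = Some v \<and> rel G U v (g \<odot> k)"
    using rel_reix'[OF q U] z(1) by auto
  qed (use g r filter_els[OF r(1) R(1)] in auto)
 qed
qed

text \<open>Currying. From left to right the realizer is applied to a pair built from its two
  arguments; since the partial application to the first argument must exist, the full strength of
  \<open>realizer\<close> for two arguments is needed. The converse applies the curried realizer to
  the two projections.\<close>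

lemma ent_all:
 assumes q: "q \<in> arrs C" "src C q = P" "tgt C q = G" and W: "W \<in> rels P" "V \<in> rels P" and U: "U \<in> rels G"
 shows "ent P (pairs P (reix q U) W) V \<longleftrightarrow> ent G U (all q W V)"
proof
 have o: "P \<in> objs C" "G \<in> objs C" using q by auto
 have rU: "reix q U \<in> rels P" using reix_closed' q U by simp
 have rel: "rel G (all q W V) a g \<longleftrightarrow> a \<in> els (src C g) \<and> g \<in> arrs C \<and> tgt C g = G \<and>
   (\<forall>k \<in> arrs C. tgt C k = src C g \<longrightarrow> (\<forall>b z. q \<odot> z = g \<odot> k \<longrightarrow> src C z = src C k \<longrightarrow> rel P W b z \<longrightarrow>
    (\<exists>c. ap (a \<odot> k) b = Some c \<and> rel P V c z)))" for a g
  using rel_all[of q W V a g] q W by simp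
 {
  assume "ent P (pairs P (reix q U) W) V"
  then obtain R where R: "R \<in> \<phi>" "PROP realizes R P (pairs P (reix q U) W) V" by (rule entE) blast
  obtain Q where Q: "Q \<in> \<phi>" "PROP pairs_up Q" using pairing by blast
  \<comment> \<open>With parameters \<open>r, p\<close> and arguments \<open>u, b\<close> this is
    \<open>r (p u b)\<close>, where \<open>p\<close> forms the pair.\<close>
  let ?t = "PA (PV 0) (PA (PA (PV 1) (PV 2)) (PV 3))"
  let ?H = "\<lambda>xs z. \<exists>u b. xs = [u, b] \<and> rel P (reix q U) u z \<and> rel P W b z"
  obtain E where E: "E \<in> \<phi>"
   and E1: "\<And>r xs. mem C r E \<Longrightarrow> set xs \<subseteq> els (src C r) \<Longrightarrow> length xs < 2 \<Longrightarrow> apl r xs \<noteq> None"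
   and E2: "\<And>r xs z. mem C r E \<Longrightarrow> set xs \<subseteq> els (src C r) \<Longrightarrow> length xs = 2 \<Longrightarrow> z \<in> arrs C \<Longrightarrow>
    src C z = src C r \<Longrightarrow> tgt C z = P \<Longrightarrow> ?H xs z \<Longrightarrow> \<exists>v. apl r xs = Some v \<and> rel P V v z"
  proof (rule realizer[of "[R, Q]" 2 ?t V P ?H])
   show "set [R, Q] \<subseteq> \<phi>" using R Q by simp
   show "?H (map (\<lambda>x. x \<odot> k) xs) (z \<odot> k)" if "?H xs z" "k \<in> arrs C" "tgt C k = src C z" for xs z k
    using that rel_cmp[OF _ rU] rel_cmp[OF _ W(1)] by auto
   fix cs xs z assume "ins C (src C z) cs [R, Q]" and "?H xs z"
   then obtain r p u b where cs: "cs = [r, p]" "mem C r R" "src C r = src C z" "mem C p Q" "src C p = src C z"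
    and xs: "xs = [u, b]" "rel P (reix q U) u z" "rel P W b z" by auto
   from Q(2)[OF cs(4), of u b] obtain s w where w: "ap p u = Some s" "ap s b = Some w"
    "w \<in> els (src C z)" "prj F0 w (\<lambda>k c. c = u \<odot> k)" "prj F1 w (\<lambda>k c. c = b \<odot> k)"
    using rel_arr(6)[OF xs(2)] rel_arr(6)[OF xs(3)] cs(5) by auto
   have "rel P (pairs P (reix q U) W) w z"
    by (rule rel_pairsI[OF xs(2,3) rU W(1) w(3-5)])
   then obtain v where "ap r w = Some v" "rel P V v z"
    using R(2) cs by blast
   with w show "\<exists>v. peval (cs @ xs) ?t = Some v \<and> rel P V v z"
    by (simp add: cs(1) xs(1) eval_nat_numeral)
  qed (use W in auto)
  show "ent G U (all q W V)"
   unfolding ent_def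
  proof (intro bexI[OF _ E] allI impI)
   fix r u g assume r: "mem C r E" "src C r = src C g" and u: "rel G U u g"
   note g = rel_arr[OF u]
   have rT: "r \<in> els (src C g)" using filter_els[OF r(1) E] r(2) by simp
   obtain w where w: "ap r u = Some w"
    using E1[OF r(1), of "[u]"] g r(2) by (auto split: option.splits)
   have wT: "w \<in> els (src C g)" by (rule ap_els[OF w g(6)])
   have "rel G (all q W V) w g"
    unfolding rel
   proof (intro conjI ballI impI allI)
    fix k b z assume k: "k \<in> arrs C" "tgt C k = src C g" and z: "q \<odot> z = g \<odot> k" "src C z = src C k" and b: "rel P W b z"
    note z' = rel_arr[OF b]
    have rk: "mem C (r \<odot> k) E" by (rule mem_cmp[OF r(1) filter_carrier[OF E] k(1)]) (use k r in simp)
    have uk: "rel P (reix q U) (u \<odot> k) z"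
     unfolding rel_reix'[OF q U] z(1) using z' rel_cmp[OF u U k] by simp
    have s: "src C z = src C (r \<odot> k)" using rT k z by (simp add: els_iff)
    have "\<exists>v. apl (r \<odot> k) [u \<odot> k, b] = Some v \<and> rel P V v z"
    proof (rule E2[OF rk _ _ z'(2) s z'(5)])
     show "set [u \<odot> k, b] \<subseteq> els (src C (r \<odot> k))"
      using rel_arr(6)[OF uk] z'(6) unfolding s by simp
     show "?H [u \<odot> k, b] z" using uk b by blast
    qed simp
    then obtain v where v: "apl (r \<odot> k) [u \<odot> k, b] = Some v" "rel P V v z"
     by blast
    have "ap (r \<odot> k) (u \<odot> k) = Some (w \<odot> k)"
     by (rule ap_cmp[OF w]) (use k g in auto)
    with v show "\<exists>c. ap (w \<odot> k) b = Some c \<and> rel P V c z"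
     by (auto split: option.splits)
   qed (use g wT in auto)
   with w show "\<exists>v. ap r u = Some v \<and> rel G (all q W V) v g" by blast
  qed
 }
 assume "ent G U (all q W V)"
 then obtain R where R: "R \<in> \<phi>" "PROP realizes R G U (all q W V)" by (rule entE) blast
 \<comment> \<open>With parameters \<open>r, z0, z1\<close> and argument \<open>x\<close> this is
   \<open>(r (x z0)) (x z1)\<close>.\<close>
 let ?t = "PA (PA (PV 0) (PA (PV 3) (PV 1))) (PA (PV 3) (PV 2))"
 show "ent P (pairs P (reix q U) W) V"
 proof (rule ent_by[of "[R, F0, F1]" ?t])
  fix cs x z assume "ins C (src C z) cs [R, F0, F1]" and x: "rel P (pairs P (reix q U) W) x z"
  then obtain r z0 z1 where cs: "cs = [r, z0, z1]" "mem C r R" "src C r = src C z" "mem C z0 F0" "src C z0 = src C z"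
   "mem C z1 F1" "src C z1 = src C z" by auto
  obtain u where u: "ap x z0 = Some u" "rel P (reix q U) u z"
   using rel_pairsD(1)[OF x rU W(1) cs(5,4)] by blast
  obtain b where b: "ap x z1 = Some b" "rel P W b z"
   using rel_pairsD(2)[OF x rU W(1) cs(7,6)] by blast
  note z = rel_arr[OF b(2)]
  have u': "rel G U u (q \<odot> z)" using u(2) rel_reix'[OF q U] by simp
  have s: "src C (q \<odot> z) = src C z" using z q by simp
  obtain w where w: "ap r u = Some w" "rel G (all q W V) w (q \<odot> z)"
   using R(2)[OF cs(2) _ u'] cs(3) s by auto
  have "w \<in> arrs C" "src C w = src C z" using rel_arr[OF w(2)] s by auto
  then have "\<exists>c. ap w b = Some c \<and> rel P V c z"
   using w(2)[unfolded rel, THEN conjunct2, THEN conjunct2, THEN conjunct2, rule_format, of "idn C (src C z)" z b]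
    b(2) z q s by simp
  with u b w show "\<exists>v. peval (cs @ [x]) ?t = Some v \<and> rel P V v z"
   by (auto simp: cs(1) eval_nat_numeral)
 qed (use R F_filter W rU o pairs_closed in auto)
qed

text \<open>Applied to the existence predicate, this is the condition on assemblies in forcing
  form.\<close>

definition tot :: "'o \<Rightarrow> 'm set \<Rightarrow> bool" where
 "tot G V \<longleftrightarrow> (\<forall>g \<in> arrs C. tgt C g = G \<longrightarrow> cvr C (src C g) (\<lambda>k. \<exists>a. rel G V a (g \<odot> k)))"

text \<open>Members of \<open>\<phi>\<close> are inhabited, so any cover can be refined until an
  element of \<open>R\<close> is available on each of its arrows.\<close>

lemma cvr_exists_filter:
 assumes "R \<in> \<phi>" "cvr C T P" "\<And>k r. k \<in> arrs C \<Longrightarrow> tgt C k = T \<Longrightarrow> P k \<Longrightarrow> mem C r R \<Longrightarrow> src C r = src C k \<Longrightarrow> P' k"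
  and stable: "\<And>k l. k \<in> arrs C \<Longrightarrow> tgt C k = T \<Longrightarrow> P k \<Longrightarrow> l \<in> arrs C \<Longrightarrow> tgt C l = src C k \<Longrightarrow> P (k \<odot> l)"
 shows "cvr C T P'"
proof (rule cvr_bind[OF assms(2)])
 fix k assume k: "k \<in> arrs C" "tgt C k = T" "P k"
 show "cvr C (src C k) (\<lambda>l. P' (k \<odot> l))"
 proof (rule cvr_mono[OF filter_inhabited[OF assms(1)]])
  fix l assume l: "l \<in> arrs C" "tgt C l = src C k" "\<exists>r. mem C r R \<and> src C r = src C l"
  then show "P' (k \<odot> l)"
   using k stable[OF k l(1,2)] assms(3)[of "k \<odot> l"] by auto
 qed (use k in simp)
qed

lemma tot_ent:
 assumes "tot G U" "ent G U V" "U \<in> rels G"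
 shows "tot G V"
 unfolding tot_def
proof (intro ballI impI)
 fix g assume g: "g \<in> arrs C" "tgt C g = G"
 obtain R where R: "R \<in> \<phi>" "PROP realizes R G U V" using assms(2) by (rule entE) blast
 have c: "cvr C (src C g) (\<lambda>k. \<exists>a. rel G U a (g \<odot> k))"
  using assms(1) g unfolding tot_def by blast
 show "cvr C (src C g) (\<lambda>k. \<exists>a. rel G V a (g \<odot> k))"
 proof (rule cvr_exists_filter[OF R(1) c])
  fix k r assume k: "k \<in> arrs C" "tgt C k = src C g" "\<exists>a. rel G U a (g \<odot> k)" and r: "mem C r R" "src C r = src C k"
  then obtain a where a: "rel G U a (g \<odot> k)" by blast
  have "src C r = src C (g \<odot> k)" using r k g by simp
  from R(2)[OF r(1) this a] show "\<exists>a. rel G V a (g \<odot> k)" by blast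
 next
  fix k l assume k: "k \<in> arrs C" "tgt C k = src C g" "\<exists>a. rel G U a (g \<odot> k)" and l: "l \<in> arrs C" "tgt C l = src C k"
  then obtain a where "rel G U a (g \<odot> k)" by blast
  from rel_cmp[OF this assms(3) l(1)] k l g show "\<exists>a. rel G U a (g \<odot> (k \<odot> l))" by auto
 qed
qed

lemma tot_pairs:
 assumes "tot G U" "tot G V" "U \<in> rels G" "V \<in> rels G" "G \<in> objs C"
 shows "tot G (pairs G U V)"
 unfolding tot_def
proof (intro ballI impI)
 fix g assume g: "g \<in> arrs C" "tgt C g = G"
 obtain Q where Q: "Q \<in> \<phi>" "PROP pairs_up Q" using pairing by blast
 let ?P = "\<lambda>k. (\<exists>a. rel G U a (g \<odot> k)) \<and> (\<exists>b. rel G V b (g \<odot> k))"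
 have cU: "cvr C (src C g) (\<lambda>k. \<exists>a. rel G U a (g \<odot> k))"
  and cV: "cvr C (src C g) (\<lambda>k. \<exists>a. rel G V a (g \<odot> k))"
  using assms(1,2) g unfolding tot_def by blast+
 have st: "\<exists>a. rel G W a (g \<odot> (k \<odot> l))" if "\<exists>a. rel G W a (g \<odot> k)" "W \<in> rels G" "k \<in> arrs C" "tgt C k = src C g"
  "l \<in> arrs C" "tgt C l = src C k" for W k l
 proof -
  from that(1) obtain a where "rel G W a (g \<odot> k)" by blast
  from rel_cmp[OF this that(2,5)] that g show ?thesis by auto
 qed
 have c: "cvr C (src C g) ?P"
 proof (rule cvr_bind[OF cU])
  fix k assume k: "k \<in> arrs C" "tgt C k = src C g" "\<exists>a. rel G U a (g \<odot> k)"
  show "cvr C (src C k) (\<lambda>l. ?P (k \<odot> l))"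
   by (rule cvr_mono[OF cvr_stable[OF cV k(1,2)]]) (use k st[OF k(3) assms(3) k(1,2)] in auto)
 qed
 show "cvr C (src C g) (\<lambda>k. \<exists>a. rel G (pairs G U V) a (g \<odot> k))"
 proof (rule cvr_exists_filter[OF Q(1) c])
  fix k p assume k: "k \<in> arrs C" "tgt C k = src C g" "?P k" and p: "mem C p Q" "src C p = src C k"
  then obtain a b where ab: "rel G U a (g \<odot> k)" "rel G V b (g \<odot> k)" by blast
  have s: "src C (g \<odot> k) = src C k" using g k by simp
  from Q(2)[OF p(1), of a b] obtain w where w: "w \<in> els (src C (g \<odot> k))"
   "prj F0 w (\<lambda>k c. c = a \<odot> k)" "prj F1 w (\<lambda>k c. c = b \<odot> k)"
   using rel_arr(6)[OF ab(1)] rel_arr(6)[OF ab(2)] p(2) s by auto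
  show "\<exists>a. rel G (pairs G U V) a (g \<odot> k)"
   using rel_pairsI[OF ab assms(3,4) w] by blast
 qed (use st assms in auto)
qed

end

section \<open>Assemblies and their subobjects\<close>

lemma Asm_simps [simp]:
 "objs (Asm C S \<phi>) = {X. is_asm C S X}"
 "src (Asm C S \<phi>) f = fst f"
 "tgt (Asm C S \<phi>) f = snd (snd f)"
 "idn (Asm C S \<phi>) X = (X, idn C (und X), X)"
 "g \<odot>\<^bsub>Asm C S \<phi>\<^esub> f = (fst f, fst (snd g) \<odot>\<^bsub>C\<^esub> fst (snd f), snd (snd g))"
 by (auto simp: Asm_def split: prod.splits)

context pca_filter
begin

abbreviation "AS \<equiv> Asm C S \<phi>"

text \<open>Every element of \<open>A \<times> G\<close> is a pair. Hence laws such as those of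
  reindexing hold as equations that can be used for rewriting, and not merely up to mutual
  entailment.\<close>

lemma rels_eqI:
 assumes U: "U \<in> rels G" and V: "V \<in> rels G" and "G \<in> objs C"
  and *: "\<And>a g. rel G U a g \<longleftrightarrow> rel G V a g"
 shows "U = V"
proof (rule sub_eqI[OF U V])
 fix x
 have "mem C x W \<longleftrightarrow> x \<in> arrs C \<and> tgt C x = prd C A G \<and> rel G W (pr1 C A G \<odot> x) (pr2 C A G \<odot> x)"
  if W: "W \<in> rels G" for W
 proof (cases "x \<in> arrs C \<and> tgt C x = prd C A G")
  case True
  then show ?thesis
   using pair_eta[of A G x] assms(3) by (simp add: rel_def)
 next
  case False
  then show ?thesis using mem_tgt[OF _ W] by auto
 qed
 with U V * show "mem C x U \<longleftrightarrow> mem C x V" by simp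
qed

lemma reix_idn:
 assumes "V \<in> rels G" "G \<in> objs C"
 shows "reix (idn C G) V = V"
proof (rule rels_eqI[OF _ assms])
 have i: "idn C G \<in> arrs C" "src C (idn C G) = G" "tgt C (idn C G) = G" using assms(2) by auto
 show "reix (idn C G) V \<in> rels G" by (rule reix_closed'[OF i assms(1)])
 fix a g
 show "rel G (reix (idn C G) V) a g \<longleftrightarrow> rel G V a g"
  unfolding rel_reix'[OF i assms(1)] using rel_arr(2,5)[of G V a g] by auto
qed

lemma reix_cmp:
 assumes "f \<in> arrs C" "g \<in> arrs C" "tgt C f = src C g" "tgt C g = G" "V \<in> rels G"
 shows "reix (g \<odot> f) V = reix f (reix g V)"
proof (rule rels_eqI)
 have c: "reix g V \<in> rels (src C g)" using reix_closed' assms by simp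
 show "reix (g \<odot> f) V \<in> rels (src C f)" "reix f (reix g V) \<in> rels (src C f)"
  using reix_closed'[of "g \<odot> f" "src C f" G V] reix_closed'[OF assms(1) refl assms(3) c] assms by auto
 show "rel (src C f) (reix (g \<odot> f) V) a x \<longleftrightarrow> rel (src C f) (reix f (reix g V)) a x" for a x
  using rel_reix'[of "g \<odot> f" "src C f" G V a x] rel_reix'[OF assms(1) refl assms(3) c, of a x]
   rel_reix'[of g "src C g" G V a "f \<odot> x"] assms by auto
qed (use assms in auto)

lemma reix_pairs:
 assumes "f \<in> arrs C" "src C f = P" "tgt C f = G" "U \<in> rels G" "V \<in> rels G"
 shows "reix f (pairs G U V) = pairs P (reix f U) (reix f V)"
proof (rule rels_eqI)
 have o: "P \<in> objs C" "G \<in> objs C" using assms by auto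
 have c: "reix f U \<in> rels P" "reix f V \<in> rels P" "pairs G U V \<in> rels G"
  using reix_closed'[OF assms(1-3)] assms o pairs_closed by auto
 show "reix f (pairs G U V) \<in> rels P" "pairs P (reix f U) (reix f V) \<in> rels P" "P \<in> objs C"
  using reix_closed'[OF assms(1-3) c(3)] pairs_closed[OF o(1) c(1,2)] o by auto
 fix a g
 have "prj Z a (\<lambda>k c. rel G W c ((f \<odot> g) \<odot> k)) \<longleftrightarrow> prj Z a (\<lambda>k c. rel P (reix f W) c (g \<odot> k))"
  if "W \<in> rels G" "g \<in> arrs C" "tgt C g = P" "src C a = src C g" for W Z
 proof -
  have "rel G W c ((f \<odot> g) \<odot> k) \<longleftrightarrow> rel P (reix f W) c (g \<odot> k)"
   if "k \<in> arrs C" "tgt C k = src C a" for k c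
   using rel_reix'[OF assms(1-3) \<open>W \<in> rels G\<close>, of c "g \<odot> k"] that \<open>g \<in> arrs C\<close> \<open>tgt C g = P\<close> \<open>src C a = src C g\<close> assms(1-3)
   by simp
  then show ?thesis unfolding prj_def by auto
 qed
 then show "rel P (reix f (pairs G U V)) a g \<longleftrightarrow> rel P (pairs P (reix f U) (reix f V)) a g"
  unfolding rel_reix'[OF assms(1-3) c(3)] rel_pairs[OF o(2) assms(4,5)] rel_pairs[OF o(1) c(1,2)]
  using assms by (auto simp: els_iff)
qed

lemma ent_incl:
 assumes "U \<in> rels G" "V \<in> rels G" "\<And>a g. rel G U a g \<Longrightarrow> rel G V a g"
 shows "ent G U V"
 by (rule ent_by[of "[]" "PV 0"]) (use assms in auto)

lemma tot_reix:
 assumes "tot G V" "f \<in> arrs C" "src C f = P" "tgt C f = G" "V \<in> rels G"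
 shows "tot P (reix f V)"
 unfolding tot_def
proof (intro ballI impI)
 fix g assume g: "g \<in> arrs C" "tgt C g = P"
 have "cvr C (src C (f \<odot> g)) (\<lambda>k. \<exists>a. rel G V a ((f \<odot> g) \<odot> k))"
  using assms(1)[unfolded tot_def, rule_format, of "f \<odot> g"] g assms(2-4) by simp
 then have "cvr C (src C g) (\<lambda>k. \<exists>a. rel G V a ((f \<odot> g) \<odot> k))"
  using g assms(2-4) by simp
 then show "cvr C (src C g) (\<lambda>k. \<exists>a. rel P (reix f V) a (g \<odot> k))"
 proof (rule cvr_mono)
  fix k assume "k \<in> arrs C" "tgt C k = src C g" "\<exists>a. rel G V a ((f \<odot> g) \<odot> k)"
  then show "\<exists>a. rel P (reix f V) a (g \<odot> k)"
   using rel_reix'[OF assms(2-5)] g assms(2-4) by auto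
 qed
qed

lemma asm_iff: "is_asm C S X \<longleftrightarrow> und X \<in> objs C \<and> rlz X \<in> rels (und X) \<and> tot (und X) (rlz X)"
proof -
 let ?X = "und X"
 let ?m = "FRel ?X (rlz X) (rv 0) (rv 1) :: ('o, 'm) bfml"
 let ?q = "FEx (Inl 0) A ?m"
 let ?vs = "[(Inl 1, ?X)] :: ((nat + nat) \<times> 'o) list"
 have "holds C (FAll (Inl 1) ?X ?q) \<longleftrightarrow> tot ?X (rlz X)" if o: "?X \<in> objs C" and r: "rlz X \<in> rels ?X"
 proof -
  have wfm: "wf_fml C [Inl 1 \<mapsto> ?X, Inl 0 \<mapsto> A] ?m"
   by (rule wf_pair) (use o r in auto)
  have wfq: "wf_fml C (upds (env_sort C Map.empty) ?vs (map snd ?vs)) ?q"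
   using wfm by simp
  have wf: "wf_fml C Map.empty (FAll (Inl 1) ?X ?q)"
   using wfq o by simp
  have F: "force C ?q T [Inl 1 \<mapsto> x] \<longleftrightarrow> cvr C T (\<lambda>k. \<exists>a. rel ?X (rlz X) a (x \<odot> k))"
   if x: "x \<in> arrs C" "src C x = T" "tgt C x = ?X" for T x
   unfolding force.simps(8)
  proof (rule cvr_cong)
   fix k assume k: "k \<in> arrs C" "tgt C k = T"
   have "force C ?m (src C k) ((sb C k [Inl 1 \<mapsto> x])(Inl 0 \<mapsto> a)) \<longleftrightarrow> rel ?X (rlz X) a (x \<odot> k)"
    if "a \<in> els (src C k)" for a
    using force_pair[of "src C k" "[Inl 1 \<mapsto> x \<odot> k, Inl 0 \<mapsto> a]" "rv 0" "rv 1" ?X "rlz X"] x k that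
    by (simp add: els_iff)
   moreover have "rel ?X (rlz X) a (x \<odot> k) \<Longrightarrow> a \<in> els (src C k)" for a
    using x k by (auto simp: rel_def els_iff)
   ultimately show "(\<exists>a\<in>arrs C. src C a = src C k \<and> tgt C a = A \<and>
     force C ?m (src C k) ((sb C k [Inl 1 \<mapsto> x])(Inl 0 \<mapsto> a))) \<longleftrightarrow> (\<exists>a. rel ?X (rlz X) a (x \<odot> k))"
    by (auto simp: els_iff)
  qed
  have "holds C (FAll (Inl 1) ?X ?q) \<longleftrightarrow> force C (FAlls ?vs ?q) (one C) Map.empty"
   using holds_iff[OF wf] by simp
  also have "\<dots> \<longleftrightarrow> tot ?X (rlz X)"
   unfolding force_FAlls[OF one_obj env_typed_empty wfq] all_ok_args upds.simps sb_empty
    all_stages[of "\<lambda>T. \<forall>a. a \<in> arrs C \<longrightarrow> src C a = T \<longrightarrow> tgt C a = ?X \<longrightarrow> force C ?q T [Inl 1 \<mapsto> a]"] tot_def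
   using F src_obj by blast
  finally show ?thesis .
 qed
 then show ?thesis
  unfolding is_asm_def by blast
qed

lemma asmD:
 assumes "is_asm C S X"
 shows "und X \<in> objs C" "rlz X \<in> rels (und X)" "tot (und X) (rlz X)"
 using assms by (auto simp: asm_iff)

lemma tracks_iff:
 assumes R: "R \<in> subs C A" and X: "is_asm C S X" and Y: "is_asm C S Y"
  and f: "f \<in> arrs C" "src C f = und X" "tgt C f = und Y"
 shows "tracks C S R X f Y \<longleftrightarrow> (\<forall>r x g. mem C r R \<longrightarrow> src C r = src C g \<longrightarrow> rel (und X) (rlz X) x g \<longrightarrow>
  (\<exists>v. ap r x = Some v \<and> rel (und Y) (rlz Y) v (f \<odot> g)))"
proof -
 note X' = asmD[OF X] and Y' = asmD[OF Y]
 let ?vs = "[(Inl 0, A), (Inl 1, A), (Inl 2, und X)] :: ((nat + nat) \<times> 'o) list"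
 let ?p = "FAnd (FMem A R (rv 0)) (FRel (und X) (rlz X) (rv 1) (rv 2)) :: ('o, 'm) bfml"
 let ?q = "dot C S 3 (rv 0) (rv 1) (\<lambda>c. FRel (und Y) (rlz Y) c (TApp f (rv 2)))"
 let ?\<Gamma> = "[Inl 0 \<mapsto> A, Inl 1 \<mapsto> A, Inl 2 \<mapsto> und X] :: nat + nat \<rightharpoonup> 'o"
 have s: "has_sort C ?\<Gamma> (TApp f (rv 2)) (und Y)" "below 3 (TApp f (rv 2))" using f by auto
 have "wf_fml C ?\<Gamma> ?p"
  using R X' wf_pair[of ?\<Gamma> "rv 1" "rv 2" "und X" "rlz X"] by simp
 then have wfi: "wf_fml C (upds (env_sort C Map.empty) ?vs (map snd ?vs)) (FImp ?p ?q)"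
  using wf_dot_rel[OF _ _ s(1) _ _ s(2) Y'(1,2), of "rv 0" "rv 1"] by simp
 then have wf: "wf_fml C Map.empty (FAlls ?vs (FImp ?p ?q))"
  unfolding wf_FAlls using X' by simp
 have F: "(force C ?p T [Inl 0 \<mapsto> r, Inl 1 \<mapsto> b, Inl 2 \<mapsto> x] \<longleftrightarrow> mem C r R \<and> rel (und X) (rlz X) b x) \<and>
  (force C ?q T [Inl 0 \<mapsto> r, Inl 1 \<mapsto> b, Inl 2 \<mapsto> x] \<longleftrightarrow> (\<exists>v. ap r b = Some v \<and> rel (und Y) (rlz Y) v (f \<odot> x)))"
  if "r \<in> arrs C" "src C r = T" "tgt C r = A" "b \<in> arrs C" "src C b = T" "tgt C b = A"
   "x \<in> arrs C" "src C x = T" "tgt C x = und X" for r b x T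
 proof -
  let ?e = "[Inl 0 \<mapsto> r, Inl 1 \<mapsto> b, Inl 2 \<mapsto> x] :: nat + nat \<rightharpoonup> 'm"
  have e: "T \<in> objs C" "env_typed C T ?e" "env_sort C ?e = ?\<Gamma>" using that by auto
  show ?thesis
   using force_pair[OF e(1,2), of "rv 1" "rv 2" "und X" "rlz X"]
    force_dot_rel[OF e(1,2), of "rv 0" "rv 1" "TApp f (rv 2)" "und Y" 3 "rlz Y"] s Y' unfolding e(3) by simp
 qed
 have t: "r \<in> arrs C \<and> tgt C r = A" if "mem C r R" for r
  using mem_tgt[OF that R] mem_arr[OF that] by blast
 have "tracks C S R X f Y \<longleftrightarrow> holds C (FAlls ?vs (FImp ?p ?q))"
  by (simp add: tracks_def Let_def)
 also have "\<dots> \<longleftrightarrow> force C (FAlls ?vs (FImp ?p ?q)) (one C) Map.empty"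
  by (rule holds_iff[OF wf])
 also have "\<dots> \<longleftrightarrow> (\<forall>T \<in> objs C. \<forall>r. r \<in> arrs C \<longrightarrow> src C r = T \<longrightarrow> tgt C r = A \<longrightarrow>
   (\<forall>b. b \<in> arrs C \<longrightarrow> src C b = T \<longrightarrow> tgt C b = A \<longrightarrow> (\<forall>x. x \<in> arrs C \<longrightarrow> src C x = T \<longrightarrow> tgt C x = und X \<longrightarrow>
    force C ?p T [Inl 0 \<mapsto> r, Inl 1 \<mapsto> b, Inl 2 \<mapsto> x] \<longrightarrow> force C ?q T [Inl 0 \<mapsto> r, Inl 1 \<mapsto> b, Inl 2 \<mapsto> x])))"
  unfolding force_FAlls_FImp[OF one_obj env_typed_empty wfi] all_ok_args upds.simps sb_empty
  by (rule all_stages)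
 also have "\<dots> \<longleftrightarrow> (\<forall>T \<in> objs C. \<forall>r. r \<in> arrs C \<longrightarrow> src C r = T \<longrightarrow> tgt C r = A \<longrightarrow>
   (\<forall>b. b \<in> arrs C \<longrightarrow> src C b = T \<longrightarrow> tgt C b = A \<longrightarrow> (\<forall>x. x \<in> arrs C \<longrightarrow> src C x = T \<longrightarrow> tgt C x = und X \<longrightarrow>
    rel (und X) (rlz X) b x \<longrightarrow> mem C r R \<longrightarrow> (\<exists>v. ap r b = Some v \<and> rel (und Y) (rlz Y) v (f \<odot> x)))))"
  using F by blast
 also have "\<dots> \<longleftrightarrow> (\<forall>r x g. mem C r R \<longrightarrow> src C r = src C g \<longrightarrow> rel (und X) (rlz X) x g \<longrightarrow>
  (\<exists>v. ap r x = Some v \<and> rel (und Y) (rlz Y) v (f \<odot> g)))"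
  unfolding all_rel
 proof (intro iffI allI impI)
  fix r x g assume *: "\<forall>T \<in> objs C. \<forall>r. r \<in> arrs C \<longrightarrow> src C r = T \<longrightarrow> tgt C r = A \<longrightarrow> (\<forall>b x. src C x = T \<longrightarrow>
    rel (und X) (rlz X) b x \<longrightarrow> mem C r R \<longrightarrow> (\<exists>v. ap r b = Some v \<and> rel (und Y) (rlz Y) v (f \<odot> x)))"
   and r: "mem C r R" "src C r = src C g" "rel (und X) (rlz X) x g"
  show "\<exists>v. ap r x = Some v \<and> rel (und Y) (rlz Y) v (f \<odot> g)"
   by (rule *[rule_format, OF _ _ refl]) (use t[OF r(1)] src_obj[of r] r in simp_all)
 qed blast
 finally show ?thesis .
qed

text \<open>\<open>hset\<close> is the largest subobject of \<open>A\<close> all of whose elements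
  transform realizers as required. By upward closure it belongs to \<open>\<phi>\<close> as soon as
  it contains some member of \<open>\<phi>\<close>.\<close>

lemma le_r_iff:
 assumes o: "X \<in> objs C" and UV: "U \<in> rels X" "V \<in> rels X"
 shows "le_r C S \<phi> X U V \<longleftrightarrow> ent X U V"
proof -
 let ?vs = "[(Inl 1, A), (Inl 2, X)] :: ((nat + nat) \<times> 'o) list"
 let ?p = "FRel X U (rv 1) (rv 2) :: ('o, 'm) bfml"
 let ?q = "dot C S 3 (rv 0) (rv 1) (\<lambda>c. FRel X V c (rv 2))"
 let ?\<Gamma> = "[Inl 0 \<mapsto> A, Inl 1 \<mapsto> A, Inl 2 \<mapsto> X] :: nat + nat \<rightharpoonup> 'o"
 have s: "has_sort C ?\<Gamma> (rv 2) X" "below 3 (rv 2)" by auto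
 have "wf_fml C ?\<Gamma> ?p"
  using UV o wf_pair[of ?\<Gamma> "rv 1" "rv 2" X U] by simp
 then have wfi: "wf_fml C (upds [Inl 0 \<mapsto> A] ?vs (map snd ?vs)) (FImp ?p ?q)"
  using wf_dot_rel[OF _ _ s(1) _ _ s(2) o UV(2), of "rv 0" "rv 1"] by simp
 then have wf: "wf_fml C [Inl 0 \<mapsto> A] (FAlls ?vs (FImp ?p ?q))"
  unfolding wf_FAlls using o by simp
 have F: "(force C ?p T [Inl 0 \<mapsto> r, Inl 1 \<mapsto> b, Inl 2 \<mapsto> x] \<longleftrightarrow> rel X U b x) \<and>
  (force C ?q T [Inl 0 \<mapsto> r, Inl 1 \<mapsto> b, Inl 2 \<mapsto> x] \<longleftrightarrow> (\<exists>v. ap r b = Some v \<and> rel X V v x))"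
  if "r \<in> els T" "b \<in> arrs C" "src C b = T" "tgt C b = A" "x \<in> arrs C" "src C x = T" "tgt C x = X" for r b x T
 proof -
  let ?e = "[Inl 0 \<mapsto> r, Inl 1 \<mapsto> b, Inl 2 \<mapsto> x] :: nat + nat \<rightharpoonup> 'm"
  have e: "T \<in> objs C" "env_typed C T ?e" "env_sort C ?e = ?\<Gamma>" using that by (auto simp: els_iff)
  show ?thesis
   using force_pair[OF e(1,2), of "rv 1" "rv 2" X U] force_dot_rel[OF e(1,2), of "rv 0" "rv 1" "rv 2" X 3 V] o UV
   unfolding e(3) by simp
 qed
 have h: "hset C S X U V = compr C (Inl 0) A (FAlls ?vs (FImp ?p ?q))"
  by (simp add: hset_def Let_def)
 have hc: "hset C S X U V \<in> subs C A"
  unfolding h by (rule mem_compr(1)[OF wf]) simp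
 have mh: "mem C a (hset C S X U V) \<longleftrightarrow> a \<in> arrs C \<and> tgt C a = A \<and> (\<forall>k \<in> arrs C. tgt C k = src C a \<longrightarrow>
   (\<forall>b x. src C x = src C k \<longrightarrow> rel X U b x \<longrightarrow> (\<exists>v. ap (a \<odot> k) b = Some v \<and> rel X V v x)))" for a
 proof -
  have "force C (FAlls ?vs (FImp ?p ?q)) (src C a) [Inl 0 \<mapsto> a] \<longleftrightarrow> (\<forall>k \<in> arrs C. tgt C k = src C a \<longrightarrow>
   (\<forall>b x. src C x = src C k \<longrightarrow> rel X U b x \<longrightarrow> (\<exists>v. ap (a \<odot> k) b = Some v \<and> rel X V v x)))"
   if a: "a \<in> arrs C" "tgt C a = A"
  proof -
   have e: "src C a \<in> objs C" "env_typed C (src C a) [Inl 0 \<mapsto> a]" using a by auto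
   have w: "wf_fml C (upds (env_sort C [Inl 0 \<mapsto> a]) ?vs (map snd ?vs)) (FImp ?p ?q)"
    using wfi a by simp
   have ak: "a \<odot> k \<in> els (src C k)" if "k \<in> arrs C" "tgt C k = src C a" for k using a that by (simp add: els_iff)
   have "force C (FAlls ?vs (FImp ?p ?q)) (src C a) [Inl 0 \<mapsto> a] \<longleftrightarrow> (\<forall>k \<in> arrs C. tgt C k = src C a \<longrightarrow>
    (\<forall>b. b \<in> arrs C \<longrightarrow> src C b = src C k \<longrightarrow> tgt C b = A \<longrightarrow> (\<forall>x. x \<in> arrs C \<longrightarrow> src C x = src C k \<longrightarrow> tgt C x = X \<longrightarrow>
     rel X U b x \<longrightarrow> (\<exists>v. ap (a \<odot> k) b = Some v \<and> rel X V v x))))"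
    unfolding force_FAlls_FImp[OF e w] all_ok_args upds.simps sb_upd sb_empty using F[OF ak] by blast
   then show ?thesis unfolding all_rel .
  qed
  then show ?thesis
   unfolding h mem_compr(2)[OF wf A_obj] by blast
 qed
 show ?thesis
  unfolding le_r_def
 proof
  assume hp: "hset C S X U V \<in> \<phi>"
  show "ent X U V"
   unfolding ent_def
  proof (intro bexI[OF _ hp] allI impI)
   fix r x g assume r: "mem C r (hset C S X U V)" "src C r = src C g" "rel X U x g"
   note g = rel_arr[OF r(3)]
   have "\<exists>v. ap (r \<odot> idn C (src C g)) x = Some v \<and> rel X V v g"
    by (rule r(1)[unfolded mh, THEN conjunct2, THEN conjunct2, rule_format])
     (use g(2) r(2,3) in simp_all)
   then show "\<exists>v. ap r x = Some v \<and> rel X V v g"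
    using cmp_idn(1)[OF mem_arr[OF r(1)] r(2)] by simp
  qed
 next
  assume "ent X U V"
  then obtain R where R: "R \<in> \<phi>" "PROP realizes R X U V" by (rule entE) blast
  show "hset C S X U V \<in> \<phi>"
  proof (rule filter_up[OF R(1) hc])
   fix r assume r: "mem C r R"
   have "\<exists>v. ap (r \<odot> k) b = Some v \<and> rel X V v x"
    if k: "k \<in> arrs C" "tgt C k = src C r" and x: "src C x = src C k" "rel X U b x" for k b x
   proof -
    have "mem C (r \<odot> k) R" by (rule mem_cmp[OF r filter_carrier[OF R(1)] k])
    moreover have "src C (r \<odot> k) = src C x" using k x mem_arr[OF r] by simp
    ultimately show ?thesis using R(2) x(2) by blast
   qed
   with filter_els[OF r R(1)] show "mem C r (hset C S X U V)"
    unfolding mh by (auto simp: els_iff)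
  qed
 qed
qed

text \<open>Tracking is entailment into the reindexed existence predicate. This reduces statements
  about morphisms of assemblies to the calculus of \<open>ent\<close>.\<close>

lemma asm_arr_iff:
 "(X, f, Y) \<in> arrs AS \<longleftrightarrow> is_asm C S X \<and> is_asm C S Y \<and> f \<in> arrs C \<and> src C f = und X \<and> tgt C f = und Y \<and>
  ent (und X) (rlz X) (reix f (rlz Y))"
proof -
 have "(\<exists>R \<in> \<phi>. tracks C S R X f Y) \<longleftrightarrow> ent (und X) (rlz X) (reix f (rlz Y))"
  if X: "is_asm C S X" and Y: "is_asm C S Y" and f: "f \<in> arrs C" "src C f = und X" "tgt C f = und Y"
 proof -
  have r: "rel (und X) (reix f (rlz Y)) v g \<longleftrightarrow> rel (und Y) (rlz Y) v (f \<odot> g)"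
   if "rel (und X) (rlz X) x g" for x g v
   using rel_reix'[OF f asmD(2)[OF Y], of v g] rel_arr[OF that] by simp
  have t: "tracks C S R X f Y \<longleftrightarrow> (\<forall>r x g. mem C r R \<longrightarrow> src C r = src C g \<longrightarrow> rel (und X) (rlz X) x g \<longrightarrow>
  (\<exists>v. ap r x = Some v \<and> rel (und X) (reix f (rlz Y)) v g))" if "R \<in> \<phi>" for R
   unfolding tracks_iff[OF filter_carrier[OF that] X Y f] using r by blast
  show ?thesis
   unfolding ent_def using t by blast
 qed
 then show ?thesis
  unfolding Asm_def by (auto simp del: Hom_iff) (auto simp: Hom_def)
qed

lemma asm_arrD:
 assumes "f \<in> arrs AS"
 shows "is_asm C S (fst f)" "is_asm C S (snd (snd f))" "und_arr f \<in> arrs C" "src C (und_arr f) = und (fst f)"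
  "tgt C (und_arr f) = und (snd (snd f))" "ent (und (fst f)) (rlz (fst f)) (reix (und_arr f) (rlz (snd (snd f))))"
 using assms asm_arr_iff[of "fst f" "und_arr f" "snd (snd f)"] by auto

lemma asm_category: "category AS"
proof unfold_locales
 fix f assume "f \<in> arrs AS"
 then show "src AS f \<in> objs AS" "tgt AS f \<in> objs AS"
  using asm_arrD[of f] by auto
next
 fix X assume "X \<in> objs AS"
 then have X: "is_asm C S X" by simp
 note X' = asmD[OF X]
 show "idn AS X \<in> Hom AS X X"
  using X X' by (simp add: asm_arr_iff reix_idn ent_refl)
next
 fix f X Y g Z assume f: "f \<in> Hom AS X Y" and g: "g \<in> Hom AS Y Z"
 then have fa: "f \<in> arrs AS" "fst f = X" "snd (snd f) = Y" and ga: "g \<in> arrs AS" "fst g = Y" "snd (snd g) = Z" by auto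
 note f' = asm_arrD[OF fa(1), unfolded fa(2,3)] and g' = asm_arrD[OF ga(1), unfolded ga(2,3)]
 note X = asmD[OF f'(1)] and Y = asmD[OF f'(2)] and Z = asmD[OF g'(2)]
 have t: "tgt C (und_arr f) = src C (und_arr g)" using f' g' by simp
 have r1: "reix (und_arr g) (rlz Z) \<in> rels (und Y)" by (rule reix_closed'[OF g'(3,4,5) Z(2)])
 have r2: "reix (und_arr f) (reix (und_arr g) (rlz Z)) \<in> rels (und X)" by (rule reix_closed'[OF f'(3,4,5) r1])
 have "ent (und X) (rlz X) (reix (und_arr f) (reix (und_arr g) (rlz Z)))"
  by (rule ent_trans[OF f'(6) ent_reix[OF g'(6) f'(3,4,5) Y(2) r1] X(2) r2])
 then have "ent (und X) (rlz X) (reix (und_arr g \<odot> und_arr f) (rlz Z))"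
  using reix_cmp[OF f'(3) g'(3) t g'(5) Z(2)] by simp
 with f' g' t fa ga show "g \<odot>\<^bsub>AS\<^esub> f \<in> Hom AS X Z"
  by (simp add: asm_arr_iff)
next
 fix f X Y assume "f \<in> Hom AS X Y"
 then have f: "f \<in> arrs AS" "fst f = X" "snd (snd f) = Y" by auto
 note f' = asm_arrD[OF f(1)]
 show "f \<odot>\<^bsub>AS\<^esub> idn AS X = f" "idn AS Y \<odot>\<^bsub>AS\<^esub> f = f"
  using f f' by (auto intro!: prod_eqI)
next
 fix f W X g Y h Z assume "f \<in> Hom AS W X" "g \<in> Hom AS X Y" "h \<in> Hom AS Y Z"
 then have "f \<in> arrs AS" "g \<in> arrs AS" "h \<in> arrs AS" "snd (snd f) = fst g" "snd (snd g) = fst h" by auto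
 with asm_arrD[of f] asm_arrD[of g] asm_arrD[of h]
 show "(h \<odot>\<^bsub>AS\<^esub> g) \<odot>\<^bsub>AS\<^esub> f = h \<odot>\<^bsub>AS\<^esub> (g \<odot>\<^bsub>AS\<^esub> f)" by simp
qed

end

sublocale pca_filter \<subseteq> Asm: category "Asm C S \<phi>"
 by (rule asm_category)

context pca_filter
begin

text \<open>In the category of assemblies a monomorphism is tested by tracked arrows only. Two
  arbitrary arrows \<open>a\<close>, \<open>b\<close> with common source become tracked once that
  source is given an existence predicate whose realizers provide realizers for both values.\<close>

lemma monic_und:
 assumes "monic AS m"
 shows "monic C (und_arr m)"
 unfolding monic_def
proof (intro conjI allI ballI impI)
 have m: "m \<in> arrs AS" by (rule Asm.monic_arr[OF assms])
 note m' = asm_arrD[OF m]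
 show "und_arr m \<in> arrs C" by (rule m'(3))
 fix T a b assume ab: "a \<in> Hom C T (src C (und_arr m))" "b \<in> Hom C T (src C (und_arr m))" "und_arr m \<odot> a = und_arr m \<odot> b"
 let ?X = "fst m"
 have a: "a \<in> arrs C" "src C a = T" "tgt C a = und ?X" and b: "b \<in> arrs C" "src C b = T" "tgt C b = und ?X"
  using ab m' by auto
 have T: "T \<in> objs C" using a by auto
 note X = asmD[OF m'(1)]
 let ?A = "reix a (rlz ?X)" and ?B = "reix b (rlz ?X)"
 have c: "?A \<in> rels T" "?B \<in> rels T" using reix_closed'[OF a X(2)] reix_closed'[OF b X(2)] .
 \<comment> \<open>A realizer of \<open>t\<close> is a pair consisting of a realizer of
   \<open>a(t)\<close> and one of \<open>b(t)\<close>; the two projections track \<open>a\<close>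
   and \<open>b\<close>.\<close>
 let ?T = "(T, pairs T ?A ?B)"
 have "is_asm C S ?T"
  unfolding asm_iff using T pairs_closed[OF T c] tot_pairs[OF _ _ c T] tot_reix[OF X(3) a X(2)] tot_reix[OF X(3) b X(2)] by simp
 then have "(?T, a, ?X) \<in> arrs AS" "(?T, b, ?X) \<in> arrs AS"
  unfolding asm_arr_iff using m' a b ent_fst[OF c T] ent_snd[OF c T] by auto
 then have "(?T, a, ?X) = (?T, b, ?X)"
  using ab(3) by - (rule Asm.monicD[OF assms], simp_all)
 then show "a = b" by simp
qed

lemma monic_asm:
 assumes "m \<in> arrs AS" "monic C (und_arr m)"
 shows "monic AS m"
 unfolding monic_def
proof (intro conjI allI ballI impI)
 fix W g h assume gh: "g \<in> Hom AS W (src AS m)" "h \<in> Hom AS W (src AS m)" "m \<odot>\<^bsub>AS\<^esub> g = m \<odot>\<^bsub>AS\<^esub> h"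
 then have "g \<in> arrs AS" "h \<in> arrs AS" "fst g = W" "fst h = W" "snd (snd g) = fst m" "snd (snd h) = fst m"
  "und_arr m \<odot> und_arr g = und_arr m \<odot> und_arr h" by auto
 moreover from this have "und_arr g = und_arr h"
  using asm_arrD[of g] asm_arrD[of h] asm_arrD[OF assms(1)] by - (rule monicD[OF assms(2)], simp_all)
 ultimately show "g = h" by (intro prod_eqI) simp_all
qed (rule assms(1))

text \<open>A subobject is described by its elements: \<open>f\<close> belongs to it when realizers
  for points of its source can be transformed uniformly into realizers in \<open>V\<close> of their
  values. Since realizers of these values are available anyway, \<open>V\<close> matters only
  relative to \<open>rlz \<Gamma>\<close>.\<close>

definition rep :: "('o, 'm) asm \<Rightarrow> ('o, 'm) asm_arr set \<Rightarrow> 'm set \<Rightarrow> bool" where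
 "rep \<Gamma> W V \<longleftrightarrow> W \<in> subs AS \<Gamma> \<and> V \<in> rels (und \<Gamma>) \<and>
  (\<forall>f. mem AS f W \<longleftrightarrow> f \<in> arrs AS \<and> snd (snd f) = \<Gamma> \<and> ent (und (fst f)) (rlz (fst f)) (reix (und_arr f) V))"

lemma rep_mem: "rep \<Gamma> W V \<Longrightarrow> mem AS f W \<longleftrightarrow>
  f \<in> arrs AS \<and> snd (snd f) = \<Gamma> \<and> ent (und (fst f)) (rlz (fst f)) (reix (und_arr f) V)"
 unfolding rep_def by blast

text \<open>The underlying object consists of the elements that have a realizer in both
  \<open>rlz \<Gamma>\<close> and \<open>V\<close>, and its existence predicate keeps both
  realizers. The first makes the inclusion tracked, the second makes the result a subobject where
  \<open>V\<close> is realized.\<close>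

lemma comprehension:
 assumes \<Gamma>: "is_asm C S \<Gamma>" and V: "V \<in> rels (und \<Gamma>)"
 obtains W m X where "rep \<Gamma> W V" "(X, m, \<Gamma>) \<in> arrs AS" "(X, m, \<Gamma>) \<in> W" "monic C m"
  "rlz X = reix m (pairs (und \<Gamma>) (rlz \<Gamma>) V)"
  "\<And>a g. rel (und \<Gamma>) (pairs (und \<Gamma>) (rlz \<Gamma>) V) a g \<Longrightarrow> mem C g (sub_of C m)"
proof -
 let ?G = "und \<Gamma>" and ?E = "pairs (und \<Gamma>) (rlz \<Gamma>) V"
 note G = asmD[OF \<Gamma>]
 have E: "?E \<in> rels ?G" by (rule pairs_closed[OF G(1,2) V])
 \<comment> \<open>The support of \<open>?E\<close>: those elements of \<open>\<Gamma>\<close> that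
   have some realizer in \<open>?E\<close>.\<close>
 let ?D = "ex_im C (pr2 C A ?G) ?E"
 have D: "?D \<in> subs C ?G"
  using ex_im_closed[of "pr2 C A ?G" ?E] E G by simp
 have memD: "mem C g ?D \<longleftrightarrow> cvr C (src C g) (\<lambda>k. \<exists>a. rel ?G ?E a (g \<odot> k))"
  if g: "g \<in> arrs C" "tgt C g = ?G" for g
 proof -
  have "mem C g ?D \<longleftrightarrow> cvr C (src C g) (\<lambda>k. \<exists>y. pr2 C A ?G \<odot> y = g \<odot> k \<and> mem C y ?E)"
   by (rule mem_ex_im) (use g E G in auto)
  also have "\<dots> \<longleftrightarrow> cvr C (src C g) (\<lambda>k. \<exists>a. rel ?G ?E a (g \<odot> k))"
  proof (rule cvr_cong)
   fix k assume k: "k \<in> arrs C" "tgt C k = src C g"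
   show "(\<exists>y. pr2 C A ?G \<odot> y = g \<odot> k \<and> mem C y ?E) \<longleftrightarrow> (\<exists>a. rel ?G ?E a (g \<odot> k))"
   proof
    assume "\<exists>y. pr2 C A ?G \<odot> y = g \<odot> k \<and> mem C y ?E"
    then obtain y where y: "pr2 C A ?G \<odot> y = g \<odot> k" "mem C y ?E" by blast
    have y': "y \<in> arrs C" "tgt C y = prd C A ?G" using y(2) mem_tgt[OF y(2) E] by auto
    have "rel ?G ?E (pr1 C A ?G \<odot> y) (pr2 C A ?G \<odot> y)"
     unfolding rel_def using y' y(2) G pair_eta[of A ?G y] by simp
    then show "\<exists>a. rel ?G ?E a (g \<odot> k)" unfolding y(1) by blast
   next
    assume "\<exists>a. rel ?G ?E a (g \<odot> k)"
    then obtain a where a: "rel ?G ?E a (g \<odot> k)" by blast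
    then show "\<exists>y. pr2 C A ?G \<odot> y = g \<odot> k \<and> mem C y ?E"
     by (intro exI[of _ "pair A ?G a (g \<odot> k)"]) (auto simp: rel_def)
   qed
  qed
  finally show ?thesis .
 qed
 obtain m where m: "monic C m" "tgt C m = ?G" "?D = sub_of C m"
  using D by (rule carrier_SubE)
 have ma: "m \<in> arrs C" using m by simp
 let ?X = "(src C m, reix m ?E)"
 have XE: "reix m ?E \<in> rels (src C m)" by (rule reix_closed'[OF ma refl m(2) E])
 have X: "is_asm C S ?X"
  unfolding asm_iff tot_def
 proof (simp add: ma XE, intro ballI impI)
  fix d assume d: "d \<in> arrs C" "tgt C d = src C m"
  have "mem C (m \<odot> d) (sub_of C m)"
   by (rule mem_cmp[OF mem_self[OF m(1)] sub_of_carrier[OF m(1,2)] d])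
  then have "mem C (m \<odot> d) ?D" by (simp add: m(3))
  then have "cvr C (src C d) (\<lambda>k. \<exists>a. rel ?G ?E a ((m \<odot> d) \<odot> k))"
   using memD[of "m \<odot> d"] d ma m(2) by simp
  then show "cvr C (src C d) (\<lambda>k. \<exists>a. rel (src C m) (reix m ?E) a (d \<odot> k))"
  proof (rule cvr_mono)
   fix k assume "k \<in> arrs C" "tgt C k = src C d" "\<exists>a. rel ?G ?E a ((m \<odot> d) \<odot> k)"
   then show "\<exists>a. rel (src C m) (reix m ?E) a (d \<odot> k)"
    using rel_reix'[OF ma refl m(2) E] d ma by auto
  qed
 qed
 have arr: "(?X, m, \<Gamma>) \<in> arrs AS"
  unfolding asm_arr_iff using X \<Gamma> ma m(2) ent_reix[OF ent_fst[OF G(2) V G(1)] ma refl m(2) E G(2)] by simp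
 have mono: "monic AS (?X, m, \<Gamma>)"
  by (rule monic_asm[OF arr]) (use m in simp)
 let ?W = "sub_of AS (?X, m, \<Gamma>)"
 have W: "?W \<in> subs AS \<Gamma>"
  by (rule Asm.sub_of_carrier[OF mono]) simp
 have "mem AS f ?W \<longleftrightarrow> f \<in> arrs AS \<and> snd (snd f) = \<Gamma> \<and> ent (und (fst f)) (rlz (fst f)) (reix (und_arr f) V)" for f
  unfolding Asm.mem_sub_of[OF mono]
 proof (intro iffI; elim conjE bexE)
  fix h assume f: "f \<in> arrs AS" and h: "h \<in> arrs AS" "src AS f = src AS h" "tgt AS h = src AS (?X, m, \<Gamma>)"
   "(?X, m, \<Gamma>) \<odot>\<^bsub>AS\<^esub> h = f"
  note h' = asm_arrD[OF h(1)] and Y = asmD[OF asm_arrD(1)[OF h(1)]]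
  have e: "fst f = fst h" "und_arr f = m \<odot> und_arr h" "snd (snd f) = \<Gamma>" "snd (snd h) = ?X"
   using h by auto
  have mV: "reix m V \<in> rels (src C m)" by (rule reix_closed'[OF ma refl m(2) V])
  have hs: "tgt C (und_arr h) = src C m" using h' e by simp
  have "ent (src C m) (reix m ?E) (reix m V)"
   by (rule ent_reix[OF ent_snd[OF G(2) V G(1)] ma refl m(2) E V])
  then have "ent (und (fst h)) (reix (und_arr h) (reix m ?E)) (reix (und_arr h) (reix m V))"
   by (rule ent_reix[OF _ h'(3,4) hs XE mV])
  moreover have "ent (und (fst h)) (rlz (fst h)) (reix (und_arr h) (reix m ?E))"
   using h'(6) e by simp
  ultimately have "ent (und (fst h)) (rlz (fst h)) (reix (und_arr h) (reix m V))"
   using ent_trans[OF _ _ Y(2) reix_closed'[OF h'(3,4) hs mV]] by blast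
  then show "f \<in> arrs AS \<and> snd (snd f) = \<Gamma> \<and> ent (und (fst f)) (rlz (fst f)) (reix (und_arr f) V)"
   using f e reix_cmp[OF h'(3) ma hs m(2) V] by simp
 next
  assume f: "f \<in> arrs AS" "snd (snd f) = \<Gamma>" and ent: "ent (und (fst f)) (rlz (fst f)) (reix (und_arr f) V)"
  note f' = asm_arrD[OF f(1), unfolded f(2)] and Y = asmD[OF asm_arrD(1)[OF f(1)]]
  let ?f = "und_arr f"
  have c: "reix ?f (rlz \<Gamma>) \<in> rels (und (fst f))" "reix ?f V \<in> rels (und (fst f))" "reix ?f ?E \<in> rels (und (fst f))"
   using reix_closed'[OF f'(3,4,5)] G V E by auto
  have entE: "ent (und (fst f)) (rlz (fst f)) (reix ?f ?E)"
   unfolding reix_pairs[OF f'(3,4,5) G(2) V]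
   by (rule ent_pair[OF f'(6) ent Y(2) c(1,2) Y(1)])
  \<comment> \<open>The points of an assembly have realizers on a cover; mapped by the entailment
    they show that the values of \<open>f\<close> lie in the support on a cover, hence
    outright.\<close>
  have "tot (und (fst f)) (reix ?f ?E)"
   by (rule tot_ent[OF Y(3) entE Y(2)])
  then have "cvr C (und (fst f)) (\<lambda>k. \<exists>a. rel (und (fst f)) (reix ?f ?E) a (idn C (und (fst f)) \<odot> k))"
   unfolding tot_def using Y(1) by (auto dest!: bspec[of _ _ "idn C (und (fst f))"])
  then have "cvr C (src C ?f) (\<lambda>k. \<exists>a. rel ?G ?E a (?f \<odot> k))"
   unfolding f'(4)
  proof (rule cvr_mono)
   fix k assume "k \<in> arrs C" "tgt C k = und (fst f)"
    "\<exists>a. rel (und (fst f)) (reix ?f ?E) a (idn C (und (fst f)) \<odot> k)"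
   then show "\<exists>a. rel ?G ?E a (?f \<odot> k)"
    using rel_reix'[OF f'(3,4,5) E] Y(1) by auto
  qed
  then have "mem C ?f (sub_of C m)"
   using memD[OF f'(3,5)] m(3) by simp
  then obtain h where h: "h \<in> arrs C" "src C ?f = src C h" "tgt C h = src C m" "m \<odot> h = ?f"
   unfolding mem_sub_of[OF m(1)] by blast
  have "reix ?f ?E = reix h (reix m ?E)"
   using reix_cmp[OF h(1) ma h(3) m(2) E] h(4) by simp
  then have ha: "(fst f, h, ?X) \<in> arrs AS"
   unfolding asm_arr_iff using f' X h entE by simp
  have feq: "f = (fst f, m \<odot> h, \<Gamma>)" using f(2) h(4) by (auto intro!: prod_eqI)
  show "f \<in> arrs AS \<and> (\<exists>h\<in>arrs AS. src AS f = src AS h \<and> tgt AS h = src AS (?X, m, \<Gamma>) \<and> (?X, m, \<Gamma>) \<odot>\<^bsub>AS\<^esub> h = f)"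
   using f(1) ha feq by (intro conjI bexI[of _ "(fst f, h, ?X)"]) auto
 qed
 with W V have "rep \<Gamma> ?W V" unfolding rep_def by blast
 moreover have "mem C g (sub_of C m)" if "rel ?G ?E a g" for a g
 proof -
  note g = rel_arr[OF that]
  have "cvr C (src C g) (\<lambda>k. \<exists>a. rel ?G ?E a (g \<odot> k))"
   by (rule cvr_now) (use rel_cmp[OF that E] in blast)
  then show ?thesis using memD[OF g(2,5)] m(3) by simp
 qed
 moreover have "(?X, m, \<Gamma>) \<in> ?W" by (rule Asm.sub_of_self[OF mono])
 ultimately show ?thesis
  using that[of ?W ?X m] arr m(1) by simp
qed

text \<open>Ties the predicate \<open>E\<close> of a chosen monomorphism to the description of
  subobjects by elements: an arrow factors through the monomorphism exactly when it is realized in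
  the image of the existence predicate.\<close>

lemma rep_mono:
 assumes W: "W \<in> subs AS \<Gamma>" and m: "m \<in> W"
 shows "rep \<Gamma> W (im (und_arr m) (rlz (fst m)))"
proof -
 note mono = Asm.in_carrierD[OF W m]
 have ma: "m \<in> arrs AS" "snd (snd m) = \<Gamma>" using mono Asm.monic_arr by auto
 note m' = asm_arrD[OF ma(1), unfolded ma(2)] and X = asmD[OF asm_arrD(1)[OF ma(1)]]
 note um = monic_und[OF mono(1)]
 let ?m = "und_arr m" and ?X = "und (fst m)" and ?G = "und \<Gamma>"
 let ?V = "im ?m (rlz (fst m))"
 have V: "?V \<in> rels ?G" using im_closed[OF m'(3), of "rlz (fst m)"] m' X by simp
 have rV: "rel ?G ?V a g \<longleftrightarrow> a \<in> els (src C g) \<and> g \<in> arrs C \<and> tgt C g = ?G \<and>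
   cvr C (src C g) (\<lambda>k. \<exists>z. ?m \<odot> z = g \<odot> k \<and> rel ?X (rlz (fst m)) (a \<odot> k) z)" for a g
  using rel_im[OF m'(3), of "rlz (fst m)" a g] m' X by simp
 \<comment> \<open>The underlying arrow is monic, so the preimage provided on a cover by an element
   of the image must be \<open>h \<odot> g\<close>: reindexing undoes the image.\<close>
 have eq: "reix (?m \<odot> h) ?V = reix h (rlz (fst m))" if h: "h \<in> arrs C" "tgt C h = ?X" for h
 proof (rule rels_eqI)
  have mh: "?m \<odot> h \<in> arrs C" "src C (?m \<odot> h) = src C h" "tgt C (?m \<odot> h) = ?G" using h m' by auto
  show "reix (?m \<odot> h) ?V \<in> rels (src C h)" "reix h (rlz (fst m)) \<in> rels (src C h)" "src C h \<in> objs C"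
   using reix_closed'[OF mh V] reix_closed'[OF h(1) refl h(2) X(2)] h by auto
  fix a g
  have "rel ?G ?V a ((?m \<odot> h) \<odot> g) \<longleftrightarrow> rel ?X (rlz (fst m)) a (h \<odot> g)"
   if g: "g \<in> arrs C" "tgt C g = src C h"
  proof
   assume "rel ?G ?V a ((?m \<odot> h) \<odot> g)"
   then have a: "a \<in> els (src C g)"
    and c: "cvr C (src C g) (\<lambda>k. \<exists>z. ?m \<odot> z = ((?m \<odot> h) \<odot> g) \<odot> k \<and> rel ?X (rlz (fst m)) (a \<odot> k) z)"
    unfolding rV using g mh by auto
   show "rel ?X (rlz (fst m)) a (h \<odot> g)"
   proof (rule rel_local[OF a _ _ _ X(2) c])
    fix k assume k: "k \<in> arrs C" "tgt C k = src C g"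
     and "\<exists>z. ?m \<odot> z = ((?m \<odot> h) \<odot> g) \<odot> k \<and> rel ?X (rlz (fst m)) (a \<odot> k) z"
    then obtain z where z: "?m \<odot> z = ((?m \<odot> h) \<odot> g) \<odot> k" "rel ?X (rlz (fst m)) (a \<odot> k) z" by blast
    note z' = rel_arr[OF z(2)]
    have eqm: "?m \<odot> z = ?m \<odot> (h \<odot> g \<odot> k)" using z(1) h g k m' by simp
    have sz: "src C z = src C k"
     using z'(3) a k by (simp add: els_iff)
    have "z = h \<odot> g \<odot> k"
     by (rule monicD[OF um eqm]) (use sz z'(2,5) h g k m' in simp_all)
    then show "rel ?X (rlz (fst m)) (a \<odot> k) ((h \<odot> g) \<odot> k)" using z(2) h g k by simp
   qed (use h g in simp_all)
  next
   assume r: "rel ?X (rlz (fst m)) a (h \<odot> g)"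
   note r' = rel_arr[OF r]
   show "rel ?G ?V a ((?m \<odot> h) \<odot> g)"
    unfolding rV
   proof (intro conjI cvr_now)
    fix k assume k: "k \<in> arrs C" "tgt C k = src C ((?m \<odot> h) \<odot> g)"
    then have "rel ?X (rlz (fst m)) (a \<odot> k) ((h \<odot> g) \<odot> k)" "?m \<odot> ((h \<odot> g) \<odot> k) = ((?m \<odot> h) \<odot> g) \<odot> k"
     using rel_cmp[OF r X(2), of k] h g m' by auto
    then show "\<exists>z. ?m \<odot> z = ((?m \<odot> h) \<odot> g) \<odot> k \<and> rel ?X (rlz (fst m)) (a \<odot> k) z" by blast
   qed (use r' h g m' in simp_all)
  qed
  then show "rel (src C h) (reix (?m \<odot> h) ?V) a g \<longleftrightarrow> rel (src C h) (reix h (rlz (fst m))) a g"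
   unfolding rel_reix'[OF mh V] rel_reix'[OF h(1) refl h(2) X(2)] by blast
 qed
 have "mem AS f W \<longleftrightarrow> f \<in> arrs AS \<and> snd (snd f) = \<Gamma> \<and> ent (und (fst f)) (rlz (fst f)) (reix (und_arr f) ?V)" for f
  unfolding mono(3) Asm.mem_sub_of[OF mono(1)]
 proof (intro iffI; elim conjE bexE)
  fix h assume f: "f \<in> arrs AS" and h: "h \<in> arrs AS" "src AS f = src AS h" "tgt AS h = src AS m" "m \<odot>\<^bsub>AS\<^esub> h = f"
  note h' = asm_arrD[OF h(1)]
  have "fst f = fst h" "und_arr f = ?m \<odot> und_arr h" "snd (snd f) = \<Gamma>" "snd (snd h) = fst m"
   using h ma by auto
  then show "f \<in> arrs AS \<and> snd (snd f) = \<Gamma> \<and> ent (und (fst f)) (rlz (fst f)) (reix (und_arr f) ?V)"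
   using f h' eq[of "und_arr h"] by simp
 next
  assume f: "f \<in> arrs AS" "snd (snd f) = \<Gamma>" and ent: "ent (und (fst f)) (rlz (fst f)) (reix (und_arr f) ?V)"
  note f' = asm_arrD[OF f(1), unfolded f(2)] and Y = asmD[OF asm_arrD(1)[OF f(1)]]
  let ?f = "und_arr f"
  have "tot (und (fst f)) (reix ?f ?V)"
   by (rule tot_ent[OF Y(3) ent Y(2)])
  then have c: "cvr C (und (fst f)) (\<lambda>k. \<exists>a. rel (und (fst f)) (reix ?f ?V) a (idn C (und (fst f)) \<odot> k))"
   unfolding tot_def using Y(1) by (auto dest!: bspec[of _ _ "idn C (und (fst f))"])
  have "mem C ?f (sub_of C ?m)"
  proof (rule cvr_mem)
   show "cvr C (src C ?f) (\<lambda>k. \<exists>a. rel (und (fst f)) (reix ?f ?V) a (idn C (und (fst f)) \<odot> k))"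
    using c f'(4) by simp
   show "sub_of C ?m \<in> subs C (tgt C ?f)"
    by (rule sub_of_carrier[OF um]) (use m' f' in simp)
   fix k assume k: "k \<in> arrs C" "tgt C k = src C ?f" "\<exists>a. rel (und (fst f)) (reix ?f ?V) a (idn C (und (fst f)) \<odot> k)"
   then obtain a where "rel ?G ?V a (?f \<odot> k)"
    using rel_reix'[OF f'(3,4,5) V] Y(1) f' by auto
   \<comment> \<open>Two covers are nested here: on the first some realizer in the image exists, on
     the second its element has a preimage under \<open>?m\<close>.\<close>
   then have c': "cvr C (src C (?f \<odot> k)) (\<lambda>l. \<exists>z. ?m \<odot> z = (?f \<odot> k) \<odot> l \<and> rel ?X (rlz (fst m)) (a \<odot> l) z)"
    unfolding rV by blast
   show "mem C (?f \<odot> k) (sub_of C ?m)"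
   proof (rule cvr_mem[OF c'])
    fix l assume l: "l \<in> arrs C" "tgt C l = src C (?f \<odot> k)"
     "\<exists>z. ?m \<odot> z = (?f \<odot> k) \<odot> l \<and> rel ?X (rlz (fst m)) (a \<odot> l) z"
    then obtain z where z: "?m \<odot> z = (?f \<odot> k) \<odot> l" "rel ?X (rlz (fst m)) (a \<odot> l) z" by blast
    have "mem C (?m \<odot> z) (sub_of C ?m)"
     by (rule mem_cmp[OF mem_self[OF um] sub_of_carrier[OF um refl]]) (use rel_arr[OF z(2)] m' in simp_all)
    then show "mem C ((?f \<odot> k) \<odot> l) (sub_of C ?m)" using z(1) by simp
   qed (use k f' m' sub_of_carrier[OF um] in simp_all)
  qed (use f' in simp)
  then obtain h where h: "h \<in> arrs C" "src C ?f = src C h" "tgt C h = src C ?m" "?m \<odot> h = ?f"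
   unfolding mem_sub_of[OF um] by blast
  have ha: "(fst f, h, fst m) \<in> arrs AS"
   unfolding asm_arr_iff using f' m' h ent eq[of h] by simp
  have feq: "f = (fst f, ?m \<odot> h, \<Gamma>)" using f(2) h(4) by (auto intro!: prod_eqI)
  show "f \<in> arrs AS \<and> (\<exists>h\<in>arrs AS. src AS f = src AS h \<and> tgt AS h = src AS m \<and> m \<odot>\<^bsub>AS\<^esub> h = f)"
   using f(1) ha feq ma by (intro conjI bexI[of _ "(fst f, h, fst m)"]) auto
 qed
 with W V show ?thesis unfolding rep_def by blast
qed

lemma rep_exists: "W \<in> subs AS \<Gamma> \<Longrightarrow> \<exists>V. rep \<Gamma> W V"
 using rep_mono Asm.sub_of_self by (metis Asm.carrier_SubE)

text \<open>An inclusion is tested on the comprehension of \<open>V\<close>, whose existence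
  predicate is the left-hand side restricted to its support. Every element realized by the left-hand
  side lies in the support, so nothing is lost by the restriction. Conversely, an entailment over
  \<open>\<Gamma>\<close> can be reindexed along any \<open>f\<close>.\<close>

lemma rep_le:
 assumes "rep \<Gamma> W V" "rep \<Gamma> W' V'" "is_asm C S \<Gamma>"
 shows "W \<sqsubseteq>\<^bsub>Sub AS \<Gamma>\<^esub> W' \<longleftrightarrow> ent (und \<Gamma>) (pairs (und \<Gamma>) (rlz \<Gamma>) V) V'"
proof
 let ?G = "und \<Gamma>" and ?E = "pairs (und \<Gamma>) (rlz \<Gamma>) V"
 note G = asmD[OF assms(3)]
 have W: "W \<in> subs AS \<Gamma>" "W' \<in> subs AS \<Gamma>" and V: "V \<in> rels ?G" "V' \<in> rels ?G"
  using assms by (auto simp: rep_def)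
 have E: "?E \<in> rels ?G" by (rule pairs_closed[OF G(1,2) V(1)])
 {
  assume le: "W \<sqsubseteq>\<^bsub>Sub AS \<Gamma>\<^esub> W'"
  obtain W0 m X where m: "rep \<Gamma> W0 V" "(X, m, \<Gamma>) \<in> arrs AS" "(X, m, \<Gamma>) \<in> W0" "monic C m" "rlz X = reix m ?E"
   and sup: "\<And>a g. rel ?G ?E a g \<Longrightarrow> mem C g (sub_of C m)"
   by (rule comprehension[OF assms(3) V(1)]) (rule that)
  note m' = asm_arrD[OF m(2), simplified]
  have "W0 \<in> subs AS \<Gamma>" using m(1) by (simp add: rep_def)
  note mc = Asm.in_carrierD[OF this m(3)]
  have "mem AS (X, m, \<Gamma>) W0"
   using Asm.mem_self[OF mc(1)] mc(3) by simp
  then have "mem AS (X, m, \<Gamma>) W"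
   unfolding rep_mem[OF m(1)] rep_mem[OF assms(1)] .
  then have "mem AS (X, m, \<Gamma>) W'"
   using le Asm.Sub_le_iff[OF W] by blast
  then have "ent (und X) (rlz X) (reix m V')"
   unfolding rep_mem[OF assms(2)] by simp
  then obtain R where R: "R \<in> \<phi>" "PROP realizes R (und X) (reix m ?E) (reix m V')"
   unfolding m(5) by (rule entE) blast
  show "ent ?G ?E V'"
   unfolding ent_def
  proof (intro bexI[OF _ R(1)] allI impI)
   fix r x g assume r: "mem C r R" "src C r = src C g" and x: "rel ?G ?E x g"
   \<comment> \<open>Having a realizer puts \<open>g\<close> into the support, so it comes from an
     element \<open>d\<close> of the comprehension, where the entailment is known.\<close>
   obtain d where d: "d \<in> arrs C" "src C g = src C d" "tgt C d = src C m" "m \<odot> d = g"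
    using sup[OF x] unfolding mem_sub_of[OF m(4)] by blast
   have "rel (und X) (reix m ?E) x d"
    using rel_reix'[OF m'(3,4,5) E] d x m' by simp
   then have "\<exists>v. ap r x = Some v \<and> rel (und X) (reix m V') v d"
    using R(2) r d by simp
   then show "\<exists>v. ap r x = Some v \<and> rel ?G V' v g"
    using rel_reix'[OF m'(3,4,5) V(2)] d(4) by auto
  qed
 }
 assume ent: "ent ?G ?E V'"
 show "W \<sqsubseteq>\<^bsub>Sub AS \<Gamma>\<^esub> W'"
  unfolding Asm.Sub_le_iff[OF W]
 proof (intro allI impI)
  fix f assume "mem AS f W"
  then have f: "f \<in> arrs AS" "snd (snd f) = \<Gamma>" and fV: "ent (und (fst f)) (rlz (fst f)) (reix (und_arr f) V)"
   unfolding rep_mem[OF assms(1)] by auto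
  note f' = asm_arrD[OF f(1), unfolded f(2)] and Y = asmD[OF asm_arrD(1)[OF f(1)]]
  let ?f = "und_arr f"
  have c: "reix ?f (rlz \<Gamma>) \<in> rels (und (fst f))" "reix ?f V \<in> rels (und (fst f))" "reix ?f V' \<in> rels (und (fst f))"
   using reix_closed'[OF f'(3,4,5)] G V by auto
  have "ent (und (fst f)) (rlz (fst f)) (reix ?f ?E)"
   unfolding reix_pairs[OF f'(3,4,5) G(2) V(1)]
   by (rule ent_pair[OF f'(6) fV Y(2) c(1,2) Y(1)])
  then have "ent (und (fst f)) (rlz (fst f)) (reix ?f V')"
   using ent_trans[OF _ ent_reix[OF ent f'(3,4,5) E V(2)] Y(2) c(3)] by blast
  with f show "mem AS f W'" unfolding rep_mem[OF assms(2)] by simp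
 qed
qed

end

context pca_filter
begin

section \<open>Terminal object, products and equalizers of assemblies\<close>

lemma rel_top:
 "G \<in> objs C \<Longrightarrow> rel G (\<top>\<^bsub>Sub C (prd C A G)\<^esub>) a g \<longleftrightarrow> a \<in> els (src C g) \<and> g \<in> arrs C \<and> tgt C g = G"
 by (auto simp: rel_def els_iff mem_top)

text \<open>Every element of \<open>A\<close> counts as a realizer of the single point, so that
  every arrow into it is tracked.\<close>

definition unit_asm :: "('o, 'm) asm" where
 "unit_asm = (one C, \<top>\<^bsub>Sub C (prd C A (one C))\<^esub>)"

lemma unit_asm: "is_asm C S unit_asm"
proof -
 have c: "\<top>\<^bsub>Sub C (prd C A (one C))\<^esub> \<in> rels (one C)"
  by (rule top_carrier) simp
 have "tot (one C) (\<top>\<^bsub>Sub C (prd C A (one C))\<^esub>)"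
  unfolding tot_def
 proof (intro ballI impI)
  fix g assume g: "g \<in> arrs C" "tgt C g = one C"
  show "cvr C (src C g) (\<lambda>k. \<exists>a. rel (one C) (\<top>\<^bsub>Sub C (prd C A (one C))\<^esub>) a (g \<odot> k))"
  proof (rule cvr_mono[OF filter_inhabited[OF F_filter(1)]])
   fix k assume "k \<in> arrs C" "tgt C k = src C g" "\<exists>r. mem C r F0 \<and> src C r = src C k"
   then show "\<exists>a. rel (one C) (\<top>\<^bsub>Sub C (prd C A (one C))\<^esub>) a (g \<odot> k)"
    using g F_els(1) by (auto simp: rel_top els_iff)
  qed (use g in simp)
 qed
 with c show ?thesis
  by (simp add: asm_iff unit_asm_def)
qed

lemma asm_terminal: "is_terminal AS unit_asm"
 unfolding is_terminal_def
proof (intro conjI ballI)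
 show "unit_asm \<in> objs AS" using unit_asm by simp
 fix X assume "X \<in> objs AS"
 then have X: "is_asm C S X" by simp
 note X' = asmD[OF X]
 have b: "bang C (und X) (one C) \<in> arrs C" "src C (bang C (und X) (one C)) = und X" "tgt C (bang C (und X) (one C)) = one C"
  using terminal_arr[OF one_terminal X'(1)] .
 have c: "rlz unit_asm \<in> rels (one C)"
  using asmD(2)[OF unit_asm] by (simp add: unit_asm_def)
 have "ent (und X) (rlz X) (reix (bang C (und X) (one C)) (rlz unit_asm))"
 proof (rule ent_incl[OF X'(2) reix_closed'[OF b c]])
  fix a g assume "rel (und X) (rlz X) a g"
  from rel_arr[OF this] show "rel (und X) (reix (bang C (und X) (one C)) (rlz unit_asm)) a g"
   unfolding rel_reix'[OF b c] using b by (simp add: unit_asm_def rel_top)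
 qed
 then have "(X, bang C (und X) (one C), unit_asm) \<in> Hom AS X unit_asm"
  using X unit_asm b by (simp add: asm_arr_iff unit_asm_def)
 moreover have "h = (X, bang C (und X) (one C), unit_asm)" if "h \<in> Hom AS X unit_asm" for h
 proof -
  from that have h: "h \<in> arrs AS" "fst h = X" "snd (snd h) = unit_asm" by auto
  note h' = asm_arrD[OF h(1)]
  have "und_arr h = bang C (und X) (one C)"
   by (rule terminal_eq[OF one_terminal]) (use h h' b in \<open>auto simp: unit_asm_def\<close>)
  with h show ?thesis by (auto intro!: prod_eqI)
 qed
 ultimately show "\<exists>!h. h \<in> Hom AS X unit_asm" by blast
qed

text \<open>Any terminal assembly is isomorphic to \<open>unit_asm\<close>, whose underlying object
  is terminal. The general form is needed because a term may name an arbitrary terminal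
  object.\<close>

lemma terminal_und:
 assumes T: "is_terminal AS T"
 shows "is_terminal C (und T)"
 unfolding is_terminal_def
proof (intro conjI ballI)
 have oT: "T \<in> objs AS" using T by (simp add: is_terminal_def)
 then have aT: "is_asm C S T" by simp
 show "und T \<in> objs C" using asmD(1)[OF aT] .
 let ?h = "bang AS T unit_asm" and ?k = "bang AS unit_asm T"
 have oU: "unit_asm \<in> objs AS" using unit_asm by simp
 note h = Asm.terminal_arr[OF asm_terminal oT] and k = Asm.terminal_arr[OF T oU]
 have "?k \<odot>\<^bsub>AS\<^esub> ?h = idn AS T"
  by (rule Asm.terminal_eq[OF T]) (use Asm.cmp_simps[OF h(1) k(1)] h k Asm.idn_simps[OF oT] in auto)
 then have kh: "und_arr ?k \<odot> und_arr ?h = idn C (und T)" by simp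
 have h': "und_arr ?h \<in> arrs C" "src C (und_arr ?h) = und T" "tgt C (und_arr ?h) = one C"
  using asm_arrD[OF h(1)] h by (auto simp: unit_asm_def)
 have k': "und_arr ?k \<in> arrs C" "src C (und_arr ?k) = one C" "tgt C (und_arr ?k) = und T"
  using asm_arrD[OF k(1)] k by (auto simp: unit_asm_def)
 fix X assume X: "X \<in> objs C"
 note b = terminal_arr[OF one_terminal X]
 show "\<exists>!f. f \<in> Hom C X (und T)"
 proof (rule ex1I[of _ "und_arr ?k \<odot> bang C X (one C)"])
  show "und_arr ?k \<odot> bang C X (one C) \<in> Hom C X (und T)" using b k' by simp
  fix f assume f: "f \<in> Hom C X (und T)"
  have "und_arr ?h \<odot> f = bang C X (one C)"
   by (rule terminal_eq[OF one_terminal]) (use f h' b in simp_all)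
  then have "und_arr ?k \<odot> bang C X (one C) = und_arr ?k \<odot> (und_arr ?h \<odot> f)" by simp
  also have "\<dots> = idn C (und T) \<odot> f"
   by (rule cmp_reassoc[OF kh]) (use f h' k' in simp_all)
  finally show "f = und_arr ?k \<odot> bang C X (one C)" using f by simp
 qed
qed

lemma asm_product:
 assumes X: "is_asm C S X" and Z: "is_asm C S Z"
 defines "Q \<equiv> (prd C (und X) (und Z), pairs (prd C (und X) (und Z))
   (reix (pr1 C (und X) (und Z)) (rlz X)) (reix (pr2 C (und X) (und Z)) (rlz Z)))"
 shows "is_asm C S Q" "(Q, pr1 C (und X) (und Z), X) \<in> arrs AS" "(Q, pr2 C (und X) (und Z), Z) \<in> arrs AS"
  "is_product AS (Q, pr1 C (und X) (und Z), X) (Q, pr2 C (und X) (und Z), Z)"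
proof -
 note X' = asmD[OF X] and Z' = asmD[OF Z]
 let ?p = "pr1 C (und X) (und Z)" and ?q = "pr2 C (und X) (und Z)" and ?P = "prd C (und X) (und Z)"
 have pq: "?p \<in> arrs C" "src C ?p = ?P" "tgt C ?p = und X" "?q \<in> arrs C" "src C ?q = ?P" "tgt C ?q = und Z" "?P \<in> objs C"
  using X' Z' by auto
 note c = reix_closed'[OF pq(1-3) X'(2)] reix_closed'[OF pq(4-6) Z'(2)]
 show Q: "is_asm C S Q"
  unfolding asm_iff Q_def
  using pq(7) pairs_closed[OF pq(7) c] tot_pairs[OF tot_reix[OF X'(3) pq(1-3) X'(2)] tot_reix[OF Z'(3) pq(4-6) Z'(2)] c pq(7)]
  by simp
 show p: "(Q, ?p, X) \<in> arrs AS" and q: "(Q, ?q, Z) \<in> arrs AS"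
  unfolding asm_arr_iff using Q X Z pq ent_fst[OF c pq(7)] ent_snd[OF c pq(7)] by (auto simp: Q_def)
 show "is_product AS (Q, ?p, X) (Q, ?q, Z)"
  unfolding is_product_def
 proof (intro conjI allI ballI)
  show "(Q, ?p, X) \<in> arrs AS" by (rule p)
  show "(Q, ?q, Z) \<in> arrs AS" by (rule q)
  show "src AS (Q, ?p, X) = src AS (Q, ?q, Z)" by (simp only: Asm_simps fst_conv)
  fix Y f g assume "f \<in> Hom AS Y (tgt AS (Q, ?p, X))" "g \<in> Hom AS Y (tgt AS (Q, ?q, Z))"
  then have f: "f \<in> arrs AS" "fst f = Y" "snd (snd f) = X" and g: "g \<in> arrs AS" "fst g = Y" "snd (snd g) = Z" by auto
  note f' = asm_arrD[OF f(1), unfolded f(2,3)] and g' = asm_arrD[OF g(1), unfolded g(2,3)]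
  note Y = asmD[OF f'(1)]
  let ?t = "tuple C ?p ?q (und_arr f) (und_arr g)"
  have t: "?t \<in> arrs C" "src C ?t = und Y" "tgt C ?t = ?P" "?p \<odot> ?t = und_arr f" "?q \<odot> ?t = und_arr g"
   using f' g' by auto
  have e: "reix ?t (rlz Q) = pairs (und Y) (reix (und_arr f) (rlz X)) (reix (und_arr g) (rlz Z))"
   using reix_pairs[OF t(1-3) c] reix_cmp[OF t(1) pq(1) _ pq(3) X'(2)] reix_cmp[OF t(1) pq(4) _ pq(6) Z'(2)] t pq
   by (simp add: Q_def)
  have "ent (und Y) (rlz Y) (reix ?t (rlz Q))"
   unfolding e
   by (rule ent_pair[OF f'(6) g'(6) Y(2) reix_closed'[OF f'(3-5) X'(2)] reix_closed'[OF g'(3-5) Z'(2)] Y(1)])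
  then have "(Y, ?t, Q) \<in> arrs AS"
   unfolding asm_arr_iff using f'(1) Q t by (simp add: Q_def)
  then have ex: "(Y, ?t, Q) \<in> Hom AS Y (src AS (Q, ?p, X)) \<and> (Q, ?p, X) \<odot>\<^bsub>AS\<^esub> (Y, ?t, Q) = f \<and> (Q, ?q, Z) \<odot>\<^bsub>AS\<^esub> (Y, ?t, Q) = g"
   using t f g by (auto intro!: prod_eqI)
  have un: "h = (Y, ?t, Q)"
   if hh: "h \<in> Hom AS Y (src AS (Q, ?p, X)) \<and> (Q, ?p, X) \<odot>\<^bsub>AS\<^esub> h = f \<and> (Q, ?q, Z) \<odot>\<^bsub>AS\<^esub> h = g" for h
  proof -
   from hh have h: "h \<in> arrs AS" "fst h = Y" "snd (snd h) = Q" by auto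
   from hh have e: "?p \<odot> und_arr h = und_arr f" "?q \<odot> und_arr h = und_arr g" by auto
   note h' = asm_arrD[OF h(1)]
   have "und_arr h = ?t"
    by (rule tuple_eqI[OF prod_cone(1)[OF X'(1) Z'(1)], symmetric]) (use h h' e pq in \<open>auto simp: Q_def\<close>)
   with h show ?thesis by (intro prod_eqI) simp_all
  qed
  show "\<exists>!h. h \<in> Hom AS Y (src AS (Q, ?p, X)) \<and> (Q, ?p, X) \<odot>\<^bsub>AS\<^esub> h = f \<and> (Q, ?q, Z) \<odot>\<^bsub>AS\<^esub> h = g"
   by (rule ex1I[of _ "(Y, ?t, Q)"]) (rule ex, rule un)
 qed
qed

text \<open>An arbitrary product cone is compared with the standard one. The isomorphism carries
  over the universal property of the underlying arrows; that it is tracked gives the second claim,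
  which says that realizers of the components yield one of the pair.\<close>

lemma product_und:
 assumes pq: "is_product AS p q"
 shows "is_product C (und_arr p) (und_arr q)"
  and "ent (und (fst p)) (pairs (und (fst p)) (reix (und_arr p) (rlz (snd (snd p)))) (reix (und_arr q) (rlz (snd (snd q)))))
   (rlz (fst p))"
proof -
 let ?X = "snd (snd p)" and ?Z = "snd (snd q)" and ?P = "fst p"
 note a = Asm.productD[OF pq]
 have qP: "fst q = ?P" using a by simp
 note p' = asm_arrD[OF a(1)] and q' = asm_arrD[OF a(2), unfolded qP]
 note X = asmD[OF p'(2)] and Z = asmD[OF q'(2)] and P = asmD[OF p'(1)]
 let ?p1 = "pr1 C (und ?X) (und ?Z)" and ?p2 = "pr2 C (und ?X) (und ?Z)" and ?R = "prd C (und ?X) (und ?Z)"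
 let ?Q = "(?R, pairs ?R (reix ?p1 (rlz ?X)) (reix ?p2 (rlz ?Z)))"
 note Q = asm_product[OF p'(2) q'(2)]
 let ?a = "(?Q, ?p1, ?X)" and ?b = "(?Q, ?p2, ?Z)"
 let ?h = "tuple AS p q ?a ?b" and ?k = "tuple AS ?a ?b p q"
 have h: "?h \<in> arrs AS" "fst ?h = ?Q" "snd (snd ?h) = ?P" "p \<odot>\<^bsub>AS\<^esub> ?h = ?a" "q \<odot>\<^bsub>AS\<^esub> ?h = ?b"
  using Asm.tuple[OF pq Q(2,3)] by auto
 have k: "?k \<in> arrs AS" "fst ?k = ?P" "snd (snd ?k) = ?Q" "?a \<odot>\<^bsub>AS\<^esub> ?k = p" "?b \<odot>\<^bsub>AS\<^esub> ?k = q"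
  using Asm.tuple[OF Q(4) a(1,2)] qP by auto
 have "?h \<odot>\<^bsub>AS\<^esub> ?k = idn AS ?P"
 proof (rule Asm.product_eqI[OF pq])
  have hk: "tgt AS ?k = src AS ?h" using h k by simp
  show "p \<odot>\<^bsub>AS\<^esub> (?h \<odot>\<^bsub>AS\<^esub> ?k) = p \<odot>\<^bsub>AS\<^esub> idn AS ?P"
   using Asm.cmp_reassoc[OF h(4) h(1) a(1) k(1) _ hk] k(4) h(3) Asm.cmp_idn(1)[OF a(1)] by simp
  show "q \<odot>\<^bsub>AS\<^esub> (?h \<odot>\<^bsub>AS\<^esub> ?k) = q \<odot>\<^bsub>AS\<^esub> idn AS ?P"
   using Asm.cmp_reassoc[OF h(5) h(1) a(2) k(1) _ hk] k(5) h(3) Asm.cmp_idn(1)[OF a(2)] qP by simp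
  show "?h \<odot>\<^bsub>AS\<^esub> ?k \<in> arrs AS" by (rule Asm.cmp_simps(1)[OF k(1) h(1) hk])
  show "idn AS ?P \<in> arrs AS" using p'(1) by (intro Asm.idn_simps) simp
 qed (use h k in auto)
 then have hk: "und_arr ?h \<odot> und_arr ?k = idn C (und ?P)" by simp
 have ph: "und_arr p \<odot> und_arr ?h = ?p1" "und_arr q \<odot> und_arr ?h = ?p2"
  using arg_cong[OF h(4), of und_arr] arg_cong[OF h(5), of und_arr] by auto
 have pk: "?p1 \<odot> und_arr ?k = und_arr p" "?p2 \<odot> und_arr ?k = und_arr q"
  using arg_cong[OF k(4), of und_arr] arg_cong[OF k(5), of und_arr] by auto
 have h': "und_arr ?h \<in> arrs C" "src C (und_arr ?h) = ?R" "tgt C (und_arr ?h) = und ?P"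
  using asm_arrD[OF h(1)] h by auto
 have k': "und_arr ?k \<in> arrs C" "src C (und_arr ?k) = und ?P" "tgt C (und_arr ?k) = ?R"
  using asm_arrD[OF k(1)] k by auto
 have pr: "?p1 \<in> arrs C" "src C ?p1 = ?R" "tgt C ?p1 = und ?X" "?p2 \<in> arrs C" "src C ?p2 = ?R" "tgt C ?p2 = und ?Z" "?R \<in> objs C"
  using X Z by auto
 show "is_product C (und_arr p) (und_arr q)"
  unfolding is_product_def
 proof (intro conjI allI ballI)
  fix T f g assume "f \<in> Hom C T (tgt C (und_arr p))" "g \<in> Hom C T (tgt C (und_arr q))"
  then have f: "f \<in> arrs C" "src C f = T" "tgt C f = und ?X" and g: "g \<in> arrs C" "src C g = T" "tgt C g = und ?Z"
   using p' q' by auto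
  let ?t = "tuple C ?p1 ?p2 f g"
  have t: "?t \<in> arrs C" "src C ?t = T" "tgt C ?t = ?R" "?p1 \<odot> ?t = f" "?p2 \<odot> ?t = g"
   using f g by auto
  show "\<exists>!l. l \<in> Hom C T (src C (und_arr p)) \<and> und_arr p \<odot> l = f \<and> und_arr q \<odot> l = g"
  proof (rule ex1I[of _ "und_arr ?h \<odot> ?t"])
   have "und_arr p \<odot> (und_arr ?h \<odot> ?t) = ?p1 \<odot> ?t"
    by (rule cmp_reassoc[OF ph(1)]) (use h' t p' in simp_all)
   moreover have "und_arr q \<odot> (und_arr ?h \<odot> ?t) = ?p2 \<odot> ?t"
    by (rule cmp_reassoc[OF ph(2)]) (use h' t q' in simp_all)
   ultimately show "und_arr ?h \<odot> ?t \<in> Hom C T (src C (und_arr p)) \<and> und_arr p \<odot> (und_arr ?h \<odot> ?t) = f \<and> und_arr q \<odot> (und_arr ?h \<odot> ?t) = g"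
    using h' t p' by simp
   fix l assume l: "l \<in> Hom C T (src C (und_arr p)) \<and> und_arr p \<odot> l = f \<and> und_arr q \<odot> l = g"
   then have l': "l \<in> arrs C" "src C l = T" "tgt C l = und ?P" using p' by auto
   have "?p1 \<odot> (und_arr ?k \<odot> l) = und_arr p \<odot> l"
    by (rule cmp_reassoc[OF pk(1)]) (use k' l' pr in simp_all)
   moreover have "?p2 \<odot> (und_arr ?k \<odot> l) = und_arr q \<odot> l"
    by (rule cmp_reassoc[OF pk(2)]) (use k' l' pr in simp_all)
   ultimately have "?t = und_arr ?k \<odot> l"
    by (intro tuple_eqI[OF prod_cone(1)[OF X(1) Z(1)]]) (use l l' k' pr in simp_all)
   then have "und_arr ?h \<odot> ?t = und_arr ?h \<odot> (und_arr ?k \<odot> l)" by simp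
   also have "\<dots> = idn C (und ?P) \<odot> l"
    by (rule cmp_reassoc[OF hk]) (use h' k' l' in simp_all)
   finally show "l = und_arr ?h \<odot> ?t" using l' by simp
  qed
 qed (use p' q' in auto)
 have c: "reix ?p1 (rlz ?X) \<in> rels ?R" "reix ?p2 (rlz ?Z) \<in> rels ?R"
  using reix_closed'[OF pr(1-3) X(2)] reix_closed'[OF pr(4-6) Z(2)] .
 have "reix (und_arr ?k) (rlz ?Q) = pairs (und ?P) (reix (und_arr p) (rlz ?X)) (reix (und_arr q) (rlz ?Z))"
  using reix_pairs[OF k' c] reix_cmp[OF k'(1) pr(1) _ pr(3) X(2)] reix_cmp[OF k'(1) pr(4) _ pr(6) Z(2)] pk k' pr
  by simp
 moreover have "reix (und_arr ?k) (reix (und_arr ?h) (rlz ?P)) = rlz ?P"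
  using reix_cmp[OF k'(1) h'(1) _ h'(3) P(2)] hk h' k' reix_idn[OF P(2,1)] by simp
 moreover have "ent ?R (rlz ?Q) (reix (und_arr ?h) (rlz ?P))"
  using asm_arrD(6)[OF h(1)] unfolding h(2,3) by simp
 then have "ent (und ?P) (reix (und_arr ?k) (rlz ?Q)) (reix (und_arr ?k) (reix (und_arr ?h) (rlz ?P)))"
  by (rule ent_reix[OF _ k'])
   (use asmD(2)[OF Q(1)] reix_closed'[OF h' P(2)] in simp_all)
 ultimately show "ent (und ?P) (pairs (und ?P) (reix (und_arr p) (rlz ?X)) (reix (und_arr q) (rlz ?Z))) (rlz ?P)"
  by simp
qed

text \<open>Every element of \<open>A\<close> realizes a valid equation, so only its validity
  matters. An entailment into \<open>V\<close> makes the equation hold wherever a point has a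
  realizer, that is, on a cover, and equality of arrows is local.\<close>

lemma rep_equalizer:
 assumes f: "f \<in> Hom AS X Y" and g: "g \<in> Hom AS X Y" and V: "V \<in> rels (und X)"
  and rel: "\<And>a x. rel (und X) V a x \<longleftrightarrow> a \<in> els (src C x) \<and> x \<in> arrs C \<and> tgt C x = und X \<and>
   und_arr f \<odot> x = und_arr g \<odot> x"
 shows "rep X {m. is_equalizer AS m f g} V"
proof -
 have f1: "f \<in> arrs AS" "fst f = X" "snd (snd f) = Y" and g1: "g \<in> arrs AS" "fst g = X" "snd (snd g) = Y"
  using f g by auto
 note f' = asm_arrD[OF f1(1), unfolded f1(2,3)] and g' = asm_arrD[OF g1(1), unfolded g1(2,3)]
 obtain W where W: "rep X W V"
  using comprehension[OF f'(1) V] by metis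
 have "mem AS h W \<longleftrightarrow> h \<in> arrs AS \<and> tgt AS h = X \<and> f \<odot>\<^bsub>AS\<^esub> h = g \<odot>\<^bsub>AS\<^esub> h" for h
 proof -
  have "ent (und (fst h)) (rlz (fst h)) (reix (und_arr h) V) \<longleftrightarrow> und_arr f \<odot> und_arr h = und_arr g \<odot> und_arr h"
   if h: "h \<in> arrs AS" "snd (snd h) = X"
  proof -
   note h' = asm_arrD[OF h(1), unfolded h(2)] and Z = asmD[OF asm_arrD(1)[OF h(1)]]
   have c: "reix (und_arr h) V \<in> rels (und (fst h))" by (rule reix_closed'[OF h'(3-5) V])
   show ?thesis
   proof
    assume e: "ent (und (fst h)) (rlz (fst h)) (reix (und_arr h) V)"
    have "tot (und (fst h)) (reix (und_arr h) V)"
     by (rule tot_ent[OF Z(3) e Z(2)])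
    then have cv: "cvr C (und (fst h)) (\<lambda>k. \<exists>a. rel (und (fst h)) (reix (und_arr h) V) a (idn C (und (fst h)) \<odot> k))"
     unfolding tot_def using Z(1) by (auto dest!: bspec[of _ _ "idn C (und (fst h))"])
    show "und_arr f \<odot> und_arr h = und_arr g \<odot> und_arr h"
    proof (rule cvr_eq)
     show "cvr C (src C (und_arr f \<odot> und_arr h)) (\<lambda>k. \<exists>a. rel (und (fst h)) (reix (und_arr h) V) a (idn C (und (fst h)) \<odot> k))"
      using cv h' f' by simp
     fix k assume k: "k \<in> arrs C" "tgt C k = src C (und_arr f \<odot> und_arr h)"
      "\<exists>a. rel (und (fst h)) (reix (und_arr h) V) a (idn C (und (fst h)) \<odot> k)"
     then obtain a where "rel (und X) V a (und_arr h \<odot> k)"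
      using rel_reix'[OF h'(3-5) V] h' f' by auto
     then have "und_arr f \<odot> (und_arr h \<odot> k) = und_arr g \<odot> (und_arr h \<odot> k)"
      unfolding rel by blast
     then show "(und_arr f \<odot> und_arr h) \<odot> k = (und_arr g \<odot> und_arr h) \<odot> k"
      using h' f' g' k by simp
    qed (use h' f' g' in simp_all)
   next
    assume e: "und_arr f \<odot> und_arr h = und_arr g \<odot> und_arr h"
    show "ent (und (fst h)) (rlz (fst h)) (reix (und_arr h) V)"
    proof (rule ent_incl[OF Z(2) c])
     fix a x assume a: "rel (und (fst h)) (rlz (fst h)) a x"
     note x = rel_arr[OF a]
     have "und_arr f \<odot> (und_arr h \<odot> x) = (und_arr g \<odot> und_arr h) \<odot> x"
      by (rule cmp_reassoc[OF e]) (use h' f' x in simp_all)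
     then show "rel (und (fst h)) (reix (und_arr h) V) a x"
      unfolding rel_reix'[OF h'(3-5) V] rel using x h' g' by simp
    qed
   qed
  qed
  then show ?thesis
   unfolding rep_mem[OF W] using f1 g1 by auto
 qed
 then have "{m. is_equalizer AS m f g} = W"
  using W f g by (intro Asm.equalizer_charI) (auto simp: rep_def)
 with W show ?thesis by simp
qed

lemma asm_finite_limits: "finite_limit_category AS"
proof unfold_locales
 show "\<exists>T. is_terminal AS T" using asm_terminal by blast
next
 fix X Y assume "X \<in> objs AS" "Y \<in> objs AS"
 then have "is_asm C S X" "is_asm C S Y" by auto
 from asm_product(4)[OF this] show "\<exists>p q. is_product AS p q \<and> tgt AS p = X \<and> tgt AS q = Y"
  by (intro exI conjI) auto
next
 fix f g X Y assume f: "f \<in> Hom AS X Y" and g: "g \<in> Hom AS X Y"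
 then have f1: "f \<in> arrs AS" "fst f = X" "snd (snd f) = Y" and g1: "g \<in> arrs AS" "fst g = X" "snd (snd g) = Y" by auto
 note f' = asm_arrD[OF f1(1), unfolded f1(2,3)] and g' = asm_arrD[OF g1(1), unfolded g1(2,3)]
 let ?p = "FEq (TApp (und_arr f) (rv 1)) (TApp (und_arr g) (rv 1)) :: ('o, 'm) bfml"
 have wf: "wf_fml C [Inl 0 \<mapsto> A, Inl 1 \<mapsto> und X] ?p"
  using f' g' by auto
 have o: "und X \<in> objs C" using asmD(1)[OF f'(1)] .
 have "rep X {m. is_equalizer AS m f g} (relset (und X) ?p)"
  by (rule rep_equalizer[OF f g relset_closed[OF wf o]]) (unfold rel_relset[OF wf o], simp)
 \<comment> \<open>The set of all equalizers has just been shown to be a subobject, and as such it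
   is nonempty.\<close>
 then obtain m where "m \<in> {m. is_equalizer AS m f g}"
  using Asm.carrier_SubE Asm.sub_of_self unfolding rep_def by metis
 then show "\<exists>e. is_equalizer AS e f g" by blast
qed

end

sublocale pca_filter \<subseteq> Asm: finite_limit_category "Asm C S \<phi>"
 by (rule asm_finite_limits)

context pca_filter
begin

section \<open>Sequents and their structural rules\<close>

text \<open>Carries the typing along with the entailment, so that structural rules can be chained
  with few side conditions.\<close>

definition seq :: "'o \<Rightarrow> 'm set \<Rightarrow> 'm set \<Rightarrow> bool" where
 "seq G U V \<longleftrightarrow> G \<in> objs C \<and> U \<in> rels G \<and> V \<in> rels G \<and> ent G U V"

lemma seq_obj: "seq G U V \<Longrightarrow> G \<in> objs C"
 and seq_closed: "seq G U V \<Longrightarrow> U \<in> rels G" "seq G U V \<Longrightarrow> V \<in> rels G"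
 by (auto simp: seq_def)

lemma seq_refl: "G \<in> objs C \<Longrightarrow> U \<in> rels G \<Longrightarrow> seq G U U"
 by (simp add: seq_def ent_refl)

lemma seq_trans: "seq G U V \<Longrightarrow> seq G V W \<Longrightarrow> seq G U W"
 using ent_trans unfolding seq_def by blast

lemma seq_fst: "seq G U W \<Longrightarrow> V \<in> rels G \<Longrightarrow> seq G (pairs G U V) W"
 using ent_fst ent_trans pairs_closed unfolding seq_def by metis

lemma seq_snd: "seq G V W \<Longrightarrow> U \<in> rels G \<Longrightarrow> seq G (pairs G U V) W"
 using ent_snd ent_trans pairs_closed unfolding seq_def by metis

lemma seq_pair: "seq G E U \<Longrightarrow> seq G E V \<Longrightarrow> seq G E (pairs G U V)"
 using ent_pair pairs_closed unfolding seq_def by metis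

lemma seq_im:
 assumes "q \<in> arrs C" "src C q = P" "tgt C q = G" "W \<in> rels P" "U \<in> rels G"
 shows "seq G (im q W) U \<longleftrightarrow> seq P W (reix q U)"
 using ent_im[OF assms] im_closed[of q W] reix_closed'[OF assms(1-3,5)] assms by (auto simp: seq_def)

lemma seq_all:
 assumes "q \<in> arrs C" "src C q = P" "tgt C q = G" "W \<in> rels P" "V \<in> rels P" "U \<in> rels G"
 shows "seq P (pairs P (reix q U) W) V \<longleftrightarrow> seq G U (all q W V)"
 using ent_all[OF assms] all_closed[of q W V] reix_closed'[OF assms(1-3,6)] assms pairs_closed
 by (auto simp: seq_def)

abbreviation imp :: "'o \<Rightarrow> 'm set \<Rightarrow> 'm set \<Rightarrow> 'm set" where
 "imp G U V \<equiv> all (idn C G) U V"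

lemma imp_closed: "G \<in> objs C \<Longrightarrow> U \<in> rels G \<Longrightarrow> V \<in> rels G \<Longrightarrow> imp G U V \<in> rels G"
 using all_closed[of "idn C G" U V] by simp

lemma rel_imp:
 assumes "G \<in> objs C" "U \<in> rels G" "V \<in> rels G"
 shows "rel G (imp G U V) a g \<longleftrightarrow> a \<in> els (src C g) \<and> g \<in> arrs C \<and> tgt C g = G \<and>
   (\<forall>k \<in> arrs C. tgt C k = src C g \<longrightarrow> (\<forall>b. rel G U b (g \<odot> k) \<longrightarrow>
    (\<exists>c. ap (a \<odot> k) b = Some c \<and> rel G V c (g \<odot> k))))"
proof -
 have i: "idn C G \<in> arrs C" "src C (idn C G) = G" "tgt C (idn C G) = G" using assms by auto
 have "(\<forall>b z. idn C G \<odot> z = g \<odot> k \<longrightarrow> src C z = src C k \<longrightarrow> rel G U b z \<longrightarrow>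
    (\<exists>c. ap (a \<odot> k) b = Some c \<and> rel G V c z)) \<longleftrightarrow>
   (\<forall>b. rel G U b (g \<odot> k) \<longrightarrow> (\<exists>c. ap (a \<odot> k) b = Some c \<and> rel G V c (g \<odot> k)))"
  if "k \<in> arrs C" "tgt C k = src C g" "g \<in> arrs C" "tgt C g = G" for k
 proof -
  have "idn C G \<odot> z = z" if "rel G U b z" for b z
   using rel_arr[OF that] by simp
  moreover have "src C (g \<odot> k) = src C k" "idn C G \<odot> (g \<odot> k) = g \<odot> k" using that by auto
  ultimately show ?thesis by metis
 qed
 then show ?thesis
  using rel_all[of "idn C G" U V a g] i assms by auto
qed

lemma seq_imp:
 assumes "U \<in> rels G" "V \<in> rels G" "W \<in> rels G" "G \<in> objs C"
 shows "seq G (pairs G W U) V \<longleftrightarrow> seq G W (imp G U V)"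
 using seq_all[of "idn C G" G G U V W] assms by (simp add: reix_idn)

lemma seq_swap:
 assumes "seq G (pairs G U V) W" "U \<in> rels G" "V \<in> rels G"
 shows "seq G (pairs G V U) W"
proof -
 have o: "G \<in> objs C" using assms(1) by (rule seq_obj)
 have "seq G (pairs G V U) (pairs G U V)"
  by (intro seq_pair seq_snd[OF seq_refl] seq_fst[OF seq_refl] o assms)
 with assms(1) show ?thesis by (blast intro: seq_trans)
qed

text \<open>Stability of implication under reindexing; it is what lets an implication cross the
  adjunction between image and reindexing.\<close>

lemma reix_imp:
 assumes f: "f \<in> arrs C" "src C f = P" "tgt C f = G" and UV: "U \<in> rels G" "V \<in> rels G"
 shows "reix f (imp G U V) = imp P (reix f U) (reix f V)"
proof (rule rels_eqI)
 have o: "G \<in> objs C" "P \<in> objs C" using f by auto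
 note c = reix_closed'[OF f UV(1)] reix_closed'[OF f UV(2)] imp_closed[OF o(1) UV]
 show "reix f (imp G U V) \<in> rels P" "imp P (reix f U) (reix f V) \<in> rels P" "P \<in> objs C"
  using reix_closed'[OF f c(3)] imp_closed[OF o(2) c(1,2)] o by auto
 fix a g
 have "rel G W b ((f \<odot> g) \<odot> k) \<longleftrightarrow> rel P (reix f W) b (g \<odot> k)"
  if "W \<in> rels G" "g \<in> arrs C" "tgt C g = P" "k \<in> arrs C" "tgt C k = src C g" for W b k
  using rel_reix'[OF f that(1), of b "g \<odot> k"] that f by simp
 note e = this[OF UV(1)] this[OF UV(2)]
 show "rel P (reix f (imp G U V)) a g \<longleftrightarrow> rel P (imp P (reix f U) (reix f V)) a g"
  unfolding rel_reix'[OF f c(3)] rel_imp[OF o(1) UV] rel_imp[OF o(2) c(1,2)]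
  using e f by auto
qed

lemma repD: "rep \<Gamma> W V \<Longrightarrow> W \<in> subs AS \<Gamma>" "rep \<Gamma> W V \<Longrightarrow> V \<in> rels (und \<Gamma>)"
 by (auto simp: rep_def)

lemma rep_ex: "is_asm C S \<Gamma> \<Longrightarrow> V \<in> rels (und \<Gamma>) \<Longrightarrow> \<exists>W. rep \<Gamma> W V"
 using comprehension by metis

lemma seq_rlz:
 assumes "f \<in> arrs AS"
 shows "seq (und (fst f)) (rlz (fst f)) (reix (und_arr f) (rlz (snd (snd f))))"
 using asm_arrD[OF assms] asmD[of "fst f"] asmD[of "snd (snd f)"] reix_closed' unfolding seq_def by blast

lemma rep_le_seq:
 assumes "rep \<Gamma> W V" "rep \<Gamma> W' V'" "is_asm C S \<Gamma>"
 shows "W \<sqsubseteq>\<^bsub>Sub AS \<Gamma>\<^esub> W' \<longleftrightarrow> seq (und \<Gamma>) (pairs (und \<Gamma>) (rlz \<Gamma>) V) V'"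
 using rep_le[OF assms] repD[OF assms(1)] repD[OF assms(2)] asmD[OF assms(3)] pairs_closed unfolding seq_def by auto

lemma rep_mem_seq:
 assumes "rep \<Gamma> W V"
 shows "mem AS f W \<longleftrightarrow> f \<in> arrs AS \<and> snd (snd f) = \<Gamma> \<and> seq (und (fst f)) (rlz (fst f)) (reix (und_arr f) V)"
proof -
 have "seq (und (fst f)) (rlz (fst f)) (reix (und_arr f) V) \<longleftrightarrow> ent (und (fst f)) (rlz (fst f)) (reix (und_arr f) V)"
  if "f \<in> arrs AS" "snd (snd f) = \<Gamma>"
  using asm_arrD[OF that(1)] asmD[of "fst f"] reix_closed' repD(2)[OF assms] that(2) unfolding seq_def by blast
 then show ?thesis
  unfolding rep_mem[OF assms] by blast
qed

text \<open>Inclusion of subobjects compares representations only in the presence of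
  \<open>rlz \<Gamma>\<close>. Equivalence in that context therefore makes the comprehension of
  \<open>V'\<close> equal to \<open>W\<close>.\<close>

lemma rep_cong:
 assumes "rep \<Gamma> W V" "is_asm C S \<Gamma>" "seq (und \<Gamma>) (pairs (und \<Gamma>) (rlz \<Gamma>) V) V'" "seq (und \<Gamma>) (pairs (und \<Gamma>) (rlz \<Gamma>) V') V"
 shows "rep \<Gamma> W V'"
proof -
 have V': "V' \<in> rels (und \<Gamma>)" using assms(3) by (rule seq_closed)
 obtain W' where W': "rep \<Gamma> W' V'" using rep_ex[OF assms(2) V'] by blast
 have "W \<sqsubseteq>\<^bsub>Sub AS \<Gamma>\<^esub> W'" "W' \<sqsubseteq>\<^bsub>Sub AS \<Gamma>\<^esub> W"
  using rep_le_seq[OF assms(1) W' assms(2)] rep_le_seq[OF W' assms(1,2)] assms(3,4) by auto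
 then have "W = W'"
  using partial_order.le_antisym[OF Asm.Sub_partial_order] repD(1)[OF assms(1)] repD(1)[OF W'] by blast
 with W' show ?thesis by simp
qed

section \<open>Representations of the logical operations\<close>

lemma rep_top:
 assumes \<Gamma>: "is_asm C S \<Gamma>" and V: "V \<in> rels (und \<Gamma>)"
  and "\<And>a g. a \<in> els (src C g) \<Longrightarrow> g \<in> arrs C \<Longrightarrow> tgt C g = und \<Gamma> \<Longrightarrow> rel (und \<Gamma>) V a g"
 shows "rep \<Gamma> (\<top>\<^bsub>Sub AS \<Gamma>\<^esub>) V"
proof -
 have o: "\<Gamma> \<in> objs AS" using \<Gamma> by simp
 have "ent (und (fst f)) (rlz (fst f)) (reix (und_arr f) V)" if f: "f \<in> arrs AS" "snd (snd f) = \<Gamma>" for f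
 proof -
  note f' = asm_arrD[OF f(1), unfolded f(2)] and X = asmD[OF asm_arrD(1)[OF f(1)]]
  show ?thesis
  proof (rule ent_incl[OF X(2) reix_closed'[OF f'(3-5) V]])
   fix a g assume "rel (und (fst f)) (rlz (fst f)) a g"
   from rel_arr[OF this] f' assms(3)[of a "und_arr f \<odot> g"]
   show "rel (und (fst f)) (reix (und_arr f) V) a g"
    unfolding rel_reix'[OF f'(3-5) V] by simp
  qed
 qed
 then show ?thesis
  unfolding rep_def using Asm.top_carrier[OF o] Asm.mem_top[OF o] V by auto
qed

lemma rep_bottom:
 assumes \<Gamma>: "is_asm C S \<Gamma>" and V: "V \<in> rels (und \<Gamma>)"
  and bot: "\<And>a g. rel (und \<Gamma>) V a g \<Longrightarrow> cvr C (src C g) (\<lambda>k. False)"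
 shows "rep \<Gamma> (\<bottom>\<^bsub>Sub AS \<Gamma>\<^esub>) V"
proof -
 note G = asmD[OF \<Gamma>]
 obtain W where W: "rep \<Gamma> W V" using rep_ex[OF \<Gamma> V] by blast
 have "\<bottom>\<^bsub>Sub AS \<Gamma>\<^esub> = W"
 proof (rule partial_order.bottom_eqI[OF Asm.Sub_partial_order repD(1)[OF W]])
  fix U assume "U \<in> subs AS \<Gamma>"
  then obtain VU where U: "rep \<Gamma> U VU" using rep_exists by blast
  have "seq (und \<Gamma>) V VU"
   using ent_bot[OF V repD(2)[OF U] bot] G V repD(2)[OF U] by (simp add: seq_def)
  then show "W \<sqsubseteq>\<^bsub>Sub AS \<Gamma>\<^esub> U"
   unfolding rep_le_seq[OF W U \<Gamma>] using G by (intro seq_snd)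
 qed
 with W show ?thesis by simp
qed

lemma rep_meet:
 assumes \<Gamma>: "is_asm C S \<Gamma>" and 1: "rep \<Gamma> W1 V1" and 2: "rep \<Gamma> W2 V2"
 shows "rep \<Gamma> (W1 \<sqinter>\<^bsub>Sub AS \<Gamma>\<^esub> W2) (pairs (und \<Gamma>) V1 V2)"
proof -
 note G = asmD[OF \<Gamma>] and V = repD(2)[OF 1] repD(2)[OF 2]
 obtain W where W: "rep \<Gamma> W (pairs (und \<Gamma>) V1 V2)"
  using rep_ex[OF \<Gamma> pairs_closed[OF G(1) V]] by blast
 have "W1 \<sqinter>\<^bsub>Sub AS \<Gamma>\<^esub> W2 = W"
 proof (rule Asm.meet_charI[OF repD(1)[OF W] repD(1)[OF 1] repD(1)[OF 2]])
  fix f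
  have "seq (und (fst f)) (rlz (fst f)) (reix (und_arr f) (pairs (und \<Gamma>) V1 V2)) \<longleftrightarrow>
    seq (und (fst f)) (rlz (fst f)) (reix (und_arr f) V1) \<and> seq (und (fst f)) (rlz (fst f)) (reix (und_arr f) V2)"
   if f: "f \<in> arrs AS" "snd (snd f) = \<Gamma>"
  proof -
   note f' = asm_arrD[OF f(1), unfolded f(2)] and X = asmD[OF asm_arrD(1)[OF f(1)]]
   note c = reix_closed'[OF f'(3-5) V(1)] reix_closed'[OF f'(3-5) V(2)]
   show ?thesis
    unfolding reix_pairs[OF f'(3-5) V]
    using seq_pair seq_trans seq_fst[OF seq_refl] seq_snd[OF seq_refl] c X(1) by blast
  qed
  then show "mem AS f W \<longleftrightarrow> mem AS f W1 \<and> mem AS f W2"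
   unfolding rep_mem_seq[OF W] rep_mem_seq[OF 1] rep_mem_seq[OF 2] by blast
 qed
 with W show ?thesis by simp
qed

text \<open>Inclusions involve the conjunct \<open>rlz \<Gamma>\<close> on the left, where it stands
  in the way of the universal property of \<open>orr\<close>. It is moved into an implication on the
  right.\<close>

lemma rep_join:
 assumes \<Gamma>: "is_asm C S \<Gamma>" and 1: "rep \<Gamma> W1 V1" and 2: "rep \<Gamma> W2 V2"
 shows "rep \<Gamma> (W1 \<squnion>\<^bsub>Sub AS \<Gamma>\<^esub> W2) (orr (und \<Gamma>) V1 V2)"
proof -
 note G = asmD[OF \<Gamma>] and V = repD(2)[OF 1] repD(2)[OF 2]
 note c = orr_closed[OF G(1) V]
 obtain W where W: "rep \<Gamma> W (orr (und \<Gamma>) V1 V2)"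
  using rep_ex[OF \<Gamma> c] by blast
 have "W1 \<squnion>\<^bsub>Sub AS \<Gamma>\<^esub> W2 = W"
 proof (rule partial_order.join_eqI[OF Asm.Sub_partial_order repD(1)[OF W] repD(1)[OF 1] repD(1)[OF 2]])
  fix U assume "U \<in> subs AS \<Gamma>"
  then obtain VU where U: "rep \<Gamma> U VU" using rep_exists by blast
  note VU = repD(2)[OF U]
  have i: "imp (und \<Gamma>) (rlz \<Gamma>) VU \<in> rels (und \<Gamma>)" by (rule imp_closed[OF G(1,2) VU])
  have e: "seq (und \<Gamma>) (pairs (und \<Gamma>) (rlz \<Gamma>) D) VU \<longleftrightarrow> seq (und \<Gamma>) D (imp (und \<Gamma>) (rlz \<Gamma>) VU)"
   if "D \<in> rels (und \<Gamma>)" for D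
   using seq_imp[OF G(2) VU that G(1)] seq_swap[of "und \<Gamma>"] that G(2) by blast
  have "seq (und \<Gamma>) (orr (und \<Gamma>) V1 V2) (imp (und \<Gamma>) (rlz \<Gamma>) VU) \<longleftrightarrow>
    seq (und \<Gamma>) V1 (imp (und \<Gamma>) (rlz \<Gamma>) VU) \<and> seq (und \<Gamma>) V2 (imp (und \<Gamma>) (rlz \<Gamma>) VU)"
   using ent_orr[OF G(1) V i] G(1) V c i by (auto simp: seq_def)
  then show "W \<sqsubseteq>\<^bsub>Sub AS \<Gamma>\<^esub> U \<longleftrightarrow> W1 \<sqsubseteq>\<^bsub>Sub AS \<Gamma>\<^esub> U \<and> W2 \<sqsubseteq>\<^bsub>Sub AS \<Gamma>\<^esub> U"
   unfolding rep_le_seq[OF W U \<Gamma>] rep_le_seq[OF 1 U \<Gamma>] rep_le_seq[OF 2 U \<Gamma>] e[OF c] e[OF V(1)] e[OF V(2)] .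
 qed
 with W show ?thesis by simp
qed

text \<open>Currying the premise \<open>V1\<close> leaves the three premises grouped differently
  from the meet; regrouping the pairs identifies the two sides.\<close>

lemma rep_himp:
 assumes \<Gamma>: "is_asm C S \<Gamma>" and 1: "rep \<Gamma> W1 V1" and 2: "rep \<Gamma> W2 V2"
 shows "rep \<Gamma> (himp (Sub AS \<Gamma>) W1 W2) (imp (und \<Gamma>) V1 V2)"
proof -
 let ?G = "und \<Gamma>"
 note G = asmD[OF \<Gamma>] and V = repD(2)[OF 1] repD(2)[OF 2]
 obtain W where W: "rep \<Gamma> W (imp ?G V1 V2)"
  using rep_ex[OF \<Gamma> imp_closed[OF G(1) V]] by blast
 have "himp (Sub AS \<Gamma>) W1 W2 = W"
 proof (rule himp_eqI[OF Asm.Sub_partial_order repD(1)[OF W]])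
  fix Z assume "Z \<in> subs AS \<Gamma>"
  then obtain VZ where Z: "rep \<Gamma> Z VZ" using rep_exists by blast
  note VZ = repD(2)[OF Z]
  note c = pairs_closed[OF G(1,2) VZ] pairs_closed[OF G(1) VZ V(1)]
  have "Z \<sqsubseteq>\<^bsub>Sub AS \<Gamma>\<^esub> W \<longleftrightarrow> seq ?G (pairs ?G (pairs ?G (rlz \<Gamma>) VZ) V1) V2"
   unfolding rep_le_seq[OF Z W \<Gamma>] using seq_imp[OF V c(1) G(1)] by blast
  moreover have "Z \<sqinter>\<^bsub>Sub AS \<Gamma>\<^esub> W1 \<sqsubseteq>\<^bsub>Sub AS \<Gamma>\<^esub> W2 \<longleftrightarrow> seq ?G (pairs ?G (rlz \<Gamma>) (pairs ?G VZ V1)) V2"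
   by (rule rep_le_seq[OF rep_meet[OF \<Gamma> Z 1] 2 \<Gamma>])
  moreover have "seq ?G (pairs ?G (pairs ?G (rlz \<Gamma>) VZ) V1) (pairs ?G (rlz \<Gamma>) (pairs ?G VZ V1))"
   by (intro seq_pair seq_fst[OF seq_fst[OF seq_refl]] seq_fst[OF seq_snd[OF seq_refl]] seq_snd[OF seq_refl] c G V VZ)
  moreover have "seq ?G (pairs ?G (rlz \<Gamma>) (pairs ?G VZ V1)) (pairs ?G (pairs ?G (rlz \<Gamma>) VZ) V1)"
   by (intro seq_pair seq_fst[OF seq_refl] seq_snd[OF seq_fst[OF seq_refl]] seq_snd[OF seq_snd[OF seq_refl]] c G V VZ)
  ultimately show "Z \<sqsubseteq>\<^bsub>Sub AS \<Gamma>\<^esub> W \<longleftrightarrow> Z \<sqinter>\<^bsub>Sub AS \<Gamma>\<^esub> W1 \<sqsubseteq>\<^bsub>Sub AS \<Gamma>\<^esub> W2"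
   using seq_trans by blast
 qed
 with W show ?thesis by simp
qed

text \<open>The elements of the comprehension of the reindexed predicate are those that
  \<open>g\<close> sends into \<open>W\<close>. By the criterion for inverse images it therefore is
  the inverse image, and no pullback of assemblies has to be constructed.\<close>

lemma rep_inv_im:
 assumes g: "g \<in> arrs AS" and W: "rep (snd (snd g)) W V"
 shows "rep (fst g) (inv_im AS g W) (reix (und_arr g) V)"
proof -
 note g' = asm_arrD[OF g] and V = repD(2)[OF W]
 obtain W' where W': "rep (fst g) W' (reix (und_arr g) V)"
  using rep_ex[OF g'(1) reix_closed'[OF g'(3-5) V]] by blast
 have "inv_im AS g W = W'"
 proof (rule Asm.inv_im_charI[OF _ repD(1)[OF W] repD(1)[OF W']])
  show "g \<in> Hom AS (fst g) (snd (snd g))" using g by simp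
  fix f
  have "mem AS f W' \<longleftrightarrow> mem AS (g \<odot>\<^bsub>AS\<^esub> f) W" if f: "f \<in> arrs AS" "snd (snd f) = fst g"
  proof -
   note f' = asm_arrD[OF f(1), unfolded f(2)]
   have gf: "g \<odot>\<^bsub>AS\<^esub> f \<in> arrs AS" by (rule Asm.cmp_simps(1)) (use f g in simp_all)
   have "reix (und_arr g \<odot> und_arr f) V = reix (und_arr f) (reix (und_arr g) V)"
    by (rule reix_cmp[OF f'(3) g'(3) _ g'(5) V]) (use f' g' in simp)
   then show ?thesis
    unfolding rep_mem[OF W'] rep_mem[OF W] using f gf by simp
  qed
  then show "mem AS f W' \<longleftrightarrow> f \<in> arrs AS \<and> tgt AS f = fst g \<and> mem AS (g \<odot>\<^bsub>AS\<^esub> f) W"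
   unfolding rep_mem[OF W'] by auto
 qed
 with W' show ?thesis by simp
qed

lemma inv_im_asm_closed:
 assumes "g \<in> arrs AS" "W \<in> subs AS (snd (snd g))"
 shows "inv_im AS g W \<in> subs AS (fst g)"
proof -
 obtain V where "rep (snd (snd g)) W V" using rep_exists[OF assms(2)] by blast
 from repD(1)[OF rep_inv_im[OF assms(1) this]] show ?thesis .
qed

text \<open>Since \<open>f\<close> is tracked, the image of \<open>?E\<close> already entails the
  existence predicate of the codomain. The conjunct contributed by the codomain can then be dropped,
  and the adjunction for realizability predicates applies.\<close>

lemma asm_ex_adj:
 assumes f: "f \<in> arrs AS" and W: "rep (fst f) W V"
  and W': "rep (snd (snd f)) W' (im (und_arr f) (pairs (und (fst f)) (rlz (fst f)) V))"
  and U: "U \<in> subs AS (snd (snd f))"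
 shows "W' \<sqsubseteq>\<^bsub>Sub AS (snd (snd f))\<^esub> U \<longleftrightarrow> W \<sqsubseteq>\<^bsub>Sub AS (fst f)\<^esub> inv_im AS f U"
proof -
 let ?G = "und (snd (snd f))" and ?P = "und (fst f)" and ?q = "und_arr f"
 let ?E = "pairs ?P (rlz (fst f)) V" and ?I = "im ?q (pairs ?P (rlz (fst f)) V)" and ?rG = "rlz (snd (snd f))"
 note f' = asm_arrD[OF f] and V = repD(2)[OF W]
 note P = asmD[OF f'(1)] and G = asmD[OF f'(2)]
 obtain VU where VU: "rep (snd (snd f)) U VU" using rep_exists[OF U] by blast
 have E: "?E \<in> rels ?P" by (rule pairs_closed[OF P(1,2) V])
 have I: "?I \<in> rels ?G" by (rule repD(2)[OF W'])
 have "seq ?P ?E (reix ?q ?rG)"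
  by (rule seq_fst[OF seq_rlz[OF f] V])
 then have IG: "seq ?G ?I ?rG"
  by (simp add: seq_im[OF f'(3-5) E G(2)])
 have "W' \<sqsubseteq>\<^bsub>Sub AS (snd (snd f))\<^esub> U \<longleftrightarrow> seq ?G (pairs ?G ?rG ?I) VU"
  by (rule rep_le_seq[OF W' VU f'(2)])
 also have "\<dots> \<longleftrightarrow> seq ?G ?I VU"
  using seq_trans[OF seq_pair[OF IG seq_refl[OF G(1) I]]] seq_snd[of ?G ?I VU ?rG] G(2) by blast
 also have "\<dots> \<longleftrightarrow> seq ?P ?E (reix ?q VU)"
  by (rule seq_im[OF f'(3-5) E repD(2)[OF VU]])
 also have "\<dots> \<longleftrightarrow> W \<sqsubseteq>\<^bsub>Sub AS (fst f)\<^esub> inv_im AS f U"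
  by (rule rep_le_seq[OF W rep_inv_im[OF f VU] f'(1), symmetric])
 finally show ?thesis .
qed

text \<open>After transposition the existence predicate of the codomain appears reindexed among the
  premises. It is redundant there, because \<open>f\<close> is tracked and the existence predicate
  of the domain is also a premise.\<close>

lemma asm_all_adj:
 assumes f: "f \<in> arrs AS" and W: "rep (fst f) W V"
  and W': "rep (snd (snd f)) W' (all (und_arr f) (rlz (fst f)) V)"
  and U: "U \<in> subs AS (snd (snd f))"
 shows "inv_im AS f U \<sqsubseteq>\<^bsub>Sub AS (fst f)\<^esub> W \<longleftrightarrow> U \<sqsubseteq>\<^bsub>Sub AS (snd (snd f))\<^esub> W'"
proof -
 let ?G = "und (snd (snd f))" and ?P = "und (fst f)" and ?q = "und_arr f"
 let ?rP = "rlz (fst f)" and ?rG = "rlz (snd (snd f))"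
 note f' = asm_arrD[OF f] and V = repD(2)[OF W]
 note P = asmD[OF f'(1)] and G = asmD[OF f'(2)]
 obtain VU where VU: "rep (snd (snd f)) U VU" using rep_exists[OF U] by blast
 note c = repD(2)[OF VU] reix_closed'[OF f'(3-5) repD(2)[OF VU]] reix_closed'[OF f'(3-5) G(2)]
 have "U \<sqsubseteq>\<^bsub>Sub AS (snd (snd f))\<^esub> W' \<longleftrightarrow> seq ?G (pairs ?G ?rG VU) (all ?q ?rP V)"
  by (rule rep_le_seq[OF VU W' f'(2)])
 also have "\<dots> \<longleftrightarrow> seq ?P (pairs ?P (reix ?q (pairs ?G ?rG VU)) ?rP) V"
  by (rule seq_all[OF f'(3-5) P(2) V pairs_closed[OF G(1,2) c(1)], symmetric])
 also have "\<dots> \<longleftrightarrow> seq ?P (pairs ?P (pairs ?P (reix ?q ?rG) (reix ?q VU)) ?rP) V"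
  by (simp add: reix_pairs[OF f'(3-5) G(2) c(1)])
 also have "\<dots> \<longleftrightarrow> seq ?P (pairs ?P ?rP (reix ?q VU)) V"
 proof -
  have "seq ?P (pairs ?P ?rP (reix ?q VU)) (pairs ?P (pairs ?P (reix ?q ?rG) (reix ?q VU)) ?rP)"
   by (intro seq_pair seq_fst[OF seq_rlz[OF f]] seq_snd[OF seq_refl] seq_fst[OF seq_refl] P c)
  moreover have "seq ?P (pairs ?P (pairs ?P (reix ?q ?rG) (reix ?q VU)) ?rP) (pairs ?P ?rP (reix ?q VU))"
   by (intro seq_pair seq_snd[OF seq_refl] seq_fst[OF seq_snd[OF seq_refl]] P c pairs_closed)
  ultimately show ?thesis using seq_trans by blast
 qed
 also have "\<dots> \<longleftrightarrow> inv_im AS f U \<sqsubseteq>\<^bsub>Sub AS (fst f)\<^esub> W"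
  by (rule rep_le_seq[OF rep_inv_im[OF f VU] W f'(1), symmetric])
 finally show ?thesis by blast
qed

text \<open>The image map is picked by \<open>SOME\<close> as a whole function. Its value at
  \<open>W\<close> can be identified only once it is known that some adjoint exists, so an adjoint
  is first exhibited at all subobjects.\<close>

lemma rep_ex_im:
 assumes f: "f \<in> arrs AS" and W: "rep (fst f) W V"
 shows "rep (snd (snd f)) (ex_im AS f W) (im (und_arr f) (pairs (und (fst f)) (rlz (fst f)) V))"
proof -
 let ?\<Delta> = "snd (snd f)" and ?P = "und (fst f)"
 note f' = asm_arrD[OF f]
 note P = asmD[OF f'(1)] and G = asmD[OF f'(2)]
 have im: "im (und_arr f) (pairs ?P (rlz (fst f)) D) \<in> rels (und ?\<Delta>)" if "D \<in> rels ?P" for D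
  using im_closed[OF f'(3)] pairs_closed[OF P(1,2) that] f' by simp
 have "\<forall>X \<in> subs AS (fst f). \<exists>W'. W' \<in> subs AS ?\<Delta> \<and> (\<forall>U \<in> subs AS ?\<Delta>.
   W' \<sqsubseteq>\<^bsub>Sub AS ?\<Delta>\<^esub> U \<longleftrightarrow> X \<sqsubseteq>\<^bsub>Sub AS (fst f)\<^esub> inv_im AS f U)"
 proof
  fix X assume X: "X \<in> subs AS (fst f)"
  obtain D where D: "rep (fst f) X D" using rep_exists[OF X] by blast
  obtain W' where W': "rep ?\<Delta> W' (im (und_arr f) (pairs ?P (rlz (fst f)) D))"
   using rep_ex[OF f'(2) im[OF repD(2)[OF D]]] by blast
  from asm_ex_adj[OF f D W'] repD(1)[OF W'] show "\<exists>W'. W' \<in> subs AS ?\<Delta> \<and> (\<forall>U \<in> subs AS ?\<Delta>.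
   W' \<sqsubseteq>\<^bsub>Sub AS ?\<Delta>\<^esub> U \<longleftrightarrow> X \<sqsubseteq>\<^bsub>Sub AS (fst f)\<^esub> inv_im AS f U)"
   by blast
 qed
 from bchoice[OF this] obtain E where E: "\<forall>X \<in> subs AS (fst f). E X \<in> subs AS ?\<Delta> \<and> (\<forall>U \<in> subs AS ?\<Delta>.
   E X \<sqsubseteq>\<^bsub>Sub AS ?\<Delta>\<^esub> U \<longleftrightarrow> X \<sqsubseteq>\<^bsub>Sub AS (fst f)\<^esub> inv_im AS f U)"
  ..
 have "is_ex_im AS f E"
  unfolding is_ex_im_def galois_connection_iff[OF Asm.Sub_partial_order Asm.Sub_partial_order]
  using E inv_im_asm_closed[OF f] by auto
 then have "is_ex_im AS f (ex_im AS f)"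
  unfolding ex_im_def by (rule someI[of "is_ex_im AS f"])
 then have ei: "ex_im AS f W \<in> subs AS ?\<Delta>" "\<And>U. U \<in> subs AS ?\<Delta> \<Longrightarrow>
   ex_im AS f W \<sqsubseteq>\<^bsub>Sub AS ?\<Delta>\<^esub> U \<longleftrightarrow> W \<sqsubseteq>\<^bsub>Sub AS (fst f)\<^esub> inv_im AS f U"
  unfolding is_ex_im_def galois_connection_iff[OF Asm.Sub_partial_order Asm.Sub_partial_order]
  using repD(1)[OF W] by auto
 obtain W' where W': "rep ?\<Delta> W' (im (und_arr f) (pairs ?P (rlz (fst f)) V))"
  using rep_ex[OF f'(2) im[OF repD(2)[OF W]]] by blast
 interpret L: partial_order "Sub AS ?\<Delta>" by (rule Asm.Sub_partial_order)
 have "ex_im AS f W = W'"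
  using asm_ex_adj[OF f W W'] ei repD(1)[OF W'] L.le_refl L.le_antisym by blast
 with W' show ?thesis by simp
qed

lemma rep_all_im:
 assumes f: "f \<in> arrs AS" and W: "rep (fst f) W V"
 shows "rep (snd (snd f)) (all_im AS f W) (all (und_arr f) (rlz (fst f)) V)"
proof -
 let ?\<Delta> = "snd (snd f)" and ?P = "und (fst f)"
 note f' = asm_arrD[OF f]
 note P = asmD[OF f'(1)] and G = asmD[OF f'(2)]
 have al: "all (und_arr f) (rlz (fst f)) D \<in> rels (und ?\<Delta>)" if "D \<in> rels ?P" for D
  using all_closed[OF f'(3), of "rlz (fst f)" D] P that f' by simp
 have "\<forall>X \<in> subs AS (fst f). \<exists>W'. W' \<in> subs AS ?\<Delta> \<and> (\<forall>U \<in> subs AS ?\<Delta>.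
   inv_im AS f U \<sqsubseteq>\<^bsub>Sub AS (fst f)\<^esub> X \<longleftrightarrow> U \<sqsubseteq>\<^bsub>Sub AS ?\<Delta>\<^esub> W')"
 proof
  fix X assume X: "X \<in> subs AS (fst f)"
  obtain D where D: "rep (fst f) X D" using rep_exists[OF X] by blast
  obtain W' where W': "rep ?\<Delta> W' (all (und_arr f) (rlz (fst f)) D)"
   using rep_ex[OF f'(2) al[OF repD(2)[OF D]]] by blast
  from asm_all_adj[OF f D W'] repD(1)[OF W'] show "\<exists>W'. W' \<in> subs AS ?\<Delta> \<and> (\<forall>U \<in> subs AS ?\<Delta>.
   inv_im AS f U \<sqsubseteq>\<^bsub>Sub AS (fst f)\<^esub> X \<longleftrightarrow> U \<sqsubseteq>\<^bsub>Sub AS ?\<Delta>\<^esub> W')"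
   by blast
 qed
 from bchoice[OF this] obtain E where E: "\<forall>X \<in> subs AS (fst f). E X \<in> subs AS ?\<Delta> \<and> (\<forall>U \<in> subs AS ?\<Delta>.
   inv_im AS f U \<sqsubseteq>\<^bsub>Sub AS (fst f)\<^esub> X \<longleftrightarrow> U \<sqsubseteq>\<^bsub>Sub AS ?\<Delta>\<^esub> E X)"
  ..
 have "is_all_im AS f E"
  unfolding is_all_im_def galois_connection_iff[OF Asm.Sub_partial_order Asm.Sub_partial_order]
  using E inv_im_asm_closed[OF f] by auto
 then have "is_all_im AS f (all_im AS f)"
  unfolding all_im_def by (rule someI[of "is_all_im AS f"])
 then have ei: "all_im AS f W \<in> subs AS ?\<Delta>" "\<And>U. U \<in> subs AS ?\<Delta> \<Longrightarrow>
   inv_im AS f U \<sqsubseteq>\<^bsub>Sub AS (fst f)\<^esub> W \<longleftrightarrow> U \<sqsubseteq>\<^bsub>Sub AS ?\<Delta>\<^esub> all_im AS f W"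
  unfolding is_all_im_def galois_connection_iff[OF Asm.Sub_partial_order Asm.Sub_partial_order]
  using repD(1)[OF W] by auto
 obtain W' where W': "rep ?\<Delta> W' (all (und_arr f) (rlz (fst f)) V)"
  using rep_ex[OF f'(2) al[OF repD(2)[OF W]]] by blast
 interpret L: partial_order "Sub AS ?\<Delta>" by (rule Asm.Sub_partial_order)
 have "all_im AS f W = W'"
  using asm_all_adj[OF f W W'] ei repD(1)[OF W'] L.le_refl L.le_antisym by blast
 with W' show ?thesis by simp
qed

text \<open>The realizability clauses for quantifiers over an assembly \<open>X\<close> only supply a realizer of the
 bound variable; the realizer of the remaining context is supplied by \<open>rlz \<Gamma>\<close>.\<close>

lemma rep_ex_product:
 assumes pq: "is_product AS p q" and W: "rep (fst p) W V"
 defines "P \<equiv> und (fst p)" and "\<Gamma> \<equiv> snd (snd q)"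
 shows "rep \<Gamma> (ex_im AS q W) (im (und_arr q) (pairs P (reix (und_arr p) (rlz (snd (snd p)))) V))"
proof -
 let ?X = "snd (snd p)" and ?G = "und \<Gamma>" and ?q = "und_arr q"
 note a = Asm.productD[OF pq]
 have qP: "fst q = fst p" using a by simp
 note p' = asm_arrD[OF a(1), folded P_def] and q' = asm_arrD[OF a(2), unfolded qP, folded P_def \<Gamma>_def]
 note X = asmD[OF p'(2)] and G = asmD[OF q'(2)] and Po = asmD[OF p'(1), folded P_def] and V = repD(2)[OF W, folded P_def]
 let ?rX = "reix (und_arr p) (rlz ?X)" and ?rG = "reix ?q (rlz \<Gamma>)" and ?rP = "rlz (fst p)"
 have c: "?rX \<in> rels P" "?rG \<in> rels P" using reix_closed'[OF p'(3-5) X(2)] reix_closed'[OF q'(3-5) G(2)] .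
 have pX: "seq P ?rP ?rX" using seq_rlz[OF a(1)] by (simp add: P_def)
 \<comment> \<open>The cone is arbitrary, so the existence predicate of the product is not literally
   a predicate of pairs; it is only entailed by the predicates of the two factors.\<close>
 have XGP: "seq P (pairs P ?rX ?rG) ?rP"
  using product_und(2)[OF pq] Po c pairs_closed[OF Po(1) c] by (simp add: seq_def P_def \<Gamma>_def)
 let ?E = "pairs P ?rP V" and ?F = "pairs P ?rX V"
 let ?VE = "im ?q ?E" and ?VF = "im ?q ?F"
 have EF: "?E \<in> rels P" "?F \<in> rels P" using pairs_closed[OF Po(1,2) V] pairs_closed[OF Po(1) c(1) V] .
 have cI: "?VE \<in> rels ?G" "?VF \<in> rels ?G" using im_closed[OF q'(3)] q' EF by auto
 have unit: "seq P D (reix ?q (im ?q D))" if "D \<in> rels P" "im ?q D \<in> rels ?G" for D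
  using seq_im[OF q'(3-5) that] seq_refl[OF G(1) that(2)] by blast
 have "seq P ?E ?F"
  by (intro seq_pair seq_fst[OF pX] seq_snd[OF seq_refl] Po V)
 then have "seq P ?E (reix ?q ?VF)"
  using unit[OF EF(2) cI(2)] seq_trans by blast
 then have 1: "seq ?G ?VE ?VF"
  using seq_im[OF q'(3-5) EF(1) cI(2)] by blast
 have "seq P (pairs P ?F ?rG) ?E"
 proof (intro seq_pair)
  have "seq P (pairs P ?F ?rG) (pairs P ?rX ?rG)"
   by (intro seq_pair seq_fst[OF seq_fst[OF seq_refl]] seq_snd[OF seq_refl] Po c V EF)
  then show "seq P (pairs P ?F ?rG) ?rP" using XGP seq_trans by blast
  show "seq P (pairs P ?F ?rG) V"
   by (intro seq_fst[OF seq_snd[OF seq_refl]] Po c V)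
 qed
 then have "seq P (pairs P ?F ?rG) (reix ?q ?VE)"
  using unit[OF EF(1) cI(1)] seq_trans by blast
 \<comment> \<open>Frobenius reciprocity by means of implication: the premise \<open>?rG\<close>
   goes to the right, the implication crosses the adjunction because reindexing preserves it, and
   the premise returns over \<open>?G\<close>.\<close>
 then have "seq P ?F (imp P ?rG (reix ?q ?VE))"
  using seq_imp[OF c(2) reix_closed'[OF q'(3-5) cI(1)] EF(2) Po(1)] by blast
 then have "seq P ?F (reix ?q (imp ?G (rlz \<Gamma>) ?VE))"
  by (simp add: reix_imp[OF q'(3-5) G(2) cI(1)])
 then have "seq ?G ?VF (imp ?G (rlz \<Gamma>) ?VE)"
  using seq_im[OF q'(3-5) EF(2) imp_closed[OF G(1,2) cI(1)]] by blast
 then have "seq ?G (pairs ?G ?VF (rlz \<Gamma>)) ?VE"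
  using seq_imp[OF G(2) cI(1,2) G(1)] by blast
 then have 2: "seq ?G (pairs ?G (rlz \<Gamma>) ?VF) ?VE"
  by (rule seq_swap[OF _ cI(2) G(2)])
 have "rep \<Gamma> (ex_im AS q W) ?VE"
  using rep_ex_im[OF a(2)] W unfolding qP \<Gamma>_def P_def by blast
 then show ?thesis
  using rep_cong[OF _ q'(2) seq_snd[OF 1 G(2)] 2] by blast
qed

text \<open>The existence predicate of the product and that of the bound variable are
  interchangeable as premises once \<open>rlz \<Gamma>\<close> is available. Both directions
  transpose the counit with one premise exchanged for the other.\<close>

lemma rep_all_product:
 assumes pq: "is_product AS p q" and W: "rep (fst p) W V"
 defines "P \<equiv> und (fst p)" and "\<Gamma> \<equiv> snd (snd q)"
 shows "rep \<Gamma> (all_im AS q W) (all (und_arr q) (reix (und_arr p) (rlz (snd (snd p)))) V)"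
proof -
 let ?X = "snd (snd p)" and ?G = "und \<Gamma>" and ?q = "und_arr q"
 note a = Asm.productD[OF pq]
 have qP: "fst q = fst p" using a by simp
 note p' = asm_arrD[OF a(1), folded P_def] and q' = asm_arrD[OF a(2), unfolded qP, folded P_def \<Gamma>_def]
 note X = asmD[OF p'(2)] and G = asmD[OF q'(2)] and Po = asmD[OF p'(1), folded P_def] and V = repD(2)[OF W, folded P_def]
 let ?rX = "reix (und_arr p) (rlz ?X)" and ?rG = "reix ?q (rlz \<Gamma>)" and ?rP = "rlz (fst p)"
 have c: "?rX \<in> rels P" "?rG \<in> rels P" using reix_closed'[OF p'(3-5) X(2)] reix_closed'[OF q'(3-5) G(2)] .
 have pX: "seq P ?rP ?rX" using seq_rlz[OF a(1)] by (simp add: P_def)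
 have XGP: "seq P (pairs P ?rX ?rG) ?rP"
  using product_und(2)[OF pq] Po c pairs_closed[OF Po(1) c] by (simp add: seq_def P_def \<Gamma>_def)
 let ?VE = "all ?q ?rP V" and ?VF = "all ?q ?rX V"
 have cI: "?VE \<in> rels ?G" "?VF \<in> rels ?G" using all_closed[OF q'(3)] q' Po c V by auto
 note rI = reix_closed'[OF q'(3-5) cI(1)] reix_closed'[OF q'(3-5) cI(2)]
 \<comment> \<open>Application of a realizer of the universal statement to a realizer in
   \<open>D\<close>, in the form of the counit; it is used for both candidate predicates.\<close>
 have counit: "seq P (pairs P (reix ?q (all ?q D V)) D) V" if "D \<in> rels P" "all ?q D V \<in> rels ?G" for D
  using seq_all[OF q'(3-5) that(1) V that(2)] seq_refl[OF G(1) that(2)] by blast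
 have "seq P (pairs P (reix ?q (pairs ?G (rlz \<Gamma>) ?VF)) ?rP) (pairs P (reix ?q ?VF) ?rX)"
  unfolding reix_pairs[OF q'(3-5) G(2) cI(2)]
  by (intro seq_pair seq_fst[OF seq_snd[OF seq_refl]] seq_snd[OF pX] Po c rI pairs_closed)
 then have "seq P (pairs P (reix ?q (pairs ?G (rlz \<Gamma>) ?VF)) ?rP) V"
  using counit[OF c(1) cI(2)] seq_trans by blast
 then have 1: "seq ?G (pairs ?G (rlz \<Gamma>) ?VF) ?VE"
  using seq_all[OF q'(3-5) Po(2) V pairs_closed[OF G(1,2) cI(2)]] by blast
 have "seq P (pairs P (reix ?q (pairs ?G (rlz \<Gamma>) ?VE)) ?rX) (pairs P (reix ?q ?VE) ?rP)"
  unfolding reix_pairs[OF q'(3-5) G(2) cI(1)]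
 proof (intro seq_pair)
  let ?D = "pairs P (pairs P ?rG (reix ?q ?VE)) ?rX"
  have "seq P ?D (pairs P ?rX ?rG)"
   by (intro seq_pair seq_fst[OF seq_fst[OF seq_refl]] seq_snd[OF seq_refl] Po c rI pairs_closed)
  then show "seq P ?D ?rP" using XGP seq_trans by blast
  show "seq P ?D (reix ?q ?VE)"
   by (intro seq_fst[OF seq_snd[OF seq_refl]] Po c rI)
 qed
 then have "seq P (pairs P (reix ?q (pairs ?G (rlz \<Gamma>) ?VE)) ?rX) V"
  using counit[OF Po(2) cI(1)] seq_trans by blast
 then have 2: "seq ?G (pairs ?G (rlz \<Gamma>) ?VE) ?VF"
  using seq_all[OF q'(3-5) c(1) V pairs_closed[OF G(1,2) cI(1)]] by blast
 have "rep \<Gamma> (all_im AS q W) ?VE"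
  using rep_all_im[OF a(2)] W unfolding qP \<Gamma>_def P_def by blast
 then show ?thesis
  using rep_cong[OF _ q'(2) 2 1] by blast
qed

end

section \<open>Soundness of the realizability interpretation\<close>

lemma agree_Inr: "agree n e' e \<Longrightarrow> e' \<circ> Inr = e \<circ> Inr"
 by (auto simp: agree_def)

lemma Inr_upd [simp]:
 "(e(Inl n \<mapsto> y)) \<circ> Inr = e \<circ> Inr"
 "(e(Inr x \<mapsto> y)) \<circ> Inr = (e \<circ> Inr)(x \<mapsto> y)"
 by auto

lemma sb_Inr: "sb C k e \<circ> Inr = sb C k (e \<circ> Inr)"
 by (auto simp: sb_def)

definition inr_env :: "(nat \<rightharpoonup> 'm) \<Rightarrow> (nat + nat \<rightharpoonup> 'm)" where
 "inr_env \<eta> = case_sum Map.empty \<eta>"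

lemma set1_und_trm: "set1_trm (und_trm t) \<subseteq> range Inr"
 by (induction t) auto

lemma trm_val_und_trm: "trm_val C T e (und_trm t) = trm_val C T (inr_env (e \<circ> Inr)) (und_trm t)"
proof (rule trm_val_cong)
 fix v assume "v \<in> set1_trm (und_trm t)"
 then obtain x where "v = Inr x" using set1_und_trm by blast
 then show "e v = inr_env (e \<circ> Inr) v" by (simp add: inr_env_def)
qed

lemma below_upd_Inr:
 assumes "below n t"
 shows "trm_val C T (e(Inr x \<mapsto> y)) t = trm_val C T e t"
  and "has_sort C (\<Gamma>(Inr x \<mapsto> Y)) t X \<longleftrightarrow> has_sort C \<Gamma> t X"
 using assms by (auto intro!: trm_val_cong has_sort_cong simp: below_def)

context pas_category
begin

lemma prj_cong:
 assumes "\<And>k c. k \<in> arrs C \<Longrightarrow> tgt C k = src C a \<Longrightarrow> c \<in> els (src C k) \<Longrightarrow> Q k c \<longleftrightarrow> Q' k c"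
 shows "prj Z a Q \<longleftrightarrow> prj Z a Q'"
proof -
 have "c \<in> els (src C k)" if "ap (a \<odot> k) z = Some c" "src C z = src C k" for k z c
  using apD[OF that(1)] that(2) by (simp add: els_iff)
 then show ?thesis unfolding prj_def using assms by metis
qed

lemma wf_proj:
 assumes "has_sort C \<Gamma> t A" "below n t" "Z \<in> subs C A"
  and "\<And>u \<Gamma>'. agree n \<Gamma>' \<Gamma> \<Longrightarrow> has_sort C \<Gamma>' u A \<Longrightarrow> below (n + 2) u \<Longrightarrow> wf_fml C \<Gamma>' (K u)"
 shows "wf_fml C \<Gamma> (FBall (Inl n) A Z (dot C S (n + 1) t (rv n) K))"
 using wf_FBall_dot[OF assms(1-3)] assms(4) by simp

lemma force_proj:
 assumes "T \<in> objs C" "env_typed C T e" "has_sort C (env_sort C e) t A" "below n t" "Z \<in> subs C A"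
  and "\<And>u \<Gamma>'. agree n \<Gamma>' (env_sort C e) \<Longrightarrow> has_sort C \<Gamma>' u A \<Longrightarrow> below (n + 2) u \<Longrightarrow> wf_fml C \<Gamma>' (K u)"
  and "\<And>u k e'. k \<in> arrs C \<Longrightarrow> tgt C k = T \<Longrightarrow> env_typed C (src C k) e' \<Longrightarrow> agree n e' (sb C k e) \<Longrightarrow>
   has_sort C (env_sort C e') u A \<Longrightarrow> below (n + 2) u \<Longrightarrow>
   force C (K u) (src C k) e' \<longleftrightarrow> K' k (trm_val C (src C k) e' u)"
 shows "force C (FBall (Inl n) A Z (dot C S (n + 1) t (rv n) K)) T e \<longleftrightarrow> prj Z (trm_val C T e t) K'"
 unfolding add_2_eq_Suc' Suc_eq_plus1[symmetric]
 by (rule force_prj[OF assms(1-5)]) (use assms(6,7) in simp_all)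

text \<open>\<open>rz V p a \<eta>\<close> is the meaning of \<open>a \<^bold>r p\<close> at the stage \<open>src a\<close>, where \<open>\<eta>\<close> assigns
 generalized elements at that stage to the free variables of \<open>p\<close>.  The condition \<open>a \<in> A\<^sub>2\<close> is
 implied by the other clauses and left out.\<close>

primrec rz :: "(('o, 'm) asm \<Rightarrow> ('o, 'm) asm_arr set \<Rightarrow> 'm set) \<Rightarrow>
  (nat, ('o, 'm) asm, ('o, 'm) asm_arr) fml \<Rightarrow> 'm \<Rightarrow> (nat \<rightharpoonup> 'm) \<Rightarrow> bool" where
 "rz V (FEq t s) a \<eta> \<longleftrightarrow>
  trm_val C (src C a) (inr_env \<eta>) (und_trm t) = trm_val C (src C a) (inr_env \<eta>) (und_trm s)"
| "rz V (FMem X U t) a \<eta> \<longleftrightarrow> rel (und X) (V X U) a (trm_val C (src C a) (inr_env \<eta>) (und_trm t))"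
| "rz V FTop a \<eta> \<longleftrightarrow> True"
| "rz V FBot a \<eta> \<longleftrightarrow> cvr C (src C a) (\<lambda>k. False)"
| "rz V (FAnd p q) a \<eta> \<longleftrightarrow>
  prj F0 a (\<lambda>k c. rz V p c (sb C k \<eta>)) \<and> prj F1 a (\<lambda>k c. rz V q c (sb C k \<eta>))"
| "rz V (FOr p q) a \<eta> \<longleftrightarrow> cvr C (src C a) (\<lambda>k.
  (prj F0 (a \<odot> k) (\<lambda>l c. mem C c F0) \<and> prj F1 (a \<odot> k) (\<lambda>l c. rz V p c (sb C l (sb C k \<eta>)))) \<or>
  (prj F0 (a \<odot> k) (\<lambda>l c. mem C c F1) \<and> prj F1 (a \<odot> k) (\<lambda>l c. rz V q c (sb C l (sb C k \<eta>)))))"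
| "rz V (FImp p q) a \<eta> \<longleftrightarrow> (\<forall>k \<in> arrs C. tgt C k = src C a \<longrightarrow> (\<forall>b \<in> els (src C k).
  rz V p b (sb C k \<eta>) \<longrightarrow> (\<exists>c. ap (a \<odot> k) b = Some c \<and> rz V q c (sb C k \<eta>))))"
| "rz V (FEx x X p) a \<eta> \<longleftrightarrow> cvr C (src C a) (\<lambda>k. \<exists>y \<in> arrs C. src C y = src C k \<and> tgt C y = und X \<and>
  prj F0 (a \<odot> k) (\<lambda>l c. rel (und X) (rlz X) c (y \<odot> l)) \<and>
  prj F1 (a \<odot> k) (\<lambda>l c. rz V p c ((sb C l (sb C k \<eta>))(x \<mapsto> y \<odot> l))))"
| "rz V (FAll x X p) a \<eta> \<longleftrightarrow> (\<forall>k \<in> arrs C. tgt C k = src C a \<longrightarrow>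
  (\<forall>b y. rel (und X) (rlz X) b y \<longrightarrow> src C y = src C k \<longrightarrow>
   (\<exists>c. ap (a \<odot> k) b = Some c \<and> rz V p c ((sb C k \<eta>)(x \<mapsto> y)))))"

end

section \<open>The realizability formula and its meaning at generalized elements\<close>

locale realizability_model = pca_filter C S \<phi>
 for C :: "('o, 'm) cat" (structure) and S and \<phi> +
 fixes \<mu> :: "('o, 'm) asm \<Rightarrow> ('o, 'm) asm_arr set \<Rightarrow> ('o, 'm) asm_arr"
  and V :: "('o, 'm) asm \<Rightarrow> ('o, 'm) asm_arr set \<Rightarrow> 'm set"
 assumes mono_choice: "is_mono_choice C S \<phi> \<mu>"
  and representation: "is_representation C S \<phi> \<mu> V"
begin

text \<open>The chosen monomorphism belongs to the subobject \<open>U\<close>, so its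
  \<open>E\<close> represents \<open>U\<close>. The predicate \<open>V\<close> is equivalent to it
  by assumption, and equivalent predicates represent the same subobject.\<close>

lemma rep_V:
 assumes X: "is_asm C S X" and U: "U \<in> subs AS X"
 shows "rep X U (V X U)"
proof -
 have XO: "X \<in> objs AS" using X by simp
 have m: "\<mu> X U \<in> U"
  using mono_choice XO U unfolding is_mono_choice_def by blast
 have r: "V X U \<in> rels (und X)" "le_r C S \<phi> (und X) (V X U) (sub_rlz C S (\<mu> X U))"
  "le_r C S \<phi> (und X) (sub_rlz C S (\<mu> X U)) (V X U)"
  using representation XO U unfolding is_representation_def by blast+
 have s: "sub_rlz C S (\<mu> X U) = im (und_arr (\<mu> X U)) (rlz (fst (\<mu> X U)))"
  by (simp add: sub_rlz_def im_def)
 have R: "rep X U (sub_rlz C S (\<mu> X U))"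
  unfolding s by (rule rep_mono[OF U m])
 note X' = asmD[OF X] and c = repD(2)[OF R]
 have "seq (und X) (V X U) (sub_rlz C S (\<mu> X U))" "seq (und X) (sub_rlz C S (\<mu> X U)) (V X U)"
  using r c X'(1) le_r_iff[OF X'(1) r(1) c] le_r_iff[OF X'(1) c r(1)] by (simp_all add: seq_def)
 then show ?thesis
  using rep_cong[OF R X] seq_snd X'(2) by blast
qed

lemma V_closed: "is_asm C S X \<Longrightarrow> U \<in> subs AS X \<Longrightarrow> V X U \<in> rels (und X)"
 using rep_V repD(2) by blast

text \<open>Nothing is required of the variables \<open>Inl n\<close>, which the realizability
  formula binds on its way down.\<close>

definition und_sorts :: "(nat \<rightharpoonup> ('o, 'm) asm) \<Rightarrow> (nat + nat \<rightharpoonup> 'o) \<Rightarrow> bool" where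
 "und_sorts \<Delta> \<Gamma> \<longleftrightarrow> (\<forall>x X. \<Delta> x = Some X \<longrightarrow> \<Gamma> (Inr x) = Some (und X))"

lemma und_sorts_agree: "und_sorts \<Delta> \<Gamma> \<Longrightarrow> agree n \<Gamma>' \<Gamma> \<Longrightarrow> und_sorts \<Delta> \<Gamma>'"
 by (simp add: und_sorts_def agree_def)

lemma und_sorts_upd [simp]:
 "und_sorts \<Delta> \<Gamma> \<Longrightarrow> und_sorts \<Delta> (\<Gamma>(Inl n \<mapsto> Y))"
 "und_sorts \<Delta> \<Gamma> \<Longrightarrow> und_sorts (\<Delta>(x \<mapsto> X)) (\<Gamma>(Inr x \<mapsto> und X))"
 by (auto simp: und_sorts_def)

lemma has_sort_und:
 "has_sort AS \<Delta> t X \<Longrightarrow> und_sorts \<Delta> \<Gamma> \<Longrightarrow> has_sort C \<Gamma> (und_trm t) (und X)"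
proof (induction t arbitrary: X)
 case (TVar x)
 then show ?case unfolding und_sorts_def has_sort.simps und_trm.simps by blast
next
 case (TApp f t)
 then show ?case using asm_arrD[of f] by auto
next
 case (TUnit T)
 then show ?case using terminal_und[of T] by auto
next
 case (TPair p q t s)
 then have pq: "is_product AS p q" and X: "fst p = X"
  and ts: "has_sort AS \<Delta> t (snd (snd p))" "has_sort AS \<Delta> s (snd (snd q))" by auto
 have "p \<in> arrs AS" "q \<in> arrs AS" using Asm.productD[OF pq] by auto
 then show ?case
  using product_und(1)[OF pq] TPair.IH(1)[OF ts(1) TPair.prems(2)] TPair.IH(2)[OF ts(2) TPair.prems(2)]
   asm_arrD[of p] asm_arrD[of q] X by simp
qed

lemma wf_rlzs:
 assumes "wf_fml AS \<Delta> p" "und_sorts \<Delta> \<Gamma>" "has_sort C \<Gamma> t A" "below n t"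
 shows "wf_fml C \<Gamma> (rlzs C S V p n t)"
 using assms
proof (induction p arbitrary: \<Delta> \<Gamma> n t)
 case (FEq s1 s2)
 then obtain X where "has_sort AS \<Delta> s1 X" "has_sort AS \<Delta> s2 X" unfolding wf_fml.simps by blast
 then show ?case unfolding rlzs.simps wf_fml.simps using has_sort_und FEq(2) by blast
next
 case (FMem X U s)
 then have X: "is_asm C S X" "U \<in> subs AS X" "has_sort AS \<Delta> s X" by auto
 show ?case
  unfolding rlzs.simps
  by (rule wf_pair[OF FMem(3) has_sort_und[OF X(3) FMem(2)] asmD(1)[OF X(1)] V_closed[OF X(1,2)]])
next
 case (FAnd p q)
 then have wf: "wf_fml AS \<Delta> p" "wf_fml AS \<Delta> q" by auto
 have "wf_fml C \<Gamma> (FBall (Inl n) A F0 (dot C S (n + 1) t (rv n) (\<lambda>c. rlzs C S V p (n + 2) c)))"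
  by (rule wf_proj[OF FAnd(5,6) F_closed(1)]) (rule FAnd(1)[OF wf(1) und_sorts_agree[OF FAnd(4)]])
 moreover have "wf_fml C \<Gamma> (FBall (Inl n) A F1 (dot C S (n + 1) t (rv n) (\<lambda>c. rlzs C S V q (n + 2) c)))"
  by (rule wf_proj[OF FAnd(5,6) F_closed(2)]) (rule FAnd(2)[OF wf(2) und_sorts_agree[OF FAnd(4)]])
 ultimately show ?case using FAnd(5) A2_iff(1) A_obj by simp
next
 case (FOr p q)
 then have wf: "wf_fml AS \<Delta> p" "wf_fml AS \<Delta> q" by auto
 have "wf_fml C \<Gamma> (FBall (Inl n) A F1 (dot C S (n + 1) t (rv n) (\<lambda>c. rlzs C S V p (n + 2) c)))"
  by (rule wf_proj[OF FOr(5,6) F_closed(2)]) (rule FOr(1)[OF wf(1) und_sorts_agree[OF FOr(4)]])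
 moreover have "wf_fml C \<Gamma> (FBall (Inl n) A F1 (dot C S (n + 1) t (rv n) (\<lambda>c. rlzs C S V q (n + 2) c)))"
  by (rule wf_proj[OF FOr(5,6) F_closed(2)]) (rule FOr(2)[OF wf(2) und_sorts_agree[OF FOr(4)]])
 moreover have "wf_fml C \<Gamma> (FBall (Inl n) A F0 (dot C S (n + 1) t (rv n) (\<lambda>c. FMem A Z c)))"
  if "Z \<in> subs C A" for Z
  by (rule wf_proj[OF FOr(5,6) F_closed(1)]) (use that in simp)
 ultimately show ?case using FOr(5) A2_iff(1) A_obj F_closed by simp
next
 case (FImp p q)
 then have wf: "wf_fml AS \<Delta> p" "wf_fml AS \<Delta> q" by auto
 let ?G = "\<Gamma>(Inl n \<mapsto> A)"
 have u: "und_sorts \<Delta> ?G" using FImp(4) by simp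
 have "wf_fml C ?G (rlzs C S V p (n + 1) (rv n))"
  by (rule FImp(1)[OF wf(1) u]) simp_all
 moreover have "wf_fml C ?G (dot C S (n + 1) t (rv n) (\<lambda>c. rlzs C S V q (n + 2) c))"
 proof (rule wf_dot_body)
  show "has_sort C ?G t A" using has_sort_agree[OF agree_upd_self FImp(6)] FImp(5) by blast
  show "below (n + 1) t" by (rule below_mono[OF FImp(6)]) simp
  fix u \<Gamma>' assume "agree (n + 1) \<Gamma>' ?G" "has_sort C \<Gamma>' u A" "below (Suc (n + 1)) u"
  then show "wf_fml C \<Gamma>' (rlzs C S V q (n + 2) u)"
   by (intro FImp(2)[OF wf(2) und_sorts_agree[OF u]]) simp_all
 qed simp_all
 ultimately show ?case by simp
next
 case (FEx x X p)
 then have X: "is_asm C S X" and wf: "wf_fml AS (\<Delta>(x \<mapsto> X)) p" by auto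
 note X' = asmD[OF X]
 let ?G = "\<Gamma>(Inr x \<mapsto> und X)"
 have u: "und_sorts (\<Delta>(x \<mapsto> X)) ?G" using FEx(3) by simp
 have t: "has_sort C ?G t A" using below_upd_Inr(2)[OF FEx(5)] FEx(4) by blast
 have "wf_fml C ?G (FBall (Inl n) A F0 (dot C S (n + 1) t (rv n)
   (\<lambda>c. FRel (und X) (rlz X) c (TVar (Inr x)))))"
  by (rule wf_proj[OF t FEx(5) F_closed(1)], rule wf_pair) (use X' in \<open>simp_all add: agree_def\<close>)
 moreover have "wf_fml C ?G (FBall (Inl n) A F1 (dot C S (n + 1) t (rv n) (\<lambda>c. rlzs C S V p (n + 2) c)))"
  by (rule wf_proj[OF t FEx(5) F_closed(2)]) (rule FEx(1)[OF wf und_sorts_agree[OF u]])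
 ultimately show ?case using FEx(4) A2_iff(1) A_obj X'(1) by simp
next
 case (FAll x X p)
 then have X: "is_asm C S X" and wf: "wf_fml AS (\<Delta>(x \<mapsto> X)) p" by auto
 note X' = asmD[OF X]
 let ?G = "\<Gamma>(Inl n \<mapsto> A, Inr x \<mapsto> und X)"
 have u: "und_sorts (\<Delta>(x \<mapsto> X)) ?G" using FAll(3) by simp
 have b: "below (n + 1) t" by (rule below_mono[OF FAll(5)]) simp
 have t: "has_sort C ?G t A"
  using below_upd_Inr(2)[OF b] has_sort_agree[OF agree_upd_self FAll(5)] FAll(4) by blast
 have "wf_fml C ?G (FRel (und X) (rlz X) (rv n) (TVar (Inr x)))"
  by (rule wf_pair) (use X' in simp_all)
 moreover have "wf_fml C ?G (dot C S (n + 1) t (rv n) (\<lambda>c. rlzs C S V p (n + 2) c))"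
 proof (rule wf_dot_body[OF t _ b])
  fix u \<Gamma>' assume "agree (n + 1) \<Gamma>' ?G" "has_sort C \<Gamma>' u A" "below (Suc (n + 1)) u"
  then show "wf_fml C \<Gamma>' (rlzs C S V p (n + 2) u)"
   by (intro FAll(1)[OF wf und_sorts_agree[OF u]]) simp_all
 qed simp_all
 ultimately show ?case using X'(1) A_obj by simp
qed simp_all

text \<open>\<open>stage \<Delta> T e n t\<close>: the environment \<open>e\<close> at \<open>T\<close> fits \<open>\<Delta>\<close> and \<open>t\<close> is a term of sort
 \<open>A\<close> for which \<open>Inl n\<close> is fresh.\<close>

definition stage :: "(nat \<rightharpoonup> ('o, 'm) asm) \<Rightarrow> 'o \<Rightarrow> (nat + nat \<rightharpoonup> 'm) \<Rightarrow> nat \<Rightarrow> ('o, 'm) btrm \<Rightarrow> bool" where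
 "stage \<Delta> T e n t \<longleftrightarrow> T \<in> objs C \<and> env_typed C T e \<and> und_sorts \<Delta> (env_sort C e) \<and>
  has_sort C (env_sort C e) t A \<and> below n t"

lemma stageD:
 assumes "stage \<Delta> T e n t"
 shows "T \<in> objs C" "env_typed C T e" "und_sorts \<Delta> (env_sort C e)" "has_sort C (env_sort C e) t A" "below n t"
  "trm_val C T e t \<in> arrs C" "src C (trm_val C T e t) = T" "tgt C (trm_val C T e t) = A"
 using assms trm_val_typed[of "env_sort C e" t A T e] env_ok_sort[of C T e] by (auto simp: stage_def)

lemma stage_sb:
 assumes "stage \<Delta> T e n t" "k \<in> arrs C" "tgt C k = T"
 shows "stage \<Delta> (src C k) (sb C k e) n t" "trm_val C (src C k) (sb C k e) t = trm_val C T e t \<odot> k"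
 using stageD[OF assms(1)] assms(2,3) env_typed_sb[of k e] env_sort_sb[of k e]
  trm_val_sb[of "env_sort C e" t A k e] env_ok_sort[of C T e] by (simp_all add: stage_def)

lemma stage_agree:
 assumes "stage \<Delta> T e n t" "env_typed C T e'" "agree m e' e" "has_sort C (env_sort C e') u A" "below l u"
 shows "stage \<Delta> T e' l u"
 using assms und_sorts_agree[OF _ agree_env_sort[OF assms(3), of C]] by (simp add: stage_def)

lemma stage_Inl:
 assumes "stage \<Delta> T e n t" "b \<in> arrs C" "src C b = T" "tgt C b = A"
 shows "stage \<Delta> T (e(Inl n \<mapsto> b)) (n + 1) t" "stage \<Delta> T (e(Inl n \<mapsto> b)) (n + 1) (rv n)"
  "trm_val C T (e(Inl n \<mapsto> b)) t = trm_val C T e t"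
proof -
 note s = stageD[OF assms(1)]
 have "has_sort C ((env_sort C e)(Inl n \<mapsto> A)) t A"
  using has_sort_agree[OF agree_upd_self s(5)] s(4) by blast
 then show "stage \<Delta> T (e(Inl n \<mapsto> b)) (n + 1) t" "stage \<Delta> T (e(Inl n \<mapsto> b)) (n + 1) (rv n)"
  "trm_val C T (e(Inl n \<mapsto> b)) t = trm_val C T e t"
  using s(1-3) assms(2-4) below_mono[OF s(5), of "n + 1"] trm_val_upd[OF s(5)] by (simp_all add: stage_def)
qed

lemma stage_Inr:
 assumes "stage \<Delta> T e n t" "y \<in> arrs C" "src C y = T" "tgt C y = und X"
 shows "stage (\<Delta>(x \<mapsto> X)) T (e(Inr x \<mapsto> y)) n t" "trm_val C T (e(Inr x \<mapsto> y)) t = trm_val C T e t"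
 using stageD[OF assms(1)] assms(2-4) below_upd_Inr[of n t] by (simp_all add: stage_def)

text \<open>Well-formedness is bundled with the semantic claim: a single induction hypothesis then
  provides both what is needed to type the continuation of an application and what is needed to
  evaluate it.\<close>

definition sound :: "(nat \<rightharpoonup> ('o, 'm) asm) \<Rightarrow> (nat, ('o, 'm) asm, ('o, 'm) asm_arr) fml \<Rightarrow> bool" where
 "sound \<Delta> p \<longleftrightarrow> wf_fml AS \<Delta> p \<and> (\<forall>T e n t. stage \<Delta> T e n t \<longrightarrow>
  (force C (rlzs C S V p n t) T e \<longleftrightarrow> rz V p (trm_val C T e t) (e \<circ> Inr)))"

lemma soundD:
 assumes "sound \<Delta> p"
 shows "stage \<Delta> T e n t \<Longrightarrow> force C (rlzs C S V p n t) T e \<longleftrightarrow> rz V p (trm_val C T e t) (e \<circ> Inr)"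
  and "und_sorts \<Delta> \<Gamma> \<Longrightarrow> has_sort C \<Gamma> t A \<Longrightarrow> below n t \<Longrightarrow> wf_fml C \<Gamma> (rlzs C S V p n t)"
 using assms wf_rlzs by (auto simp: sound_def)

lemma sound_proj:
 assumes p: "sound \<Delta> p" and s: "stage \<Delta> T e n t" and Z: "Z \<in> subs C A"
 shows "force C (FBall (Inl n) A Z (dot C S (n + 1) t (rv n) (\<lambda>c. rlzs C S V p (n + 2) c))) T e \<longleftrightarrow>
  prj Z (trm_val C T e t) (\<lambda>k c. rz V p c (sb C k (e \<circ> Inr)))"
proof (rule force_proj[OF stageD(1,2,4,5)[OF s] Z])
 show "wf_fml C \<Gamma>' (rlzs C S V p (n + 2) u)"
  if "agree n \<Gamma>' (env_sort C e)" "has_sort C \<Gamma>' u A" "below (n + 2) u" for u \<Gamma>'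
  by (rule soundD(2)[OF p und_sorts_agree[OF stageD(3)[OF s] that(1)] that(2,3)])
 show "force C (rlzs C S V p (n + 2) u) (src C k) e' \<longleftrightarrow> rz V p (trm_val C (src C k) e' u) (sb C k (e \<circ> Inr))"
  if "k \<in> arrs C" "tgt C k = T" "env_typed C (src C k) e'" "agree n e' (sb C k e)"
   "has_sort C (env_sort C e') u A" "below (n + 2) u" for u k e'
  using soundD(1)[OF p stage_agree[OF stage_sb(1)[OF s that(1,2)] that(3-6)]] agree_Inr[OF that(4)]
  by (simp add: sb_Inr)
qed

lemma sound_dot:
 assumes p: "sound \<Delta> p" and s: "stage \<Delta> T e (n + 1) t" and b: "stage \<Delta> T e (n + 1) (rv n)"
 shows "force C (dot C S (n + 1) t (rv n) (\<lambda>c. rlzs C S V p (n + 2) c)) T e \<longleftrightarrow>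
  (\<exists>c. ap (trm_val C T e t) (trm_val C T e (rv n)) = Some c \<and> rz V p c (e \<circ> Inr))"
proof (rule force_dot_body[OF stageD(1,2,4)[OF s] stageD(4)[OF b] stageD(5)[OF s] stageD(5)[OF b]])
 show "wf_fml C \<Gamma>' (rlzs C S V p (n + 2) u)"
  if "agree (n + 1) \<Gamma>' (env_sort C e)" "has_sort C \<Gamma>' u A" "below (Suc (n + 1)) u" for u \<Gamma>'
  by (rule soundD(2)[OF p und_sorts_agree[OF stageD(3)[OF s] that(1)] that(2)]) (use that(3) in simp)
 show "force C (rlzs C S V p (n + 2) u) T e' \<longleftrightarrow> rz V p (trm_val C T e' u) (e \<circ> Inr)"
  if "env_typed C T e'" "agree (n + 1) e' e" "has_sort C (env_sort C e') u A" "below (Suc (n + 1)) u" for u e'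
  using soundD(1)[OF p stage_agree[OF s that(1-3), of "n + 2"]] that(4) agree_Inr[OF that(2)] by simp
qed

lemma mem_A2_if_prj:
 "a \<in> arrs C \<Longrightarrow> tgt C a = A \<Longrightarrow> prj F0 a Q \<Longrightarrow> prj F1 a Q' \<Longrightarrow> mem C a (A2_sub C S)"
 unfolding A2_iff(2) using prj_mono[of F0 a Q "\<lambda>k c. True"] prj_mono[of F1 a Q' "\<lambda>k c. True"] by simp

lemma sound: "wf_fml AS \<Delta> p \<Longrightarrow> sound \<Delta> p"
proof (induction p arbitrary: \<Delta>)
 case (FEq s1 s2)
 have "force C (rlzs C S V (FEq s1 s2) n t) T e \<longleftrightarrow> rz V (FEq s1 s2) (trm_val C T e t) (e \<circ> Inr)"
  if "stage \<Delta> T e n t" for T e n t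
  unfolding rlzs.simps force.simps rz.simps stageD(7)[OF that]
  using trm_val_und_trm[of C T e s1] trm_val_und_trm[of C T e s2] by (simp only:)
 then show ?case using FEq unfolding sound_def by blast
next
 case (FMem X U s)
 then have s: "has_sort AS \<Delta> s X" by auto
 have "force C (rlzs C S V (FMem X U s) n t) T e \<longleftrightarrow> rz V (FMem X U s) (trm_val C T e t) (e \<circ> Inr)"
  if "stage \<Delta> T e n t" for T e n t
  unfolding rlzs.simps rz.simps stageD(7)[OF that]
  using force_pair[OF stageD(1,2,4)[OF that] has_sort_und[OF s stageD(3)[OF that]], of "V X U"]
   trm_val_und_trm[of C T e s] by (simp only:)
 then show ?case using FMem unfolding sound_def by blast
next
 case FTop
 then show ?case by (simp add: sound_def)
next
 case FBot
 then show ?case using stageD(7) by (simp add: sound_def)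
next
 case (FAnd p q)
 then have p: "sound \<Delta> p" and q: "sound \<Delta> q" by auto
 have "force C (rlzs C S V (FAnd p q) n t) T e \<longleftrightarrow> rz V (FAnd p q) (trm_val C T e t) (e \<circ> Inr)"
  if s: "stage \<Delta> T e n t" for T e n t
  unfolding rlzs.simps rz.simps force.simps(2,5) sound_proj[OF p s F_closed(1)] sound_proj[OF q s F_closed(2)]
  using mem_A2_if_prj[OF stageD(6,8)[OF s]] by blast
 then show ?case using FAnd(3) unfolding sound_def by blast
next
 case (FOr p q)
 then have p: "sound \<Delta> p" and q: "sound \<Delta> q" by auto
 have "force C (rlzs C S V (FOr p q) n t) T e \<longleftrightarrow> rz V (FOr p q) (trm_val C T e t) (e \<circ> Inr)"
  if s: "stage \<Delta> T e n t" for T e n t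
 proof -
  let ?a = "trm_val C T e t"
  let ?f = "\<lambda>Z r. FAnd (FMem A (A2_sub C S) t)
   (FAnd (FBall (Inl n) A F0 (dot C S (n + 1) t (rv n) (\<lambda>c. FMem A Z c)))
    (FBall (Inl n) A F1 (dot C S (n + 1) t (rv n) (\<lambda>c. rlzs C S V r (n + 2) c))))"
   and ?Q = "\<lambda>Z r k. prj F0 (?a \<odot> k) (\<lambda>l c. mem C c Z) \<and>
    prj F1 (?a \<odot> k) (\<lambda>l c. rz V r c (sb C l (sb C k (e \<circ> Inr))))"
  have disj: "force C (?f Z r) (src C k) (sb C k e) \<longleftrightarrow> ?Q Z r k"
   if k: "k \<in> arrs C" "tgt C k = T" and Z: "Z \<in> subs C A" and r: "sound \<Delta> r" for k Z r
  proof -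
   note sk = stage_sb[OF s k]
   have 1: "force C (FBall (Inl n) A F0 (dot C S (n + 1) t (rv n) (\<lambda>c. FMem A Z c))) (src C k) (sb C k e) \<longleftrightarrow>
     prj F0 (trm_val C (src C k) (sb C k e) t) (\<lambda>l c. mem C c Z)"
    by (rule force_proj[OF stageD(1,2,4,5)[OF sk(1)] F_closed(1)]) (use Z in simp_all)
   show ?thesis
    unfolding force.simps(2,5) 1 sound_proj[OF r sk(1) F_closed(2)] sb_Inr
    using mem_A2_if_prj[OF stageD(6,8)[OF sk(1)]] unfolding sk(2) by blast
  qed
  have "force C (FOr (?f F0 p) (?f F1 q)) T e \<longleftrightarrow> cvr C T (\<lambda>k. ?Q F0 p k \<or> ?Q F1 q k)"
   unfolding force.simps(6)
   by (rule cvr_cong) (simp only: disj[OF _ _ F_closed(1) p] disj[OF _ _ F_closed(2) q])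
  then show ?thesis unfolding rlzs.simps rz.simps stageD(7)[OF s] .
 qed
 then show ?case using FOr(3) unfolding sound_def by blast
next
 case (FImp p q)
 then have p: "sound \<Delta> p" and q: "sound \<Delta> q" by auto
 have "force C (rlzs C S V (FImp p q) n t) T e \<longleftrightarrow> rz V (FImp p q) (trm_val C T e t) (e \<circ> Inr)"
  if s: "stage \<Delta> T e n t" for T e n t
 proof -
  let ?vs = "[(Inl n, A)] :: ((nat + nat) \<times> 'o) list"
  let ?p = "rlzs C S V p (n + 1) (rv n)" and ?q = "dot C S (n + 1) t (rv n) (\<lambda>c. rlzs C S V q (n + 2) c)"
  have "wf_fml C (env_sort C e) (rlzs C S V (FImp p q) n t)"
   by (rule wf_rlzs[OF FImp(3) stageD(3-5)[OF s]])
  then have wf: "wf_fml C (upds (env_sort C e) ?vs (map snd ?vs)) (FImp ?p ?q)" by simp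
  have body: "(force C ?p (src C k) ((sb C k e)(Inl n \<mapsto> b)) \<longleftrightarrow> rz V p b (sb C k (e \<circ> Inr))) \<and>
    (force C ?q (src C k) ((sb C k e)(Inl n \<mapsto> b)) \<longleftrightarrow>
     (\<exists>c. ap (trm_val C T e t \<odot> k) b = Some c \<and> rz V q c (sb C k (e \<circ> Inr))))"
   if k: "k \<in> arrs C" "tgt C k = T" and b: "b \<in> arrs C" "src C b = src C k" "tgt C b = A" for k b
   unfolding soundD(1)[OF p stage_Inl(2)[OF stage_sb(1)[OF s k] b]]
    sound_dot[OF q stage_Inl(1,2)[OF stage_sb(1)[OF s k] b]] stage_Inl(3)[OF stage_sb(1)[OF s k] b]
    stage_sb(2)[OF s k] Inr_upd sb_Inr by simp
  have "force C (rlzs C S V (FImp p q) n t) T e \<longleftrightarrow> force C (FAlls ?vs (FImp ?p ?q)) T e" by simp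
  also have "\<dots> \<longleftrightarrow> rz V (FImp p q) (trm_val C T e t) (e \<circ> Inr)"
   unfolding force_FAlls_FImp[OF stageD(1,2)[OF s] wf] all_ok_args upds.simps rz.simps stageD(7)[OF s] ball_els
   using body by blast
  finally show ?thesis .
 qed
 then show ?case using FImp(3) unfolding sound_def by blast
next
 case (FEx x X p)
 then have X: "is_asm C S X" and p: "sound (\<Delta>(x \<mapsto> X)) p" by auto
 note X' = asmD[OF X]
 have "force C (rlzs C S V (FEx x X p) n t) T e \<longleftrightarrow> rz V (FEx x X p) (trm_val C T e t) (e \<circ> Inr)"
  if s: "stage \<Delta> T e n t" for T e n t
 proof -
  let ?a = "trm_val C T e t"
  let ?f0 = "FBall (Inl n) A F0 (dot C S (n + 1) t (rv n)
    (\<lambda>c. FRel (und X) (rlz X) c (TVar (Inr x))))"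
   and ?f1 = "FBall (Inl n) A F1 (dot C S (n + 1) t (rv n) (\<lambda>c. rlzs C S V p (n + 2) c))"
  let ?Q = "\<lambda>k y. prj F0 (?a \<odot> k) (\<lambda>l c. rel (und X) (rlz X) c (y \<odot> l)) \<and>
   prj F1 (?a \<odot> k) (\<lambda>l c. rz V p c ((sb C l (sb C k (e \<circ> Inr)))(x \<mapsto> y \<odot> l)))"
  let ?R = "\<lambda>k. \<exists>y \<in> arrs C. src C y = src C k \<and> tgt C y = und X \<and> ?Q k y"
  have body: "force C (FAnd ?f0 ?f1) (src C k) ((sb C k e)(Inr x \<mapsto> y)) \<longleftrightarrow> ?Q k y"
   if k: "k \<in> arrs C" "tgt C k = T" and y: "y \<in> arrs C" "src C y = src C k" "tgt C y = und X" for k y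
  proof -
   let ?e = "(sb C k e)(Inr x \<mapsto> y)"
   note sk = stage_sb[OF s k] and sy = stage_Inr[OF stage_sb(1)[OF s k] y, of x]
   have "force C ?f0 (src C k) ?e \<longleftrightarrow>
     prj F0 (trm_val C (src C k) ?e t) (\<lambda>l c. rel (und X) (rlz X) c (y \<odot> l))"
   proof (rule force_proj[OF stageD(1,2,4,5)[OF sy(1)] F_closed(1)])
    show "wf_fml C \<Gamma>' (FRel (und X) (rlz X) u (TVar (Inr x)))"
     if "agree n \<Gamma>' (env_sort C ?e)" "has_sort C \<Gamma>' u A" "below (n + 2) u" for u \<Gamma>'
     by (rule wf_pair) (use that X' y in \<open>simp_all add: agree_def\<close>)
    show "force C (FRel (und X) (rlz X) u (TVar (Inr x))) (src C l) e' \<longleftrightarrow>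
      rel (und X) (rlz X) (trm_val C (src C l) e' u) (y \<odot> l)"
     if l: "l \<in> arrs C" "tgt C l = src C k" "env_typed C (src C l) e'" "agree n e' (sb C l ?e)"
      "has_sort C (env_sort C e') u A" "below (n + 2) u" for u l e'
    proof -
     have "e' (Inr x) = Some (y \<odot> l)" using l(4) by (simp add: agree_def)
     moreover from this have "has_sort C (env_sort C e') (TVar (Inr x)) (und X)"
      using y l by (simp add: env_sort_def)
     ultimately show ?thesis
      using force_pair[OF src_obj[OF l(1)] l(3,5), of "TVar (Inr x)" "und X" "rlz X"] by simp
    qed
   qed
   then show ?thesis
    unfolding force.simps(5) sound_proj[OF p sy(1) F_closed(2)] sy(2) sk(2) Inr_upd sb_Inr sb_upd
    by (simp only:)
  qed
  have "force C (FEx (Inr x) (und X) (FAnd ?f0 ?f1)) T e \<longleftrightarrow> cvr C T ?R"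
   unfolding force.simps(8)
  proof (rule cvr_cong)
   fix k assume k: "k \<in> arrs C" "tgt C k = T"
   show "(\<exists>y \<in> arrs C. src C y = src C k \<and> tgt C y = und X \<and>
     force C (FAnd ?f0 ?f1) (src C k) ((sb C k e)(Inr x \<mapsto> y))) \<longleftrightarrow> ?R k"
    using body[OF k] by blast
  qed
  \<comment> \<open>The condition on \<open>A2\<close> stands outside the existential quantifier,
    while the witness, and with it the two projections, exists on a cover only. Membership in
    \<open>A2\<close> is local.\<close>
  moreover have "mem C ?a (A2_sub C S)" if c: "cvr C T ?R"
  proof (rule cvr_mem)
   show "cvr C (src C ?a) ?R" unfolding stageD(7)[OF s] by (rule c)
   show "?a \<in> arrs C" "A2_sub C S \<in> subs C (tgt C ?a)" using stageD(6,8)[OF s] A2_iff(1) by simp_all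
   fix k assume k: "k \<in> arrs C" "tgt C k = src C ?a" and "?R k"
   then have "\<exists>y. ?Q k y" by blast
   moreover have "?a \<odot> k \<in> arrs C" "tgt C (?a \<odot> k) = A" using stageD(6,8)[OF s] k by simp_all
   ultimately show "mem C (?a \<odot> k) (A2_sub C S)" using mem_A2_if_prj by blast
  qed
  ultimately show ?thesis
   unfolding rlzs.simps rz.simps force.simps(2,5) stageD(7)[OF s] by blast
 qed
 then show ?case using FEx(2) unfolding sound_def by blast
next
 case (FAll x X p)
 then have X: "is_asm C S X" and p: "sound (\<Delta>(x \<mapsto> X)) p" by auto
 have "force C (rlzs C S V (FAll x X p) n t) T e \<longleftrightarrow> rz V (FAll x X p) (trm_val C T e t) (e \<circ> Inr)"
  if s: "stage \<Delta> T e n t" for T e n t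
 proof -
  let ?a = "trm_val C T e t" and ?vs = "[(Inl n, A), (Inr x, und X)] :: ((nat + nat) \<times> 'o) list"
  let ?p = "FRel (und X) (rlz X) (rv n) (TVar (Inr x)) :: ('o, 'm) bfml"
   and ?q = "dot C S (n + 1) t (rv n) (\<lambda>c. rlzs C S V p (n + 2) c)"
  have "wf_fml C (env_sort C e) (rlzs C S V (FAll x X p) n t)"
   by (rule wf_rlzs[OF FAll(2) stageD(3-5)[OF s]])
  then have wf: "wf_fml C (upds (env_sort C e) ?vs (map snd ?vs)) (FImp ?p ?q)" by simp
  have body: "(force C ?p (src C k) ((sb C k e)(Inl n \<mapsto> b, Inr x \<mapsto> y)) \<longleftrightarrow> rel (und X) (rlz X) b y) \<and>
    (force C ?q (src C k) ((sb C k e)(Inl n \<mapsto> b, Inr x \<mapsto> y)) \<longleftrightarrow>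
     (\<exists>c. ap (?a \<odot> k) b = Some c \<and> rz V p c ((sb C k (e \<circ> Inr))(x \<mapsto> y))))"
   if k: "k \<in> arrs C" "tgt C k = T" and b: "b \<in> arrs C" "src C b = src C k" "tgt C b = A"
    and y: "y \<in> arrs C" "src C y = src C k" "tgt C y = und X" for k b y
  proof -
   let ?e = "(sb C k e)(Inl n \<mapsto> b, Inr x \<mapsto> y)"
   note sb = stage_Inl[OF stage_sb(1)[OF s k] b]
   note st = stage_Inr[OF sb(1) y, of x] and sr = stage_Inr[OF sb(2) y, of x]
   have "has_sort C (env_sort C ?e) (TVar (Inr x)) (und X)" using y by (simp add: env_sort_def)
   from force_pair[OF stageD(1,2,4)[OF sr(1)] this, of "rlz X"]
   show ?thesis
    unfolding sound_dot[OF p st(1) sr(1)] st(2) sr(2) sb(3) stage_sb(2)[OF s k] Inr_upd sb_Inr by simp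
  qed
  have r: "b \<in> arrs C \<and> src C b = src C y \<and> tgt C b = A \<and> y \<in> arrs C \<and> tgt C y = und X"
   if "rel (und X) (rlz X) b y" for b y
   using rel_arr[OF that] by blast
  have "force C (rlzs C S V (FAll x X p) n t) T e \<longleftrightarrow> force C (FAlls ?vs (FImp ?p ?q)) T e" by simp
  also have "\<dots> \<longleftrightarrow> (\<forall>k \<in> arrs C. tgt C k = T \<longrightarrow> (\<forall>b y. b \<in> arrs C \<longrightarrow> src C b = src C k \<longrightarrow> tgt C b = A \<longrightarrow>
    y \<in> arrs C \<longrightarrow> src C y = src C k \<longrightarrow> tgt C y = und X \<longrightarrow> rel (und X) (rlz X) b y \<longrightarrow>
    (\<exists>c. ap (?a \<odot> k) b = Some c \<and> rz V p c ((sb C k (e \<circ> Inr))(x \<mapsto> y)))))"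
   unfolding force_FAlls_FImp[OF stageD(1,2)[OF s] wf] all_ok_args upds.simps using body by blast
  also have "\<dots> \<longleftrightarrow> rz V (FAll x X p) ?a (e \<circ> Inr)"
   unfolding rz.simps stageD(7)[OF s] using r by metis
  finally show ?thesis .
 qed
 then show ?case using FAll(2) unfolding sound_def by blast
qed

lemma force_rlzs:
 assumes "wf_fml AS \<Delta> p" "T \<in> objs C" "env_typed C T e" "und_sorts \<Delta> (env_sort C e)"
  "has_sort C (env_sort C e) t A" "below n t"
 shows "force C (rlzs C S V p n t) T e \<longleftrightarrow> rz V p (trm_val C T e t) (e \<circ> Inr)"
 using soundD(1)[OF sound[OF assms(1)]] assms(2-6) by (simp add: stage_def)

end

lemma env_okI:
 "(\<And>v g. e v = Some g \<Longrightarrow> g \<in> arrs C \<and> src C g = Z) \<Longrightarrow>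
  (\<And>v X. \<Gamma> v = Some X \<Longrightarrow> \<exists>g. e v = Some g \<and> tgt C g = X) \<Longrightarrow> env_ok C \<Gamma> Z e"
 by (simp add: env_ok_def)

lemma env_okD:
 "env_ok C \<Gamma> Z e \<Longrightarrow> e v = Some g \<Longrightarrow> g \<in> arrs C \<and> src C g = Z"
 "env_ok C \<Gamma> Z e \<Longrightarrow> \<Gamma> v = Some X \<Longrightarrow> \<exists>g. e v = Some g \<and> tgt C g = X"
 by (auto simp: env_ok_def)

definition und_env :: "(nat \<rightharpoonup> ('o, 'm) asm_arr) \<Rightarrow> (nat \<rightharpoonup> 'm)" where
 "und_env e = (\<lambda>x. map_option und_arr (e x))"

section \<open>Truth values are represented by predicates of realizers\<close>

context realizability_model
begin

abbreviation "und_ok \<Delta> G \<eta> \<equiv> env_ok C (\<lambda>x. map_option fst (\<Delta> x :: ('o, 'm) asm option)) G \<eta>"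

definition rzset :: "(nat, ('o, 'm) asm, ('o, 'm) asm_arr) fml \<Rightarrow> 'o \<Rightarrow> (nat \<rightharpoonup> 'm) \<Rightarrow> 'm set" where
 "rzset p G \<eta> = fml_val C (rlzs C S V p 1 (rv 0)) (prd C A G)
  (case_sum [0 \<mapsto> pr1 C A G] (sb C (pr2 C A G) \<eta>))"

lemma
 assumes p: "wf_fml AS \<Delta> p" and \<eta>: "und_ok \<Delta> G \<eta>" and G: "G \<in> objs C"
 shows rzset_closed: "rzset p G \<eta> \<in> rels G"
  and rel_rzset: "rel G (rzset p G \<eta>) a g \<longleftrightarrow>
   a \<in> els (src C g) \<and> g \<in> arrs C \<and> tgt C g = G \<and> rz V p a (sb C g \<eta>)"
proof -
 let ?\<Gamma> = "case_sum [0 \<mapsto> A] (\<lambda>x. map_option fst (\<Delta> x)) :: nat + nat \<rightharpoonup> 'o"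
 let ?e = "case_sum [0 \<mapsto> pr1 C A G] (sb C (pr2 C A G) \<eta>) :: nat + nat \<rightharpoonup> 'm"
 let ?r = "rlzs C S V p 1 (rv 0)"
 have b: "below 1 (rv 0)" by simp
 have us: "und_sorts \<Delta> ?\<Gamma>" by (simp add: und_sorts_def)
 have wf: "wf_fml C ?\<Gamma> ?r"
  by (rule wf_rlzs[OF p us _ b]) simp
 have \<eta>1: "h \<in> arrs C" "src C h = G" if "\<eta> x = Some h" for x h
  using env_okD(1)[OF \<eta> that] by auto
 have \<eta>2: "\<exists>h. \<eta> x = Some h \<and> tgt C h = und X" if "\<Delta> x = Some X" for x X
  by (rule env_okD(2)[OF \<eta>]) (simp add: that)
 have e: "env_ok C ?\<Gamma> (prd C A G) ?e"
 proof (rule env_okI)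
  fix v h assume "?e v = Some h"
  then show "h \<in> arrs C \<and> src C h = prd C A G"
   using G \<eta>1 by (cases v) (auto simp: sb_def split: if_splits)
 next
  fix v X assume "?\<Gamma> v = Some X"
  then show "\<exists>h. ?e v = Some h \<and> tgt C h = X"
  proof (cases v)
   case (Inl i)
   with \<open>?\<Gamma> v = Some X\<close> show ?thesis using G by (auto split: if_splits)
  next
   case (Inr x)
   with \<open>?\<Gamma> v = Some X\<close> obtain Y where Y: "\<Delta> x = Some Y" "X = fst Y" by auto
   then obtain h where "\<eta> x = Some h" "tgt C h = X" using \<eta>2 by blast
   then show ?thesis using Inr \<eta>1[of x h] G by (simp add: sb_def)
  qed
 qed
 have P: "prd C A G \<in> objs C" using G by simp
 show "rzset p G \<eta> \<in> rels G"
  unfolding rzset_def by (rule fml_val_closed[OF wf e P])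
 have "rel G (rzset p G \<eta>) a g \<longleftrightarrow> rz V p a (sb C g \<eta>)"
  if a: "a \<in> els (src C g)" and g: "g \<in> arrs C" "tgt C g = G"
 proof -
  have a': "a \<in> arrs C" "src C a = src C g" "tgt C a = A" using a by (auto simp: els_iff)
  let ?t = "pair A G a g"
  let ?f = "case_sum [0 \<mapsto> a] (sb C g \<eta>) :: nat + nat \<rightharpoonup> 'm"
  have t: "?t \<in> arrs C" "src C ?t = src C g" "tgt C ?t = prd C A G" "pr1 C A G \<odot> ?t = a" "pr2 C A G \<odot> ?t = g"
   using a' g by auto
  have h: "(h \<odot> pr2 C A G) \<odot> ?t = h \<odot> g" if "\<eta> x = Some h" for h x
   using \<eta>1[OF that] t G by simp
  have s: "sb C ?t ?e = ?f"
  proof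
   fix v show "sb C ?t ?e v = ?f v"
   proof (cases v)
    case (Inl i)
    then show ?thesis using t(4) by (simp add: sb_def)
   next
    case (Inr x)
    then show ?thesis using h[of x] by (cases "\<eta> x") (simp_all add: sb_def)
   qed
  qed
  have f1: "env_typed C (src C g) ?f"
   unfolding env_typed_def
  proof (intro allI impI)
   fix v h assume "?f v = Some h"
   then show "h \<in> arrs C \<and> src C h = src C g"
    using a' g \<eta>1 by (cases v) (auto simp: sb_def split: if_splits)
  qed
  have f2: "und_sorts \<Delta> (env_sort C ?f)"
   unfolding und_sorts_def
  proof (intro allI impI)
   fix x X assume "\<Delta> x = Some X"
   then obtain h where "\<eta> x = Some h" "tgt C h = und X" using \<eta>2 by blast
   then show "env_sort C ?f (Inr x) = Some (und X)"
    using \<eta>1[of x h] g by (simp add: env_sort_def sb_def)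
  qed
  have f3: "has_sort C (env_sort C ?f) (rv 0) A" using a' by (simp add: env_sort_def)
  have o: "src C g \<in> objs C" using g by simp
  have "rel G (rzset p G \<eta>) a g \<longleftrightarrow> mem C ?t (rzset p G \<eta>)"
   using a' g by (simp add: rel_def)
  also have "\<dots> \<longleftrightarrow> force C ?r (src C g) ?f"
   using mem_fml_val[OF wf, of ?t ?e] e t(1-3) unfolding rzset_def s by simp
  also have "\<dots> \<longleftrightarrow> rz V p (trm_val C (src C g) ?f (rv 0)) (?f \<circ> Inr)"
   by (rule force_rlzs[OF p o f1 f2 f3 b])
  finally show ?thesis by (simp add: comp_def)
 qed
 then show "rel G (rzset p G \<eta>) a g \<longleftrightarrow>
   a \<in> els (src C g) \<and> g \<in> arrs C \<and> tgt C g = G \<and> rz V p a (sb C g \<eta>)"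
  using rel_arr(2,5,6)[of G "rzset p G \<eta>" a g] by blast
qed

lemma und_ok_env:
 assumes "env_ok AS \<Delta> \<Gamma> e"
 shows "und_ok \<Delta> (und \<Gamma>) (und_env e)"
proof (rule env_okI)
 fix x g assume "und_env e x = Some g"
 then obtain f where f: "e x = Some f" "g = und_arr f" by (auto simp: und_env_def)
 then have "f \<in> arrs AS" "src AS f = \<Gamma>" using env_okD(1)[OF assms] by blast+
 then show "g \<in> arrs C \<and> src C g = und \<Gamma>" using asm_arrD[of f] f by simp
next
 fix x X assume "map_option fst (\<Delta> x) = Some X"
 then obtain Y where Y: "\<Delta> x = Some Y" "X = und Y" by auto
 then obtain f where f: "e x = Some f" "tgt AS f = Y" using env_okD(2)[OF assms] by blast
 then have "f \<in> arrs AS" using env_okD(1)[OF assms] by blast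
 then show "\<exists>g. und_env e x = Some g \<and> tgt C g = X" using asm_arrD[of f] f Y by (simp add: und_env_def)
qed

lemma und_sorts_ok: "und_sorts \<Delta> (case_sum Map.empty (\<lambda>x. map_option fst (\<Delta> x)))"
 by (simp add: und_sorts_def)

lemma inr_env_ok: "und_ok \<Delta> G \<eta> \<Longrightarrow> env_ok C (case_sum Map.empty (\<lambda>x. map_option fst (\<Delta> x))) G (inr_env \<eta>)"
 unfolding env_ok_def inr_env_def by (auto split: sum.splits)

lemma sb_inr_env: "sb C g (inr_env \<eta>) = inr_env (sb C g \<eta>)"
 by (auto simp: sb_def inr_env_def split: sum.splits)

text \<open>Terminal objects and product cones of assemblies remain such in the base, so the arrows
  induced by their universal properties have the corresponding induced arrows as underlying
  arrows.\<close>

lemma trm_val_und: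
 assumes "has_sort AS \<Delta> t X" "env_ok AS \<Delta> \<Gamma> e" "is_asm C S \<Gamma>"
 shows "und_arr (trm_val AS \<Gamma> e t) = trm_val C (und \<Gamma>) (inr_env (und_env e)) (und_trm t)"
 using assms(1)
proof (induction t arbitrary: X)
 case (TVar x)
 then obtain f where "e x = Some f" using env_okD(2)[OF assms(2)] unfolding has_sort.simps by blast
 then show ?case by (simp add: inr_env_def und_env_def)
next
 case (TApp f t)
 then have "has_sort AS \<Delta> t (src AS f)" unfolding has_sort.simps by blast
 from TApp.IH[OF this] show ?case by simp
next
 case (TUnit T)
 then have T: "is_terminal AS T" unfolding has_sort.simps by blast
 have o: "\<Gamma> \<in> objs AS" using assms(3) by simp
 note h = Asm.terminal_arr[OF T o] and uT = terminal_und[OF T]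
 note h' = asm_arrD[OF h(1)] and b = terminal_arr[OF uT asmD(1)[OF assms(3)]]
 have "und_arr (bang AS \<Gamma> T) = bang C (und \<Gamma>) (und T)"
  by (rule terminal_eq[OF uT]) (use h h' b in simp_all)
 then show ?case by simp
next
 case (TPair p q t s)
 then have pq: "is_product AS p q" and ts: "has_sort AS \<Delta> t (tgt AS p)" "has_sort AS \<Delta> s (tgt AS q)" by auto
 have o: "\<Gamma> \<in> objs AS" using assms(3) by simp
 note t = Asm.trm_val_typed[OF ts(1) assms(2) o] and s = Asm.trm_val_typed[OF ts(2) assms(2) o]
 let ?t = "trm_val AS \<Gamma> e t" and ?s = "trm_val AS \<Gamma> e s"
 let ?h = "tuple AS p q ?t ?s"
 have h: "?h \<in> arrs AS" "fst ?h = \<Gamma>" "snd (snd ?h) = fst p" "p \<odot>\<^bsub>AS\<^esub> ?h = ?t" "q \<odot>\<^bsub>AS\<^esub> ?h = ?s"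
  using Asm.tuple[OF pq t(1) s(1)] t s by auto
 have e: "und_arr p \<odot> und_arr ?h = und_arr ?t" "und_arr q \<odot> und_arr ?h = und_arr ?s"
  using arg_cong[OF h(4), of und_arr] arg_cong[OF h(5), of und_arr] by auto
 note a = Asm.productD[OF pq]
 have "tuple C (und_arr p) (und_arr q) (und_arr ?t) (und_arr ?s) = und_arr ?h"
  by (rule tuple_eqI[OF product_und(1)[OF pq]])
   (use e h asm_arrD[OF h(1)] asm_arrD[OF a(1)] asm_arrD[OF t(1)] t s in simp_all)
 then show ?case using TPair.IH(1)[OF ts(1)] TPair.IH(2)[OF ts(2)] by simp
qed

lemma trm_val_und_at:
 assumes "has_sort AS \<Delta> t X" "env_ok AS \<Delta> \<Gamma> e" "is_asm C S \<Gamma>" "g \<in> arrs C" "tgt C g = und \<Gamma>"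
 shows "trm_val C (src C g) (inr_env (sb C g (und_env e))) (und_trm t) = und_arr (trm_val AS \<Gamma> e t) \<odot> g"
 unfolding trm_val_und[OF assms(1-3)]
 using trm_val_sb[OF has_sort_und[OF assms(1) und_sorts_ok], of g "inr_env (und_env e)"]
  inr_env_ok[OF und_ok_env[OF assms(2)]] assms(4,5) by (simp add: sb_inr_env)

text \<open>A predicate over the context is determined by its elements. Each case of the main
  induction thereby reduces to comparing the operation on predicates with the corresponding clause
  of \<open>rz\<close>.\<close>

lemma rep_rzset:
 assumes "rep \<Gamma> W D" "is_asm C S \<Gamma>" "wf_fml AS \<Delta> p" "env_ok AS \<Delta> \<Gamma> e"
  and "\<And>a g. a \<in> els (src C g) \<Longrightarrow> g \<in> arrs C \<Longrightarrow> tgt C g = und \<Gamma> \<Longrightarrow>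
   rel (und \<Gamma>) D a g \<longleftrightarrow> rz V p a (sb C g (und_env e))"
 shows "rep \<Gamma> W (rzset p (und \<Gamma>) (und_env e))"
proof -
 note u = und_ok_env[OF assms(4)] and o = asmD(1)[OF assms(2)]
 have "D = rzset p (und \<Gamma>) (und_env e)"
 proof (rule rels_eqI[OF repD(2)[OF assms(1)] rzset_closed[OF assms(3) u o] o])
  show "rel (und \<Gamma>) D a g \<longleftrightarrow> rel (und \<Gamma>) (rzset p (und \<Gamma>) (und_env e)) a g" for a g
   unfolding rel_rzset[OF assms(3) u o] using assms(5)[of a g] rel_arr(2,5,6)[of "und \<Gamma>" D a g] by blast
 qed
 with assms(1) show ?thesis by simp
qed

lemma sb_und_env:
 assumes "env_ok AS \<Delta> \<Gamma> e" "g \<in> arrs C" "tgt C g = und \<Gamma>" "k \<in> arrs C" "tgt C k = src C g"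
 shows "sb C (g \<odot> k) (und_env e) = sb C k (sb C g (und_env e))"
 using sb_sb[of _ g "und_env e" k] und_ok_env[OF assms(1)] assms(2-5) by simp

lemma und_env_ext:
 "und_env (env_ext AS v X \<Gamma> e) = (sb C (und_arr (pr2 AS X \<Gamma>)) (und_env e))(v \<mapsto> und_arr (pr1 AS X \<Gamma>))"
 by (auto simp: env_ext_def und_env_def sb_def fun_eq_iff option.map_comp comp_def)

lemma rel_rzset_cmp:
 assumes "wf_fml AS \<Delta> p" "env_ok AS \<Delta> \<Gamma> e" "is_asm C S \<Gamma>" "g \<in> arrs C" "tgt C g = und \<Gamma>"
  "k \<in> arrs C" "tgt C k = src C g"
 shows "rel (und \<Gamma>) (rzset p (und \<Gamma>) (und_env e)) c (g \<odot> k) \<longleftrightarrow>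
  c \<in> els (src C k) \<and> rz V p c (sb C k (sb C g (und_env e)))"
 unfolding rel_rzset[OF assms(1) und_ok_env[OF assms(2)] asmD(1)[OF assms(3)]]
 using sb_und_env[OF assms(2,4-7)] assms(4-7) by simp

lemma asm_context:
 assumes "is_asm C S X" "is_asm C S \<Gamma>"
 shows "is_product AS (pr1 AS X \<Gamma>) (pr2 AS X \<Gamma>)"
  and "fst (pr1 AS X \<Gamma>) = prd AS X \<Gamma>" "snd (snd (pr1 AS X \<Gamma>)) = X" "snd (snd (pr2 AS X \<Gamma>)) = \<Gamma>"
  and "is_asm C S (prd AS X \<Gamma>)"
  and "is_product C (und_arr (pr1 AS X \<Gamma>)) (und_arr (pr2 AS X \<Gamma>))"
  and "und_arr (pr1 AS X \<Gamma>) \<in> arrs C" "src C (und_arr (pr1 AS X \<Gamma>)) = und (prd AS X \<Gamma>)"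
   "tgt C (und_arr (pr1 AS X \<Gamma>)) = und X"
  and "und_arr (pr2 AS X \<Gamma>) \<in> arrs C" "src C (und_arr (pr2 AS X \<Gamma>)) = und (prd AS X \<Gamma>)"
   "tgt C (und_arr (pr2 AS X \<Gamma>)) = und \<Gamma>"
proof -
 have o: "X \<in> objs AS" "\<Gamma> \<in> objs AS" using assms by simp_all
 note P = Asm.prod_cone[OF o]
 show pq: "is_product AS (pr1 AS X \<Gamma>) (pr2 AS X \<Gamma>)" by (rule P(1))
 note a = Asm.productD[OF pq]
 show f: "fst (pr1 AS X \<Gamma>) = prd AS X \<Gamma>" by (simp add: prd_def)
 have f': "fst (pr2 AS X \<Gamma>) = prd AS X \<Gamma>" using a f by simp
 show t: "snd (snd (pr1 AS X \<Gamma>)) = X" "snd (snd (pr2 AS X \<Gamma>)) = \<Gamma>" using P by simp_all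
 note a1 = asm_arrD[OF a(1), unfolded f t(1)] and a2 = asm_arrD[OF a(2), unfolded f' t(2)]
 show "is_asm C S (prd AS X \<Gamma>)" by (rule a1(1))
 show "is_product C (und_arr (pr1 AS X \<Gamma>)) (und_arr (pr2 AS X \<Gamma>))" by (rule product_und(1)[OF pq])
 show "und_arr (pr1 AS X \<Gamma>) \<in> arrs C" "src C (und_arr (pr1 AS X \<Gamma>)) = und (prd AS X \<Gamma>)"
   "tgt C (und_arr (pr1 AS X \<Gamma>)) = und X"
  "und_arr (pr2 AS X \<Gamma>) \<in> arrs C" "src C (und_arr (pr2 AS X \<Gamma>)) = und (prd AS X \<Gamma>)"
   "tgt C (und_arr (pr2 AS X \<Gamma>)) = und \<Gamma>"
  by (rule a1(3-5) a2(3-5))+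
qed

lemma env_ok_context:
 assumes "is_asm C S X" "is_asm C S \<Gamma>" "env_ok AS \<Delta> \<Gamma> e"
 shows "env_ok AS (\<Delta>(v \<mapsto> X)) (prd AS X \<Gamma>) (env_ext AS v X \<Gamma> e)"
proof -
 have o: "X \<in> objs AS" "\<Gamma> \<in> objs AS" using assms by simp_all
 note c = asm_context[OF assms(1,2)]
 note a = Asm.productD[OF c(1)]
 have "env_ext AS v X \<Gamma> e = (sb AS (pr2 AS X \<Gamma>) e)(v \<mapsto> pr1 AS X \<Gamma>)"
  by (auto simp: env_ext_def sb_def)
 moreover have f': "fst (pr2 AS X \<Gamma>) = prd AS X \<Gamma>" using a c(2) by simp
 have "env_ok AS \<Delta> (src AS (pr2 AS X \<Gamma>)) (sb AS (pr2 AS X \<Gamma>) e)"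
  by (rule Asm.env_ok_sb) (use assms(3) c(4) a(2) in simp_all)
 then have "env_ok AS \<Delta> (prd AS X \<Gamma>) (sb AS (pr2 AS X \<Gamma>) e)" using f' by simp
 then have "env_ok AS (\<Delta>(v \<mapsto> X)) (prd AS X \<Gamma>) ((sb AS (pr2 AS X \<Gamma>) e)(v \<mapsto> pr1 AS X \<Gamma>))"
  by (rule env_ok_upd) (use a(1) c(2,3) in simp_all)
 ultimately show ?thesis by simp
qed

text \<open>The underlying object of the extended context is some product of the base and not the
  chosen one. Its elements \<open>z\<close> are therefore described by their two projections instead
  of as pairs.\<close>

lemma rel_rzset_context:
 assumes "wf_fml AS (\<Delta>(v \<mapsto> X)) p" "env_ok AS \<Delta> \<Gamma> e" "is_asm C S \<Gamma>" "is_asm C S X"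
  and g: "g \<in> arrs C" "tgt C g = und \<Gamma>" and k: "k \<in> arrs C" "tgt C k = src C g"
  and z: "z \<in> arrs C" "tgt C z = und (prd AS X \<Gamma>)" "und_arr (pr2 AS X \<Gamma>) \<odot> z = g \<odot> k" "und_arr (pr1 AS X \<Gamma>) \<odot> z = y"
 shows "rel (und (prd AS X \<Gamma>)) (rzset p (und (prd AS X \<Gamma>)) (und_env (env_ext AS v X \<Gamma> e))) c z \<longleftrightarrow>
  c \<in> els (src C z) \<and> rz V p c ((sb C k (sb C g (und_env e)))(v \<mapsto> y))"
proof -
 note c = asm_context[OF assms(4,3)]
 have "sb C z (sb C (und_arr (pr2 AS X \<Gamma>)) (und_env e)) = sb C (und_arr (pr2 AS X \<Gamma>) \<odot> z) (und_env e)"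
  by (rule sb_und_env[OF assms(2), symmetric]) (use c z in simp_all)
 also have "\<dots> = sb C k (sb C g (und_env e))"
  unfolding z(3) by (rule sb_und_env[OF assms(2) g k])
 finally have "sb C z (und_env (env_ext AS v X \<Gamma> e)) = (sb C k (sb C g (und_env e)))(v \<mapsto> y)"
  unfolding und_env_ext using z(4) by simp
 then show ?thesis
  unfolding rel_rzset[OF assms(1) und_ok_env[OF env_ok_context[OF assms(4,3,2)]] asmD(1)[OF c(5)]]
  using z by simp
qed

text \<open>Each connective is interpreted by an operation on subobjects whose representation is
  known; it remains to match that representation with the realizability clause. The context grows at
  quantifiers, so it is kept arbitrary in the induction.\<close>

lemma rep_fml_val:
 assumes "wf_fml AS \<Delta> p" "env_ok AS \<Delta> \<Gamma> e" "is_asm C S \<Gamma>"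
 shows "rep \<Gamma> (fml_val AS p \<Gamma> e) (rzset p (und \<Gamma>) (und_env e))"
 using assms
proof (induction p arbitrary: \<Delta> \<Gamma> e)
 case (FEq t s)
 then obtain X where X: "has_sort AS \<Delta> t X" "has_sort AS \<Delta> s X" unfolding wf_fml.simps by blast
 have o: "\<Gamma> \<in> objs AS" using FEq(3) by simp
 note t = Asm.trm_val_typed[OF X(1) FEq(2) o] and s = Asm.trm_val_typed[OF X(2) FEq(2) o]
 note u = und_ok_env[OF FEq(2)] and G = asmD(1)[OF FEq(3)]
 show ?case
  unfolding fml_val.simps
 proof (rule rep_equalizer)
  show "trm_val AS \<Gamma> e t \<in> Hom AS \<Gamma> X" "trm_val AS \<Gamma> e s \<in> Hom AS \<Gamma> X"
   using t s by simp_all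
  show "rzset (FEq t s) (und \<Gamma>) (und_env e) \<in> rels (und \<Gamma>)" by (rule rzset_closed[OF FEq(1) u G])
  show "rel (und \<Gamma>) (rzset (FEq t s) (und \<Gamma>) (und_env e)) a x \<longleftrightarrow>
    a \<in> els (src C x) \<and> x \<in> arrs C \<and> tgt C x = und \<Gamma> \<and>
    und_arr (trm_val AS \<Gamma> e t) \<odot> x = und_arr (trm_val AS \<Gamma> e s) \<odot> x" for a x
   unfolding rel_rzset[OF FEq(1) u G]
   using trm_val_und_at[OF X(1) FEq(2,3), of x] trm_val_und_at[OF X(2) FEq(2,3), of x] by (auto simp: els_iff)
 qed
next
 case (FMem X U t)
 then have X: "is_asm C S X" and U: "U \<in> subs AS X" and ts: "has_sort AS \<Delta> t X" by auto
 have o: "\<Gamma> \<in> objs AS" using FMem(3) by simp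
 note t = Asm.trm_val_typed[OF ts FMem(2) o]
 let ?t = "trm_val AS \<Gamma> e t"
 have t': "fst ?t = \<Gamma>" "snd (snd ?t) = X" using t by simp_all
 note a = asm_arrD[OF t(1), unfolded t']
 have "rep (snd (snd ?t)) U (V X U)" unfolding t' by (rule rep_V[OF X U])
 from rep_inv_im[OF t(1) this] have "rep \<Gamma> (inv_im AS ?t U) (reix (und_arr ?t) (V X U))"
  unfolding t' .
 then show ?case
  unfolding fml_val.simps
 proof (rule rep_rzset[OF _ FMem(3,1,2)])
  fix a g assume g: "a \<in> els (src C g)" "g \<in> arrs C" "tgt C g = und \<Gamma>"
  then have "src C a = src C g" by (simp add: els_iff)
  then show "rel (und \<Gamma>) (reix (und_arr ?t) (V X U)) a g \<longleftrightarrow> rz V (FMem X U t) a (sb C g (und_env e))"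
   using trm_val_und_at[OF ts FMem(2,3) g(2,3)] g rel_reix'[OF a(3-5) V_closed[OF X U], of a g] by simp
 qed
next
 case FTop
 note u = und_ok_env[OF FTop(2)] and G = asmD(1)[OF FTop(3)]
 show ?case
  unfolding fml_val.simps
  by (rule rep_top[OF FTop(3) rzset_closed[OF FTop(1) u G]]) (simp add: rel_rzset[OF FTop(1) u G])
next
 case FBot
 note u = und_ok_env[OF FBot(2)] and G = asmD(1)[OF FBot(3)]
 show ?case
  unfolding fml_val.simps
  by (rule rep_bottom[OF FBot(3) rzset_closed[OF FBot(1) u G]]) (auto simp: rel_rzset[OF FBot(1) u G] els_iff)
next
 case (FAnd p q)
 then have wf: "wf_fml AS \<Delta> p" "wf_fml AS \<Delta> q" by auto
 note p = FAnd(1)[OF wf(1) FAnd(4,5)] and q = FAnd(2)[OF wf(2) FAnd(4,5)]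
 show ?case
  unfolding fml_val.simps
 proof (rule rep_rzset[OF rep_meet[OF FAnd(5) p q] FAnd(5,3,4)])
  fix a g assume g: "a \<in> els (src C g)" "g \<in> arrs C" "tgt C g = und \<Gamma>"
  then have a: "src C a = src C g" by (simp add: els_iff)
  have "prj Z a (\<lambda>k c. rel (und \<Gamma>) (rzset r (und \<Gamma>) (und_env e)) c (g \<odot> k)) \<longleftrightarrow>
    prj Z a (\<lambda>k c. rz V r c (sb C k (sb C g (und_env e))))" if "wf_fml AS \<Delta> r" for Z r
   by (rule prj_cong) (use rel_rzset_cmp[OF that FAnd(4,5) g(2,3)] a in simp)
  from this[OF wf(1)] this[OF wf(2)]
  show "rel (und \<Gamma>) (pairs (und \<Gamma>) (rzset p (und \<Gamma>) (und_env e)) (rzset q (und \<Gamma>) (und_env e))) a g \<longleftrightarrow>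
    rz V (FAnd p q) a (sb C g (und_env e))"
   unfolding rel_pairs[OF asmD(1)[OF FAnd(5)] repD(2)[OF p] repD(2)[OF q]] rz.simps using g by blast
 qed
next
 case (FOr p q)
 then have wf: "wf_fml AS \<Delta> p" "wf_fml AS \<Delta> q" by auto
 note p = FOr(1)[OF wf(1) FOr(4,5)] and q = FOr(2)[OF wf(2) FOr(4,5)]
 show ?case
  unfolding fml_val.simps
 proof (rule rep_rzset[OF rep_join[OF FOr(5) p q] FOr(5,3,4)])
  fix a g assume g: "a \<in> els (src C g)" "g \<in> arrs C" "tgt C g = und \<Gamma>"
  then have a: "src C a = src C g" "a \<in> arrs C" by (simp_all add: els_iff)
  let ?R = "\<lambda>r k. prj F1 (a \<odot> k) (\<lambda>l c. rel (und \<Gamma>) (rzset r (und \<Gamma>) (und_env e)) c ((g \<odot> k) \<odot> l))"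
   and ?Q = "\<lambda>r k. prj F1 (a \<odot> k) (\<lambda>l c. rz V r c (sb C l (sb C k (sb C g (und_env e)))))"
  have e: "?R r k \<longleftrightarrow> ?Q r k" if r: "wf_fml AS \<Delta> r" and k: "k \<in> arrs C" "tgt C k = src C g" for r k
  proof (rule prj_cong)
   fix l c assume l: "l \<in> arrs C" "tgt C l = src C (a \<odot> k)" "c \<in> els (src C l)"
   have gk: "g \<odot> k \<in> arrs C" "tgt C (g \<odot> k) = und \<Gamma>" "tgt C l = src C (g \<odot> k)" using g k l a by simp_all
   show "rel (und \<Gamma>) (rzset r (und \<Gamma>) (und_env e)) c ((g \<odot> k) \<odot> l) \<longleftrightarrow>
     rz V r c (sb C l (sb C k (sb C g (und_env e))))"
    using rel_rzset_cmp[OF r FOr(4,5) gk(1,2) l(1) gk(3)] sb_und_env[OF FOr(4) g(2,3) k] l(3) by simp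
  qed
  have "cvr C (src C g) (\<lambda>k. (prj F0 (a \<odot> k) (\<lambda>l c. mem C c F0) \<and> ?R p k) \<or> (prj F0 (a \<odot> k) (\<lambda>l c. mem C c F1) \<and> ?R q k)) \<longleftrightarrow>
   cvr C (src C g) (\<lambda>k. (prj F0 (a \<odot> k) (\<lambda>l c. mem C c F0) \<and> ?Q p k) \<or> (prj F0 (a \<odot> k) (\<lambda>l c. mem C c F1) \<and> ?Q q k))"
   by (rule cvr_cong) (simp only: e[OF wf(1)] e[OF wf(2)])
  then show "rel (und \<Gamma>) (orr (und \<Gamma>) (rzset p (und \<Gamma>) (und_env e)) (rzset q (und \<Gamma>) (und_env e))) a g \<longleftrightarrow>
    rz V (FOr p q) a (sb C g (und_env e))"
   unfolding rel_orr[OF asmD(1)[OF FOr(5)] repD(2)[OF p] repD(2)[OF q]] rz.simps a(1) using g by blast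
 qed
next
 case (FImp p q)
 then have wf: "wf_fml AS \<Delta> p" "wf_fml AS \<Delta> q" by auto
 note p = FImp(1)[OF wf(1) FImp(4,5)] and q = FImp(2)[OF wf(2) FImp(4,5)]
 show ?case
  unfolding fml_val.simps
 proof (rule rep_rzset[OF rep_himp[OF FImp(5) p q] FImp(5,3,4)])
  fix a g assume g: "a \<in> els (src C g)" "g \<in> arrs C" "tgt C g = und \<Gamma>"
  then have a: "src C a = src C g" by (simp add: els_iff)
  have "c \<in> els (src C k)" if "ap (a \<odot> k) b = Some c" "b \<in> els (src C k)" for k b c
   using ap_els[OF that] .
  then show "rel (und \<Gamma>) (imp (und \<Gamma>) (rzset p (und \<Gamma>) (und_env e)) (rzset q (und \<Gamma>) (und_env e))) a g \<longleftrightarrow>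
    rz V (FImp p q) a (sb C g (und_env e))"
   unfolding rel_imp[OF asmD(1)[OF FImp(5)] repD(2)[OF p] repD(2)[OF q]] rz.simps a
   using rel_rzset_cmp[OF wf(1) FImp(4,5) g(2,3)] rel_rzset_cmp[OF wf(2) FImp(4,5) g(2,3)] g by metis
 qed
next
 case (FEx x X p)
 then have X: "is_asm C S X" and wf: "wf_fml AS (\<Delta>(x \<mapsto> X)) p" by auto
 note c = asm_context[OF X FEx(4)] and ok = env_ok_context[OF X FEx(4,3)]
 note X' = asmD[OF X] and P' = asmD[OF c(5)] and G' = asmD[OF FEx(4)]
 let ?p = "und_arr (pr1 AS X \<Gamma>)" and ?q = "und_arr (pr2 AS X \<Gamma>)" and ?P = "und (prd AS X \<Gamma>)"
 let ?W = "fml_val AS p (prd AS X \<Gamma>) (env_ext AS x X \<Gamma> e)"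
 let ?D = "rzset p ?P (und_env (env_ext AS x X \<Gamma> e))"
 have D: "rep (prd AS X \<Gamma>) ?W ?D" by (rule FEx(1)[OF wf ok c(5)])
 \<comment> \<open>The form with the existence predicate of the bound variable alone is required:
   the clause for the quantifier provides a realizer of \<open>x\<close> but none of the
   context.\<close>
 have "rep \<Gamma> (ex_im AS (pr2 AS X \<Gamma>) ?W) (im ?q (pairs ?P (reix ?p (rlz X)) ?D))"
  using rep_ex_product[OF c(1), of ?W ?D] D unfolding c(2-4) .
 then show ?case
  unfolding fml_val.simps
 proof (rule rep_rzset[OF _ FEx(4,2,3)])
  fix a g assume g: "a \<in> els (src C g)" "g \<in> arrs C" "tgt C g = und \<Gamma>"
  then have a: "a \<in> arrs C" "src C a = src C g" by (simp_all add: els_iff)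
  note r = reix_closed'[OF c(7-9) X'(2)]
  have cl: "pairs ?P (reix ?p (rlz X)) ?D \<in> rels (src C ?q)"
   using pairs_closed[OF P'(1) r repD(2)[OF D]] c(11) by simp
  let ?Q = "\<lambda>k y. prj F0 (a \<odot> k) (\<lambda>l c. rel (und X) (rlz X) c (y \<odot> l)) \<and>
  prj F1 (a \<odot> k) (\<lambda>l c. rz V p c ((sb C l (sb C k (sb C g (und_env e))))(x \<mapsto> y \<odot> l)))"
  have body: "rel ?P (pairs ?P (reix ?p (rlz X)) ?D) (a \<odot> k) z \<longleftrightarrow> ?Q k y"
   if k: "k \<in> arrs C" "tgt C k = src C g" and z: "z \<in> arrs C" "tgt C z = ?P" "?q \<odot> z = g \<odot> k" "?p \<odot> z = y" for k y z
  proof -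
   have sz: "src C z = src C k"
    using arg_cong[OF z(3), of "src C"] cmp_simps(2)[OF z(1) c(10)] z(2) c(11) cmp_simps(2)[OF k(1) g(2)] k(2) by simp
   have 1: "prj F0 (a \<odot> k) (\<lambda>l c. rel ?P (reix ?p (rlz X)) c (z \<odot> l)) \<longleftrightarrow>
     prj F0 (a \<odot> k) (\<lambda>l c. rel (und X) (rlz X) c (y \<odot> l))"
   proof (rule prj_cong)
    fix l b assume l: "l \<in> arrs C" "tgt C l = src C (a \<odot> k)"
    have lz: "tgt C l = src C z" using l k a sz by simp
    have "?p \<odot> (z \<odot> l) = y \<odot> l"
     by (rule cmp_reassoc[OF z(4)]) (use c z l lz in simp_all)
    then show "rel ?P (reix ?p (rlz X)) b (z \<odot> l) \<longleftrightarrow> rel (und X) (rlz X) b (y \<odot> l)"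
     unfolding rel_reix'[OF c(7-9) X'(2)] using z l lz by simp
   qed
   have 2: "prj F1 (a \<odot> k) (\<lambda>l c. rel ?P ?D c (z \<odot> l)) \<longleftrightarrow>
     prj F1 (a \<odot> k) (\<lambda>l c. rz V p c ((sb C l (sb C k (sb C g (und_env e))))(x \<mapsto> y \<odot> l)))"
   proof (rule prj_cong)
    fix l b assume l: "l \<in> arrs C" "tgt C l = src C (a \<odot> k)" "b \<in> els (src C l)"
    have lz: "tgt C l = src C z" using l k a sz by simp
    have zl: "z \<odot> l \<in> arrs C" "tgt C (z \<odot> l) = ?P" "src C (z \<odot> l) = src C l" using z l lz by simp_all
    have "?p \<odot> (z \<odot> l) = y \<odot> l"
     by (rule cmp_reassoc[OF z(4)]) (use c z l lz in simp_all)
    moreover have "?q \<odot> (z \<odot> l) = g \<odot> (k \<odot> l)"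
     using cmp_reassoc[OF z(3) z(1) c(10) l(1) _ lz] c(11) z(2) g k l a by simp
    moreover have kl: "k \<odot> l \<in> arrs C" "tgt C (k \<odot> l) = src C g" using k l a by simp_all
    ultimately have "rel ?P ?D b (z \<odot> l) \<longleftrightarrow>
      b \<in> els (src C (z \<odot> l)) \<and> rz V p b ((sb C (k \<odot> l) (sb C g (und_env e)))(x \<mapsto> y \<odot> l))"
     by (intro rel_rzset_context[OF wf FEx(3,4) X g(2,3) _ _ zl(1,2)])
    moreover have "sb C (k \<odot> l) (sb C g (und_env e)) = sb C l (sb C k (sb C g (und_env e)))"
     by (rule sb_sb[OF env_ok_sb[OF und_ok_env[OF FEx(3), folded g(3)] g(2), folded k(2)] k(1) l(1), symmetric])
      (use l k a in simp)
    ultimately show "rel ?P ?D b (z \<odot> l) \<longleftrightarrow>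
      rz V p b ((sb C l (sb C k (sb C g (und_env e))))(x \<mapsto> y \<odot> l))"
     using l(3) zl(3) by simp
   qed
   have ak: "a \<odot> k \<in> els (src C z)" using els_cmp[OF g(1) k] sz by simp
   show ?thesis
    unfolding rel_pairs[OF P'(1) r repD(2)[OF D]] 1 2 using ak z by blast
  qed
  have "rel (und \<Gamma>) (im ?q (pairs ?P (reix ?p (rlz X)) ?D)) a g \<longleftrightarrow>
    cvr C (src C g) (\<lambda>k. \<exists>z. ?q \<odot> z = g \<odot> k \<and> rel ?P (pairs ?P (reix ?p (rlz X)) ?D) (a \<odot> k) z)"
   using rel_im[OF c(10) cl, of a g] g unfolding c(11,12) by blast
  also have "\<dots> \<longleftrightarrow> cvr C (src C g) (\<lambda>k. \<exists>y \<in> arrs C. src C y = src C k \<and> tgt C y = und X \<and> ?Q k y)"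
  proof (rule cvr_cong)
   fix k assume k: "k \<in> arrs C" "tgt C k = src C g"
   show "(\<exists>z. ?q \<odot> z = g \<odot> k \<and> rel ?P (pairs ?P (reix ?p (rlz X)) ?D) (a \<odot> k) z) \<longleftrightarrow>
     (\<exists>y \<in> arrs C. src C y = src C k \<and> tgt C y = und X \<and> ?Q k y)"
   proof
    assume "\<exists>z. ?q \<odot> z = g \<odot> k \<and> rel ?P (pairs ?P (reix ?p (rlz X)) ?D) (a \<odot> k) z"
    then obtain z where z: "?q \<odot> z = g \<odot> k" "rel ?P (pairs ?P (reix ?p (rlz X)) ?D) (a \<odot> k) z" by blast
    note z' = rel_arr[OF z(2)]
    have "src C z = src C k" using z'(3) a k by simp
    then show "\<exists>y \<in> arrs C. src C y = src C k \<and> tgt C y = und X \<and> ?Q k y"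
     using body[OF k z'(2,5) z(1) refl] z(2) c(7-9) z'(2,5) by (intro bexI[of _ "?p \<odot> z"]) simp_all
   next
    assume "\<exists>y \<in> arrs C. src C y = src C k \<and> tgt C y = und X \<and> ?Q k y"
    then obtain y where y: "y \<in> arrs C" "src C y = src C k" "tgt C y = und X" "?Q k y" by blast
    \<comment> \<open>A witness \<open>y\<close> together with the restricted context gives an
      element of the extended context, because the underlying cone is a product in the base.\<close>
    let ?z = "tuple C ?p ?q y (g \<odot> k)"
    have "g \<odot> k \<in> arrs C" "src C (g \<odot> k) = src C k" "tgt C (g \<odot> k) = und \<Gamma>" using g k by simp_all
    then have z: "?z \<in> arrs C" "tgt C ?z = ?P" "?p \<odot> ?z = y" "?q \<odot> ?z = g \<odot> k"
     using tuple[OF c(6) y(1), of "g \<odot> k"] y c by simp_all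
    from body[OF k z(1,2,4,3)] y(4) z(4)
    show "\<exists>z. ?q \<odot> z = g \<odot> k \<and> rel ?P (pairs ?P (reix ?p (rlz X)) ?D) (a \<odot> k) z" by blast
   qed
  qed
  finally show "rel (und \<Gamma>) (im ?q (pairs ?P (reix ?p (rlz X)) ?D)) a g \<longleftrightarrow>
    rz V (FEx x X p) a (sb C g (und_env e))"
   unfolding rz.simps a(2) .
 qed
next
 case (FAll x X p)
 then have X: "is_asm C S X" and wf: "wf_fml AS (\<Delta>(x \<mapsto> X)) p" by auto
 note c = asm_context[OF X FAll(4)] and ok = env_ok_context[OF X FAll(4,3)]
 note X' = asmD[OF X] and P' = asmD[OF c(5)] and G' = asmD[OF FAll(4)]
 let ?p = "und_arr (pr1 AS X \<Gamma>)" and ?q = "und_arr (pr2 AS X \<Gamma>)" and ?P = "und (prd AS X \<Gamma>)"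
 let ?W = "fml_val AS p (prd AS X \<Gamma>) (env_ext AS x X \<Gamma> e)"
 let ?D = "rzset p ?P (und_env (env_ext AS x X \<Gamma> e))"
 have D: "rep (prd AS X \<Gamma>) ?W ?D" by (rule FAll(1)[OF wf ok c(5)])
 have "rep \<Gamma> (all_im AS (pr2 AS X \<Gamma>) ?W) (all ?q (reix ?p (rlz X)) ?D)"
  using rep_all_product[OF c(1), of ?W ?D] D unfolding c(2-4) .
 then show ?case
  unfolding fml_val.simps
 proof (rule rep_rzset[OF _ FAll(4,2,3)])
  fix a g assume g: "a \<in> els (src C g)" "g \<in> arrs C" "tgt C g = und \<Gamma>"
  then have a: "a \<in> arrs C" "src C a = src C g" by (simp_all add: els_iff)
  have r: "reix ?p (rlz X) \<in> rels (src C ?q)" "?D \<in> rels (src C ?q)"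
   using reix_closed'[OF c(7-9) X'(2)] repD(2)[OF D] c(11) by simp_all
  have D_iff: "rel ?P ?D b z \<longleftrightarrow> b \<in> els (src C z) \<and> rz V p b ((sb C k (sb C g (und_env e)))(x \<mapsto> y))"
   if "k \<in> arrs C" "tgt C k = src C g" "z \<in> arrs C" "tgt C z = ?P" "?q \<odot> z = g \<odot> k" "?p \<odot> z = y" for k z b y
   by (rule rel_rzset_context[OF wf FAll(3,4) X g(2,3) that])
  have "rel (und \<Gamma>) (all ?q (reix ?p (rlz X)) ?D) a g \<longleftrightarrow>
   (\<forall>k \<in> arrs C. tgt C k = src C g \<longrightarrow> (\<forall>b z. ?q \<odot> z = g \<odot> k \<longrightarrow> src C z = src C k \<longrightarrow> rel ?P (reix ?p (rlz X)) b z \<longrightarrow>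
    (\<exists>c. ap (a \<odot> k) b = Some c \<and> rel ?P ?D c z)))"
   using rel_all[OF c(10) r, of a g] g unfolding c(11,12) by blast
  also have "\<dots> \<longleftrightarrow> rz V (FAll x X p) a (sb C g (und_env e))"
   unfolding rz.simps a(2)
  \<comment> \<open>Values \<open>y\<close> of the bound variable correspond to elements
    \<open>z\<close> of the extended context over \<open>g \<odot> k\<close>: tuples in one
    direction, the projection \<open>?p\<close> in the other.\<close>
  proof (intro iffI ballI impI allI)
   fix k b y assume k: "k \<in> arrs C" "tgt C k = src C g" and b: "rel (und X) (rlz X) b y" "src C y = src C k"
    and *: "\<forall>k \<in> arrs C. tgt C k = src C g \<longrightarrow> (\<forall>b z. ?q \<odot> z = g \<odot> k \<longrightarrow> src C z = src C k \<longrightarrow> rel ?P (reix ?p (rlz X)) b z \<longrightarrow>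
    (\<exists>c. ap (a \<odot> k) b = Some c \<and> rel ?P ?D c z))"
   note y = rel_arr[OF b(1)]
   let ?z = "tuple C ?p ?q y (g \<odot> k)"
   have "g \<odot> k \<in> arrs C" "src C (g \<odot> k) = src C k" "tgt C (g \<odot> k) = und \<Gamma>" using g k by simp_all
   then have z: "?z \<in> arrs C" "src C ?z = src C k" "tgt C ?z = ?P" "?p \<odot> ?z = y" "?q \<odot> ?z = g \<odot> k"
    using tuple[OF c(6) y(2), of "g \<odot> k"] b(2) y c by simp_all
   have "rel ?P (reix ?p (rlz X)) b ?z"
    unfolding rel_reix'[OF c(7-9) X'(2)] using z b by simp
   with *[rule_format, OF k z(5,2)] obtain v where "ap (a \<odot> k) b = Some v" "rel ?P ?D v ?z" by blast
   then show "\<exists>v. ap (a \<odot> k) b = Some v \<and> rz V p v ((sb C k (sb C g (und_env e)))(x \<mapsto> y))"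
    using D_iff[OF k z(1,3,5,4)] by blast
  next
   fix k b z assume k: "k \<in> arrs C" "tgt C k = src C g" and z: "?q \<odot> z = g \<odot> k" "src C z = src C k"
    and b: "rel ?P (reix ?p (rlz X)) b z"
    and *: "\<forall>k \<in> arrs C. tgt C k = src C g \<longrightarrow> (\<forall>b y. rel (und X) (rlz X) b y \<longrightarrow> src C y = src C k \<longrightarrow>
   (\<exists>c. ap (a \<odot> k) b = Some c \<and> rz V p c ((sb C k (sb C g (und_env e)))(x \<mapsto> y))))"
   note z' = rel_arr[OF b]
   have b': "rel (und X) (rlz X) b (?p \<odot> z)"
    using b unfolding rel_reix'[OF c(7-9) X'(2)] by blast
   have "src C (?p \<odot> z) = src C k" using c z z' by simp
   with *[rule_format, OF k b'] obtain v where v: "ap (a \<odot> k) b = Some v"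
    "rz V p v ((sb C k (sb C g (und_env e)))(x \<mapsto> ?p \<odot> z))" by blast
   moreover have "v \<in> els (src C z)" by (rule ap_els[OF v(1) z'(6)])
   ultimately show "\<exists>v. ap (a \<odot> k) b = Some v \<and> rel ?P ?D v z"
    using D_iff[OF k z'(2,5) z(1) refl] by blast
  qed
  finally show "rel (und \<Gamma>) (all ?q (reix ?p (rlz X)) ?D) a g \<longleftrightarrow> rz V (FAll x X p) a (sb C g (und_env e))" .
 qed
qed

lemma und_env_empty [simp]: "und_env Map.empty = Map.empty"
 by (simp add: und_env_def)

lemma mem_realizer_set:
 assumes "wf_fml AS Map.empty p"
 shows "realizer_set C S V p \<in> subs C A"
  and "mem C a (realizer_set C S V p) \<longleftrightarrow> a \<in> els (src C a) \<and> rz V p a Map.empty"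
proof -
 have u: "und_sorts Map.empty \<Gamma>" for \<Gamma> by (simp add: und_sorts_def)
 have b: "below 1 (rv 0)" by simp
 have wf: "wf_fml C [Inl 0 \<mapsto> A] (rlzs C S V p 1 (rv 0))"
  by (rule wf_rlzs[OF assms u _ b]) simp
 show "realizer_set C S V p \<in> subs C A"
  unfolding realizer_set_def by (rule mem_compr(1)[OF wf A_obj])
 let ?e = "[Inl 0 \<mapsto> a] :: nat + nat \<rightharpoonup> 'm"
 have "force C (rlzs C S V p 1 (rv 0)) (src C a) ?e \<longleftrightarrow> rz V p a Map.empty" if "a \<in> arrs C" "tgt C a = A"
 proof -
  have "force C (rlzs C S V p 1 (rv 0)) (src C a) ?e \<longleftrightarrow> rz V p (trm_val C (src C a) ?e (rv 0)) (?e \<circ> Inr)"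
   by (rule force_rlzs[OF assms _ _ u _ b]) (use that in simp_all)
  moreover have "?e \<circ> Inr = Map.empty" by auto
  ultimately show ?thesis by simp
 qed
 then show "mem C a (realizer_set C S V p) \<longleftrightarrow> a \<in> els (src C a) \<and> rz V p a Map.empty"
  unfolding realizer_set_def mem_compr(2)[OF wf A_obj] els_iff by blast
qed

text \<open>Truth means that the identity of the terminal assembly belongs to the truth value, which
  is an entailment over that assembly. Passing from it to the filter uses that \<open>\<phi>\<close>
  is closed under application, the other direction that constant functions are realized.\<close>

theorem realizability_iff_truth:
 assumes wf: "wf_fml AS Map.empty p"
 shows "truth_value AS p = \<top>\<^bsub>Sub AS (one AS)\<^esub> \<longleftrightarrow> realizer_set C S V p \<in> \<phi>"
proof -
 let ?I = "one AS" and ?Z = "realizer_set C S V p"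
 have oI: "?I \<in> objs AS" by (rule Asm.one_obj)
 then have aI: "is_asm C S ?I" unfolding Asm_simps by (rule CollectD)
 note I = asmD[OF aI]
 let ?D = "rzset p (und ?I) Map.empty"
 have ok: "und_ok Map.empty (und ?I) Map.empty" by (simp add: env_ok_def)
 have relD: "rel (und ?I) ?D a g \<longleftrightarrow>
   a \<in> els (src C g) \<and> g \<in> arrs C \<and> tgt C g = und ?I \<and> rz V p a Map.empty" for a g
  using rel_rzset[OF wf ok I(1), of a g] by simp
 have rep: "rep ?I (truth_value AS p) ?D"
  unfolding truth_value_def using rep_fml_val[OF wf env_ok_empty aI] by simp
 note D = repD(2)[OF rep] and Z = mem_realizer_set[OF wf]
 have "truth_value AS p = \<top>\<^bsub>Sub AS ?I\<^esub> \<longleftrightarrow> mem AS (idn AS ?I) (truth_value AS p)"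
  by (rule Asm.eq_top_iff[OF oI repD(1)[OF rep]])
 also have "\<dots> \<longleftrightarrow> ent (und ?I) (rlz ?I) ?D"
  unfolding rep_mem[OF rep] using Asm.idn_simps[OF oI] reix_idn[OF D I(1)] by simp
 also have "\<dots> \<longleftrightarrow> ?Z \<in> \<phi>"
 proof
  assume z: "?Z \<in> \<phi>"
  show "ent (und ?I) (rlz ?I) ?D"
  \<comment> \<open>The polynomial returns its parameter and discards the argument: the constant
    function whose value is a realizer of \<open>p\<close>.\<close>
  proof (rule ent_by[of "[?Z]" "PV 0"])
   fix cs x g assume cs: "ins C (src C g) cs [?Z]" and x: "rel (und ?I) (rlz ?I) x g"
   then obtain d where d: "cs = [d]" "mem C d ?Z" "src C d = src C g" by auto
   then show "\<exists>v. peval (cs @ [x]) (PV 0) = Some v \<and> rel (und ?I) ?D v g"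
    using Z(2)[of d] rel_arr[OF x] relD[of d g] by simp
  qed (use z I D in simp_all)
 next
  assume e: "ent (und ?I) (rlz ?I) ?D"
  \<comment> \<open>The terminal assembly \<open>?I\<close> is an arbitrary choice. The entailment
    is transported to \<open>unit_asm\<close>, where every element of \<open>A\<close> may serve as
    argument.\<close>
  have oU: "unit_asm \<in> objs AS" using unit_asm by simp
  let ?b = "bang AS unit_asm ?I" and ?T = "rlz unit_asm"
  note b = Asm.terminal_arr[OF Asm.one_terminal oU]
  have b': "fst ?b = unit_asm" "snd (snd ?b) = ?I" using b by simp_all
  note a = asm_arrD[OF b(1), unfolded b'] and U = asmD[OF unit_asm]
  let ?u = "und_arr ?b" and ?O = "und unit_asm"
  have "ent ?O ?T (reix ?u ?D)"
   by (rule ent_trans[OF a(6) ent_reix[OF e a(3-5) I(2) D] U(2) reix_closed'[OF a(3-5) D]])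
  then obtain R where R: "R \<in> \<phi>"
   "PROP realizes R ?O ?T (reix ?u ?D)"
   by (rule entE) (rule that)
  have step: "\<exists>v. ap r x = Some v \<and> mem C v ?Z" if r: "mem C r R" and x: "mem C x F0" and s: "src C r = src C x" for r x
  proof -
   have x': "x \<in> els (src C x)" by (rule F_els(1)[OF x])
   then have o: "src C x \<in> objs C" by (auto simp: els_iff)
   note t = terminal_arr[OF one_terminal o]
   let ?g = "bang C (src C x) (one C)"
   have "rel ?O ?T x ?g"
    using rel_top[of "one C" x ?g] x' t by (simp add: unit_asm_def)
   with R(2)[OF r, of ?g x] s t obtain v where v: "ap r x = Some v" "rel ?O (reix ?u ?D) v ?g" by auto
   from v(2) have "rel (und ?I) ?D v (?u \<odot> ?g)"
    unfolding rel_reix'[OF a(3-5) D] by blast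
   then have "rz V p v Map.empty" unfolding relD by blast
   moreover have "v \<in> els (src C v)" using apD[OF v(1)] by (simp add: els_iff)
   ultimately show ?thesis using v(1) Z(2) by blast
  qed
  have df: "ap r x \<noteq> None" if "mem C r R" "mem C x F0" "src C r = src C x" for r x
   using step[OF that] by auto
  show "?Z \<in> \<phi>"
  \<comment> \<open>Applying \<open>R\<close> to the elements of any member of \<open>\<phi>\<close>
    produces realizers of \<open>p\<close>; \<open>F0\<close> is taken as such a member. The image
    belongs to \<open>\<phi>\<close>, and its elements are such applications on a cover, so they lie
    in the set of realizers by locality.\<close>
  proof (rule filter_up[OF filter_app(1)[OF R(1) F_filter(1) df] Z(1)])
   fix y assume y: "mem C y (app_image C S R F0)"
   have yA: "y \<in> els (src C y)"
    by (rule filter_els[OF y filter_app(1)[OF R(1) F_filter(1) df]])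
   have c: "cvr C (src C y) (\<lambda>k. \<exists>r x. mem C r R \<and> mem C x F0 \<and> ap r x = Some (y \<odot> k))"
    by (rule filter_app(2)[OF R(1) F_filter(1) df y])
   show "mem C y ?Z"
   proof (rule cvr_mem[OF c])
    fix k assume "\<exists>r x. mem C r R \<and> mem C x F0 \<and> ap r x = Some (y \<odot> k)"
    then obtain r x where r: "mem C r R" "mem C x F0" "ap r x = Some (y \<odot> k)" by blast
    from step[OF r(1,2) apD(4)[OF r(3)]] r(3) show "mem C (y \<odot> k) ?Z" by simp
   qed (use yA Z(1) in \<open>auto simp: els_iff\<close>)
  qed
 qed
 finally show ?thesis .
qed

end

theorem theorem33:
  fixes B :: "('o, 'm) cat"
    and S :: "('o, 'm) pas"
    and \<phi> :: "'m set set"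
    and \<mu> :: "('o, 'm) asm \<Rightarrow> ('o, 'm) asm_arr set \<Rightarrow> ('o, 'm) asm_arr"
    and V :: "('o, 'm) asm \<Rightarrow> ('o, 'm) asm_arr set \<Rightarrow> 'm set"
    and p :: "(nat, ('o, 'm) asm, ('o, 'm) asm_arr) fml"
  assumes "heyting_category B"
    and "is_pca B S"
    and "is_pas_filter B S \<phi>"
    and "combinatory_complete B S \<phi>"
    and "is_mono_choice B S \<phi> \<mu>"
    and "is_representation B S \<phi> \<mu> V"
    and "closed_fml (Asm B S \<phi>) p"
  shows "truth_value (Asm B S \<phi>) p = \<top>\<^bsub>Sub (Asm B S \<phi>) (one (Asm B S \<phi>))\<^esub>
     \<longleftrightarrow> realizer_set B S V p \<in> \<phi>"
proof -
  interpret heyting_category B by (rule assms(1))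
  interpret realizability_model B S \<phi> \<mu> V
    by unfold_locales (use assms in \<open>auto simp: is_pca_def\<close>)
  show ?thesis
    using realizability_iff_truth assms(7) by (simp add: closed_fml_def)
qed

end
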